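(* Let $((H,\omega),g,\chi)$ be a quasi-Yetter-Drinfeld datum for $q=\chi(g)$, where $q\neq 1$ is a primitive $N$-th root of unity. (i) There is a bialgebra $R=R((H,\omega),g,\chi)$ in ${}_H^H\mathcal{YD}$ with basis $(x^{[n]})_{0\le n\le N-1}$ and with the following structure (coaction $\rho$, action $\vartriangleright$, unit, multiplication, comultiplication, counit): $$\rho(x^{[n]})=g^n\otimes x^{[n]},\qquad h\vartriangleright x^{[n]}=\chi_{[n]}(h)\,x^{[n]},\qquad 1_R=x^{[0]},$$ $$m_R(x^{[a]}\otimes x^{[b]})=[[a+b\le N-1]]\Big[\prod_{0\le i\le a-1}\omega^{-1}(g\otimes g^i\otimes g^b)\Big]x^{[a+b]}\quad (a,b\ge 0),$$ $$\Delta_R(x^{[n]})=\sum_{0\le i\le n}\beta(i,n)\,x^{[i]}\otimes x^{[n-i]},\qquad \varepsilon_R(x^{[n]})=\delta_{n,0}.$$ (ii) For this $R$, let $B:=R\#H$ be the bosonization of $R$ by $H$. Then the coradical $B_0$ of $B$ satisfies $B_0\subseteq \Bbbk 1_R\otimes H$.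
   Context: Conventions: $\Bbbk$ is an algebraically closed field of characteristic zero; everything is over $\Bbbk$. $\Delta(h)=h_1\otimes h_2$ (summation omitted), $\ast$ is convolution, $\omega^{-1}$ is the convolution inverse, $G(H)$ is the set of grouplike elements, empty products equal $1$, and $[[P]]$ is $1$ if $P$ holds and $0$ otherwise (when it is $0$ the expression is $0$). A coalgebra with multiplication and unit is a coalgebra $H$ with coalgebra maps $m:H\otimes H\to H$, $u:\Bbbk\to H$; $1_H=u(1)$. A dual quasi-bialgebra $(H,\omega)$ is a coalgebra with multiplication and unit together with a convolution invertible $\omega:H^{\otimes 3}\to\Bbbk$ such that $(\varepsilon\otimes\omega)\ast\omega(\mathrm{id}\otimes m\otimes \mathrm{id})\ast(\omega\otimes\varepsilon)=\omega(\mathrm{id}\otimes \mathrm{id}\otimes m)\ast\omega(m\otimes \mathrm{id}\otimes \mathrm{id})$ (3-cocycle), $\omega(h\otimes 1_H\otimes h')=\varepsilon(h)\varepsilon(h')$ (normalized), $h_1(k_1l_1)\,\omega(h_2\otimes k_2\otimes l_2)=\omega(h_1\otimes k_1\otimes l_1)\,(h_2k_2)l_2$ and $1_Hh=h=h1_H$. Multiplication on the span of $G(H)$ is then associative, so powers $g^n$ of $g\in G(H)$ make sense. Quasi-Yetter-Drinfeld datum $((H,\omega),g,\chi)$: $(H,\omega)$ a dual quasi-bialgebra, $g\in G(H)$, $\chi\in H^*$ with $\chi(1_H)=1$, such that for all $h,l\in H$: $\chi(hl)=\omega^{-1}(h_1\otimes l_1\otimes g)\chi(l_2)\omega(h_2\otimes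 g\otimes l_3)\chi(h_3)\omega^{-1}(g\otimes h_4\otimes l_4)$ and $g\chi(h_1)h_2=h_1\chi(h_2)g$. It is a datum "for $q$" if $q=\chi(g)$. Define $\chi_{[0]}=\varepsilon$ and for $n\ge1$: $\chi_{[n]}=\omega(-\otimes g\otimes g^{n-1})\ast\chi\ast\omega^{-1}(g\otimes-\otimes g^{n-1})\ast\chi_{[n-1]}\ast\omega(g\otimes g^{n-1}\otimes-)$. Define $\beta(i,n)=\binom{n}{i}_q\prod_{0\le j\le i-1}\omega(g\otimes g^j\otimes g^{n-i})$ for $0\le i\le n$, with $\binom{n}{i}_q$ the Gaussian binomial coefficient. The category ${}_H^H\mathcal{YD}$: objects are left $H$-comodules $(V,\rho)$, $\rho(v)=v_{-1}\otimes v_0$, with a linear map $H\otimes V\to V$, $h\otimes v\mapsto h\vartriangleright v$, such that $(hl)\vartriangleright v=\omega^{-1}(h_1\otimes l_1\otimes v_{-1})\,\omega(h_2\otimes(l_2\vartriangleright v_0)_{-1}\otimes l_3)\,\omega^{-1}((h_3\vartriangleright(l_2\vartriangleright v_0)_0)_{-1}\otimes h_4\otimes l_4)\,(h_3\vartriangleright(l_2\vartriangleright v_0)_0)_0$, $1_H\vartriangleright v=v$, and $(h_1\vartriangleright v)_{-1}h_2\otimes(h_1\vartriangleright v)_0=h_1v_{-1}\otimes(h_2\vartriangleright v_0)$. Morphisms are comodule maps $f$ with $f(h\vartriangleright v)=h\vartriangleright f(v)$. It is a prebraided monoidal category: unit $\Bbbk$ with trivial coaction $1\mapsto 1_H\otimes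 1$ and action $h\vartriangleright 1=\varepsilon(h)$; $V\otimes W$ has coaction $v_{-1}w_{-1}\otimes v_0\otimes w_0$ and action $h\vartriangleright(v\otimes w)=\omega(h_1\otimes v_{-1}\otimes w_{-2})\,\omega^{-1}((h_2\vartriangleright v_0)_{-2}\otimes h_3\otimes w_{-1})\,\omega((h_2\vartriangleright v_0)_{-1}\otimes(h_4\vartriangleright w_0)_{-1}\otimes h_5)\,(h_2\vartriangleright v_0)_0\otimes(h_4\vartriangleright w_0)_0$; associativity constraint $a_{U,V,W}((u\otimes v)\otimes w)=\omega^{-1}(u_{-1}\otimes v_{-1}\otimes w_{-1})\,u_0\otimes(v_0\otimes w_0)$, usual unit constraints; prebraiding $c_{V,W}(v\otimes w)=(v_{-1}\vartriangleright w)\otimes v_0$. A bialgebra in ${}_H^H\mathcal{YD}$ is an object $R$ with an algebra structure $(m_R,u_R)$ and coalgebra structure $(\Delta_R,\varepsilon_R)$ in this monoidal category such that $\Delta_R,\varepsilon_R$ are unital and multiplicative, where multiplicativity of $\Delta_R$ means $\Delta_Rm_R=(m_R\otimes m_R)\Omega_R(\Delta_R\otimes\Delta_R)$ with $\Omega_R=a^{-1}_{R,R,R\otimes R}(R\otimes a_{R,R,R})(R\otimes (c_{R,R}\otimes R))(R\otimes a^{-1}_{R,R,R})a_{R,R,R\otimes R}$. Bosonization: for a bialgebra $R$ in ${}_H^H\mathcal{YD}$, write $r\cdot_R s=m_R(r\otimes s)$, $\Delta_R(r)=r^1\otimes r^2$. $R\#H$ is the vector space $B=R\otimes H$ (elements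 $r\otimes h$ also written $r\#h$) with the dual quasi-bialgebra structure $(r\otimes h)(s\otimes k)=\omega^{-1}(r_{-2}\otimes h_1\otimes s_{-2}k_1)\,\omega(h_2\otimes s_{-1}\otimes k_2)\,\omega^{-1}[(h_3\vartriangleright s_0)_{-2}\otimes h_4\otimes k_3]\,\omega(r_{-1}\otimes(h_3\vartriangleright s_0)_{-1}\otimes h_5k_4)\; r_0\cdot_R(h_3\vartriangleright s_0)_0\otimes h_6k_5$, unit $1_R\otimes1_H$, $\Delta_B(r\otimes h)=\omega^{-1}(r^1_{-1}\otimes r^2_{-2}\otimes h_1)\,r^1_0\otimes r^2_{-1}h_2\otimes r^2_0\otimes h_3$, $\varepsilon_B(r\otimes h)=\varepsilon_R(r)\varepsilon_H(h)$, $\omega_B((r\otimes h)\otimes(s\otimes k)\otimes(t\otimes l))=\varepsilon_R(r)\varepsilon_R(s)\varepsilon_R(t)\omega(h\otimes k\otimes l)$. *)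

theory Defs
  imports Complex_Main "HOL-Library.Function_Algebras" "HOL-Computational_Algebra.Polynomial"
begin

section \<open>Vector spaces and tensor products\<close>

text \<open>
  A vector space is a subspace \<open>car V\<close> of a type that is a vector space under \<open>scl V\<close>.
  All maps are only constrained on carriers.
\<close>

record ('k, 'v) vspace =
  car :: "'v set"
  scl :: "'k \<Rightarrow> 'v \<Rightarrow> 'v"

definition is_vspace :: "('k::field, 'v::ab_group_add, 'm) vspace_scheme \<Rightarrow> bool" where
  "is_vspace V \<longleftrightarrow> vector_space (scl V) \<and> module.subspace (scl V) (car V)"

definition ground :: "('k::field, 'k) vspace" where
  "ground = \<lparr>car = UNIV, scl = (*)\<rparr>"

definition lin_map ::
  "('k::field, 'v::ab_group_add, 'm) vspace_scheme \<Rightarrow> ('k, 'w::ab_group_add, 'n) vspace_scheme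
    \<Rightarrow> ('v \<Rightarrow> 'w) \<Rightarrow> bool" where
  "lin_map V W f \<longleftrightarrow>
     (\<forall>x\<in>car V. f x \<in> car W) \<and>
     (\<forall>x\<in>car V. \<forall>y\<in>car V. f (x + y) = f x + f y) \<and>
     (\<forall>c. \<forall>x\<in>car V. f (scl V c x) = scl W c (f x))"

definition bilin_map ::
  "('k::field, 'u::ab_group_add, 'l) vspace_scheme \<Rightarrow> ('k, 'v::ab_group_add, 'm) vspace_scheme
    \<Rightarrow> ('k, 'w::ab_group_add, 'n) vspace_scheme \<Rightarrow> ('u \<Rightarrow> 'v \<Rightarrow> 'w) \<Rightarrow> bool" where
  "bilin_map U V W f \<longleftrightarrow>
     (\<forall>u\<in>car U. lin_map V W (f u)) \<and> (\<forall>v\<in>car V. lin_map U W (\<lambda>u. f u v))"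

text \<open>
  The tensor product of \<open>V\<close> and \<open>W\<close> is modelled inside the dual of the space of bilinear forms
  on \<open>V \<times> W\<close>: the pure tensor of \<open>v\<close> and \<open>w\<close> is evaluation at \<open>(v, w)\<close>, and the tensor product
  is the span of the pure tensors. Over a field this is the usual tensor product; its universal
  property is \<open>bilin_map_tens\<close>, \<open>sweedler_tens\<close> and \<open>lin_map_sweedler\<close> below. The vector space operations on the
  function type are pointwise.
\<close>

type_synonym ('k, 'v, 'w) tensor = "('v \<Rightarrow> 'w \<Rightarrow> 'k) \<Rightarrow> 'k"

definition tens ::
  "('k::field, 'v::ab_group_add, 'm) vspace_scheme \<Rightarrow> ('k, 'w::ab_group_add, 'n) vspace_scheme
    \<Rightarrow> 'v \<Rightarrow> 'w \<Rightarrow> ('k, 'v, 'w) tensor" where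
  "tens V W v w = (\<lambda>\<beta>. if bilin_map V W ground \<beta> then \<beta> v w else 0)"

definition tscl :: "'k::field \<Rightarrow> ('b \<Rightarrow> 'k) \<Rightarrow> 'b \<Rightarrow> 'k" where
  "tscl c t = (\<lambda>\<beta>. c * t \<beta>)"

text \<open>The subspace of \<open>V \<otimes> W\<close> spanned by the tensors of elements of \<open>A \<subseteq> V\<close> and \<open>B \<subseteq> W\<close>.\<close>

definition subtensor ::
  "('k::field, 'v::ab_group_add, 'm) vspace_scheme \<Rightarrow> ('k, 'w::ab_group_add, 'n) vspace_scheme
    \<Rightarrow> 'v set \<Rightarrow> 'w set \<Rightarrow> ('k, 'v, 'w) tensor set" where
  "subtensor V W A B = module.span tscl {tens V W a b | a b. a \<in> A \<and> b \<in> B}"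

definition tensor_space ::
  "('k::field, 'v::ab_group_add, 'm) vspace_scheme \<Rightarrow> ('k, 'w::ab_group_add, 'n) vspace_scheme
    \<Rightarrow> ('k, ('k, 'v, 'w) tensor) vspace" where
  "tensor_space V W = \<lparr>car = subtensor V W (car V) (car W), scl = tscl\<rparr>"

text \<open>
  Extension of a bilinear map from pure tensors to tensors, i.e. Sweedler summation: if \<open>t\<close> is the
  sum of the pure tensors of the pairs \<open>(v\<^sub>i, w\<^sub>i)\<close> then \<open>sweedler V W t f\<close> is the sum of the
  \<open>f v\<^sub>i w\<^sub>i\<close>. For bilinear \<open>f\<close> this does not depend on the representation of \<open>t\<close>.
\<close>

definition sweedler ::
  "('k::field, 'v::ab_group_add, 'm) vspace_scheme \<Rightarrow> ('k, 'w::ab_group_add, 'n) vspace_scheme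
    \<Rightarrow> ('k, 'v, 'w) tensor \<Rightarrow> ('v \<Rightarrow> 'w \<Rightarrow> 'z::ab_group_add) \<Rightarrow> 'z" where
  "sweedler V W t f =
     (THE z. \<exists>xs. set xs \<subseteq> car V \<times> car W \<and> t = (\<Sum>(v, w)\<leftarrow>xs. tens V W v w)
               \<and> z = (\<Sum>(v, w)\<leftarrow>xs. f v w))"

text \<open>The tensor product of the linear maps \<open>f : V \<rightarrow> V'\<close> and \<open>g : W \<rightarrow> W'\<close>.\<close>

definition tmap ::
  "('k::field, 'v::ab_group_add, 'm) vspace_scheme \<Rightarrow> ('k, 'w::ab_group_add, 'n) vspace_scheme
    \<Rightarrow> ('k, 'v'::ab_group_add, 'm') vspace_scheme \<Rightarrow> ('k, 'w'::ab_group_add, 'n') vspace_scheme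
    \<Rightarrow> ('v \<Rightarrow> 'v') \<Rightarrow> ('w \<Rightarrow> 'w') \<Rightarrow> ('k, 'v, 'w) tensor \<Rightarrow> ('k, 'v', 'w') tensor" where
  "tmap V W V' W' f g t = sweedler V W t (\<lambda>v w. tens V' W' (f v) (g w))"


subsection \<open>The universal property\<close>

lemma vector_space_tscl: "vector_space (tscl :: 'k::field \<Rightarrow> ('b \<Rightarrow> 'k) \<Rightarrow> _)"
  by unfold_locales (auto simp: tscl_def fun_eq_iff algebra_simps)

lemma is_vspace_ground: "is_vspace (ground :: ('k::field, 'k) vspace)"
proof -
  interpret vector_space "(*) :: 'k \<Rightarrow> 'k \<Rightarrow> 'k"
    by unfold_locales (auto simp: algebra_simps)
  show ?thesis
    by (auto simp: is_vspace_def ground_def vector_space_axioms)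
qed

lemma is_vspace_tensor_space:
  fixes V :: "('k::field, 'v::ab_group_add, 'm) vspace_scheme"
    and W :: "('k, 'w::ab_group_add, 'n) vspace_scheme"
  shows "is_vspace (tensor_space V W)"
proof -
  interpret vector_space "tscl :: 'k \<Rightarrow> ('k, 'v, 'w) tensor \<Rightarrow> _"
    by (rule vector_space_tscl)
  show ?thesis
    by (simp add: is_vspace_def tensor_space_def subtensor_def vector_space_axioms)
qed

lemma separating_functional:
  assumes "vector_space s" "z \<noteq> 0"
  obtains \<phi> where "Vector_Spaces.linear s ((*) :: 'k::field \<Rightarrow> 'k \<Rightarrow> 'k) \<phi>" "\<phi> z = 1"
proof -
  interpret vector_space s by fact
  interpret f: vector_space "(*) :: 'k \<Rightarrow> 'k \<Rightarrow> 'k"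
    by unfold_locales (auto simp: algebra_simps)
  interpret vector_space_pair s "(*) :: 'k \<Rightarrow> 'k \<Rightarrow> 'k" ..
  have "independent {z}" using assms(2) by (simp add: independent_insert)
  from linear_independent_extend[OF this, of "\<lambda>_. 1"] that show ?thesis by auto
qed

lemma sum_tens_apply:
  assumes "bilin_map V W ground \<beta>"
  shows "(\<Sum>(v, w)\<leftarrow>xs. tens V W v w) \<beta> = (\<Sum>(v, w)\<leftarrow>xs. \<beta> v w)"
  by (induction xs) (auto simp: tens_def assms split: prod.splits)

lemma sweedler_welldef:
  fixes V :: "('k::field, 'v::ab_group_add, 'm) vspace_scheme"
    and W :: "('k, 'w::ab_group_add, 'n) vspace_scheme"
    and Z :: "('k, 'z::ab_group_add, 'l) vspace_scheme"
  assumes Z: "is_vspace Z" and f: "bilin_map V W Z f"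
    and xs: "set xs \<subseteq> car V \<times> car W" and ys: "set ys \<subseteq> car V \<times> car W"
    and eq: "(\<Sum>(v, w)\<leftarrow>xs. tens V W v w) = (\<Sum>(v, w)\<leftarrow>ys. tens V W v w)"
  shows "(\<Sum>(v, w)\<leftarrow>xs. f v w) = (\<Sum>(v, w)\<leftarrow>ys. f v w)"
proof (rule ccontr)
  let ?S = "\<lambda>xs. \<Sum>(v, w)\<leftarrow>xs. f v w"
  assume "?S xs \<noteq> ?S ys"
  hence "?S xs - ?S ys \<noteq> 0" by simp
  moreover have "vector_space (scl Z)" using Z by (simp add: is_vspace_def)
  ultimately obtain \<phi> where
    \<phi>: "Vector_Spaces.linear (scl Z) ((*) :: 'k \<Rightarrow> 'k \<Rightarrow> 'k) \<phi>" and ne: "\<phi> (?S xs - ?S ys) = 1"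
    using separating_functional by metis
  interpret Vector_Spaces.linear "scl Z" "(*) :: 'k \<Rightarrow> 'k \<Rightarrow> 'k" \<phi> by fact
  have b: "bilin_map V W ground (\<lambda>v w. \<phi> (f v w))"
    using f by (auto simp: bilin_map_def lin_map_def ground_def add scale)
  have S: "\<phi> (?S zs) = (\<Sum>(v, w)\<leftarrow>zs. \<phi> (f v w))" for zs
    by (induction zs) (auto simp: add)
  have "\<phi> (?S xs) = \<phi> (?S ys)"
    unfolding S sum_tens_apply[OF b, symmetric] eq ..
  with ne show False by (simp add: diff)
qed

lemma sweedler_sum:
  assumes "is_vspace Z" "bilin_map V W Z f" "set xs \<subseteq> car V \<times> car W"
  shows "sweedler V W (\<Sum>(v, w)\<leftarrow>xs. tens V W v w) f = (\<Sum>(v, w)\<leftarrow>xs. f v w)"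
  unfolding sweedler_def
proof (rule the_equality)
  show "\<exists>ys. set ys \<subseteq> car V \<times> car W
      \<and> (\<Sum>(v, w)\<leftarrow>xs. tens V W v w) = (\<Sum>(v, w)\<leftarrow>ys. tens V W v w)
      \<and> (\<Sum>(v, w)\<leftarrow>xs. f v w) = (\<Sum>(v, w)\<leftarrow>ys. f v w)"
    using assms(3) by (intro exI[of _ xs] conjI refl)
next
  fix z
  assume "\<exists>ys. set ys \<subseteq> car V \<times> car W
      \<and> (\<Sum>(v, w)\<leftarrow>xs. tens V W v w) = (\<Sum>(v, w)\<leftarrow>ys. tens V W v w)
      \<and> z = (\<Sum>(v, w)\<leftarrow>ys. f v w)"
  then obtain ys where ys: "set ys \<subseteq> car V \<times> car W"
    "(\<Sum>(v, w)\<leftarrow>xs. tens V W v w) = (\<Sum>(v, w)\<leftarrow>ys. tens V W v w)"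
    "z = (\<Sum>(v, w)\<leftarrow>ys. f v w)" by (elim exE conjE)
  show "z = (\<Sum>(v, w)\<leftarrow>xs. f v w)"
    unfolding ys(3) by (rule sweedler_welldef[OF assms(1,2,3) ys(1,2), symmetric])
qed

lemma sweedler_tens:
  assumes "is_vspace Z" "bilin_map V W Z f" "v \<in> car V" "w \<in> car W"
  shows "sweedler V W (tens V W v w) f = f v w"
  using sweedler_sum[OF assms(1,2), of "[(v, w)]"] assms(3,4) by simp

lemma tscl_tens:
  assumes "v \<in> car V" "w \<in> car W"
  shows "tscl c (tens V W v w) = tens V W (scl V c v) w"
  using assms by (auto simp: tscl_def tens_def bilin_map_def lin_map_def ground_def fun_eq_iff)

lemma tscl_sum_tens:
  fixes V :: "('k::field, 'v::ab_group_add, 'm) vspace_scheme"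
    and W :: "('k, 'w::ab_group_add, 'n) vspace_scheme"
  assumes "set xs \<subseteq> car V \<times> car W"
  shows "tscl c (\<Sum>(v, w)\<leftarrow>xs. tens V W v w)
           = (\<Sum>(v, w)\<leftarrow>map (\<lambda>(v, w). (scl V c v, w)) xs. tens V W v w)"
  using assms
proof (induction xs)
  case Nil
  show ?case by (simp add: tscl_def fun_eq_iff)
next
  case (Cons a xs)
  have add: "tscl c (x + y) = tscl c x + tscl c y" for x y :: "('k, 'v, 'w) tensor"
    by (simp add: tscl_def fun_eq_iff distrib_left)
  obtain v w where a: "a = (v, w)" by (cases a)
  have vw: "v \<in> car V" "w \<in> car W" and xs: "set xs \<subseteq> car V \<times> car W"
    using Cons.prems a by auto
  show ?case
    by (simp only: a list.map sum_list.Cons prod.case add Cons.IH[OF xs] tscl_tens[OF vw])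
qed

lemma map_scl_carrier:
  assumes "is_vspace V" "set xs \<subseteq> car V \<times> car W"
  shows "set (map (\<lambda>(v, w). (scl V c v, w)) xs) \<subseteq> car V \<times> car W"
proof -
  interpret vector_space "scl V" using assms(1) by (simp add: is_vspace_def)
  show ?thesis using assms by (auto simp: is_vspace_def subspace_scale)
qed

lemma tensor_space_sumE:
  fixes V :: "('k::field, 'v::ab_group_add, 'm) vspace_scheme"
    and W :: "('k, 'w::ab_group_add, 'n) vspace_scheme"
  assumes "is_vspace V" "t \<in> car (tensor_space V W)"
  obtains xs where "set xs \<subseteq> car V \<times> car W" "t = (\<Sum>(v, w)\<leftarrow>xs. tens V W v w)"
proof -
  interpret t: vector_space "tscl :: 'k \<Rightarrow> ('k, 'v, 'w) tensor \<Rightarrow> _"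
    by (rule vector_space_tscl)
  have "t \<in> t.span {tens V W a b | a b. a \<in> car V \<and> b \<in> car W}"
    using assms(2) by (simp add: tensor_space_def subtensor_def)
  hence "\<exists>xs. set xs \<subseteq> car V \<times> car W \<and> t = (\<Sum>(v, w)\<leftarrow>xs. tens V W v w)"
  proof (induction rule: t.span_induct_alt)
    case base
    show ?case by (rule exI[of _ "[]"]) simp
  next
    case (step c x y)
    from step.IH obtain ys where
      ys: "set ys \<subseteq> car V \<times> car W" "y = (\<Sum>(v, w)\<leftarrow>ys. tens V W v w)"
      by (elim exE conjE)
    from step.hyps obtain a b where ab: "x = tens V W a b" "a \<in> car V" "b \<in> car W"
      unfolding mem_Collect_eq by (elim exE conjE)
    have "set ((scl V c a, b) # ys) \<subseteq> car V \<times> car W"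
      using map_scl_carrier[OF assms(1), of "[(a, b)]" W c] ab(2,3) ys(1) by simp
    moreover have "tscl c x + y = (\<Sum>(v, w)\<leftarrow>(scl V c a, b) # ys. tens V W v w)"
      by (simp only: ab(1) ys(2) list.map sum_list.Cons prod.case tscl_tens[OF ab(2,3)])
    ultimately show ?case by (intro exI conjI)
  qed
  then obtain xs where "set xs \<subseteq> car V \<times> car W" "t = (\<Sum>(v, w)\<leftarrow>xs. tens V W v w)"
    by (elim exE conjE)
  thus ?thesis by (rule that)
qed

lemma lin_map_sweedler:
  assumes V: "is_vspace V" and Z: "is_vspace Z" and f: "bilin_map V W Z f"
  shows "lin_map (tensor_space V W) Z (\<lambda>t. sweedler V W t f)"
proof -
  interpret Z: vector_space "scl Z" using Z by (simp add: is_vspace_def)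
  have sub: "Z.subspace (car Z)" using Z by (simp add: is_vspace_def)
  have closed: "(\<Sum>(v, w)\<leftarrow>xs. f v w) \<in> car Z" if "set xs \<subseteq> car V \<times> car W" for xs
    using that f
    by (induction xs)
       (auto simp: bilin_map_def lin_map_def intro!: Z.subspace_add[OF sub] Z.subspace_0[OF sub])
  have scale: "(\<Sum>(v, w)\<leftarrow>map (\<lambda>(v, w). (scl V c v, w)) xs. f v w)
      = scl Z c (\<Sum>(v, w)\<leftarrow>xs. f v w)" if "set xs \<subseteq> car V \<times> car W" for xs c
    using that f by (induction xs) (auto simp: bilin_map_def lin_map_def Z.scale_right_distrib)
  show ?thesis
    unfolding lin_map_def
  proof (intro conjI ballI allI)
    fix t assume "t \<in> car (tensor_space V W)"
    then obtain xs where xs: "set xs \<subseteq> car V \<times> car W" "t = (\<Sum>(v, w)\<leftarrow>xs. tens V W v w)"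
      by (rule tensor_space_sumE[OF V])
    show "sweedler V W t f \<in> car Z"
      using closed[OF xs(1)] by (simp add: xs(2) sweedler_sum[OF Z f xs(1)])
    fix c
    have "scl (tensor_space V W) c t
        = (\<Sum>(v, w)\<leftarrow>map (\<lambda>(v, w). (scl V c v, w)) xs. tens V W v w)"
      unfolding xs(2) tscl_sum_tens[OF xs(1), symmetric] by (simp add: tensor_space_def)
    thus "sweedler V W (scl (tensor_space V W) c t) f = scl Z c (sweedler V W t f)"
      unfolding xs(2) sweedler_sum[OF Z f xs(1)]
      using sweedler_sum[OF Z f map_scl_carrier[OF V xs(1)]] scale[OF xs(1)] by metis
  next
    fix t u assume t: "t \<in> car (tensor_space V W)" and u: "u \<in> car (tensor_space V W)"
    obtain xs where xs: "set xs \<subseteq> car V \<times> car W" "t = (\<Sum>(v, w)\<leftarrow>xs. tens V W v w)"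
      using t by (rule tensor_space_sumE[OF V])
    obtain ys where ys: "set ys \<subseteq> car V \<times> car W" "u = (\<Sum>(v, w)\<leftarrow>ys. tens V W v w)"
      using u by (rule tensor_space_sumE[OF V])
    have "set (xs @ ys) \<subseteq> car V \<times> car W" using xs ys by simp
    from sweedler_sum[OF Z f this]
    show "sweedler V W (t + u) f = sweedler V W t f + sweedler V W u f"
      by (simp add: xs(2) ys(2) sweedler_sum[OF Z f xs(1)] sweedler_sum[OF Z f ys(1)])
  qed
qed

lemma bilin_mapD:
  assumes "bilin_map V W Z f" "v \<in> car V" "w \<in> car W"
  shows "f v w \<in> car Z"
    and "v' \<in> car V \<Longrightarrow> f (v + v') w = f v w + f v' w"
    and "w' \<in> car W \<Longrightarrow> f v (w + w') = f v w + f v w'"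
    and "f (scl V c v) w = scl Z c (f v w)"
    and "f v (scl W c w) = scl Z c (f v w)"
  using assms unfolding bilin_map_def lin_map_def by blast+

lemma tens_add_left:
  assumes "v \<in> car V" "v' \<in> car V" "w \<in> car W"
  shows "tens V W (v + v') w = tens V W v w + tens V W v' w"
proof
  fix \<beta> show "tens V W (v + v') w \<beta> = (tens V W v w + tens V W v' w) \<beta>"
    using bilin_mapD(2)[of V W ground \<beta> v w v'] assms
    by (cases "bilin_map V W ground \<beta>") (simp_all add: tens_def)
qed

lemma tens_add_right:
  assumes "v \<in> car V" "w \<in> car W" "w' \<in> car W"
  shows "tens V W v (w + w') = tens V W v w + tens V W v w'"
proof
  fix \<beta> show "tens V W v (w + w') \<beta> = (tens V W v w + tens V W v w') \<beta>"
    using bilin_mapD(3)[of V W ground \<beta> v w w'] assms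
    by (cases "bilin_map V W ground \<beta>") (simp_all add: tens_def)
qed

lemma tens_scl_right:
  assumes "v \<in> car V" "w \<in> car W"
  shows "tens V W v (scl W c w) = tscl c (tens V W v w)"
proof
  fix \<beta> show "tens V W v (scl W c w) \<beta> = tscl c (tens V W v w) \<beta>"
    using bilin_mapD(5)[of V W ground \<beta> v w c] assms
    by (cases "bilin_map V W ground \<beta>") (simp_all add: tens_def tscl_def ground_def)
qed

lemma bilin_map_tens:
  fixes V :: "('k::field, 'v::ab_group_add, 'm) vspace_scheme"
    and W :: "('k, 'w::ab_group_add, 'n) vspace_scheme"
  shows "bilin_map V W (tensor_space V W) (tens V W)"
proof -
  interpret t: vector_space "tscl :: 'k \<Rightarrow> ('k, 'v, 'w) tensor \<Rightarrow> _"
    by (rule vector_space_tscl)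
  have "tens V W v w \<in> car (tensor_space V W)" if "v \<in> car V" "w \<in> car W" for v w
    using that by (auto simp: tensor_space_def subtensor_def intro!: t.span_base)
  moreover have "scl (tensor_space V W) = tscl"
    by (simp add: tensor_space_def)
  ultimately show ?thesis
    by (simp add: bilin_map_def lin_map_def tens_add_left tens_add_right tens_scl_right
        tscl_tens[symmetric])
qed


section \<open>Coalgebras\<close>

record ('k, 'h) coalg = "('k, 'h) vspace" +
  comul :: "'h \<Rightarrow> ('k, 'h, 'h) tensor"
  counit :: "'h \<Rightarrow> 'k"

text \<open>
  \<open>copn C h (\<lambda>h\<^sub>1 \<dots> h\<^sub>n. e)\<close> is Sweedler notation for the n-fold comultiplication of \<open>h\<close>.
\<close>

definition cop2 :: "('k::field, 'h::ab_group_add, 'm) coalg_scheme \<Rightarrow> 'h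
    \<Rightarrow> ('h \<Rightarrow> 'h \<Rightarrow> 'z::ab_group_add) \<Rightarrow> 'z" where
  "cop2 C h f = sweedler C C (comul C h) f"

definition cop3 :: "('k::field, 'h::ab_group_add, 'm) coalg_scheme \<Rightarrow> 'h
    \<Rightarrow> ('h \<Rightarrow> 'h \<Rightarrow> 'h \<Rightarrow> 'z::ab_group_add) \<Rightarrow> 'z" where
  "cop3 C h f = cop2 C h (\<lambda>h1 h'. cop2 C h' (f h1))"

definition cop4 :: "('k::field, 'h::ab_group_add, 'm) coalg_scheme \<Rightarrow> 'h
    \<Rightarrow> ('h \<Rightarrow> 'h \<Rightarrow> 'h \<Rightarrow> 'h \<Rightarrow> 'z::ab_group_add) \<Rightarrow> 'z" where
  "cop4 C h f = cop2 C h (\<lambda>h1 h'. cop3 C h' (f h1))"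

definition cop5 :: "('k::field, 'h::ab_group_add, 'm) coalg_scheme \<Rightarrow> 'h
    \<Rightarrow> ('h \<Rightarrow> 'h \<Rightarrow> 'h \<Rightarrow> 'h \<Rightarrow> 'h \<Rightarrow> 'z::ab_group_add) \<Rightarrow> 'z" where
  "cop5 C h f = cop2 C h (\<lambda>h1 h'. cop4 C h' (f h1))"

definition cop6 :: "('k::field, 'h::ab_group_add, 'm) coalg_scheme \<Rightarrow> 'h
    \<Rightarrow> ('h \<Rightarrow> 'h \<Rightarrow> 'h \<Rightarrow> 'h \<Rightarrow> 'h \<Rightarrow> 'h \<Rightarrow> 'z::ab_group_add) \<Rightarrow> 'z" where
  "cop6 C h f = cop2 C h (\<lambda>h1 h'. cop5 C h' (f h1))"

definition is_coalgebra :: "('k::field, 'h::ab_group_add, 'm) coalg_scheme \<Rightarrow> bool" where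
  "is_coalgebra C \<longleftrightarrow>
     is_vspace C \<and> lin_map C (tensor_space C C) (comul C) \<and> lin_map C ground (counit C) \<and>
     (\<forall>h\<in>car C.
        cop2 C h (\<lambda>a b. cop2 C a (\<lambda>a1 a2.
            tens C (tensor_space C C) a1 (tens C C a2 b)))
          = cop2 C h (\<lambda>a b. cop2 C b (\<lambda>b1 b2.
            tens C (tensor_space C C) a (tens C C b1 b2))) \<and>
        cop2 C h (\<lambda>a b. scl C (counit C a) b) = h \<and>
        cop2 C h (\<lambda>a b. scl C (counit C b) a) = h)"

definition grouplike :: "('k::field, 'h::ab_group_add, 'm) coalg_scheme \<Rightarrow> 'h set" where
  "grouplike C = {g \<in> car C. comul C g = tens C C g g \<and> counit C g = 1}"

definition subcoalgebra ::
  "('k::field, 'h::ab_group_add, 'm) coalg_scheme \<Rightarrow> 'h set \<Rightarrow> bool" where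
  "subcoalgebra C D \<longleftrightarrow>
     D \<subseteq> car C \<and> module.subspace (scl C) D \<and> (\<forall>d\<in>D. comul C d \<in> subtensor C C D D)"

definition simple_subcoalgebra ::
  "('k::field, 'h::ab_group_add, 'm) coalg_scheme \<Rightarrow> 'h set \<Rightarrow> bool" where
  "simple_subcoalgebra C D \<longleftrightarrow>
     subcoalgebra C D \<and> D \<noteq> {0} \<and> (\<forall>E. subcoalgebra C E \<and> E \<subseteq> D \<longrightarrow> E = {0} \<or> E = D)"

definition coradical :: "('k::field, 'h::ab_group_add, 'm) coalg_scheme \<Rightarrow> 'h set" where
  "coradical C = module.span (scl C) (\<Union>{D. simple_subcoalgebra C D})"

text \<open>Convolution of linear, trilinear and quadrilinear forms.\<close>

definition conv :: "('k::field, 'h::ab_group_add, 'm) coalg_scheme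
    \<Rightarrow> ('h \<Rightarrow> 'k) \<Rightarrow> ('h \<Rightarrow> 'k) \<Rightarrow> 'h \<Rightarrow> 'k" where
  "conv C \<phi> \<psi> h = cop2 C h (\<lambda>h1 h2. \<phi> h1 * \<psi> h2)"

definition conv3 :: "('k::field, 'h::ab_group_add, 'm) coalg_scheme
    \<Rightarrow> ('h \<Rightarrow> 'h \<Rightarrow> 'h \<Rightarrow> 'k) \<Rightarrow> ('h \<Rightarrow> 'h \<Rightarrow> 'h \<Rightarrow> 'k) \<Rightarrow> 'h \<Rightarrow> 'h \<Rightarrow> 'h \<Rightarrow> 'k" where
  "conv3 C \<phi> \<psi> h k l =
     cop2 C h (\<lambda>h1 h2. cop2 C k (\<lambda>k1 k2. cop2 C l (\<lambda>l1 l2. \<phi> h1 k1 l1 * \<psi> h2 k2 l2)))"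

definition conv4 :: "('k::field, 'h::ab_group_add, 'm) coalg_scheme
    \<Rightarrow> ('h \<Rightarrow> 'h \<Rightarrow> 'h \<Rightarrow> 'h \<Rightarrow> 'k) \<Rightarrow> ('h \<Rightarrow> 'h \<Rightarrow> 'h \<Rightarrow> 'h \<Rightarrow> 'k) \<Rightarrow> 'h \<Rightarrow> 'h \<Rightarrow> 'h \<Rightarrow> 'h \<Rightarrow> 'k" where
  "conv4 C \<phi> \<psi> h k l m =
     cop2 C h (\<lambda>h1 h2. cop2 C k (\<lambda>k1 k2. cop2 C l (\<lambda>l1 l2. cop2 C m (\<lambda>m1 m2.
       \<phi> h1 k1 l1 m1 * \<psi> h2 k2 l2 m2))))"

definition trilin_form ::
  "('k::field, 'h::ab_group_add, 'm) vspace_scheme \<Rightarrow> ('h \<Rightarrow> 'h \<Rightarrow> 'h \<Rightarrow> 'k) \<Rightarrow> bool" where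
  "trilin_form V \<phi> \<longleftrightarrow>
     (\<forall>h\<in>car V. bilin_map V V ground (\<phi> h)) \<and>
     (\<forall>k\<in>car V. \<forall>l\<in>car V. lin_map V ground (\<lambda>h. \<phi> h k l))"

definition conv_inverse3 :: "('k::field, 'h::ab_group_add, 'm) coalg_scheme
    \<Rightarrow> ('h \<Rightarrow> 'h \<Rightarrow> 'h \<Rightarrow> 'k) \<Rightarrow> ('h \<Rightarrow> 'h \<Rightarrow> 'h \<Rightarrow> 'k) \<Rightarrow> bool" where
  "conv_inverse3 C \<phi> \<psi> \<longleftrightarrow>
     trilin_form C \<psi> \<and>
     (\<forall>h\<in>car C. \<forall>k\<in>car C. \<forall>l\<in>car C.
        conv3 C \<phi> \<psi> h k l = counit C h * counit C k * counit C l \<and>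
        conv3 C \<psi> \<phi> h k l = counit C h * counit C k * counit C l)"


section \<open>Dual quasi-bialgebras\<close>

text \<open>
  A linear map on \<open>H \<otimes> H\<close> or \<open>H \<otimes> H \<otimes> H\<close> is given by the corresponding bilinear or trilinear
  map, and the unit map by the element \<open>one\<close>.
\<close>

record ('k, 'h) dqb = "('k, 'h) coalg" +
  mul :: "'h \<Rightarrow> 'h \<Rightarrow> 'h"
  one :: 'h
  omega :: "'h \<Rightarrow> 'h \<Rightarrow> 'h \<Rightarrow> 'k"

text \<open>The convolution inverse is unique only as a trilinear form on the carrier.\<close>

definition omega_inv ::
  "('k::field, 'h::ab_group_add, 'm) dqb_scheme \<Rightarrow> 'h \<Rightarrow> 'h \<Rightarrow> 'h \<Rightarrow> 'k" where
  "omega_inv H = (SOME \<psi>. conv_inverse3 H (omega H) \<psi>)"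

definition coalgebra_with_mult_unit ::
  "('k::field, 'h::ab_group_add, 'm) dqb_scheme \<Rightarrow> bool" where
  "coalgebra_with_mult_unit H \<longleftrightarrow>
     is_coalgebra H \<and> bilin_map H H H (mul H) \<and>
     (\<forall>h\<in>car H. \<forall>k\<in>car H.
        comul H (mul H h k)
          = cop2 H h (\<lambda>h1 h2. cop2 H k (\<lambda>k1 k2. tens H H (mul H h1 k1) (mul H h2 k2))) \<and>
        counit H (mul H h k) = counit H h * counit H k) \<and>
     one H \<in> car H \<and> comul H (one H) = tens H H (one H) (one H) \<and> counit H (one H) = 1"

definition dual_quasi_bialgebra ::
  "('k::field, 'h::ab_group_add, 'm) dqb_scheme \<Rightarrow> bool" where
  "dual_quasi_bialgebra H \<longleftrightarrow>
     coalgebra_with_mult_unit H \<and>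
     trilin_form H (omega H) \<and> (\<exists>\<psi>. conv_inverse3 H (omega H) \<psi>) \<and>
     (\<forall>h\<in>car H. \<forall>k\<in>car H. \<forall>l\<in>car H. \<forall>m\<in>car H.
        conv4 H (conv4 H (\<lambda>h k l m. counit H h * omega H k l m)
                         (\<lambda>h k l m. omega H h (mul H k l) m))
                (\<lambda>h k l m. omega H h k l * counit H m) h k l m
          = conv4 H (\<lambda>h k l m. omega H h k (mul H l m))
                    (\<lambda>h k l m. omega H (mul H h k) l m) h k l m) \<and>
     (\<forall>h\<in>car H. \<forall>h'\<in>car H. omega H h (one H) h' = counit H h * counit H h') \<and>
     (\<forall>h\<in>car H. \<forall>k\<in>car H. \<forall>l\<in>car H.
        cop2 H h (\<lambda>h1 h2. cop2 H k (\<lambda>k1 k2. cop2 H l (\<lambda>l1 l2.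
            scl H (omega H h2 k2 l2) (mul H h1 (mul H k1 l1)))))
          = cop2 H h (\<lambda>h1 h2. cop2 H k (\<lambda>k1 k2. cop2 H l (\<lambda>l1 l2.
            scl H (omega H h1 k1 l1) (mul H (mul H h2 k2) l2))))) \<and>
     (\<forall>h\<in>car H. mul H (one H) h = h \<and> mul H h (one H) = h)"

primrec gpow :: "('k::field, 'h::ab_group_add, 'm) dqb_scheme \<Rightarrow> 'h \<Rightarrow> nat \<Rightarrow> 'h" where
  "gpow H g 0 = one H"
| "gpow H g (Suc n) = mul H g (gpow H g n)"


section \<open>Quasi-Yetter-Drinfeld data\<close>

definition qYD_datum :: "('k::field, 'h::ab_group_add, 'm) dqb_scheme
    \<Rightarrow> 'h \<Rightarrow> ('h \<Rightarrow> 'k) \<Rightarrow> bool" where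
  "qYD_datum H g \<chi> \<longleftrightarrow>
     dual_quasi_bialgebra H \<and> g \<in> grouplike H \<and> lin_map H ground \<chi> \<and> \<chi> (one H) = 1 \<and>
     (\<forall>h\<in>car H. \<forall>l\<in>car H.
        \<chi> (mul H h l) =
          cop4 H h (\<lambda>h1 h2 h3 h4. cop4 H l (\<lambda>l1 l2 l3 l4.
            omega_inv H h1 l1 g * \<chi> l2 * omega H h2 g l3 * \<chi> h3 * omega_inv H g h4 l4))) \<and>
     (\<forall>h\<in>car H.
        cop2 H h (\<lambda>h1 h2. scl H (\<chi> h1) (mul H g h2))
          = cop2 H h (\<lambda>h1 h2. scl H (\<chi> h2) (mul H h1 g)))"

primrec chi_br :: "('k::field, 'h::ab_group_add, 'm) dqb_scheme
    \<Rightarrow> 'h \<Rightarrow> ('h \<Rightarrow> 'k) \<Rightarrow> nat \<Rightarrow> 'h \<Rightarrow> 'k" where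
  "chi_br H g \<chi> 0 = counit H"
| "chi_br H g \<chi> (Suc n) =
     conv H (conv H (conv H (conv H
       (\<lambda>h. omega H h g (gpow H g n))
       \<chi>)
       (\<lambda>h. omega_inv H g h (gpow H g n)))
       (chi_br H g \<chi> n))
       (\<lambda>h. omega H g (gpow H g n) h)"

text \<open>
  Gaussian binomial coefficients are defined by the q-Pascal rule, so that \<open>q\<close> may be a root of
  unity; \<open>gauss_binom_qfact\<close> relates them to q-factorials.
\<close>

fun gauss_binom :: "'k::field \<Rightarrow> nat \<Rightarrow> nat \<Rightarrow> 'k" where
  "gauss_binom q n 0 = 1"
| "gauss_binom q 0 (Suc k) = 0"
| "gauss_binom q (Suc n) (Suc k) = gauss_binom q n k + q ^ Suc k * gauss_binom q n (Suc k)"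

definition qint :: "'k::field \<Rightarrow> nat \<Rightarrow> 'k" where
  "qint q n = (\<Sum>i<n. q ^ i)"

definition qfact :: "'k::field \<Rightarrow> nat \<Rightarrow> 'k" where
  "qfact q n = (\<Prod>i<n. qint q (Suc i))"

lemma gauss_binom_eq_0: "n < k \<Longrightarrow> gauss_binom q n k = 0"
  by (induction q n k rule: gauss_binom.induct) auto

lemma qint_add: "qint q (m + n) = qint q m + q ^ m * qint q n"
  by (induction n) (auto simp: qint_def algebra_simps power_add)

lemma gauss_binom_qfact:
  "gauss_binom q (k + l) k * (qfact q k * qfact q l) = qfact q (k + l)"
proof (induction "k + l" arbitrary: k l)
  case 0
  thus ?case by (simp add: qfact_def)
next
  case (Suc n)
  show ?case
  proof (cases "k = 0 \<or> l = 0")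
    case True
    have "gauss_binom q k k = 1" for k by (induction k) (auto simp: gauss_binom_eq_0)
    with True show ?thesis by (auto simp: qfact_def)
  next
    case False
    then obtain a b where ab: "k = Suc a" "l = Suc b" by (metis not0_implies_Suc)
    have n: "n = a + Suc b" using Suc(2) ab by simp
    have kl: "Suc a + Suc b = Suc n" using n by simp
    have f: "qfact q (Suc i) = qfact q i * qint q (Suc i)" for i by (simp add: qfact_def)
    have 1: "gauss_binom q n a * (qfact q a * qfact q (Suc b)) = qfact q n"
      using Suc(1)[OF n] unfolding n[symmetric] .
    have n': "n = Suc a + b" using n by simp
    have 2: "gauss_binom q n (Suc a) * (qfact q (Suc a) * qfact q b) = qfact q n"
      using Suc(1)[OF n'] unfolding n'[symmetric] .
    have "gauss_binom q (k + l) k * (qfact q k * qfact q l)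
        = (gauss_binom q n a + q ^ Suc a * gauss_binom q n (Suc a))
            * (qfact q (Suc a) * qfact q (Suc b))"
      by (simp only: ab kl gauss_binom.simps)
    also have "\<dots> = qint q (Suc a) * (gauss_binom q n a * (qfact q a * qfact q (Suc b)))
        + q ^ Suc a * qint q (Suc b) * (gauss_binom q n (Suc a) * (qfact q (Suc a) * qfact q b))"
      unfolding f by (simp only: distrib_right distrib_left mult_ac)
    also have "\<dots> = (qint q (Suc a) + q ^ Suc a * qint q (Suc b)) * qfact q n"
      by (simp only: 1 2 distrib_right)
    also have "\<dots> = qint q (Suc a + Suc b) * qfact q n" by (simp only: qint_add)
    also have "\<dots> = qfact q (k + l)"
      unfolding ab kl f by (rule mult.commute)
    finally show ?thesis .
  qed
qed

definition beta_coeff :: "('k::field, 'h::ab_group_add, 'm) dqb_scheme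
    \<Rightarrow> 'h \<Rightarrow> 'k \<Rightarrow> nat \<Rightarrow> nat \<Rightarrow> 'k" where
  "beta_coeff H g q i n =
     gauss_binom q n i * (\<Prod>j<i. omega H g (gpow H g j) (gpow H g (n - i)))"

definition primitive_root_of_unity :: "nat \<Rightarrow> 'k::field \<Rightarrow> bool" where
  "primitive_root_of_unity N q \<longleftrightarrow> N > 0 \<and> q ^ N = 1 \<and> (\<forall>m. 0 < m \<and> m < N \<longrightarrow> q ^ m \<noteq> 1)"


section \<open>The category of Yetter-Drinfeld modules\<close>

record ('k, 'h, 'v) yd_obj = "('k, 'v) vspace" +
  coact :: "'v \<Rightarrow> ('k, 'h, 'v) tensor"
  act :: "'h \<Rightarrow> 'v \<Rightarrow> 'v"

text \<open>
  \<open>coa1 H V v (\<lambda>a v\<^sub>0. e)\<close> and \<open>coa2 H V v (\<lambda>b a v\<^sub>0. e)\<close> are Sweedler notation for the coaction,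
  with \<open>a\<close> and \<open>b\<close> standing for \<open>v\<close> with index \<open>-1\<close> and \<open>-2\<close>.
\<close>

definition coa1 :: "('k::field, 'h::ab_group_add, 'm) dqb_scheme
    \<Rightarrow> ('k, 'h, 'v::ab_group_add, 'n) yd_obj_scheme \<Rightarrow> 'v
    \<Rightarrow> ('h \<Rightarrow> 'v \<Rightarrow> 'z::ab_group_add) \<Rightarrow> 'z" where
  "coa1 H V v f = sweedler H V (coact V v) f"

definition coa2 :: "('k::field, 'h::ab_group_add, 'm) dqb_scheme
    \<Rightarrow> ('k, 'h, 'v::ab_group_add, 'n) yd_obj_scheme \<Rightarrow> 'v
    \<Rightarrow> ('h \<Rightarrow> 'h \<Rightarrow> 'v \<Rightarrow> 'z::ab_group_add) \<Rightarrow> 'z" where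
  "coa2 H V v f = coa1 H V v (\<lambda>b v'. coa1 H V v' (f b))"

definition left_comodule :: "('k::field, 'h::ab_group_add, 'm) dqb_scheme
    \<Rightarrow> ('k, 'h, 'v::ab_group_add, 'n) yd_obj_scheme \<Rightarrow> bool" where
  "left_comodule H V \<longleftrightarrow>
     is_vspace V \<and> lin_map V (tensor_space H V) (coact V) \<and>
     (\<forall>v\<in>car V.
        coa1 H V v (\<lambda>a v0. cop2 H a (\<lambda>a1 a2. tens H (tensor_space H V) a1 (tens H V a2 v0)))
          = coa1 H V v (\<lambda>a v0. coa1 H V v0 (\<lambda>b v00.
              tens H (tensor_space H V) a (tens H V b v00))) \<and>
        coa1 H V v (\<lambda>a v0. scl V (counit H a) v0) = v)"

definition yd_object :: "('k::field, 'h::ab_group_add, 'm) dqb_scheme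
    \<Rightarrow> ('k, 'h, 'v::ab_group_add, 'n) yd_obj_scheme \<Rightarrow> bool" where
  "yd_object H V \<longleftrightarrow>
     left_comodule H V \<and> bilin_map H V V (act V) \<and>
     (\<forall>h\<in>car H. \<forall>l\<in>car H. \<forall>v\<in>car V.
        act V (mul H h l) v =
          cop4 H h (\<lambda>h1 h2 h3 h4. cop4 H l (\<lambda>l1 l2 l3 l4.
            coa1 H V v (\<lambda>a v0.
            coa1 H V (act V l2 v0) (\<lambda>b u0.
            coa1 H V (act V h3 u0) (\<lambda>c w0.
              scl V (omega_inv H h1 l1 a * omega H h2 b l3 * omega_inv H c h4 l4) w0)))))) \<and>
     (\<forall>v\<in>car V. act V (one H) v = v) \<and>
     (\<forall>h\<in>car H. \<forall>v\<in>car V.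
        cop2 H h (\<lambda>h1 h2. coa1 H V (act V h1 v) (\<lambda>a w0. tens H V (mul H a h2) w0))
          = cop2 H h (\<lambda>h1 h2. coa1 H V v (\<lambda>a v0. tens H V (mul H h1 a) (act V h2 v0))))"

definition yd_hom :: "('k::field, 'h::ab_group_add, 'm) dqb_scheme
    \<Rightarrow> ('k, 'h, 'v::ab_group_add, 'n) yd_obj_scheme
    \<Rightarrow> ('k, 'h, 'w::ab_group_add, 'l) yd_obj_scheme \<Rightarrow> ('v \<Rightarrow> 'w) \<Rightarrow> bool" where
  "yd_hom H V W f \<longleftrightarrow>
     lin_map V W f \<and>
     (\<forall>v\<in>car V. coact W (f v) = tmap H V H W (\<lambda>h. h) f (coact V v)) \<and>
     (\<forall>h\<in>car H. \<forall>v\<in>car V. f (act V h v) = act W h (f v))"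

definition yd_unit :: "('k::field, 'h::ab_group_add, 'm) dqb_scheme \<Rightarrow> ('k, 'h, 'k) yd_obj" where
  "yd_unit H = \<lparr>car = car ground, scl = scl ground,
     coact = (\<lambda>c. tens H ground (one H) c),
     act = (\<lambda>h c. counit H h * c)\<rparr>"

definition yd_tensor :: "('k::field, 'h::ab_group_add, 'm) dqb_scheme
    \<Rightarrow> ('k, 'h, 'v::ab_group_add, 'n) yd_obj_scheme
    \<Rightarrow> ('k, 'h, 'w::ab_group_add, 'l) yd_obj_scheme
    \<Rightarrow> ('k, 'h, ('k, 'v, 'w) tensor) yd_obj" where
  "yd_tensor H V W = \<lparr>car = car (tensor_space V W), scl = scl (tensor_space V W),
     coact = (\<lambda>t. sweedler V W t (\<lambda>v w.
       coa1 H V v (\<lambda>a v0. coa1 H W w (\<lambda>b w0.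
         tens H (tensor_space V W) (mul H a b) (tens V W v0 w0))))),
     act = (\<lambda>h t. sweedler V W t (\<lambda>v w.
       cop5 H h (\<lambda>h1 h2 h3 h4 h5.
         coa1 H V v (\<lambda>v1 v0.
         coa2 H W w (\<lambda>w2 w1 w0.
         coa2 H V (act V h2 v0) (\<lambda>x2 x1 x0.
         coa1 H W (act W h4 w0) (\<lambda>y1 y0.
           tscl (omega H h1 v1 w2 * omega_inv H x2 h3 w1 * omega H x1 y1 h5)
             (tens V W x0 y0))))))))\<rparr>"

definition yd_assoc :: "('k::field, 'h::ab_group_add, 'm) dqb_scheme
    \<Rightarrow> ('k, 'h, 'u::ab_group_add, 'n1) yd_obj_scheme
    \<Rightarrow> ('k, 'h, 'v::ab_group_add, 'n2) yd_obj_scheme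
    \<Rightarrow> ('k, 'h, 'w::ab_group_add, 'n3) yd_obj_scheme
    \<Rightarrow> ('k, ('k, 'u, 'v) tensor, 'w) tensor \<Rightarrow> ('k, 'u, ('k, 'v, 'w) tensor) tensor" where
  "yd_assoc H U V W t =
     sweedler (tensor_space U V) W t (\<lambda>s w. sweedler U V s (\<lambda>u v.
       coa1 H U u (\<lambda>a u0. coa1 H V v (\<lambda>b v0. coa1 H W w (\<lambda>c w0.
         tscl (omega_inv H a b c) (tens U (tensor_space V W) u0 (tens V W v0 w0)))))))"

definition yd_assoc_inv :: "('k::field, 'h::ab_group_add, 'm) dqb_scheme
    \<Rightarrow> ('k, 'h, 'u::ab_group_add, 'n1) yd_obj_scheme
    \<Rightarrow> ('k, 'h, 'v::ab_group_add, 'n2) yd_obj_scheme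
    \<Rightarrow> ('k, 'h, 'w::ab_group_add, 'n3) yd_obj_scheme
    \<Rightarrow> ('k, 'u, ('k, 'v, 'w) tensor) tensor \<Rightarrow> ('k, ('k, 'u, 'v) tensor, 'w) tensor" where
  "yd_assoc_inv H U V W =
     inv_into (car (tensor_space (tensor_space U V) W)) (yd_assoc H U V W)"

definition yd_lunit :: "('k::field, 'v::ab_group_add, 'n) vspace_scheme
    \<Rightarrow> ('k, 'k, 'v) tensor \<Rightarrow> 'v" where
  "yd_lunit V t = sweedler ground V t (\<lambda>c v. scl V c v)"

definition yd_runit :: "('k::field, 'v::ab_group_add, 'n) vspace_scheme
    \<Rightarrow> ('k, 'v, 'k) tensor \<Rightarrow> 'v" where
  "yd_runit V t = sweedler V ground t (\<lambda>v c. scl V c v)"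

definition yd_braid :: "('k::field, 'h::ab_group_add, 'm) dqb_scheme
    \<Rightarrow> ('k, 'h, 'v::ab_group_add, 'n) yd_obj_scheme
    \<Rightarrow> ('k, 'h, 'w::ab_group_add, 'l) yd_obj_scheme
    \<Rightarrow> ('k, 'v, 'w) tensor \<Rightarrow> ('k, 'w, 'v) tensor" where
  "yd_braid H V W t =
     sweedler V W t (\<lambda>v w. coa1 H V v (\<lambda>a v0. tens W V (act W a w) v0))"


section \<open>Bialgebras in the category\<close>

record ('k, 'h, 'r) yd_bialg = "('k, 'h, 'r) yd_obj" +
  rmul :: "('k, 'r, 'r) tensor \<Rightarrow> 'r"
  runit :: "'k \<Rightarrow> 'r"
  rcomul :: "'r \<Rightarrow> ('k, 'r, 'r) tensor"
  rcounit :: "'r \<Rightarrow> 'k"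

definition yd_algebra :: "('k::field, 'h::ab_group_add, 'm) dqb_scheme
    \<Rightarrow> ('k, 'h, 'r::ab_group_add, 'n) yd_bialg_scheme \<Rightarrow> bool" where
  "yd_algebra H R \<longleftrightarrow>
     (let R2 = yd_tensor H R R; I = yd_unit H in
      yd_hom H R2 R (rmul R) \<and> yd_hom H I R (runit R) \<and>
      (\<forall>t\<in>car (yd_tensor H R2 R).
         rmul R (tmap R2 R R R (rmul R) (\<lambda>r. r) t)
           = rmul R (tmap R R2 R R (\<lambda>r. r) (rmul R) (yd_assoc H R R R t))) \<and>
      (\<forall>t\<in>car (yd_tensor H I R). rmul R (tmap I R R R (runit R) (\<lambda>r. r) t) = yd_lunit R t) \<and>
      (\<forall>t\<in>car (yd_tensor H R I). rmul R (tmap R I R R (\<lambda>r. r) (runit R) t) = yd_runit R t))"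

definition yd_coalgebra :: "('k::field, 'h::ab_group_add, 'm) dqb_scheme
    \<Rightarrow> ('k, 'h, 'r::ab_group_add, 'n) yd_bialg_scheme \<Rightarrow> bool" where
  "yd_coalgebra H R \<longleftrightarrow>
     (let R2 = yd_tensor H R R; I = yd_unit H in
      yd_hom H R R2 (rcomul R) \<and> yd_hom H R I (rcounit R) \<and>
      (\<forall>r\<in>car R.
         yd_assoc H R R R (tmap R R R2 R (rcomul R) (\<lambda>r. r) (rcomul R r))
           = tmap R R R R2 (\<lambda>r. r) (rcomul R) (rcomul R r) \<and>
         yd_lunit R (tmap R R I R (rcounit R) (\<lambda>r. r) (rcomul R r)) = r \<and>
         yd_runit R (tmap R R R I (\<lambda>r. r) (rcounit R) (rcomul R r)) = r))"

definition yd_Omega :: "('k::field, 'h::ab_group_add, 'm) dqb_scheme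
    \<Rightarrow> ('k, 'h, 'r::ab_group_add, 'n) yd_obj_scheme
    \<Rightarrow> ('k, ('k, 'r, 'r) tensor, ('k, 'r, 'r) tensor) tensor
    \<Rightarrow> ('k, ('k, 'r, 'r) tensor, ('k, 'r, 'r) tensor) tensor" where
  "yd_Omega H R =
     (let R2 = yd_tensor H R R; RR2 = yd_tensor H R R2; R2R = yd_tensor H R2 R in
        yd_assoc_inv H R R R2
      \<circ> tmap R R2R R RR2 (\<lambda>r. r) (yd_assoc H R R R)
      \<circ> tmap R R2R R R2R (\<lambda>r. r) (tmap R2 R R2 R (yd_braid H R R) (\<lambda>r. r))
      \<circ> tmap R RR2 R R2R (\<lambda>r. r) (yd_assoc_inv H R R R)
      \<circ> yd_assoc H R R R2)"

definition yd_bialgebra :: "('k::field, 'h::ab_group_add, 'm) dqb_scheme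
    \<Rightarrow> ('k, 'h, 'r::ab_group_add, 'n) yd_bialg_scheme \<Rightarrow> bool" where
  "yd_bialgebra H R \<longleftrightarrow>
     yd_object H R \<and> yd_algebra H R \<and> yd_coalgebra H R \<and>
     (let R2 = yd_tensor H R R; I = yd_unit H in
      (\<forall>t\<in>car R2.
         rcomul R (rmul R t)
           = tmap R2 R2 R R (rmul R) (rmul R)
               (yd_Omega H R (tmap R R R2 R2 (rcomul R) (rcomul R) t)) \<and>
         rcounit R (rmul R t) = yd_lunit I (tmap R R I I (rcounit R) (rcounit R) t)) \<and>
      rcomul R (runit R 1) = tens R R (runit R 1) (runit R 1) \<and>
      rcounit R (runit R 1) = 1)"


section \<open>Bosonization\<close>

text \<open>
  In the product, \<open>r2, r1, r0\<close> stand for \<open>r\<close> with index \<open>-2, -1, 0\<close>, likewise for \<open>s\<close>, and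
  \<open>x2, x1, x0\<close> for the same components of the action of \<open>h3\<close> on \<open>s0\<close>.
\<close>

definition boson_mul :: "('k::field, 'h::ab_group_add, 'm) dqb_scheme
    \<Rightarrow> ('k, 'h, 'r::ab_group_add, 'n) yd_bialg_scheme
    \<Rightarrow> ('k, 'r, 'h) tensor \<Rightarrow> ('k, 'r, 'h) tensor \<Rightarrow> ('k, 'r, 'h) tensor" where
  "boson_mul H R t u =
     sweedler R H t (\<lambda>r h. sweedler R H u (\<lambda>s k.
       coa2 H R r (\<lambda>r2 r1 r0. coa2 H R s (\<lambda>s2 s1 s0.
       cop6 H h (\<lambda>h1 h2 h3 h4 h5 h6. cop5 H k (\<lambda>k1 k2 k3 k4 k5.
       coa2 H R (act R h3 s0) (\<lambda>x2 x1 x0.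
         tscl (omega_inv H r2 h1 (mul H s2 k1) * omega H h2 s1 k2
               * omega_inv H x2 h4 k3 * omega H r1 x1 (mul H h5 k4))
           (tens R H (rmul R (tens R R r0 x0)) (mul H h6 k5)))))))))"

definition boson_comul :: "('k::field, 'h::ab_group_add, 'm) dqb_scheme
    \<Rightarrow> ('k, 'h, 'r::ab_group_add, 'n) yd_bialg_scheme
    \<Rightarrow> ('k, 'r, 'h) tensor \<Rightarrow> ('k, ('k, 'r, 'h) tensor, ('k, 'r, 'h) tensor) tensor" where
  "boson_comul H R t =
     (let B = tensor_space R H in
      sweedler R H t (\<lambda>r h.
        sweedler R R (rcomul R r) (\<lambda>p s.
        coa1 H R p (\<lambda>p1 p0. coa2 H R s (\<lambda>s2 s1 s0. cop3 H h (\<lambda>h1 h2 h3.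
          tscl (omega_inv H p1 s2 h1)
            (tens B B (tens R H p0 (mul H s1 h2)) (tens R H s0 h3))))))))"

definition boson_counit :: "('k::field, 'h::ab_group_add, 'm) dqb_scheme
    \<Rightarrow> ('k, 'h, 'r::ab_group_add, 'n) yd_bialg_scheme \<Rightarrow> ('k, 'r, 'h) tensor \<Rightarrow> 'k" where
  "boson_counit H R t = sweedler R H t (\<lambda>r h. rcounit R r * counit H h)"

definition boson_omega :: "('k::field, 'h::ab_group_add, 'm) dqb_scheme
    \<Rightarrow> ('k, 'h, 'r::ab_group_add, 'n) yd_bialg_scheme
    \<Rightarrow> ('k, 'r, 'h) tensor \<Rightarrow> ('k, 'r, 'h) tensor \<Rightarrow> ('k, 'r, 'h) tensor \<Rightarrow> 'k" where
  "boson_omega H R t u v =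
     sweedler R H t (\<lambda>r h. sweedler R H u (\<lambda>s k. sweedler R H v (\<lambda>p l.
       rcounit R r * rcounit R s * rcounit R p * omega H h k l)))"

definition bosonization :: "('k::field, 'h::ab_group_add, 'm) dqb_scheme
    \<Rightarrow> ('k, 'h, 'r::ab_group_add, 'n) yd_bialg_scheme \<Rightarrow> ('k, ('k, 'r, 'h) tensor) dqb" where
  "bosonization H R = \<lparr>car = car (tensor_space R H), scl = scl (tensor_space R H),
     comul = boson_comul H R, counit = boson_counit H R,
     mul = boson_mul H R, one = tens R H (runit R 1) (one H), omega = boson_omega H R\<rparr>"

definition is_basis_family :: "('k::field, 'v::ab_group_add, 'n) vspace_scheme
    \<Rightarrow> nat \<Rightarrow> (nat \<Rightarrow> 'v) \<Rightarrow> bool" where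
  "is_basis_family V N x \<longleftrightarrow>
     inj_on x {..<N} \<and> \<not> module.dependent (scl V) (x ` {..<N}) \<and>
     module.span (scl V) (x ` {..<N}) = car V"

end

theory Submission imports Defs begin

text \<open>
  The pair \<open>(g, \<chi>)\<close> of a quasi-Yetter-Drinfeld datum is the same as a
  one-dimensional Yetter-Drinfeld module, with coaction \<open>v \<mapsto> g \<otimes> v\<close> and action \<open>h \<mapsto> \<chi>(h)\<close>
  (\<open>yd_character\<close>). The tensor product of two of them is again one-dimensional. Its degree is the
  product of the degrees, and its character is \<open>tensor_char\<close>. Unfolding the definition of
  \<open>\<chi>\<^bsub>[n]\<^esub>\<close> shows that it is the character of the tensor power of the given module, bracketed to the right.
  The associativity constraint on one-dimensional modules is multiplication by a nonzero scalar, so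
  it forces equality of characters: the bracketing does not matter, and \<open>\<chi>\<^bsub>[a+b]\<^esub>\<close> is the character of
  \<open>x\<^bsup>[a]\<^esup> \<otimes> x\<^bsup>[b]\<^esup>\<close> (\<open>chi_add\<close>). Hence all spaces in sight have bases of vectors that are homogeneous
  for the coaction and eigenvectors for the action, and a linear map that preserves degree and
  character of basis vectors is a morphism. This proves that the structure maps of \<open>R\<close> are morphisms.

  The axioms of \<open>R\<close> become identities between scalars at powers of \<open>g\<close>. There the cocycle is trivial:
  with \<open>\<theta>(a,b) = \<Prod>\<^bsub>i<a\<^esub> \<omega>\<^sup>-\<^sup>1(g, g\<^sup>i, g\<^sup>b)\<close>, which is the coefficient of the multiplication of \<open>R\<close>
  (\<open>cobd\<close>), the scalar \<open>\<omega>\<^sup>-\<^sup>1(g\<^sup>a, g\<^sup>b, g\<^sup>c)\<close> is the coboundary of \<open>\<theta>\<close> (\<open>omgi_coboundary\<close>), and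
  \<open>\<chi>\<^bsub>[c]\<^esub>(g\<^sup>b) = q\<^bsup>bc\<^esup> \<theta>(b,c) / \<theta>(c,b)\<close> (\<open>chi_gp\<close>). After this substitution all factors \<open>\<theta>\<close> cancel. What is
  left is the quantum line \<open>k[x]/(x\<^sup>N)\<close>: coassociativity is the trinomial identity for \<open>q\<close>-binomial
  coefficients, and multiplicativity of the comultiplication is the \<open>q\<close>-Vandermonde identity together
  with the vanishing of the binomial coefficients that would leave the truncation range, which holds
  because \<open>q\<close> is a primitive \<open>N\<close>-th root of unity (\<open>comul_mul_X\<close>).

  The identities between characters and \<open>\<omega>\<close> are equations between multilinear forms on \<open>H\<close>. The
  linear maps from \<open>H\<close> to an algebra \<open>A\<close> form an algebra \<open>Conv A\<close> under convolution. Iterating this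
  four times on the ground field gives the algebra of four-linear forms, in which the cocycle condition is a
  single equation (\<open>cocycle_A4\<close>). Evaluation at grouplikes is an algebra homomorphism, so it turns this equation
  into equations between forms in one or two variables, and each long computation is a
  chain of rewriting steps in an associative algebra.

  For the coradical, filter \<open>R # H\<close> by the degree in \<open>x\<close>. If \<open>d\<close> is a nonzero element of a
  subcoalgebra \<open>D\<close>, with top component \<open>x\<^bsup>[n]\<^esup> # h\<close>, then applying the functional \<open>x\<^bsup>[m]\<^esup> # k \<mapsto> \<delta>\<^bsub>m,n\<^esub> \<epsilon>(k)\<close> to the
  left tensor factor of \<open>\<Delta>(d)\<close> leaves \<open>1 # h\<close>, and this lies in \<open>D\<close>. So \<open>D\<close> meets \<open>1 # H\<close>
  (\<open>subcoalgebra_meets_base\<close>). The intersection is a subcoalgebra (\<open>subtensor_Int\<close>), and if \<open>D\<close> is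
  simple it is all of \<open>D\<close>.
\<close>

section \<open>Linear maps and Sweedler sums\<close>

lemma vspaceD:
  assumes "is_vspace V"
  shows "0 \<in> car V"
    and "x \<in> car V \<Longrightarrow> y \<in> car V \<Longrightarrow> x + y \<in> car V"
    and "x \<in> car V \<Longrightarrow> y \<in> car V \<Longrightarrow> x - y \<in> car V"
    and "x \<in> car V \<Longrightarrow> scl V c x \<in> car V"
    and "(\<And>i. i \<in> I \<Longrightarrow> f i \<in> car V) \<Longrightarrow> (\<Sum>i\<in>I. f i) \<in> car V"
proof -
  interpret vector_space "scl V" using assms by (simp add: is_vspace_def)
  have s: "subspace (car V)" using assms by (simp add: is_vspace_def)
  show "0 \<in> car V" "x \<in> car V \<Longrightarrow> y \<in> car V \<Longrightarrow> x + y \<in> car V"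
    "x \<in> car V \<Longrightarrow> y \<in> car V \<Longrightarrow> x - y \<in> car V" "x \<in> car V \<Longrightarrow> scl V c x \<in> car V"
    "(\<And>i. i \<in> I \<Longrightarrow> f i \<in> car V) \<Longrightarrow> (\<Sum>i\<in>I. f i) \<in> car V"
    using s by (auto simp: subspace_0 subspace_add subspace_diff subspace_scale subspace_sum)
qed

lemma vspace_simps:
  assumes "is_vspace V"
  shows "scl V c (x + y) = scl V c x + scl V c y"
    and "scl V (a + b) x = scl V a x + scl V b x"
    and "scl V a (scl V b x) = scl V (a * b) x"
    and "scl V 1 x = x" and "scl V 0 x = 0" and "scl V c 0 = 0"
    and "scl V c (x - y) = scl V c x - scl V c y"
    and "scl V c (\<Sum>i\<in>I. f i) = (\<Sum>i\<in>I. scl V c (f i))"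
proof -
  interpret vector_space "scl V" using assms by (simp add: is_vspace_def)
  show "scl V c (x + y) = scl V c x + scl V c y" "scl V (a + b) x = scl V a x + scl V b x"
    "scl V a (scl V b x) = scl V (a * b) x" "scl V 1 x = x" "scl V 0 x = 0" "scl V c 0 = 0"
    "scl V c (x - y) = scl V c x - scl V c y"
    "scl V c (\<Sum>i\<in>I. f i) = (\<Sum>i\<in>I. scl V c (f i))"
    by (simp_all add: scale_right_distrib scale_left_distrib scale_right_diff_distrib scale_sum_right)
qed

lemma car_scl [simp]:
  "car (tensor_space V W) = subtensor V W (car V) (car W)"
  "scl (tensor_space V W) = tscl" "car ground = UNIV" "scl ground = (*)"
  by (simp_all add: tensor_space_def ground_def)

lemmas tspaceD = vspaceD[OF is_vspace_tensor_space, simplified]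
lemmas tspace_simps = vspace_simps[OF is_vspace_tensor_space, simplified]

lemma lin_mapD:
  assumes "lin_map V W f"
  shows "x \<in> car V \<Longrightarrow> f x \<in> car W"
    and "x \<in> car V \<Longrightarrow> y \<in> car V \<Longrightarrow> f (x + y) = f x + f y"
    and "x \<in> car V \<Longrightarrow> f (scl V c x) = scl W c (f x)"
  using assms by (simp_all add: lin_map_def)

lemma lin_map_0:
  assumes "is_vspace V" "lin_map V W f"
  shows "f 0 = 0"
  using lin_mapD(2)[OF assms(2), of 0 0] vspaceD(1)[OF assms(1)] by simp

lemma lin_map_sum:
  assumes "is_vspace V" "lin_map V W f" "\<And>i. i \<in> I \<Longrightarrow> v i \<in> car V"
  shows "f (\<Sum>i\<in>I. v i) = (\<Sum>i\<in>I. f (v i))"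
  using assms(3)
proof (induction I rule: infinite_finite_induct)
  case (insert i I)
  thus ?case
    using lin_mapD(2)[OF assms(2), of "v i" "\<Sum>i\<in>I. v i"] vspaceD(5)[OF assms(1), of I v] by simp
qed (simp_all add: lin_map_0[OF assms(1,2)])

lemma bilin_mapI:
  assumes "\<And>u. u \<in> car U \<Longrightarrow> lin_map V W (f u)" "\<And>v. v \<in> car V \<Longrightarrow> lin_map U W (\<lambda>u. f u v)"
  shows "bilin_map U V W f"
  using assms by (simp add: bilin_map_def)

lemma lin_bilin1: "bilin_map U V W f \<Longrightarrow> u \<in> car U \<Longrightarrow> lin_map V W (f u)"
  and lin_bilin2: "bilin_map U V W f \<Longrightarrow> v \<in> car V \<Longrightarrow> lin_map U W (\<lambda>u. f u v)"
  by (simp_all add: bilin_map_def)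

lemma lin_id: "lin_map V V (\<lambda>v. v)"
  by (simp add: lin_map_def)

lemma lin_comp: "lin_map W Z f \<Longrightarrow> lin_map V W g \<Longrightarrow> lin_map V Z (\<lambda>v. f (g v))"
  by (simp add: lin_map_def)

text \<open>Linearity only concerns arguments in the carrier.\<close>

lemma lin_cong:
  assumes "is_vspace V" "\<And>v. v \<in> car V \<Longrightarrow> f v = g v"
  shows "lin_map V Z f \<longleftrightarrow> lin_map V Z g"
  using assms(2) vspaceD(2,4)[OF assms(1)] by (auto simp: lin_map_def)

lemma lin_zero: "is_vspace Z \<Longrightarrow> lin_map V Z (\<lambda>v. 0)"
  by (simp add: lin_map_def vspaceD vspace_simps)

lemma lin_add: "is_vspace Z \<Longrightarrow> lin_map V Z f \<Longrightarrow> lin_map V Z g \<Longrightarrow> lin_map V Z (\<lambda>v. f v + g v)"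
  by (simp add: lin_map_def vspaceD vspace_simps algebra_simps)

lemma lin_sum:
  "is_vspace Z \<Longrightarrow> (\<And>i. i \<in> I \<Longrightarrow> lin_map V Z (f i)) \<Longrightarrow> lin_map V Z (\<lambda>v. \<Sum>i\<in>I. f i v)"
  by (induction I rule: infinite_finite_induct) (auto intro: lin_zero lin_add)

lemma lin_scl: "is_vspace Z \<Longrightarrow> lin_map V Z f \<Longrightarrow> lin_map V Z (\<lambda>v. scl Z c (f v))"
  by (simp add: lin_map_def vspaceD vspace_simps mult.commute)

lemma lin_sclL: "is_vspace Z \<Longrightarrow> z \<in> car Z \<Longrightarrow> lin_map V ground \<alpha> \<Longrightarrow> lin_map V Z (\<lambda>v. scl Z (\<alpha> v) z)"
  by (simp add: lin_map_def vspaceD vspace_simps)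

lemmas lin_mulR = lin_scl[OF is_vspace_ground, simplified]
lemmas lin_mulL = lin_sclL[OF is_vspace_ground, simplified]
lemmas lin_tscl = lin_scl[OF is_vspace_tensor_space, simplified]
lemmas lin_tsclL = lin_sclL[OF is_vspace_tensor_space, simplified]

lemma tens_car: "v \<in> car V \<Longrightarrow> w \<in> car W \<Longrightarrow> tens V W v w \<in> subtensor V W (car V) (car W)"
  using bilin_mapD(1)[OF bilin_map_tens, of v V w W] by simp

lemma lin_tens1: "w \<in> car W \<Longrightarrow> lin_map U V f \<Longrightarrow> lin_map U (tensor_space V W) (\<lambda>u. tens V W (f u) w)"
  by (rule lin_comp[OF lin_bilin2[OF bilin_map_tens]])

lemma lin_tens2: "v \<in> car V \<Longrightarrow> lin_map U W f \<Longrightarrow> lin_map U (tensor_space V W) (\<lambda>u. tens V W v (f u))"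
  by (rule lin_comp[OF lin_bilin1[OF bilin_map_tens]])

lemma sweedler_car:
  "is_vspace V \<Longrightarrow> is_vspace Z \<Longrightarrow> bilin_map V W Z F \<Longrightarrow> t \<in> car (tensor_space V W)
    \<Longrightarrow> sweedler V W t F \<in> car Z"
  by (rule lin_mapD(1)[OF lin_map_sweedler])

lemma sweedler_cong:
  assumes "\<And>v w. v \<in> car V \<Longrightarrow> w \<in> car W \<Longrightarrow> F v w = G v w"
  shows "sweedler V W t F = sweedler V W t G"
proof -
  have *: "(\<Sum>(v, w)\<leftarrow>xs. F v w) = (\<Sum>(v, w)\<leftarrow>xs. G v w)" if "set xs \<subseteq> car V \<times> car W" for xs
    using that assms by (induction xs) auto
  show ?thesis
    unfolding sweedler_def
    by (rule arg_cong[of _ _ The], rule ext, rule ex_cong1, rule conj_cong[OF refl],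
        rule conj_cong[OF refl], simp add: *)
qed

lemma lin_sweedler_arg:
  assumes "is_vspace V" "is_vspace Z" "lin_map U (tensor_space V W) T" "bilin_map V W Z F"
  shows "lin_map U Z (\<lambda>u. sweedler V W (T u) F)"
  by (rule lin_comp[OF lin_map_sweedler[OF assms(1,2,4)] assms(3)])

lemma lin_sum_list:
  assumes "is_vspace Z" "\<And>x. x \<in> set xs \<Longrightarrow> lin_map V Z (f x)"
  shows "lin_map V Z (\<lambda>v. \<Sum>x\<leftarrow>xs. f x v)"
  using assms(2) by (induction xs) (auto intro: lin_zero lin_add assms(1))

text \<open>
  Once the tensor is written as a finite sum of pure tensors, a Sweedler sum is a finite sum of
  values of the summand, so it inherits linearity in any parameter.
\<close>

lemma lin_sweedler_body:
  assumes V: "is_vspace V" and Z: "is_vspace Z" and U: "is_vspace U"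
    and t: "t \<in> car (tensor_space V W)"
    and b: "\<And>u. u \<in> car U \<Longrightarrow> bilin_map V W Z (F u)"
    and l: "\<And>v w. v \<in> car V \<Longrightarrow> w \<in> car W \<Longrightarrow> lin_map U Z (\<lambda>u. F u v w)"
  shows "lin_map U Z (\<lambda>u. sweedler V W t (F u))"
proof -
  obtain xs where xs: "set xs \<subseteq> car V \<times> car W" "t = (\<Sum>(v, w)\<leftarrow>xs. tens V W v w)"
    using tensor_space_sumE[OF V t] by metis
  have "lin_map U Z (\<lambda>u. \<Sum>p\<leftarrow>xs. F u (fst p) (snd p))"
    using xs(1) l by (intro lin_sum_list Z) (auto simp: subset_iff)
  moreover have "sweedler V W t (F u) = (\<Sum>p\<leftarrow>xs. F u (fst p) (snd p))" if "u \<in> car U" for u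
    unfolding xs(2) sweedler_sum[OF Z b[OF that] xs(1)] by (simp add: case_prod_beta')
  ultimately show ?thesis
    using lin_cong[OF U, of "\<lambda>u. sweedler V W t (F u)" "\<lambda>u. \<Sum>p\<leftarrow>xs. F u (fst p) (snd p)"] by blast
qed

lemma sweedler_map:
  assumes V: "is_vspace V" and Z: "is_vspace Z" and Z': "is_vspace Z'"
    and t: "t \<in> car (tensor_space V W)"
    and b: "bilin_map V W Z F" and \<Phi>: "lin_map Z Z' \<Phi>"
  shows "\<Phi> (sweedler V W t F) = sweedler V W t (\<lambda>v w. \<Phi> (F v w))"
proof -
  obtain xs where xs: "set xs \<subseteq> car V \<times> car W" "t = (\<Sum>(v, w)\<leftarrow>xs. tens V W v w)"
    using tensor_space_sumE[OF V t] by metis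
  have b': "bilin_map V W Z' (\<lambda>v w. \<Phi> (F v w))"
    by (intro bilin_mapI lin_comp[OF \<Phi>] lin_bilin1[OF b] lin_bilin2[OF b])
  have "\<Phi> (\<Sum>(v, w)\<leftarrow>xs. F v w) = (\<Sum>(v, w)\<leftarrow>xs. \<Phi> (F v w)) \<and> (\<Sum>(v, w)\<leftarrow>xs. F v w) \<in> car Z"
    using xs(1)
    by (induction xs)
       (auto simp: lin_map_0[OF Z \<Phi>] lin_mapD[OF \<Phi>] vspaceD[OF Z] bilin_mapD(1)[OF b])
  thus ?thesis by (simp add: xs(2) sweedler_sum[OF Z b xs(1)] sweedler_sum[OF Z' b' xs(1)])
qed

lemma lin_tmap:
  assumes "is_vspace V" "lin_map V V' f" "lin_map W W' g"
  shows "lin_map (tensor_space V W) (tensor_space V' W') (tmap V W V' W' f g)"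
  unfolding tmap_def
  by (intro lin_sweedler_arg assms is_vspace_tensor_space lin_id bilin_mapI lin_tens1 lin_tens2
      lin_mapD(1)[OF assms(2)] lin_mapD(1)[OF assms(3)])

lemma tmap_tens:
  assumes "lin_map V V' f" "lin_map W W' g" "v \<in> car V" "w \<in> car W"
  shows "tmap V W V' W' f g (tens V W v w) = tens V' W' (f v) (g w)"
proof -
  have "bilin_map V W (tensor_space V' W') (\<lambda>v w. tens V' W' (f v) (g w))"
    by (intro bilin_mapI lin_tens1 lin_tens2 assms(1,2) lin_mapD(1)[OF assms(1)] lin_mapD(1)[OF assms(2)])
  thus ?thesis
    unfolding tmap_def by (rule sweedler_tens[OF is_vspace_tensor_space _ assms(3,4)])
qed


section \<open>Iterated convolution algebras\<close>

record ('k, 'a) alg = "('k, 'a) vspace" +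
  amul :: "'a \<Rightarrow> 'a \<Rightarrow> 'a"
  aone :: 'a

definition is_alg :: "('k::field, 'a::ab_group_add, 'm) alg_scheme \<Rightarrow> bool" where
  "is_alg A \<longleftrightarrow> is_vspace A \<and> bilin_map A A A (amul A) \<and> aone A \<in> car A
    \<and> (\<forall>x\<in>car A. \<forall>y\<in>car A. \<forall>z\<in>car A. amul A (amul A x y) z = amul A x (amul A y z))
    \<and> (\<forall>x\<in>car A. amul A (aone A) x = x \<and> amul A x (aone A) = x)"

definition alg_hom :: "('k::field, 'a::ab_group_add, 'm) alg_scheme
    \<Rightarrow> ('k, 'b::ab_group_add, 'n) alg_scheme \<Rightarrow> ('a \<Rightarrow> 'b) \<Rightarrow> bool" where
  "alg_hom A B f \<longleftrightarrow> lin_map A B f \<and> f (aone A) = aone B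
    \<and> (\<forall>x\<in>car A. \<forall>y\<in>car A. f (amul A x y) = amul B (f x) (f y))"

text \<open>
  The inverse is a parameter because \<open>\<omega>\<close> and
  \<open>\<omega>\<^sup>-\<^sup>1\<close> are given together, and because homomorphisms transport
  such pairs directly.
\<close>

definition inverse_pair :: "('k::field, 'a::ab_group_add, 'm) alg_scheme \<Rightarrow> 'a \<Rightarrow> 'a \<Rightarrow> bool" where
  "inverse_pair A x y \<longleftrightarrow> x \<in> car A \<and> y \<in> car A \<and> amul A x y = aone A \<and> amul A y x = aone A"

text \<open>The ground field, as the start of the iteration of \<open>Conv\<close>.\<close>

definition base_alg :: "('k::field, 'k) alg" where
  "base_alg = \<lparr>car = UNIV, scl = (*), amul = (*), aone = 1\<rparr>"

lemma base_alg_simps [simp]: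
  "car base_alg = UNIV" "scl base_alg = (*)" "amul base_alg = (*)" "aone base_alg = 1"
  by (simp_all add: base_alg_def)

lemma lin_map_base_alg [simp]: "lin_map V base_alg f = lin_map V ground f"
  by (simp add: lin_map_def)

lemma is_vspace_base_alg: "is_vspace base_alg"
  using is_vspace_ground by (simp add: is_vspace_def)

lemma is_alg_base_alg: "is_alg base_alg"
  by (simp add: is_alg_def is_vspace_base_alg bilin_map_def lin_map_def algebra_simps)

lemma is_algD:
  assumes "is_alg A"
  shows "is_vspace A" and "bilin_map A A A (amul A)" and "aone A \<in> car A"
    and "x \<in> car A \<Longrightarrow> y \<in> car A \<Longrightarrow> amul A x y \<in> car A"
    and "x \<in> car A \<Longrightarrow> y \<in> car A \<Longrightarrow> z \<in> car A \<Longrightarrow> amul A (amul A x y) z = amul A x (amul A y z)"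
    and "x \<in> car A \<Longrightarrow> amul A (aone A) x = x" and "x \<in> car A \<Longrightarrow> amul A x (aone A) = x"
    and "x \<in> car A \<Longrightarrow> y \<in> car A \<Longrightarrow> amul A (scl A c x) y = scl A c (amul A x y)"
    and "x \<in> car A \<Longrightarrow> y \<in> car A \<Longrightarrow> amul A x (scl A c y) = scl A c (amul A x y)"
  using assms by (auto simp: is_alg_def dest: bilin_mapD)

lemma lin_amul1: "is_alg A \<Longrightarrow> y \<in> car A \<Longrightarrow> lin_map V A f \<Longrightarrow> lin_map V A (\<lambda>v. amul A (f v) y)"
  by (rule lin_comp[OF lin_bilin2[OF is_algD(2)]])

lemma lin_amul2: "is_alg A \<Longrightarrow> x \<in> car A \<Longrightarrow> lin_map V A f \<Longrightarrow> lin_map V A (\<lambda>v. amul A x (f v))"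
  by (rule lin_comp[OF lin_bilin1[OF is_algD(2)]])

lemma alg_homD:
  assumes "alg_hom A B f"
  shows "lin_map A B f" and "f (aone A) = aone B"
    and "x \<in> car A \<Longrightarrow> y \<in> car A \<Longrightarrow> f (amul A x y) = amul B (f x) (f y)"
    and "x \<in> car A \<Longrightarrow> f x \<in> car B"
    and "x \<in> car A \<Longrightarrow> f (scl A c x) = scl B c (f x)"
  using assms by (auto simp: alg_hom_def dest: lin_mapD)

lemma alg_hom_comp: "alg_hom B C g \<Longrightarrow> alg_hom A B f \<Longrightarrow> alg_hom A C (\<lambda>x. g (f x))"
  by (auto simp: alg_hom_def lin_comp lin_mapD)

lemma alg_hom_inverse_pair: "alg_hom A B f \<Longrightarrow> inverse_pair A x y \<Longrightarrow> inverse_pair B (f x) (f y)"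
  unfolding inverse_pair_def by (metis alg_homD(2,3,4))

locale coalgebra =
  fixes C :: "('k::field, 'h::ab_group_add, 'm) coalg_scheme"
  assumes coalg: "is_coalgebra C"
begin

lemma C_vspace: "is_vspace C"
  using coalg by (simp add: is_coalgebra_def)

lemma lin_comul: "lin_map C (tensor_space C C) (comul C)"
  using coalg by (simp add: is_coalgebra_def)

lemma lin_counit: "lin_map C ground (counit C)"
  using coalg by (simp add: is_coalgebra_def)

lemma comul_car: "h \<in> car C \<Longrightarrow> comul C h \<in> car (tensor_space C C)"
  by (rule lin_mapD(1)[OF lin_comul])

lemma cop2_car: "is_vspace Z \<Longrightarrow> h \<in> car C \<Longrightarrow> bilin_map C C Z F \<Longrightarrow> cop2 C h F \<in> car Z"
  unfolding cop2_def by (rule sweedler_car[OF C_vspace _ _ comul_car])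

lemma cop2_cong: "(\<And>a b. a \<in> car C \<Longrightarrow> b \<in> car C \<Longrightarrow> F a b = G a b) \<Longrightarrow> cop2 C h F = cop2 C h G"
  unfolding cop2_def by (rule sweedler_cong)

lemma lin_cop2_arg:
  "is_vspace Z \<Longrightarrow> bilin_map C C Z F \<Longrightarrow> lin_map U C T \<Longrightarrow> lin_map U Z (\<lambda>u. cop2 C (T u) F)"
  unfolding cop2_def by (intro lin_sweedler_arg C_vspace lin_comp[OF lin_comul])

lemma lin_cop2_body:
  assumes "is_vspace Z" "is_vspace U" "h \<in> car C"
    "\<And>u. u \<in> car U \<Longrightarrow> bilin_map C C Z (F u)"
    "\<And>a b. a \<in> car C \<Longrightarrow> b \<in> car C \<Longrightarrow> lin_map U Z (\<lambda>u. F u a b)"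
  shows "lin_map U Z (\<lambda>u. cop2 C h (F u))"
  unfolding cop2_def by (rule lin_sweedler_body[OF C_vspace assms(1,2) comul_car assms(4,5)]) (rule assms(3))

lemma cop2_map:
  assumes "lin_map Z Z' \<Phi>" "is_vspace Z" "is_vspace Z'" "bilin_map C C Z F" "h \<in> car C"
  shows "\<Phi> (cop2 C h F) = cop2 C h (\<lambda>a b. \<Phi> (F a b))"
  unfolding cop2_def by (rule sweedler_map[OF C_vspace assms(2,3) comul_car assms(4,1)]) (rule assms(5))

lemma cop2_comul:
  assumes "comul C h = tens C C a b" "a \<in> car C" "b \<in> car C" "is_vspace Z" "bilin_map C C Z F"
  shows "cop2 C h F = F a b"
  unfolding cop2_def assms(1) by (rule sweedler_tens[OF assms(4,5,2,3)])

lemma cop2_grouplike: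
  assumes "g \<in> grouplike C" "is_vspace Z" "bilin_map C C Z F"
  shows "cop2 C g F = F g g"
  using assms(1) by (intro cop2_comul[OF _ _ _ assms(2,3)]) (auto simp: grouplike_def)

lemma cop2_counitL:
  assumes "is_vspace Z" "lin_map C Z F" "h \<in> car C"
  shows "cop2 C h (\<lambda>a b. scl Z (counit C a) (F b)) = F h"
proof -
  have b: "bilin_map C C C (\<lambda>a b. scl C (counit C a) b)"
    by (intro bilin_mapI lin_scl lin_sclL lin_id lin_counit C_vspace)
  have "h = cop2 C h (\<lambda>a b. scl C (counit C a) b)"
    using coalg assms(3) by (simp add: is_coalgebra_def)
  hence "F h = F (cop2 C h (\<lambda>a b. scl C (counit C a) b))" by simp
  also have "\<dots> = cop2 C h (\<lambda>a b. F (scl C (counit C a) b))"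
    by (rule cop2_map[OF assms(2) C_vspace assms(1) b assms(3)])
  also have "\<dots> = cop2 C h (\<lambda>a b. scl Z (counit C a) (F b))"
    by (rule cop2_cong) (simp add: lin_mapD(3)[OF assms(2)])
  finally show ?thesis ..
qed

lemma cop2_counitR:
  assumes "is_vspace Z" "lin_map C Z F" "h \<in> car C"
  shows "cop2 C h (\<lambda>a b. scl Z (counit C b) (F a)) = F h"
proof -
  have b: "bilin_map C C C (\<lambda>a b. scl C (counit C b) a)"
    by (intro bilin_mapI lin_scl lin_sclL lin_id lin_counit C_vspace)
  have "h = cop2 C h (\<lambda>a b. scl C (counit C b) a)"
    using coalg assms(3) by (simp add: is_coalgebra_def)
  hence "F h = F (cop2 C h (\<lambda>a b. scl C (counit C b) a))" by simp
  also have "\<dots> = cop2 C h (\<lambda>a b. F (scl C (counit C b) a))"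
    by (rule cop2_map[OF assms(2) C_vspace assms(1) b assms(3)])
  also have "\<dots> = cop2 C h (\<lambda>a b. scl Z (counit C b) (F a))"
    by (rule cop2_cong) (simp add: lin_mapD(3)[OF assms(2)])
  finally show ?thesis ..
qed

text \<open>
  Coassociativity is an equation in \<open>C \<otimes> (C \<otimes> C)\<close>. Both sides of the
  claim are images of its two sides under the linear map that a trilinear \<open>F\<close> induces
  there.
\<close>

lemma cop2_coassoc:
  assumes Z: "is_vspace Z" and h: "h \<in> car C"
    and F: "\<And>a b. a \<in> car C \<Longrightarrow> b \<in> car C \<Longrightarrow> lin_map C Z (F a b)"
      "\<And>a c. a \<in> car C \<Longrightarrow> c \<in> car C \<Longrightarrow> lin_map C Z (\<lambda>b. F a b c)"
      "\<And>b c. b \<in> car C \<Longrightarrow> c \<in> car C \<Longrightarrow> lin_map C Z (\<lambda>a. F a b c)"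
  shows "cop2 C h (\<lambda>a b. cop2 C a (\<lambda>a1 a2. F a1 a2 b)) = cop2 C h (\<lambda>a b. cop2 C b (\<lambda>b1 b2. F a b1 b2))"
proof -
  let ?T = "tensor_space C C" and ?TT = "tensor_space C (tensor_space C C)"
  note vs = C_vspace Z is_vspace_tensor_space
  define \<Phi> where "\<Phi> t = sweedler C ?T t (\<lambda>a s. sweedler C C s (F a))" for t
  have bF: "bilin_map C C Z (F a)" if "a \<in> car C" for a
    using that by (intro bilin_mapI F)
  have bS: "bilin_map C ?T Z (\<lambda>a s. sweedler C C s (F a))"
    by (intro bilin_mapI lin_sweedler_arg lin_sweedler_body vs lin_id bF F)
  have lin: "lin_map ?TT Z \<Phi>"
    unfolding \<Phi>_def by (intro lin_sweedler_arg vs lin_id bS)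
  have \<Phi>: "\<Phi> (tens C ?T a (tens C C b c)) = F a b c" if "a \<in> car C" "b \<in> car C" "c \<in> car C" for a b c
    unfolding \<Phi>_def using that
    by (simp add: sweedler_tens[OF Z bS] tens_car sweedler_tens[OF Z bF])
  have b1: "bilin_map C C ?TT (\<lambda>a1 a2. tens C ?T a1 (tens C C a2 b))" if "b \<in> car C" for b
    using that by (intro bilin_mapI lin_tens1 lin_tens2 lin_id) (simp_all add: tens_car)
  have b2: "bilin_map C C ?TT (\<lambda>b1 b2. tens C ?T a (tens C C b1 b2))" if "a \<in> car C" for a
    using that by (intro bilin_mapI lin_tens1 lin_tens2 lin_id) (simp_all add: tens_car)
  have b1': "bilin_map C C ?TT (\<lambda>a b. cop2 C a (\<lambda>a1 a2. tens C ?T a1 (tens C C a2 b)))"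
    by (intro bilin_mapI lin_cop2_arg lin_cop2_body lin_id vs b1 lin_tens2)
  have b2': "bilin_map C C ?TT (\<lambda>a b. cop2 C b (\<lambda>b1 b2. tens C ?T a (tens C C b1 b2)))"
    by (intro bilin_mapI lin_cop2_arg lin_cop2_body lin_id vs b2 lin_tens1) (simp_all add: tens_car)
  have "\<Phi> (cop2 C h (\<lambda>a b. cop2 C a (\<lambda>a1 a2. tens C ?T a1 (tens C C a2 b))))
      = cop2 C h (\<lambda>a b. cop2 C a (\<lambda>a1 a2. F a1 a2 b))"
    unfolding cop2_map[OF lin vs(3,2) b1' h]
    by (intro cop2_cong) (simp add: cop2_map[OF lin vs(3,2) b1] \<Phi> cong: cop2_cong)
  moreover have "\<Phi> (cop2 C h (\<lambda>a b. cop2 C b (\<lambda>b1 b2. tens C ?T a (tens C C b1 b2))))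
      = cop2 C h (\<lambda>a b. cop2 C b (\<lambda>b1 b2. F a b1 b2))"
    unfolding cop2_map[OF lin vs(3,2) b2' h]
    by (intro cop2_cong) (simp add: cop2_map[OF lin vs(3,2) b2] \<Phi> cong: cop2_cong)
  moreover have "cop2 C h (\<lambda>a b. cop2 C a (\<lambda>a1 a2. tens C ?T a1 (tens C C a2 b)))
      = cop2 C h (\<lambda>a b. cop2 C b (\<lambda>b1 b2. tens C ?T a (tens C C b1 b2)))"
    using coalg h by (simp add: is_coalgebra_def)
  ultimately show ?thesis by simp
qed

text \<open>
  The space of linear maps from \<open>C\<close> to \<open>A\<close> with the convolution product.
  Iterating it \<open>n\<close> times on the ground field gives the curried
  \<open>n\<close>-linear forms, with the convolution of the coalgebra
  \<open>C\<^bsup>\<otimes>n\<^esup>\<close>. Elements vanish off the carrier so that equality of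
  functions is equality of linear maps.
\<close>

definition Conv :: "('k, 'a::ab_group_add, 'n) alg_scheme \<Rightarrow> ('k, 'h \<Rightarrow> 'a) alg" where
  "Conv A = \<lparr>car = {\<alpha>. lin_map C A \<alpha> \<and> (\<forall>h. h \<notin> car C \<longrightarrow> \<alpha> h = 0)},
     scl = (\<lambda>c \<alpha> h. scl A c (\<alpha> h)),
     amul = (\<lambda>\<alpha> \<beta> h. if h \<in> car C then cop2 C h (\<lambda>a b. amul A (\<alpha> a) (\<beta> b)) else 0),
     aone = (\<lambda>h. if h \<in> car C then scl A (counit C h) (aone A) else 0)\<rparr>"

lemma Conv_simps:
  "\<alpha> \<in> car (Conv A) \<longleftrightarrow> lin_map C A \<alpha> \<and> (\<forall>h. h \<notin> car C \<longrightarrow> \<alpha> h = 0)"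
  "scl (Conv A) c \<alpha> h = scl A c (\<alpha> h)"
  "amul (Conv A) \<alpha> \<beta> h = (if h \<in> car C then cop2 C h (\<lambda>a b. amul A (\<alpha> a) (\<beta> b)) else 0)"
  "aone (Conv A) h = (if h \<in> car C then scl A (counit C h) (aone A) else 0)"
  by (simp_all add: Conv_def)

lemma ConvD: "\<alpha> \<in> car (Conv A) \<Longrightarrow> lin_map C A \<alpha>" "\<alpha> \<in> car (Conv A) \<Longrightarrow> h \<in> car C \<Longrightarrow> \<alpha> h \<in> car A"
  by (auto simp: Conv_simps dest: lin_mapD)

lemma Conv_eqI:
  assumes "\<alpha> \<in> car (Conv A)" "\<beta> \<in> car (Conv A)" "\<And>h. h \<in> car C \<Longrightarrow> \<alpha> h = \<beta> h"
  shows "\<alpha> = \<beta>"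
  using assms by (fastforce simp: Conv_simps)

lemma Conv_carI:
  assumes "lin_map C A \<alpha>" "\<And>h. h \<notin> car C \<Longrightarrow> \<alpha> h = 0"
  shows "\<alpha> \<in> car (Conv A)"
  using assms by (simp add: Conv_simps)

lemma lin_if: "lin_map C A \<alpha> \<Longrightarrow> lin_map C A (\<lambda>h. if h \<in> car C then \<alpha> h else 0)"
  by (subst lin_cong[OF C_vspace, where g = \<alpha>]) simp_all

lemma bilin_amul:
  assumes "is_alg A" "lin_map C A \<alpha>" "lin_map C A \<beta>"
  shows "bilin_map C C A (\<lambda>a b. amul A (\<alpha> a) (\<beta> b))"
  by (intro bilin_mapI lin_amul1 lin_amul2 assms lin_mapD(1)[OF assms(2)] lin_mapD(1)[OF assms(3)])

lemma is_vspace_Conv: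
  assumes A: "is_vspace A"
  shows "is_vspace (Conv A)"
proof -
  have v: "vector_space (scl (Conv A))"
    by unfold_locales (simp_all add: fun_eq_iff Conv_simps vspace_simps[OF A])
  interpret vector_space "scl (Conv A)" by (rule v)
  have "0 \<in> car (Conv A)" using lin_zero[OF A] by (simp add: Conv_simps zero_fun_def)
  moreover have "\<alpha> + \<beta> \<in> car (Conv A)" if "\<alpha> \<in> car (Conv A)" "\<beta> \<in> car (Conv A)" for \<alpha> \<beta>
    using that lin_add[OF A, of C \<alpha> \<beta>] by (simp add: Conv_simps plus_fun_def)
  moreover have "scl (Conv A) c \<alpha> \<in> car (Conv A)" if "\<alpha> \<in> car (Conv A)" for c \<alpha>
    using that lin_scl[OF A, of C \<alpha> c] by (simp add: Conv_def vspace_simps[OF A])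
  ultimately show ?thesis by (simp add: is_vspace_def v subspace_def)
qed

lemma lin_eval: "h \<in> car C \<Longrightarrow> lin_map (Conv A) A (\<lambda>\<alpha>. \<alpha> h)"
  by (simp add: lin_map_def Conv_simps)

lemma Conv_amul_car:
  assumes A: "is_alg A" and "\<alpha> \<in> car (Conv A)" "\<beta> \<in> car (Conv A)"
  shows "amul (Conv A) \<alpha> \<beta> \<in> car (Conv A)"
  unfolding Conv_simps(1,3) using assms ConvD(1)
  by (intro conjI lin_if lin_cop2_arg is_algD(1) bilin_amul lin_id) auto

lemma Conv_aone_car: "is_alg A \<Longrightarrow> aone (Conv A) \<in> car (Conv A)"
  unfolding Conv_simps(1,4) by (intro conjI lin_if lin_sclL is_algD(1) is_algD(3) lin_counit) auto

text \<open>
  Associativity and unit laws are the coassociativity and counit laws of \<open>C\<close>, read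
  through the multiplication of \<open>A\<close>.
\<close>

theorem is_alg_Conv:
  assumes A: "is_alg A"
  shows "is_alg (Conv A)"
proof -
  note Av = is_algD(1)[OF A]
  note Cv = is_vspace_Conv[OF Av]
  let ?m = "amul A"
  have lin: "lin_map (Conv A) (Conv A) F"
    if "\<And>\<beta>. \<beta> \<in> car (Conv A) \<Longrightarrow> F \<beta> \<in> car (Conv A)"
      "\<And>h. h \<in> car C \<Longrightarrow> lin_map (Conv A) A (\<lambda>\<beta>. F \<beta> h)" for F
    unfolding lin_map_def
  proof (intro conjI ballI allI)
    fix \<beta> \<gamma> c assume b: "\<beta> \<in> car (Conv A)" and c: "\<gamma> \<in> car (Conv A)"
    show "F (\<beta> + \<gamma>) = F \<beta> + F \<gamma>"
      by (rule Conv_eqI[of _ A]) (simp_all add: that(1) vspaceD[OF Cv] b c lin_mapD(2)[OF that(2)])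
    show "F (scl (Conv A) c \<beta>) = scl (Conv A) c (F \<beta>)" for c
      by (rule Conv_eqI[of _ A])
        (simp_all add: that(1) vspaceD[OF Cv] b lin_mapD(3)[OF that(2)] Conv_simps(2))
  qed (rule that(1))
  have bil: "bilin_map (Conv A) (Conv A) (Conv A) (amul (Conv A))"
  proof (intro bilin_mapI lin Conv_amul_car[OF A])
    fix \<alpha> h assume a: "\<alpha> \<in> car (Conv A)" and h: "h \<in> car C"
    show "lin_map (Conv A) A (\<lambda>\<beta>. amul (Conv A) \<alpha> \<beta> h)" "lin_map (Conv A) A (\<lambda>\<beta>. amul (Conv A) \<beta> \<alpha> h)"
      using h by (auto simp: Conv_simps(3) intro!: lin_cop2_body Av Cv bilin_amul A ConvD[OF a] ConvD
          lin_amul1 lin_amul2 lin_eval)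
  qed
  have assoc: "amul (Conv A) (amul (Conv A) \<alpha> \<beta>) \<gamma> h = amul (Conv A) \<alpha> (amul (Conv A) \<beta> \<gamma>) h"
    if car: "\<alpha> \<in> car (Conv A)" "\<beta> \<in> car (Conv A)" "\<gamma> \<in> car (Conv A)" and h: "h \<in> car C" for \<alpha> \<beta> \<gamma> h
  proof -
    note l = ConvD(1)[OF car(1)] ConvD(1)[OF car(2)] ConvD(1)[OF car(3)]
    note c = ConvD(2)[OF car(1)] ConvD(2)[OF car(2)] ConvD(2)[OF car(3)]
    have "amul (Conv A) (amul (Conv A) \<alpha> \<beta>) \<gamma> h
      = cop2 C h (\<lambda>a b. cop2 C a (\<lambda>a1 a2. ?m (?m (\<alpha> a1) (\<beta> a2)) (\<gamma> b)))"
      unfolding Conv_simps(3) using h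
      by (simp add: cop2_map[OF lin_amul1[OF A _ lin_id] Av Av bilin_amul[OF A l(1,2)]] c cong: cop2_cong)
    also have "\<dots> = cop2 C h (\<lambda>a b. cop2 C a (\<lambda>a1 a2. ?m (\<alpha> a1) (?m (\<beta> a2) (\<gamma> b))))"
      by (simp add: is_algD(5)[OF A] c cong: cop2_cong)
    also have "\<dots> = cop2 C h (\<lambda>a b. cop2 C b (\<lambda>b1 b2. ?m (\<alpha> a) (?m (\<beta> b1) (\<gamma> b2))))"
      by (intro cop2_coassoc[OF Av h] lin_amul1 lin_amul2 l c A is_algD(4)[OF A])
    also have "\<dots> = amul (Conv A) \<alpha> (amul (Conv A) \<beta> \<gamma>) h"
      unfolding Conv_simps(3) using h
      by (simp add: cop2_map[OF lin_amul2[OF A _ lin_id] Av Av bilin_amul[OF A l(2,3)]] c cong: cop2_cong)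
    finally show ?thesis .
  qed
  have unit: "amul (Conv A) (aone (Conv A)) \<alpha> h = \<alpha> h \<and> amul (Conv A) \<alpha> (aone (Conv A)) h = \<alpha> h"
    if a: "\<alpha> \<in> car (Conv A)" and h: "h \<in> car C" for \<alpha> h
    using h cop2_counitL[OF Av ConvD(1)[OF a] h] cop2_counitR[OF Av ConvD(1)[OF a] h]
    by (simp add: Conv_simps(3,4) is_algD[OF A] ConvD[OF a] cong: cop2_cong)
  show ?thesis
    unfolding is_alg_def
    by (intro conjI ballI Cv bil Conv_aone_car A)
       (rule Conv_eqI[of _ A]; simp add: assoc unit Conv_amul_car[OF A] Conv_aone_car[OF A])+
qed

lemma Conv_lin_mapI:
  assumes A: "is_vspace A" and "\<And>x. x \<in> car V \<Longrightarrow> F x \<in> car (Conv A)"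
    and "\<And>h. h \<in> car C \<Longrightarrow> lin_map V A (\<lambda>x. F x h)" and "is_vspace V"
  shows "lin_map V (Conv A) F"
  unfolding lin_map_def
proof (intro conjI ballI allI)
  note Cv = is_vspace_Conv[OF A]
  fix x y c assume b: "x \<in> car V" and c: "y \<in> car V"
  show "F (x + y) = F x + F y"
    by (rule Conv_eqI[of _ A]) (simp_all add: assms(2) vspaceD[OF Cv] vspaceD[OF assms(4)] b c lin_mapD(2)[OF assms(3)])
  show "F (scl V c x) = scl (Conv A) c (F x)" for c
    by (rule Conv_eqI[of _ A])
      (simp_all add: assms(2) vspaceD[OF Cv] vspaceD[OF assms(4)] b lin_mapD(3)[OF assms(3)] Conv_simps(2))
qed (rule assms(2))

text \<open>
  A grouplike spans a subcoalgebra on which convolution is the product of \<open>A\<close>. This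
  is how forms lose a variable.
\<close>

lemma alg_hom_eval:
  assumes A: "is_alg A" and g: "g \<in> grouplike C"
  shows "alg_hom (Conv A) A (\<lambda>\<alpha>. \<alpha> g)"
proof -
  have gc: "g \<in> car C" "counit C g = 1" using g by (auto simp: grouplike_def)
  show ?thesis
    unfolding alg_hom_def Conv_simps(3,4)
    by (auto simp: gc lin_eval vspace_simps[OF is_algD(1)[OF A]]
        intro!: cop2_grouplike[OF g is_algD(1)[OF A] bilin_amul[OF A]] ConvD)
qed

text \<open>Postcomposition: it lets a homomorphism act below the first variable of a form.\<close>

definition cmap :: "('a \<Rightarrow> 'b::ab_group_add) \<Rightarrow> ('h \<Rightarrow> 'a::ab_group_add) \<Rightarrow> 'h \<Rightarrow> 'b" where
  "cmap \<phi> \<alpha> = (\<lambda>h. if h \<in> car C then \<phi> (\<alpha> h) else 0)"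

lemma alg_hom_cmap:
  assumes A: "is_alg A" and B: "is_alg B" and \<phi>: "alg_hom A B \<phi>"
  shows "alg_hom (Conv A) (Conv B) (cmap \<phi>)"
proof -
  note Av = is_algD(1)[OF A] and Bv = is_algD(1)[OF B] and l = alg_homD(1)[OF \<phi>]
  note CA = is_alg_Conv[OF A] and CB = is_alg_Conv[OF B]
  have car: "cmap \<phi> \<alpha> \<in> car (Conv B)" if "\<alpha> \<in> car (Conv A)" for \<alpha>
    unfolding cmap_def by (rule Conv_carI) (simp_all add: lin_if lin_comp[OF l] ConvD(1)[OF that])
  have mul: "cmap \<phi> (amul (Conv A) \<alpha> \<beta>) h = amul (Conv B) (cmap \<phi> \<alpha>) (cmap \<phi> \<beta>) h"
    if "\<alpha> \<in> car (Conv A)" "\<beta> \<in> car (Conv A)" "h \<in> car C" for \<alpha> \<beta> h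
    using that
    by (simp add: cmap_def Conv_simps(3) cop2_map[OF l Av Bv bilin_amul[OF A]] ConvD
        alg_homD(3)[OF \<phi>] cong: cop2_cong)
  show ?thesis
    unfolding alg_hom_def
  proof (intro conjI ballI)
    show "lin_map (Conv A) (Conv B) (cmap \<phi>)"
      by (rule Conv_lin_mapI[OF Bv car _ is_vspace_Conv[OF Av]])
         (simp_all add: cmap_def lin_comp[OF l lin_eval])
    show "cmap \<phi> (aone (Conv A)) = aone (Conv B)"
      by (auto simp: cmap_def fun_eq_iff Conv_simps(4) lin_mapD(3)[OF l] is_algD[OF A] alg_homD(2)[OF \<phi>])
    fix \<alpha> \<beta> assume ab: "\<alpha> \<in> car (Conv A)" "\<beta> \<in> car (Conv A)"
    show "cmap \<phi> (amul (Conv A) \<alpha> \<beta>) = amul (Conv B) (cmap \<phi> \<alpha>) (cmap \<phi> \<beta>)"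
      by (rule Conv_eqI[of _ B]) (simp_all add: car ab Conv_amul_car A B mul)
  qed
qed

text \<open>The forms that depend on the first variable through the counit only.\<close>

definition cinc :: "('k, 'a::ab_group_add, 'n) alg_scheme \<Rightarrow> 'a \<Rightarrow> 'h \<Rightarrow> 'a" where
  "cinc A x = (\<lambda>h. if h \<in> car C then scl A (counit C h) x else 0)"

lemma alg_hom_cinc:
  assumes A: "is_alg A"
  shows "alg_hom A (Conv A) (cinc A)"
proof -
  note Av = is_algD(1)[OF A]
  have lin: "lin_map C A (\<lambda>h. scl A (counit C h) x)" if "x \<in> car A" for x
    by (intro lin_sclL Av lin_counit that)
  have car: "cinc A x \<in> car (Conv A)" if "x \<in> car A" for x
    unfolding cinc_def by (rule Conv_carI) (simp_all add: lin_if lin that)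
  have mul: "cinc A (amul A x y) h = amul (Conv A) (cinc A x) (cinc A y) h"
    if "x \<in> car A" "y \<in> car A" "h \<in> car C" for x y h
    using that cop2_counitL[OF Av lin[OF is_algD(4)[OF A that(1,2)]] that(3)]
    by (simp add: cinc_def Conv_simps(3) is_algD(8,9)[OF A] vspaceD[OF Av] vspace_simps[OF Av] mult.commute cong: cop2_cong)
  show ?thesis
    unfolding alg_hom_def
  proof (intro conjI ballI)
    show "lin_map A (Conv A) (cinc A)"
      by (rule Conv_lin_mapI[OF Av car _ Av]) (simp_all add: cinc_def lin_scl[OF Av lin_id])
    show "cinc A (aone A) = aone (Conv A)" by (simp add: cinc_def fun_eq_iff Conv_simps(4))
    fix x y assume xy: "x \<in> car A" "y \<in> car A"
    show "cinc A (amul A x y) = amul (Conv A) (cinc A x) (cinc A y)"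
      by (rule Conv_eqI[of _ A]) (simp_all add: car xy Conv_amul_car A mul is_algD(4)[OF A])
  qed
qed

end


section \<open>Products of lists in an algebra\<close>

definition lprod :: "('k::field, 'a::ab_group_add, 'm) alg_scheme \<Rightarrow> 'a list \<Rightarrow> 'a" where
  "lprod A xs = foldr (amul A) xs (aone A)"

lemma lprod_simps: "lprod A [] = aone A" "lprod A (x # xs) = amul A x (lprod A xs)"
  by (simp_all add: lprod_def)

lemma lprod_car: "is_alg A \<Longrightarrow> set xs \<subseteq> car A \<Longrightarrow> lprod A xs \<in> car A"
  by (induction xs) (simp_all add: lprod_simps is_algD)

lemma lprod_append:
  "is_alg A \<Longrightarrow> set xs \<subseteq> car A \<Longrightarrow> set ys \<subseteq> car A \<Longrightarrow> lprod A (xs @ ys) = amul A (lprod A xs) (lprod A ys)"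
  by (induction xs) (simp_all add: lprod_simps is_algD lprod_car)

text \<open>
  Since products are taken over lists, an equation between products applies inside a longer
  product without any bookkeeping of brackets.
\<close>

lemma lprod_segment:
  assumes "lprod A us = lprod A vs" "is_alg A" "set us \<subseteq> car A" "set vs \<subseteq> car A"
    "set xs \<subseteq> car A" "set ys \<subseteq> car A"
  shows "lprod A (xs @ us @ ys) = lprod A (xs @ vs @ ys)"
  using assms by (simp add: lprod_append)

lemma lprod_inverse:
  assumes "is_alg A" "inverse_pair A x y"
  shows "lprod A [x, y] = lprod A []" "lprod A [y, x] = lprod A []"
  using assms by (simp_all add: lprod_simps inverse_pair_def is_algD)

lemma alg_hom_lprod:
  assumes "is_alg A" "alg_hom A B f"
  shows "set xs \<subseteq> car A \<Longrightarrow> f (lprod A xs) = lprod B (map f xs)"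
  by (induction xs) (simp_all add: lprod_simps alg_homD[OF assms(2)] lprod_car[OF assms(1)])

text \<open>
  The cocycle condition has the shape \<open>p q r = u v\<close> with invertible factors. The
  computations below need it in these four forms, where some factors are moved to the other side.
\<close>

lemma lprod_moves:
  assumes A: "is_alg A" and inv: "inverse_pair A p p'" "inverse_pair A q q'" "inverse_pair A r r'"
    "inverse_pair A u u'" "inverse_pair A v v'"
    and eq: "lprod A [p, q, r] = lprod A [u, v]"
  shows "lprod A [v, r'] = lprod A [u', p, q]"
    and "lprod A [q, r, v'] = lprod A [p', u]"
    and "lprod A [r', q', p'] = lprod A [v', u']"
    and "lprod A [r, v'] = lprod A [q', p', u]"
proof -
  have c: "p \<in> car A" "q \<in> car A" "r \<in> car A" "u \<in> car A" "v \<in> car A"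
     "p' \<in> car A" "q' \<in> car A" "r' \<in> car A" "u' \<in> car A" "v' \<in> car A"
    using inv by (simp_all add: inverse_pair_def)
  have seg: "lprod A zs = lprod A ws"
    if "lprod A us = lprod A vs" "zs = xs @ us @ ys" "ws = xs @ vs @ ys"
      "set us \<subseteq> car A" "set vs \<subseteq> car A" "set xs \<subseteq> car A" "set ys \<subseteq> car A" for us vs xs ys zs ws
    unfolding that(2,3) by (rule lprod_segment[OF that(1) A that(4-7)])
  note P = lprod_inverse[OF A inv(1)] and Q = lprod_inverse[OF A inv(2)]
    and R = lprod_inverse[OF A inv(3)] and U = lprod_inverse[OF A inv(4)] and V = lprod_inverse[OF A inv(5)]
  have "lprod A [v, r'] = lprod A [u', u, v, r']"
    by (rule seg[OF U(2)[symmetric], where xs = "[]" and ys = "[v, r']"]) (simp_all add: c)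
  also have "\<dots> = lprod A [u', p, q, r, r']"
    by (rule seg[OF eq[symmetric], where xs = "[u']" and ys = "[r']"]) (simp_all add: c)
  also have "\<dots> = lprod A [u', p, q]"
    by (rule seg[OF R(1), where xs = "[u', p, q]" and ys = "[]"]) (simp_all add: c)
  finally show "lprod A [v, r'] = lprod A [u', p, q]" .
  have "lprod A [q, r, v'] = lprod A [p', p, q, r, v']"
    by (rule seg[OF P(2)[symmetric], where xs = "[]" and ys = "[q, r, v']"]) (simp_all add: c)
  also have "\<dots> = lprod A [p', u, v, v']"
    by (rule seg[OF eq, where xs = "[p']" and ys = "[v']"]) (simp_all add: c)
  also have "\<dots> = lprod A [p', u]"
    by (rule seg[OF V(1), where xs = "[p', u]" and ys = "[]"]) (simp_all add: c)
  finally show e2: "lprod A [q, r, v'] = lprod A [p', u]" .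
  have "lprod A [r, v'] = lprod A [q', q, r, v']"
    by (rule seg[OF Q(2)[symmetric], where xs = "[]" and ys = "[r, v']"]) (simp_all add: c)
  also have "\<dots> = lprod A [q', p', u]"
    by (rule seg[OF e2, where xs = "[q']" and ys = "[]"]) (simp_all add: c)
  finally show e4: "lprod A [r, v'] = lprod A [q', p', u]" .
  have "lprod A [r', q', p'] = lprod A [r', q', p', u, u']"
    by (rule seg[OF U(1)[symmetric], where xs = "[r', q', p']" and ys = "[]"]) (simp_all add: c)
  also have "\<dots> = lprod A [r', r, v', u']"
    by (rule seg[OF e4[symmetric], where xs = "[r']" and ys = "[u']"]) (simp_all add: c)
  also have "\<dots> = lprod A [v', u']"
    by (rule seg[OF R(2), where xs = "[]" and ys = "[v', u']"]) (simp_all add: c)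
  finally show "lprod A [r', q', p'] = lprod A [v', u']" .
qed

section \<open>Dual quasi-bialgebras through convolution algebras\<close>

locale dual_quasi_bialg =
  fixes H :: "('k::field, 'h::ab_group_add, 'm) dqb_scheme"
  assumes dqb: "dual_quasi_bialgebra H"
begin

sublocale coalgebra H
  using dqb by unfold_locales (simp add: dual_quasi_bialgebra_def coalgebra_with_mult_unit_def)

abbreviation "\<A>\<^sub>1 \<equiv> Conv base_alg"
abbreviation "\<A>\<^sub>2 \<equiv> Conv \<A>\<^sub>1"
abbreviation "\<A>\<^sub>3 \<equiv> Conv \<A>\<^sub>2"
abbreviation "\<A>\<^sub>4 \<equiv> Conv \<A>\<^sub>3"

lemmas algs = is_alg_base_alg is_alg_Conv

lemma cwmu: "coalgebra_with_mult_unit H"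
  using dqb by (simp add: dual_quasi_bialgebra_def)

lemma bilin_mul: "bilin_map H H H (mul H)"
  using cwmu by (simp add: coalgebra_with_mult_unit_def)

lemma mul_car: "h \<in> car H \<Longrightarrow> k \<in> car H \<Longrightarrow> mul H h k \<in> car H"
  by (rule bilin_mapD(1)[OF bilin_mul])

lemma lin_mul1: "k \<in> car H \<Longrightarrow> lin_map V H f \<Longrightarrow> lin_map V H (\<lambda>v. mul H (f v) k)"
  by (rule lin_comp[OF lin_bilin2[OF bilin_mul]])

lemma lin_mul2: "h \<in> car H \<Longrightarrow> lin_map V H f \<Longrightarrow> lin_map V H (\<lambda>v. mul H h (f v))"
  by (rule lin_comp[OF lin_bilin1[OF bilin_mul]])

lemma counit_mul: "h \<in> car H \<Longrightarrow> k \<in> car H \<Longrightarrow> counit H (mul H h k) = counit H h * counit H k"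
  using cwmu by (simp add: coalgebra_with_mult_unit_def)

lemma one_grouplike: "one H \<in> grouplike H"
  using cwmu by (simp add: coalgebra_with_mult_unit_def grouplike_def)

lemma grouplikeD: "g \<in> grouplike H \<Longrightarrow> g \<in> car H" "g \<in> grouplike H \<Longrightarrow> counit H g = 1"
  by (simp_all add: grouplike_def)

lemmas one_car = grouplikeD(1)[OF one_grouplike]

lemma mul_one: "h \<in> car H \<Longrightarrow> mul H (one H) h = h" "h \<in> car H \<Longrightarrow> mul H h (one H) = h"
  using dqb by (simp_all add: dual_quasi_bialgebra_def)

text \<open>The multiplication is a coalgebra map.\<close>

lemma cop2_mul:
  assumes Z: "is_vspace Z" and F: "bilin_map H H Z F" and h: "h \<in> car H" and k: "k \<in> car H"
  shows "cop2 H (mul H h k) F = cop2 H h (\<lambda>a b. cop2 H k (\<lambda>c d. F (mul H a c) (mul H b d)))"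
proof -
  let ?T = "tensor_space H H"
  note T = is_vspace_tensor_space
  define \<Phi> where "\<Phi> t = sweedler H H t F" for t
  have \<Phi>: "lin_map ?T Z \<Phi>"
    unfolding \<Phi>_def by (intro lin_sweedler_arg C_vspace Z lin_id F)
  have b1: "bilin_map H H ?T (\<lambda>c d. tens H H (mul H a c) (mul H b d))" if "a \<in> car H" "b \<in> car H" for a b
    using that by (intro bilin_mapI lin_tens1 lin_tens2 lin_mul2 lin_id mul_car)
  have b2: "bilin_map H H ?T (\<lambda>a b. cop2 H k (\<lambda>c d. tens H H (mul H a c) (mul H b d)))"
    using k by (intro bilin_mapI lin_cop2_body C_vspace T lin_tens1 lin_tens2 lin_mul1 lin_mul2 lin_id mul_car)
  have "cop2 H (mul H h k) F = \<Phi> (cop2 H h (\<lambda>a b. cop2 H k (\<lambda>c d. tens H H (mul H a c) (mul H b d))))"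
    using cwmu h k unfolding cop2_def[of H "mul H h k"] \<Phi>_def
    by (simp add: coalgebra_with_mult_unit_def)
  also have "\<dots> = cop2 H h (\<lambda>a b. cop2 H k (\<lambda>c d. \<Phi> (tens H H (mul H a c) (mul H b d))))"
    unfolding cop2_map[OF \<Phi> T Z b2 h] by (intro cop2_cong cop2_map[OF \<Phi> T Z b1 k])
  also have "\<dots> = cop2 H h (\<lambda>a b. cop2 H k (\<lambda>c d. F (mul H a c) (mul H b d)))"
    unfolding \<Phi>_def by (intro cop2_cong sweedler_tens[OF Z F] mul_car)
  finally show ?thesis .
qed

lemma grouplike_mul:
  assumes "g \<in> grouplike H" "g' \<in> grouplike H"
  shows "mul H g g' \<in> grouplike H"
proof -
  note c = grouplikeD(1)[OF assms(1)] grouplikeD(1)[OF assms(2)]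
  have "comul H (mul H g g') = cop2 H g (\<lambda>a b. cop2 H g' (\<lambda>c d. tens H H (mul H a c) (mul H b d)))"
    using cwmu c by (simp add: coalgebra_with_mult_unit_def)
  also have "\<dots> = cop2 H g' (\<lambda>c d. tens H H (mul H g c) (mul H g d))"
    using c by (intro cop2_grouplike[OF assms(1) is_vspace_tensor_space[of H H]] bilin_mapI lin_cop2_body C_vspace
        is_vspace_tensor_space lin_tens1 lin_tens2 lin_mul1 lin_mul2 lin_id mul_car)
  also have "\<dots> = tens H H (mul H g g') (mul H g g')"
    using c by (intro cop2_grouplike[OF assms(2) is_vspace_tensor_space[of H H]] bilin_mapI
        lin_tens1 lin_tens2 lin_mul1 lin_mul2 lin_id mul_car)
  finally show ?thesis
    using c by (simp add: grouplike_def mul_car counit_mul assms[THEN grouplikeD(2)])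
qed

subsection \<open>Homomorphisms induced by the multiplication\<close>

text \<open>Precomposition with the multiplication: one variable of a form is split into a product of two.\<close>

definition cmu :: "('h \<Rightarrow> 'a::ab_group_add) \<Rightarrow> 'h \<Rightarrow> 'h \<Rightarrow> 'a" where
  "cmu \<alpha> = (\<lambda>h k. if h \<in> car H \<and> k \<in> car H then \<alpha> (mul H h k) else 0)"

lemma Conv_amul_apply2:
  assumes "is_alg A" "\<alpha> \<in> car (Conv (Conv A))" "\<beta> \<in> car (Conv (Conv A))" "h \<in> car H" "k \<in> car H"
  shows "amul (Conv (Conv A)) \<alpha> \<beta> h k = cop2 H h (\<lambda>a b. amul (Conv A) (\<alpha> a) (\<beta> b) k)"
  using cop2_map[OF lin_eval[OF assms(5)] is_algD(1)[OF is_alg_Conv] is_algD(1) bilin_amul[OF is_alg_Conv] assms(4),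
      OF assms(1,1,1) ConvD(1)[OF assms(2)] ConvD(1)[OF assms(3)]] assms(4)
  by (simp add: Conv_simps(3))

text \<open>
  Convolution is compatible with precomposition by the coalgebra map \<open>H \<otimes> H
  \<rightarrow> H\<close>.
\<close>

lemma alg_hom_cmu:
  assumes A: "is_alg A"
  shows "alg_hom (Conv A) (Conv (Conv A)) cmu"
proof -
  note Av = is_algD(1)[OF A] and CAv = is_algD(1)[OF is_alg_Conv[OF A]]
  have car: "cmu \<alpha> \<in> car (Conv (Conv A))" if "\<alpha> \<in> car (Conv A)" for \<alpha>
  proof -
    have *: "lin_map H A (\<lambda>k. \<alpha> (mul H h k))" "lin_map H A (\<lambda>k. \<alpha> (mul H k h))" if "h \<in> car H" for h
      by (intro lin_comp[OF ConvD(1)[OF \<open>\<alpha> \<in> car (Conv A)\<close>]] lin_mul1 lin_mul2 lin_id that)+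
    have 1: "cmu \<alpha> h \<in> car (Conv A)" for h
      unfolding cmu_def using *[of h] lin_zero[OF Av, of H]
      by (cases "h \<in> car H") (auto simp: Conv_simps lin_if)
    show ?thesis
      by (intro Conv_carI Conv_lin_mapI Av 1 C_vspace) (auto simp: cmu_def fun_eq_iff lin_if *)
  qed
  have mul: "cmu (amul (Conv A) \<alpha> \<beta>) h k = amul (Conv (Conv A)) (cmu \<alpha>) (cmu \<beta>) h k"
    if ab: "\<alpha> \<in> car (Conv A)" "\<beta> \<in> car (Conv A)" and h: "h \<in> car H" and k: "k \<in> car H" for \<alpha> \<beta> h k
  proof -
    have "cmu (amul (Conv A) \<alpha> \<beta>) h k
        = cop2 H h (\<lambda>a b. cop2 H k (\<lambda>c d. amul A (\<alpha> (mul H a c)) (\<beta> (mul H b d))))"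
      using cop2_mul[OF Av bilin_amul[OF A ConvD(1)[OF ab(1)] ConvD(1)[OF ab(2)]] h k] h k
      by (simp add: cmu_def Conv_simps(3) mul_car)
    also have "\<dots> = cop2 H h (\<lambda>a b. amul (Conv A) (cmu \<alpha> a) (cmu \<beta> b) k)"
      unfolding Conv_simps(3) using k by (simp add: cmu_def cong: cop2_cong)
    finally show ?thesis using Conv_amul_apply2[OF A car[OF ab(1)] car[OF ab(2)] h k] by simp
  qed
  show ?thesis
    unfolding alg_hom_def
  proof (intro conjI ballI)
    show "lin_map (Conv A) (Conv (Conv A)) cmu"
    proof (rule Conv_lin_mapI[OF CAv car _ CAv])
      fix h assume h: "h \<in> car H"
      show "lin_map (Conv A) (Conv A) (\<lambda>x. cmu x h)"
      proof (rule Conv_lin_mapI[OF Av ConvD(2)[OF car h] _ CAv])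
        fix k assume k: "k \<in> car H"
        show "lin_map (Conv A) A (\<lambda>x. cmu x h k)"
          using h k by (simp add: cmu_def lin_eval mul_car)
      qed
    qed
    show "cmu (aone (Conv A)) = aone (Conv (Conv A))"
      by (auto simp: cmu_def fun_eq_iff Conv_simps(2,4) mul_car counit_mul vspace_simps[OF Av])
    fix \<alpha> \<beta> assume ab: "\<alpha> \<in> car (Conv A)" "\<beta> \<in> car (Conv A)"
    note c = car[OF Conv_amul_car[OF A ab]] Conv_amul_car[OF is_alg_Conv[OF A] car[OF ab(1)] car[OF ab(2)]]
    show "cmu (amul (Conv A) \<alpha> \<beta>) = amul (Conv (Conv A)) (cmu \<alpha>) (cmu \<beta>)"
    proof (rule Conv_eqI[OF c])
      fix h assume h: "h \<in> car H"
      show "cmu (amul (Conv A) \<alpha> \<beta>) h = amul (Conv (Conv A)) (cmu \<alpha>) (cmu \<beta>) h"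
        by (rule Conv_eqI[OF ConvD(2)[OF c(1) h] ConvD(2)[OF c(2) h]]) (rule mul[OF ab h])
    qed
  qed
qed


subsection \<open>Forms as elements of convolution algebras\<close>

text \<open>
  \<open>E1\<close>, \<open>E2\<close> and \<open>E3\<close> embed forms in one, two and three
  variables into the iterated convolution algebras, by cutting them off outside the carrier.
\<close>

definition E1 :: "('h \<Rightarrow> 'k) \<Rightarrow> 'h \<Rightarrow> 'k" where
  "E1 f = (\<lambda>h. if h \<in> car H then f h else 0)"

definition E2 :: "('h \<Rightarrow> 'h \<Rightarrow> 'k) \<Rightarrow> 'h \<Rightarrow> 'h \<Rightarrow> 'k" where
  "E2 f = (\<lambda>h l. if h \<in> car H \<and> l \<in> car H then f h l else 0)"

definition E3 :: "('h \<Rightarrow> 'h \<Rightarrow> 'h \<Rightarrow> 'k) \<Rightarrow> 'h \<Rightarrow> 'h \<Rightarrow> 'h \<Rightarrow> 'k" where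
  "E3 f = (\<lambda>h k l. if h \<in> car H \<and> k \<in> car H \<and> l \<in> car H then f h k l else 0)"

lemma E1_car: "lin_map H ground f \<Longrightarrow> E1 f \<in> car \<A>\<^sub>1"
  unfolding E1_def by (rule Conv_carI) (simp_all add: lin_if[of base_alg, simplified])

lemma E2_car:
  assumes "bilin_map H H ground f"
  shows "E2 f \<in> car \<A>\<^sub>2"
proof -
  have 1: "E2 f h \<in> car \<A>\<^sub>1" for h
    using E1_car[OF lin_bilin1[OF assms, of h]] lin_zero[OF is_vspace_ground, of H]
    by (cases "h \<in> car H") (auto simp: E1_def E2_def Conv_simps)
  show ?thesis
    by (intro Conv_carI Conv_lin_mapI is_vspace_base_alg 1 C_vspace)
       (auto simp: E2_def fun_eq_iff lin_if[of base_alg, simplified] lin_bilin2[OF assms])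
qed

lemma E3_car:
  assumes "trilin_form H f"
  shows "E3 f \<in> car \<A>\<^sub>3"
proof -
  have f: "h \<in> car H \<Longrightarrow> bilin_map H H ground (f h)"
    "k \<in> car H \<Longrightarrow> l \<in> car H \<Longrightarrow> lin_map H ground (\<lambda>h. f h k l)" for h k l
    using assms by (simp_all add: trilin_form_def)
  have 0: "0 \<in> car \<A>\<^sub>2" by (rule vspaceD(1)[OF is_algD(1)]) (intro algs)
  have 1: "E3 f h \<in> car \<A>\<^sub>2" for h
    using E2_car[OF f(1), of h] 0 by (cases "h \<in> car H") (auto simp: E2_def E3_def zero_fun_def)
  have 2: "E3 f h k \<in> car \<A>\<^sub>1" for h k
    using E1_car[OF lin_bilin1[OF f(1)], of h k] lin_zero[OF is_vspace_ground, of H]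
    by (cases "h \<in> car H \<and> k \<in> car H") (auto simp: E1_def E3_def Conv_simps)
  have 3: "lin_map H \<A>\<^sub>1 (\<lambda>h. E3 f h k)" for k
    by (intro Conv_lin_mapI is_vspace_base_alg C_vspace 2)
       (cases "k \<in> car H", auto simp: E3_def lin_if[of base_alg, simplified] lin_zero is_vspace_ground f)
  show ?thesis
    by (intro Conv_carI Conv_lin_mapI[of \<A>\<^sub>1] is_algD(1) algs 1 3 C_vspace) (auto simp: E3_def fun_eq_iff)
qed

lemma amul_A2:
  assumes "\<alpha> \<in> car \<A>\<^sub>2" "\<beta> \<in> car \<A>\<^sub>2" "h \<in> car H" "k \<in> car H"
  shows "amul \<A>\<^sub>2 \<alpha> \<beta> h k = cop2 H h (\<lambda>h1 h2. cop2 H k (\<lambda>k1 k2. \<alpha> h1 k1 * \<beta> h2 k2))"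
  unfolding Conv_amul_apply2[OF is_alg_base_alg assms] Conv_simps(3)[where A = base_alg] using assms by simp

lemma amul_apply:
  assumes A: "is_alg A" and "\<alpha> \<in> car (Conv A)" "\<beta> \<in> car (Conv A)" "h \<in> car H"
    and \<Phi>: "lin_map A B \<Phi>" "is_vspace B"
  shows "\<Phi> (amul (Conv A) \<alpha> \<beta> h) = cop2 H h (\<lambda>a b. \<Phi> (amul A (\<alpha> a) (\<beta> b)))"
  using cop2_map[OF \<Phi>(1) is_algD(1)[OF A] \<Phi>(2) bilin_amul[OF A ConvD(1)[OF assms(2)] ConvD(1)[OF assms(3)]] assms(4)]
    assms(4) by (simp add: Conv_simps(3))

lemma amul_A3:
  assumes a: "\<alpha> \<in> car \<A>\<^sub>3" and b: "\<beta> \<in> car \<A>\<^sub>3" and "h \<in> car H" "k \<in> car H" "l \<in> car H"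
  shows "amul \<A>\<^sub>3 \<alpha> \<beta> h k l = conv3 H \<alpha> \<beta> h k l"
proof -
  have "amul \<A>\<^sub>3 \<alpha> \<beta> h k l = cop2 H h (\<lambda>a b. amul \<A>\<^sub>2 (\<alpha> a) (\<beta> b) k l)"
    by (rule amul_apply[OF _ a b assms(3), of base_alg "\<lambda>x. x k l"])
       (intro algs lin_comp[OF lin_eval lin_eval] assms is_vspace_base_alg)+
  thus ?thesis
    unfolding conv3_def using assms by (simp add: amul_A2 ConvD(2)[OF a] ConvD(2)[OF b] cong: cop2_cong)
qed

lemma amul_A4:
  assumes a: "\<alpha> \<in> car \<A>\<^sub>4" and b: "\<beta> \<in> car \<A>\<^sub>4" and "h \<in> car H" "k \<in> car H" "l \<in> car H" "m \<in> car H"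
  shows "amul \<A>\<^sub>4 \<alpha> \<beta> h k l m = conv4 H \<alpha> \<beta> h k l m"
proof -
  have "amul \<A>\<^sub>4 \<alpha> \<beta> h k l m = cop2 H h (\<lambda>a b. amul \<A>\<^sub>3 (\<alpha> a) (\<beta> b) k l m)"
    by (rule amul_apply[OF _ a b assms(3), of base_alg "\<lambda>x. x k l m"])
       (intro algs lin_comp[OF lin_comp[OF lin_eval lin_eval] lin_eval] assms is_vspace_base_alg)+
  thus ?thesis
    unfolding conv4_def using assms
    by (simp add: amul_A3 conv3_def ConvD(2)[OF a] ConvD(2)[OF b] cong: cop2_cong)
qed

lemma omega_trilin: "trilin_form H (omega H)"
  using dqb by (simp add: dual_quasi_bialgebra_def)

lemma omega_inv_inverse: "conv_inverse3 H (omega H) (omega_inv H)"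
proof -
  have "\<exists>\<psi>. conv_inverse3 H (omega H) \<psi>" using dqb by (simp add: dual_quasi_bialgebra_def)
  thus ?thesis unfolding omega_inv_def by (rule someI_ex)
qed

lemma omega_inv_trilin: "trilin_form H (omega_inv H)"
  using omega_inv_inverse by (simp add: conv_inverse3_def)

lemma trilin_formD:
  assumes "trilin_form H f"
  shows "h \<in> car H \<Longrightarrow> k \<in> car H \<Longrightarrow> lin_map V H g \<Longrightarrow> lin_map V ground (\<lambda>v. f h k (g v))"
    and "h \<in> car H \<Longrightarrow> k \<in> car H \<Longrightarrow> lin_map V H g \<Longrightarrow> lin_map V ground (\<lambda>v. f h (g v) k)"
    and "h \<in> car H \<Longrightarrow> k \<in> car H \<Longrightarrow> lin_map V H g \<Longrightarrow> lin_map V ground (\<lambda>v. f (g v) h k)"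
proof -
  have f: "h \<in> car H \<Longrightarrow> bilin_map H H ground (f h)"
    "k \<in> car H \<Longrightarrow> l \<in> car H \<Longrightarrow> lin_map H ground (\<lambda>h. f h k l)" for h k l
    using assms by (simp_all add: trilin_form_def)
  show "h \<in> car H \<Longrightarrow> k \<in> car H \<Longrightarrow> lin_map V H g \<Longrightarrow> lin_map V ground (\<lambda>v. f h k (g v))"
    by (rule lin_comp[OF lin_bilin1[OF f(1)]])
  show "h \<in> car H \<Longrightarrow> k \<in> car H \<Longrightarrow> lin_map V H g \<Longrightarrow> lin_map V ground (\<lambda>v. f h (g v) k)"
    by (rule lin_comp[OF lin_bilin2[OF f(1)]])
  show "h \<in> car H \<Longrightarrow> k \<in> car H \<Longrightarrow> lin_map V H g \<Longrightarrow> lin_map V ground (\<lambda>v. f (g v) h k)"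
    by (rule lin_comp[OF f(2)])
qed

lemmas lin_omega = trilin_formD[OF omega_trilin] and lin_omega_inv = trilin_formD[OF omega_inv_trilin]

definition \<Omega> :: "'h \<Rightarrow> 'h \<Rightarrow> 'h \<Rightarrow> 'k" where "\<Omega> = E3 (omega H)"
definition \<Omega>' :: "'h \<Rightarrow> 'h \<Rightarrow> 'h \<Rightarrow> 'k" where "\<Omega>' = E3 (omega_inv H)"

lemma \<Omega>_car: "\<Omega> \<in> car \<A>\<^sub>3" "\<Omega>' \<in> car \<A>\<^sub>3"
  unfolding \<Omega>_def \<Omega>'_def by (intro E3_car omega_trilin omega_inv_trilin)+

lemma A3_eqI:
  assumes "\<alpha> \<in> car \<A>\<^sub>3" "\<beta> \<in> car \<A>\<^sub>3"
    "\<And>h k l. h \<in> car H \<Longrightarrow> k \<in> car H \<Longrightarrow> l \<in> car H \<Longrightarrow> \<alpha> h k l = \<beta> h k l"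
  shows "\<alpha> = \<beta>"
  using assms by (intro Conv_eqI[of _ \<A>\<^sub>2] Conv_eqI[of _ \<A>\<^sub>1] Conv_eqI[of _ base_alg]) (auto dest: ConvD(2))

lemma A4_eqI:
  assumes "\<alpha> \<in> car \<A>\<^sub>4" "\<beta> \<in> car \<A>\<^sub>4"
    "\<And>h k l m. h \<in> car H \<Longrightarrow> k \<in> car H \<Longrightarrow> l \<in> car H \<Longrightarrow> m \<in> car H \<Longrightarrow> \<alpha> h k l m = \<beta> h k l m"
  shows "\<alpha> = \<beta>"
  using assms by (intro Conv_eqI[of _ \<A>\<^sub>3] A3_eqI) (auto dest: ConvD(2))

lemma \<Omega>_inverse: "inverse_pair \<A>\<^sub>3 \<Omega> \<Omega>'"
proof -
  note car = \<Omega>_car is_algD(3)[OF is_alg_Conv[OF is_alg_Conv[OF is_alg_Conv[OF is_alg_base_alg]]]]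
    is_algD(4)[OF is_alg_Conv[OF is_alg_Conv[OF is_alg_Conv[OF is_alg_base_alg]]]]
  have 1: "conv3 H (E3 \<phi>) (E3 \<psi>) h k l = conv3 H \<phi> \<psi> h k l" for \<phi> \<psi> h k l
    unfolding conv3_def by (intro cop2_cong) (simp add: E3_def)
  have inv: "conv3 H (omega H) (omega_inv H) h k l = counit H h * counit H k * counit H l"
    "conv3 H (omega_inv H) (omega H) h k l = counit H h * counit H k * counit H l"
    if "h \<in> car H" "k \<in> car H" "l \<in> car H" for h k l
    using omega_inv_inverse that by (simp_all add: conv_inverse3_def)
  have "amul \<A>\<^sub>3 \<Omega> \<Omega>' = aone \<A>\<^sub>3" "amul \<A>\<^sub>3 \<Omega>' \<Omega> = aone \<A>\<^sub>3"
    by (rule A3_eqI; simp add: car amul_A3; simp add: \<Omega>_def \<Omega>'_def 1 inv Conv_simps(2,4))+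
  thus ?thesis using \<Omega>_car by (simp add: inverse_pair_def)
qed

text \<open>
  The five homomorphisms send \<open>\<omega>\<close> to the factors \<open>\<epsilon> \<otimes> \<omega>\<close>, \<open>\<omega>(id \<otimes> m \<otimes> id)\<close>, \<open>\<omega> \<otimes> \<epsilon>\<close>,
  \<open>\<omega>(id \<otimes> id \<otimes> m)\<close> and \<open>\<omega>(m \<otimes> id \<otimes> id)\<close> of the cocycle condition, in this order.
\<close>

definition \<Phi>1 where "\<Phi>1 = cinc \<A>\<^sub>3"
definition \<Phi>2 :: "('h \<Rightarrow> 'h \<Rightarrow> 'h \<Rightarrow> 'k) \<Rightarrow> 'h \<Rightarrow> 'h \<Rightarrow> 'h \<Rightarrow> 'h \<Rightarrow> 'k" where "\<Phi>2 = cmap cmu"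
definition \<Phi>3 where "\<Phi>3 = cmap (cmap (cmap (cinc base_alg)))"
definition \<Phi>4 :: "('h \<Rightarrow> 'h \<Rightarrow> 'h \<Rightarrow> 'k) \<Rightarrow> 'h \<Rightarrow> 'h \<Rightarrow> 'h \<Rightarrow> 'h \<Rightarrow> 'k" where "\<Phi>4 = cmap (cmap cmu)"
definition \<Phi>5 :: "('h \<Rightarrow> 'h \<Rightarrow> 'h \<Rightarrow> 'k) \<Rightarrow> 'h \<Rightarrow> 'h \<Rightarrow> 'h \<Rightarrow> 'h \<Rightarrow> 'k" where "\<Phi>5 = cmu"

lemma alg_hom_\<Phi>:
  "alg_hom \<A>\<^sub>3 \<A>\<^sub>4 \<Phi>1" "alg_hom \<A>\<^sub>3 \<A>\<^sub>4 \<Phi>2" "alg_hom \<A>\<^sub>3 \<A>\<^sub>4 \<Phi>3" "alg_hom \<A>\<^sub>3 \<A>\<^sub>4 \<Phi>4" "alg_hom \<A>\<^sub>3 \<A>\<^sub>4 \<Phi>5"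
  unfolding \<Phi>1_def \<Phi>2_def \<Phi>3_def \<Phi>4_def \<Phi>5_def
  by (intro alg_hom_cinc alg_hom_cmap alg_hom_cmu algs)+

lemma \<Phi>_apply:
  assumes "h \<in> car H" "k \<in> car H" "l \<in> car H" "m \<in> car H"
  shows "\<Phi>1 \<alpha> h k l m = counit H h * \<alpha> k l m" "\<Phi>2 \<alpha> h k l m = \<alpha> h (mul H k l) m"
    "\<Phi>3 \<alpha> h k l m = counit H m * \<alpha> h k l" "\<Phi>4 \<alpha> h k l m = \<alpha> h k (mul H l m)"
    "\<Phi>5 \<alpha> h k l m = \<alpha> (mul H h k) l m"
  using assms by (simp_all add: \<Phi>1_def \<Phi>2_def \<Phi>3_def \<Phi>4_def \<Phi>5_def cinc_def cmap_def cmu_def Conv_simps(2))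

text \<open>
  Pointwise, this is the cocycle condition, since multiplication in the fourth convolution algebra
  is convolution of four-linear forms.
\<close>

theorem cocycle_A4: "lprod \<A>\<^sub>4 [\<Phi>1 \<Omega>, \<Phi>2 \<Omega>, \<Phi>3 \<Omega>] = lprod \<A>\<^sub>4 [\<Phi>4 \<Omega>, \<Phi>5 \<Omega>]"
proof -
  have A4: "is_alg \<A>\<^sub>4" by (intro algs)
  note \<Phi> = alg_hom_\<Phi>[THEN alg_homD(4), OF \<Omega>_car(1)]
  have w: "\<Omega> h k l = omega H h k l" if "h \<in> car H" "k \<in> car H" "l \<in> car H" for h k l
    using that by (simp add: \<Omega>_def E3_def)
  have cong: "conv4 H \<phi> \<psi> h k l m = conv4 H \<phi>' \<psi>' h k l m"
    if "\<And>h k l m. h \<in> car H \<Longrightarrow> k \<in> car H \<Longrightarrow> l \<in> car H \<Longrightarrow> m \<in> car H \<Longrightarrow> \<phi> h k l m = \<phi>' h k l m"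
      "\<And>h k l m. h \<in> car H \<Longrightarrow> k \<in> car H \<Longrightarrow> l \<in> car H \<Longrightarrow> m \<in> car H \<Longrightarrow> \<psi> h k l m = \<psi>' h k l m"
    for \<phi> \<psi> \<phi>' \<psi>' h k l m
    unfolding conv4_def by (intro cop2_cong) (simp add: that)
  have "amul \<A>\<^sub>4 (amul \<A>\<^sub>4 (\<Phi>1 \<Omega>) (\<Phi>2 \<Omega>)) (\<Phi>3 \<Omega>) = amul \<A>\<^sub>4 (\<Phi>4 \<Omega>) (\<Phi>5 \<Omega>)"
  proof (rule A4_eqI)
    fix h k l m assume c: "h \<in> car H" "k \<in> car H" "l \<in> car H" "m \<in> car H"
    have "amul \<A>\<^sub>4 (amul \<A>\<^sub>4 (\<Phi>1 \<Omega>) (\<Phi>2 \<Omega>)) (\<Phi>3 \<Omega>) h k l m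
      = conv4 H (conv4 H (\<lambda>h k l m. counit H h * omega H k l m) (\<lambda>h k l m. omega H h (mul H k l) m))
          (\<lambda>h k l m. omega H h k l * counit H m) h k l m"
      unfolding amul_A4[OF is_algD(4)[OF A4 \<Phi>(1,2)] \<Phi>(3) c]
      by (intro cong) (simp_all add: amul_A4 \<Phi> \<Phi>_apply w mul_car mult.commute cong: cong)
    also have "\<dots> = conv4 H (\<lambda>h k l m. omega H h k (mul H l m)) (\<lambda>h k l m. omega H (mul H h k) l m) h k l m"
      using dqb c by (simp add: dual_quasi_bialgebra_def)
    also have "\<dots> = amul \<A>\<^sub>4 (\<Phi>4 \<Omega>) (\<Phi>5 \<Omega>) h k l m"
      unfolding amul_A4[OF \<Phi>(4,5) c] by (intro cong) (simp_all add: \<Phi>_apply w mul_car)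
    finally show "amul \<A>\<^sub>4 (amul \<A>\<^sub>4 (\<Phi>1 \<Omega>) (\<Phi>2 \<Omega>)) (\<Phi>3 \<Omega>) h k l m = amul \<A>\<^sub>4 (\<Phi>4 \<Omega>) (\<Phi>5 \<Omega>) h k l m" .
  qed (intro is_algD(4)[OF A4] \<Phi>)+
  thus ?thesis by (simp add: lprod_simps is_algD[OF A4] \<Phi>)
qed

text \<open>
  A homomorphism out of the algebra of four-linear forms gives an instance of the cocycle
  condition in its target, with invertible factors.
\<close>

lemma cocycle_hom:
  assumes "alg_hom \<A>\<^sub>4 B \<Psi>"
  shows "lprod B [\<Psi> (\<Phi>1 \<Omega>), \<Psi> (\<Phi>2 \<Omega>), \<Psi> (\<Phi>3 \<Omega>)] = lprod B [\<Psi> (\<Phi>4 \<Omega>), \<Psi> (\<Phi>5 \<Omega>)]"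
    and "inverse_pair B (\<Psi> (\<Phi>1 \<Omega>)) (\<Psi> (\<Phi>1 \<Omega>'))" and "inverse_pair B (\<Psi> (\<Phi>2 \<Omega>)) (\<Psi> (\<Phi>2 \<Omega>'))"
    and "inverse_pair B (\<Psi> (\<Phi>3 \<Omega>)) (\<Psi> (\<Phi>3 \<Omega>'))" and "inverse_pair B (\<Psi> (\<Phi>4 \<Omega>)) (\<Psi> (\<Phi>4 \<Omega>'))"
    and "inverse_pair B (\<Psi> (\<Phi>5 \<Omega>)) (\<Psi> (\<Phi>5 \<Omega>'))"
proof -
  have A4: "is_alg \<A>\<^sub>4" by (intro algs)
  note \<Phi> = alg_hom_\<Phi>[THEN alg_homD(4), OF \<Omega>_car(1)]
  from arg_cong[OF cocycle_A4, of \<Psi>]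
  show "lprod B [\<Psi> (\<Phi>1 \<Omega>), \<Psi> (\<Phi>2 \<Omega>), \<Psi> (\<Phi>3 \<Omega>)] = lprod B [\<Psi> (\<Phi>4 \<Omega>), \<Psi> (\<Phi>5 \<Omega>)]"
    by (simp add: alg_hom_lprod[OF A4 assms] \<Phi>)
qed (intro alg_hom_inverse_pair[OF assms] alg_hom_inverse_pair[OF alg_hom_\<Phi>(1)]
       alg_hom_inverse_pair[OF alg_hom_\<Phi>(2)] alg_hom_inverse_pair[OF alg_hom_\<Phi>(3)]
       alg_hom_inverse_pair[OF alg_hom_\<Phi>(4)] alg_hom_inverse_pair[OF alg_hom_\<Phi>(5)] \<Omega>_inverse)+

end


section \<open>Word identities behind the tensor product\<close>

lemma lprod_rewrite:
  assumes "is_alg A" and "lprod A us = lprod A vs" and "set us \<subseteq> car A" and "set vs \<subseteq> car A"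
    and "set xs \<subseteq> car A" and "set ys \<subseteq> car A" and "zs = xs @ us @ ys" and "ws = xs @ vs @ ys"
  shows "lprod A zs = lprod A ws"
  using lprod_segment[OF assms(2,1,3-6)] assms(7,8) by simp

text \<open>
  This and the two following lemmas are the calculations behind the tensor product of
  one-dimensional modules, as rewriting of words in an algebra. In the names of the factors, \<open>o\<close> and \<open>i\<close> stand for
  \<open>\<omega>\<close> and \<open>\<omega>\<^sup>-\<^sup>1\<close>, \<open>f\<close> for a functional \<open>F\<close>, and the rest lists the arguments: \<open>o_h_ab_c\<close> is \<open>\<omega>(h, ab, c)\<close>,
  \<open>o_hab\<close> is \<open>\<omega>(h, a, b)\<close> and \<open>f_ah_b\<close> is \<open>F((ah)b)\<close>. The values of the characters of
  the modules of degree \<open>a\<close>, \<open>b\<close> and \<open>c\<close> are \<open>x\<close>, \<open>y\<close> and \<open>z\<close>.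

  Here the goal is that \<open>o_hab x i_ahb y o_abh\<close>, the character of the tensor product, moves
  past \<open>F\<close>: the factors \<open>x\<close> and \<open>y\<close> carry \<open>h\<close> past \<open>a\<close> and \<open>b\<close>, and the factors \<open>\<omega>\<close> rebracket.
\<close>

lemma tensor_twist_chain:
  assumes A: "is_alg A"
    and mem: "set [o_hab, x, i_ahb, y, o_abh, f_ab_h, f_a_bh, f_a_hb, f_ah_b, f_ha_b, f_h_ab] \<subseteq> car A"
    and Q1: "lprod A [f_a_bh, o_abh] = lprod A [o_abh, f_ab_h]"
    and T1: "lprod A [y, f_a_bh] = lprod A [f_a_hb, y]"
    and Q2: "lprod A [i_ahb, f_a_hb] = lprod A [f_ah_b, i_ahb]"
    and T2: "lprod A [x, f_ah_b] = lprod A [f_ha_b, x]"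
    and Q3: "lprod A [f_h_ab, o_hab] = lprod A [o_hab, f_ha_b]"
  shows "lprod A [o_hab, x, i_ahb, y, o_abh, f_ab_h] = lprod A [f_h_ab, o_hab, x, i_ahb, y, o_abh]"
proof -
  have car: "o_hab \<in> car A" "x \<in> car A" "i_ahb \<in> car A" "y \<in> car A" "o_abh \<in> car A" "f_ab_h \<in> car A" "f_a_bh \<in> car A" "f_a_hb \<in> car A" "f_ah_b \<in> car A" "f_ha_b \<in> car A" "f_h_ab \<in> car A"
    using mem by simp_all
  note seg = lprod_rewrite[OF A]
  have "lprod A [o_hab, x, i_ahb, y, o_abh, f_ab_h]
    = lprod A [o_hab, x, i_ahb, y, f_a_bh, o_abh]"
    by (rule seg[OF Q1[symmetric], where xs = "[o_hab, x, i_ahb, y]" and ys = "[]"]) (simp_all add: car)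
  also have "\<dots>
    = lprod A [o_hab, x, i_ahb, f_a_hb, y, o_abh]"
    by (rule seg[OF T1, where xs = "[o_hab, x, i_ahb]" and ys = "[o_abh]"]) (simp_all add: car)
  also have "\<dots>
    = lprod A [o_hab, x, f_ah_b, i_ahb, y, o_abh]"
    by (rule seg[OF Q2, where xs = "[o_hab, x]" and ys = "[y, o_abh]"]) (simp_all add: car)
  also have "\<dots>
    = lprod A [o_hab, f_ha_b, x, i_ahb, y, o_abh]"
    by (rule seg[OF T2, where xs = "[o_hab]" and ys = "[i_ahb, y, o_abh]"]) (simp_all add: car)
  also have "\<dots>
    = lprod A [f_h_ab, o_hab, x, i_ahb, y, o_abh]"
    by (rule seg[OF Q3[symmetric], where xs = "[]" and ys = "[x, i_ahb, y, o_abh]"]) (simp_all add: car)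
  finally show ?thesis .
qed
text \<open>
  The scalar \<open>s = \<omega>(a, b, c)\<close> enters on one side and leaves on the other. Its inverse is the associativity constraint between
  the two bracketings. The equations \<open>Q\<close> are
  cocycle conditions and the equations \<open>T\<close> move \<open>h\<close> past a degree.
\<close>

lemma tensor_associative_chain:
  assumes A: "is_alg A"
    and mem: "set [s, o_h_ab_c, o_hab, x, i_ahb, y, o_abh, i_ab_h_c, z, o_ab_c_h, o_h_a_bc, o_ha_b_c, o_ah_b_c, i_a_h_bc, o_hbc, o_a_hb_c, i_a_bh_c, i_bhc, o_a_b_hc, o_a_bh_c, o_a_b_ch, o_bch, o_a_bc_h] \<subseteq> car A"
    and Q1: "lprod A [s, o_h_ab_c, o_hab] = lprod A [o_h_a_bc, o_ha_b_c]"
    and T1: "lprod A [o_ha_b_c, x] = lprod A [x, o_ah_b_c]"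
    and Q2: "lprod A [o_ah_b_c, i_ahb] = lprod A [i_a_h_bc, o_hbc, o_a_hb_c]"
    and Q3: "lprod A [o_abh, i_ab_h_c] = lprod A [i_a_bh_c, i_bhc, o_a_b_hc]"
    and T2: "lprod A [o_a_hb_c, y] = lprod A [y, o_a_bh_c]"
    and I: "lprod A [o_a_bh_c, i_a_bh_c] = lprod A []"
    and T3: "lprod A [o_a_b_hc, z] = lprod A [z, o_a_b_ch]"
    and Q4: "lprod A [o_a_b_ch, o_ab_c_h] = lprod A [o_bch, o_a_bc_h, s]"
  shows "lprod A [s, o_h_ab_c, o_hab, x, i_ahb, y, o_abh, i_ab_h_c, z, o_ab_c_h]
    = lprod A [o_h_a_bc, x, i_a_h_bc, o_hbc, y, i_bhc, z, o_bch, o_a_bc_h, s]"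
proof -
  have car: "s \<in> car A" "o_h_ab_c \<in> car A" "o_hab \<in> car A" "x \<in> car A" "i_ahb \<in> car A" "y \<in> car A" "o_abh \<in> car A" "i_ab_h_c \<in> car A" "z \<in> car A" "o_ab_c_h \<in> car A" "o_h_a_bc \<in> car A" "o_ha_b_c \<in> car A" "o_ah_b_c \<in> car A" "i_a_h_bc \<in> car A" "o_hbc \<in> car A" "o_a_hb_c \<in> car A" "i_a_bh_c \<in> car A" "i_bhc \<in> car A" "o_a_b_hc \<in> car A" "o_a_bh_c \<in> car A" "o_a_b_ch \<in> car A" "o_bch \<in> car A" "o_a_bc_h \<in> car A"
    using mem by simp_all
  note seg = lprod_rewrite[OF A]
  have "lprod A [s, o_h_ab_c, o_hab, x, i_ahb, y, o_abh, i_ab_h_c, z, o_ab_c_h]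
    = lprod A [o_h_a_bc, o_ha_b_c, x, i_ahb, y, o_abh, i_ab_h_c, z, o_ab_c_h]"
    by (rule seg[OF Q1, where xs = "[]" and ys = "[x, i_ahb, y, o_abh, i_ab_h_c, z, o_ab_c_h]"]) (simp_all add: car)
  also have "\<dots>
    = lprod A [o_h_a_bc, x, o_ah_b_c, i_ahb, y, o_abh, i_ab_h_c, z, o_ab_c_h]"
    by (rule seg[OF T1, where xs = "[o_h_a_bc]" and ys = "[i_ahb, y, o_abh, i_ab_h_c, z, o_ab_c_h]"]) (simp_all add: car)
  also have "\<dots>
    = lprod A [o_h_a_bc, x, i_a_h_bc, o_hbc, o_a_hb_c, y, o_abh, i_ab_h_c, z, o_ab_c_h]"
    by (rule seg[OF Q2, where xs = "[o_h_a_bc, x]" and ys = "[y, o_abh, i_ab_h_c, z, o_ab_c_h]"]) (simp_all add: car)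
  also have "\<dots>
    = lprod A [o_h_a_bc, x, i_a_h_bc, o_hbc, o_a_hb_c, y, i_a_bh_c, i_bhc, o_a_b_hc, z, o_ab_c_h]"
    by (rule seg[OF Q3, where xs = "[o_h_a_bc, x, i_a_h_bc, o_hbc, o_a_hb_c, y]" and ys = "[z, o_ab_c_h]"]) (simp_all add: car)
  also have "\<dots>
    = lprod A [o_h_a_bc, x, i_a_h_bc, o_hbc, y, o_a_bh_c, i_a_bh_c, i_bhc, o_a_b_hc, z, o_ab_c_h]"
    by (rule seg[OF T2, where xs = "[o_h_a_bc, x, i_a_h_bc, o_hbc]" and ys = "[i_a_bh_c, i_bhc, o_a_b_hc, z, o_ab_c_h]"]) (simp_all add: car)
  also have "\<dots>
    = lprod A [o_h_a_bc, x, i_a_h_bc, o_hbc, y, i_bhc, o_a_b_hc, z, o_ab_c_h]"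
    by (rule seg[OF I, where xs = "[o_h_a_bc, x, i_a_h_bc, o_hbc, y]" and ys = "[i_bhc, o_a_b_hc, z, o_ab_c_h]"]) (simp_all add: car)
  also have "\<dots>
    = lprod A [o_h_a_bc, x, i_a_h_bc, o_hbc, y, i_bhc, z, o_a_b_ch, o_ab_c_h]"
    by (rule seg[OF T3, where xs = "[o_h_a_bc, x, i_a_h_bc, o_hbc, y, i_bhc]" and ys = "[o_ab_c_h]"]) (simp_all add: car)
  also have "\<dots>
    = lprod A [o_h_a_bc, x, i_a_h_bc, o_hbc, y, i_bhc, z, o_bch, o_a_bc_h, s]"
    by (rule seg[OF Q4, where xs = "[o_h_a_bc, x, i_a_h_bc, o_hbc, y, i_bhc, z]" and ys = "[]"]) (simp_all add: car)
  finally show ?thesis .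
qed
text \<open>
  The factors \<open>xh\<close> and \<open>xl\<close> are the character \<open>x\<close> at
  \<open>h\<close> and at \<open>l\<close>. The left side expands the character of the tensor
  product at \<open>hl\<close> through the equations for the two modules, the right side combines
  its values at \<open>h\<close> and at \<open>l\<close>. The equations \<open>R\<close> are
  cocycle conditions, one for each placement of \<open>a\<close> before \<open>b\<close> and
  \<open>h\<close> before \<open>l\<close> among four arguments, and the equations
  \<open>T\<close> move a variable past a degree.
\<close>

lemma tensor_multiplicative_chain:
  assumes A: "is_alg A"
    and mem: "set [o_hl_a_b, i_hla, xl, o_hal, xh, i_ahl, i_a_hl_b, i_hlb, yl, o_hbl, yh, i_bhl, o_a_b_hl, i_h_l_ab, o_lab, o_h_la_b, i_ah_l_b, i_a_h_lb, o_a_bh_l, o_abh, i_ab_h_l, o_h_al_b, i_ha_l_b, i_alb, o_h_a_lb, i_a_h_bl, o_a_hb_l, o_ah_b_l, i_ahb, o_h_a_bl, o_ha_b_l, o_abl, o_h_ab_l, o_hab] \<subseteq> car A"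
    and R1: "lprod A [o_hl_a_b, i_hla] = lprod A [i_h_l_ab, o_lab, o_h_la_b]"
    and R3: "lprod A [i_ahl, i_a_hl_b, i_hlb] = lprod A [i_ah_l_b, i_a_h_lb]"
    and R6: "lprod A [o_a_bh_l, o_abh, i_ab_h_l] = lprod A [i_bhl, o_a_b_hl]"
    and T1: "lprod A [o_h_la_b, xl] = lprod A [xl, o_h_al_b]"
    and T2: "lprod A [xh, i_ah_l_b] = lprod A [i_ha_l_b, xh]"
    and R2: "lprod A [o_h_al_b, o_hal, i_ha_l_b] = lprod A [i_alb, o_h_a_lb]"
    and T3: "lprod A [i_a_h_lb, yl] = lprod A [yl, i_a_h_bl]"
    and T4: "lprod A [yh, o_a_bh_l] = lprod A [o_a_hb_l, yh]"
    and R5: "lprod A [i_a_h_bl, o_hbl, o_a_hb_l] = lprod A [o_ah_b_l, i_ahb]"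
    and C: "lprod A [xh, yl] = lprod A [yl, xh]"
    and T5: "lprod A [o_h_a_lb, yl] = lprod A [yl, o_h_a_bl]"
    and T6: "lprod A [xh, o_ah_b_l] = lprod A [o_ha_b_l, xh]"
    and R4: "lprod A [o_h_a_bl, o_ha_b_l] = lprod A [o_abl, o_h_ab_l, o_hab]"
  shows "lprod A [o_hl_a_b, i_hla, xl, o_hal, xh, i_ahl, i_a_hl_b, i_hlb, yl, o_hbl, yh, i_bhl, o_a_b_hl]
    = lprod A [i_h_l_ab, o_lab, xl, i_alb, yl, o_abl, o_h_ab_l, o_hab, xh, i_ahb, yh, o_abh, i_ab_h_l]"
proof -
  have car: "o_hl_a_b \<in> car A" "i_hla \<in> car A" "xl \<in> car A" "o_hal \<in> car A" "xh \<in> car A" "i_ahl \<in> car A" "i_a_hl_b \<in> car A" "i_hlb \<in> car A" "yl \<in> car A" "o_hbl \<in> car A" "yh \<in> car A" "i_bhl \<in> car A" "o_a_b_hl \<in> car A" "i_h_l_ab \<in> car A" "o_lab \<in> car A" "o_h_la_b \<in> car A" "i_ah_l_b \<in> car A" "i_a_h_lb \<in> car A" "o_a_bh_l \<in> car A" "o_abh \<in> car A" "i_ab_h_l \<in> car A" "o_h_al_b \<in> car A" "i_ha_l_b \<in> car A" "i_alb \<in> car A" "o_h_a_lb \<in> car A" "i_a_h_bl \<in> car A" "o_a_hb_l \<in> car A" "o_ah_b_l \<in> car A" "i_ahb \<in> car A" "o_h_a_bl \<in> car A" "o_ha_b_l \<in> car A" "o_abl \<in> car A" "o_h_ab_l \<in>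 car A" "o_hab \<in> car A"
    using mem by simp_all
  note seg = lprod_rewrite[OF A]
  have "lprod A [o_hl_a_b, i_hla, xl, o_hal, xh, i_ahl, i_a_hl_b, i_hlb, yl, o_hbl, yh, i_bhl, o_a_b_hl]
    = lprod A [i_h_l_ab, o_lab, o_h_la_b, xl, o_hal, xh, i_ahl, i_a_hl_b, i_hlb, yl, o_hbl, yh, i_bhl, o_a_b_hl]"
    by (rule seg[OF R1, where xs = "[]" and ys = "[xl, o_hal, xh, i_ahl, i_a_hl_b, i_hlb, yl, o_hbl, yh, i_bhl, o_a_b_hl]"]) (simp_all add: car)
  also have "\<dots>
    = lprod A [i_h_l_ab, o_lab, o_h_la_b, xl, o_hal, xh, i_ah_l_b, i_a_h_lb, yl, o_hbl, yh, i_bhl, o_a_b_hl]"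
    by (rule seg[OF R3, where xs = "[i_h_l_ab, o_lab, o_h_la_b, xl, o_hal, xh]" and ys = "[yl, o_hbl, yh, i_bhl, o_a_b_hl]"]) (simp_all add: car)
  also have "\<dots>
    = lprod A [i_h_l_ab, o_lab, o_h_la_b, xl, o_hal, xh, i_ah_l_b, i_a_h_lb, yl, o_hbl, yh, o_a_bh_l, o_abh, i_ab_h_l]"
    by (rule seg[OF R6[symmetric], where xs = "[i_h_l_ab, o_lab, o_h_la_b, xl, o_hal, xh, i_ah_l_b, i_a_h_lb, yl, o_hbl, yh]" and ys = "[]"]) (simp_all add: car)
  also have "\<dots>
    = lprod A [i_h_l_ab, o_lab, xl, o_h_al_b, o_hal, xh, i_ah_l_b, i_a_h_lb, yl, o_hbl, yh, o_a_bh_l, o_abh, i_ab_h_l]"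
    by (rule seg[OF T1, where xs = "[i_h_l_ab, o_lab]" and ys = "[o_hal, xh, i_ah_l_b, i_a_h_lb, yl, o_hbl, yh, o_a_bh_l, o_abh, i_ab_h_l]"]) (simp_all add: car)
  also have "\<dots>
    = lprod A [i_h_l_ab, o_lab, xl, o_h_al_b, o_hal, i_ha_l_b, xh, i_a_h_lb, yl, o_hbl, yh, o_a_bh_l, o_abh, i_ab_h_l]"
    by (rule seg[OF T2, where xs = "[i_h_l_ab, o_lab, xl, o_h_al_b, o_hal]" and ys = "[i_a_h_lb, yl, o_hbl, yh, o_a_bh_l, o_abh, i_ab_h_l]"]) (simp_all add: car)
  also have "\<dots>
    = lprod A [i_h_l_ab, o_lab, xl, i_alb, o_h_a_lb, xh, i_a_h_lb, yl, o_hbl, yh, o_a_bh_l, o_abh, i_ab_h_l]"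
    by (rule seg[OF R2, where xs = "[i_h_l_ab, o_lab, xl]" and ys = "[xh, i_a_h_lb, yl, o_hbl, yh, o_a_bh_l, o_abh, i_ab_h_l]"]) (simp_all add: car)
  also have "\<dots>
    = lprod A [i_h_l_ab, o_lab, xl, i_alb, o_h_a_lb, xh, yl, i_a_h_bl, o_hbl, yh, o_a_bh_l, o_abh, i_ab_h_l]"
    by (rule seg[OF T3, where xs = "[i_h_l_ab, o_lab, xl, i_alb, o_h_a_lb, xh]" and ys = "[o_hbl, yh, o_a_bh_l, o_abh, i_ab_h_l]"]) (simp_all add: car)
  also have "\<dots>
    = lprod A [i_h_l_ab, o_lab, xl, i_alb, o_h_a_lb, xh, yl, i_a_h_bl, o_hbl, o_a_hb_l, yh, o_abh, i_ab_h_l]"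
    by (rule seg[OF T4, where xs = "[i_h_l_ab, o_lab, xl, i_alb, o_h_a_lb, xh, yl, i_a_h_bl, o_hbl]" and ys = "[o_abh, i_ab_h_l]"]) (simp_all add: car)
  also have "\<dots>
    = lprod A [i_h_l_ab, o_lab, xl, i_alb, o_h_a_lb, xh, yl, o_ah_b_l, i_ahb, yh, o_abh, i_ab_h_l]"
    by (rule seg[OF R5, where xs = "[i_h_l_ab, o_lab, xl, i_alb, o_h_a_lb, xh, yl]" and ys = "[yh, o_abh, i_ab_h_l]"]) (simp_all add: car)
  also have "\<dots>
    = lprod A [i_h_l_ab, o_lab, xl, i_alb, o_h_a_lb, yl, xh, o_ah_b_l, i_ahb, yh, o_abh, i_ab_h_l]"
    by (rule seg[OF C, where xs = "[i_h_l_ab, o_lab, xl, i_alb, o_h_a_lb]" and ys = "[o_ah_b_l, i_ahb, yh, o_abh, i_ab_h_l]"]) (simp_all add: car)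
  also have "\<dots>
    = lprod A [i_h_l_ab, o_lab, xl, i_alb, yl, o_h_a_bl, xh, o_ah_b_l, i_ahb, yh, o_abh, i_ab_h_l]"
    by (rule seg[OF T5, where xs = "[i_h_l_ab, o_lab, xl, i_alb]" and ys = "[xh, o_ah_b_l, i_ahb, yh, o_abh, i_ab_h_l]"]) (simp_all add: car)
  also have "\<dots>
    = lprod A [i_h_l_ab, o_lab, xl, i_alb, yl, o_h_a_bl, o_ha_b_l, xh, i_ahb, yh, o_abh, i_ab_h_l]"
    by (rule seg[OF T6, where xs = "[i_h_l_ab, o_lab, xl, i_alb, yl, o_h_a_bl]" and ys = "[i_ahb, yh, o_abh, i_ab_h_l]"]) (simp_all add: car)
  also have "\<dots>
    = lprod A [i_h_l_ab, o_lab, xl, i_alb, yl, o_abl, o_h_ab_l, o_hab, xh, i_ahb, yh, o_abh, i_ab_h_l]"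
    by (rule seg[OF R4, where xs = "[i_h_l_ab, o_lab, xl, i_alb, yl]" and ys = "[xh, i_ahb, yh, o_abh, i_ab_h_l]"]) (simp_all add: car)
  finally show ?thesis .
qed


context dual_quasi_bialg
begin

section \<open>The cocycle condition at grouplikes\<close>

lemma alg_hom_eval2:
  "is_alg A \<Longrightarrow> a \<in> grouplike H \<Longrightarrow> b \<in> grouplike H \<Longrightarrow> alg_hom (Conv (Conv A)) A (\<lambda>\<alpha>. \<alpha> a b)"
  by (rule alg_hom_comp[OF alg_hom_eval alg_hom_eval]) (simp_all add: is_alg_Conv)

lemma alg_hom_eval3:
  "is_alg A \<Longrightarrow> a \<in> grouplike H \<Longrightarrow> b \<in> grouplike H \<Longrightarrow> c \<in> grouplike H
    \<Longrightarrow> alg_hom (Conv (Conv (Conv A))) A (\<lambda>\<alpha>. \<alpha> a b c)"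
  by (rule alg_hom_comp[OF alg_hom_eval2 alg_hom_eval]) (simp_all add: is_alg_Conv)

lemma alg_hom_cmap_eval:
  "is_alg A \<Longrightarrow> is_alg B \<Longrightarrow> a \<in> grouplike H \<Longrightarrow> alg_hom A B f \<Longrightarrow> alg_hom (Conv A) B (\<lambda>\<alpha>. f (\<alpha> a))"
  by (rule alg_hom_comp[OF _ alg_hom_eval])

lemma alg_hom_cmap_eval2:
  "is_alg A \<Longrightarrow> is_alg B \<Longrightarrow> a \<in> grouplike H \<Longrightarrow> b \<in> grouplike H \<Longrightarrow> alg_hom A B f
    \<Longrightarrow> alg_hom (Conv (Conv A)) B (\<lambda>\<alpha>. f (\<alpha> a b))"
  by (rule alg_hom_comp[OF _ alg_hom_eval2])

lemmas ev = alg_hom_eval3 alg_hom_eval2 alg_hom_eval alg_hom_cmap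

text \<open>
  In this family of lemmas the name lists the four arguments of the cocycle condition: grouplikes
  \<open>a\<close>, \<open>b\<close>, \<open>c\<close> are substituted at their positions and
  \<open>h\<close>, \<open>l\<close> remain variables. The form \<open>f\<close> is arbitrary so
  that the same equations serve \<open>\<omega>\<close> and
  \<open>\<omega>\<^sup>-\<^sup>1\<close>.
\<close>

lemma cocycle_hlab:
  assumes grp: "a \<in> grouplike H" "b \<in> grouplike H"
  defines "\<Psi> \<equiv> cmap (cmap (\<lambda>\<alpha>. \<alpha> a b))"
  shows "alg_hom \<A>\<^sub>4 \<A>\<^sub>2 \<Psi>"
    and "\<Psi> (\<Phi>1 (E3 f)) = E2 (\<lambda>h l. counit H h * f l a b)"
    and "\<Psi> (\<Phi>2 (E3 f)) = E2 (\<lambda>h l. f h (mul H l a) b)"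
    and "\<Psi> (\<Phi>3 (E3 f)) = E2 (\<lambda>h l. f h l a)"
    and "\<Psi> (\<Phi>4 (E3 f)) = E2 (\<lambda>h l. f h l (mul H a b))"
    and "\<Psi> (\<Phi>5 (E3 f)) = E2 (\<lambda>h l. f (mul H h l) a b)"
proof -
  show "alg_hom \<A>\<^sub>4 \<A>\<^sub>2 \<Psi>"
    unfolding \<Psi>_def by (intro ev alg_hom_cmap_eval2 alg_hom_cmap_eval algs grp)
qed (use grp in \<open>auto simp: grouplike_def \<Psi>_def fun_eq_iff E3_def E2_def E1_def mul_car \<Phi>1_def \<Phi>2_def \<Phi>3_def \<Phi>4_def \<Phi>5_def
      cinc_def cmap_def cmu_def Conv_simps(2)\<close>)

lemma cocycle_halb:
  assumes grp: "a \<in> grouplike H" "b \<in> grouplike H"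
  defines "\<Psi> \<equiv> cmap (\<lambda>\<alpha>. cmap (\<lambda>\<alpha>. \<alpha> b) (\<alpha> a))"
  shows "alg_hom \<A>\<^sub>4 \<A>\<^sub>2 \<Psi>"
    and "\<Psi> (\<Phi>1 (E3 f)) = E2 (\<lambda>h l. counit H h * f a l b)"
    and "\<Psi> (\<Phi>2 (E3 f)) = E2 (\<lambda>h l. f h (mul H a l) b)"
    and "\<Psi> (\<Phi>3 (E3 f)) = E2 (\<lambda>h l. f h a l)"
    and "\<Psi> (\<Phi>4 (E3 f)) = E2 (\<lambda>h l. f h a (mul H l b))"
    and "\<Psi> (\<Phi>5 (E3 f)) = E2 (\<lambda>h l. f (mul H h a) l b)"
proof -
  show "alg_hom \<A>\<^sub>4 \<A>\<^sub>2 \<Psi>"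
    unfolding \<Psi>_def by (intro ev alg_hom_cmap_eval2 alg_hom_cmap_eval algs grp)
qed (use grp in \<open>auto simp: grouplike_def \<Psi>_def fun_eq_iff E3_def E2_def E1_def mul_car \<Phi>1_def \<Phi>2_def \<Phi>3_def \<Phi>4_def \<Phi>5_def
      cinc_def cmap_def cmu_def Conv_simps(2)\<close>)

lemma cocycle_habl:
  assumes grp: "a \<in> grouplike H" "b \<in> grouplike H"
  defines "\<Psi> \<equiv> cmap (\<lambda>\<alpha>. \<alpha> a b)"
  shows "alg_hom \<A>\<^sub>4 \<A>\<^sub>2 \<Psi>"
    and "\<Psi> (\<Phi>1 (E3 f)) = E2 (\<lambda>h l. counit H h * f a b l)"
    and "\<Psi> (\<Phi>2 (E3 f)) = E2 (\<lambda>h l. f h (mul H a b) l)"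
    and "\<Psi> (\<Phi>3 (E3 f)) = E2 (\<lambda>h l. counit H l * f h a b)"
    and "\<Psi> (\<Phi>4 (E3 f)) = E2 (\<lambda>h l. f h a (mul H b l))"
    and "\<Psi> (\<Phi>5 (E3 f)) = E2 (\<lambda>h l. f (mul H h a) b l)"
proof -
  show "alg_hom \<A>\<^sub>4 \<A>\<^sub>2 \<Psi>"
    unfolding \<Psi>_def by (intro ev alg_hom_cmap_eval2 alg_hom_cmap_eval algs grp)
qed (use grp in \<open>auto simp: grouplike_def \<Psi>_def fun_eq_iff E3_def E2_def E1_def mul_car \<Phi>1_def \<Phi>2_def \<Phi>3_def \<Phi>4_def \<Phi>5_def
      cinc_def cmap_def cmu_def Conv_simps(2)\<close>)

lemma cocycle_ahlb:
  assumes grp: "a \<in> grouplike H" "b \<in> grouplike H"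
  defines "\<Psi> \<equiv> (\<lambda>\<alpha>. cmap (cmap (\<lambda>\<alpha>. \<alpha> b)) (\<alpha> a))"
  shows "alg_hom \<A>\<^sub>4 \<A>\<^sub>2 \<Psi>"
    and "\<Psi> (\<Phi>1 (E3 f)) = E2 (\<lambda>h l. f h l b)"
    and "\<Psi> (\<Phi>2 (E3 f)) = E2 (\<lambda>h l. f a (mul H h l) b)"
    and "\<Psi> (\<Phi>3 (E3 f)) = E2 (\<lambda>h l. f a h l)"
    and "\<Psi> (\<Phi>4 (E3 f)) = E2 (\<lambda>h l. f a h (mul H l b))"
    and "\<Psi> (\<Phi>5 (E3 f)) = E2 (\<lambda>h l. f (mul H a h) l b)"
proof -
  show "alg_hom \<A>\<^sub>4 \<A>\<^sub>2 \<Psi>"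
    unfolding \<Psi>_def by (intro ev alg_hom_cmap_eval2 alg_hom_cmap_eval algs grp)
qed (use grp in \<open>auto simp: grouplike_def \<Psi>_def fun_eq_iff E3_def E2_def E1_def mul_car \<Phi>1_def \<Phi>2_def \<Phi>3_def \<Phi>4_def \<Phi>5_def
      cinc_def cmap_def cmu_def Conv_simps(2)\<close>)

lemma cocycle_ahbl:
  assumes grp: "a \<in> grouplike H" "b \<in> grouplike H"
  defines "\<Psi> \<equiv> (\<lambda>\<alpha>. cmap (\<lambda>\<alpha>. \<alpha> b) (\<alpha> a))"
  shows "alg_hom \<A>\<^sub>4 \<A>\<^sub>2 \<Psi>"
    and "\<Psi> (\<Phi>1 (E3 f)) = E2 (\<lambda>h l. f h b l)"
    and "\<Psi> (\<Phi>2 (E3 f)) = E2 (\<lambda>h l. f a (mul H h b) l)"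
    and "\<Psi> (\<Phi>3 (E3 f)) = E2 (\<lambda>h l. counit H l * f a h b)"
    and "\<Psi> (\<Phi>4 (E3 f)) = E2 (\<lambda>h l. f a h (mul H b l))"
    and "\<Psi> (\<Phi>5 (E3 f)) = E2 (\<lambda>h l. f (mul H a h) b l)"
proof -
  show "alg_hom \<A>\<^sub>4 \<A>\<^sub>2 \<Psi>"
    unfolding \<Psi>_def by (intro ev alg_hom_cmap_eval2 alg_hom_cmap_eval algs grp)
qed (use grp in \<open>auto simp: grouplike_def \<Psi>_def fun_eq_iff E3_def E2_def E1_def mul_car \<Phi>1_def \<Phi>2_def \<Phi>3_def \<Phi>4_def \<Phi>5_def
      cinc_def cmap_def cmu_def Conv_simps(2)\<close>)

lemma cocycle_abhl:
  assumes grp: "a \<in> grouplike H" "b \<in> grouplike H"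
  defines "\<Psi> \<equiv> (\<lambda>\<alpha>. \<alpha> a b)"
  shows "alg_hom \<A>\<^sub>4 \<A>\<^sub>2 \<Psi>"
    and "\<Psi> (\<Phi>1 (E3 f)) = E2 (\<lambda>h l. f b h l)"
    and "\<Psi> (\<Phi>2 (E3 f)) = E2 (\<lambda>h l. f a (mul H b h) l)"
    and "\<Psi> (\<Phi>3 (E3 f)) = E2 (\<lambda>h l. counit H l * f a b h)"
    and "\<Psi> (\<Phi>4 (E3 f)) = E2 (\<lambda>h l. f a b (mul H h l))"
    and "\<Psi> (\<Phi>5 (E3 f)) = E2 (\<lambda>h l. f (mul H a b) h l)"
proof -
  show "alg_hom \<A>\<^sub>4 \<A>\<^sub>2 \<Psi>"
    unfolding \<Psi>_def by (intro ev alg_hom_cmap_eval2 alg_hom_cmap_eval algs grp)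
qed (use grp in \<open>auto simp: grouplike_def \<Psi>_def fun_eq_iff E3_def E2_def E1_def mul_car \<Phi>1_def \<Phi>2_def \<Phi>3_def \<Phi>4_def \<Phi>5_def
      cinc_def cmap_def cmu_def Conv_simps(2)\<close>)

lemma cocycle_habc:
  assumes grp: "a \<in> grouplike H" "b \<in> grouplike H" "c \<in> grouplike H"
  defines "\<Psi> \<equiv> cmap (\<lambda>\<alpha>. \<alpha> a b c)"
  shows "alg_hom \<A>\<^sub>4 \<A>\<^sub>1 \<Psi>"
    and "\<Psi> (\<Phi>1 (E3 f)) = E1 (\<lambda>h. counit H h * f a b c)"
    and "\<Psi> (\<Phi>2 (E3 f)) = E1 (\<lambda>h. f h (mul H a b) c)"
    and "\<Psi> (\<Phi>3 (E3 f)) = E1 (\<lambda>h. f h a b)"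
    and "\<Psi> (\<Phi>4 (E3 f)) = E1 (\<lambda>h. f h a (mul H b c))"
    and "\<Psi> (\<Phi>5 (E3 f)) = E1 (\<lambda>h. f (mul H h a) b c)"
proof -
  show "alg_hom \<A>\<^sub>4 \<A>\<^sub>1 \<Psi>"
    unfolding \<Psi>_def by (intro ev alg_hom_cmap_eval2 alg_hom_cmap_eval algs grp)
qed (use grp in \<open>auto simp: grouplike_def \<Psi>_def fun_eq_iff E3_def E2_def E1_def mul_car \<Phi>1_def \<Phi>2_def \<Phi>3_def \<Phi>4_def \<Phi>5_def
      cinc_def cmap_def cmu_def Conv_simps(2)\<close>)

lemma cocycle_ahbc:
  assumes grp: "a \<in> grouplike H" "b \<in> grouplike H" "c \<in> grouplike H"
  defines "\<Psi> \<equiv> (\<lambda>\<alpha>. cmap (\<lambda>\<alpha>. \<alpha> b c) (\<alpha> a))"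
  shows "alg_hom \<A>\<^sub>4 \<A>\<^sub>1 \<Psi>"
    and "\<Psi> (\<Phi>1 (E3 f)) = E1 (\<lambda>h. f h b c)"
    and "\<Psi> (\<Phi>2 (E3 f)) = E1 (\<lambda>h. f a (mul H h b) c)"
    and "\<Psi> (\<Phi>3 (E3 f)) = E1 (\<lambda>h. f a h b)"
    and "\<Psi> (\<Phi>4 (E3 f)) = E1 (\<lambda>h. f a h (mul H b c))"
    and "\<Psi> (\<Phi>5 (E3 f)) = E1 (\<lambda>h. f (mul H a h) b c)"
proof -
  show "alg_hom \<A>\<^sub>4 \<A>\<^sub>1 \<Psi>"
    unfolding \<Psi>_def by (intro ev alg_hom_cmap_eval2 alg_hom_cmap_eval algs grp)
qed (use grp in \<open>auto simp: grouplike_def \<Psi>_def fun_eq_iff E3_def E2_def E1_def mul_car \<Phi>1_def \<Phi>2_def \<Phi>3_def \<Phi>4_def \<Phi>5_def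
      cinc_def cmap_def cmu_def Conv_simps(2)\<close>)

lemma cocycle_abhc:
  assumes grp: "a \<in> grouplike H" "b \<in> grouplike H" "c \<in> grouplike H"
  defines "\<Psi> \<equiv> (\<lambda>\<alpha>. cmap (\<lambda>\<alpha>. \<alpha> c) (\<alpha> a b))"
  shows "alg_hom \<A>\<^sub>4 \<A>\<^sub>1 \<Psi>"
    and "\<Psi> (\<Phi>1 (E3 f)) = E1 (\<lambda>h. f b h c)"
    and "\<Psi> (\<Phi>2 (E3 f)) = E1 (\<lambda>h. f a (mul H b h) c)"
    and "\<Psi> (\<Phi>3 (E3 f)) = E1 (\<lambda>h. f a b h)"
    and "\<Psi> (\<Phi>4 (E3 f)) = E1 (\<lambda>h. f a b (mul H h c))"
    and "\<Psi> (\<Phi>5 (E3 f)) = E1 (\<lambda>h. f (mul H a b) h c)"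
proof -
  show "alg_hom \<A>\<^sub>4 \<A>\<^sub>1 \<Psi>"
    unfolding \<Psi>_def by (intro ev alg_hom_cmap_eval2 alg_hom_cmap_eval algs grp)
qed (use grp in \<open>auto simp: grouplike_def \<Psi>_def fun_eq_iff E3_def E2_def E1_def mul_car \<Phi>1_def \<Phi>2_def \<Phi>3_def \<Phi>4_def \<Phi>5_def
      cinc_def cmap_def cmu_def Conv_simps(2)\<close>)

lemma cocycle_abch:
  assumes grp: "a \<in> grouplike H" "b \<in> grouplike H" "c \<in> grouplike H"
  defines "\<Psi> \<equiv> (\<lambda>\<alpha>. \<alpha> a b c)"
  shows "alg_hom \<A>\<^sub>4 \<A>\<^sub>1 \<Psi>"
    and "\<Psi> (\<Phi>1 (E3 f)) = E1 (\<lambda>h. f b c h)"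
    and "\<Psi> (\<Phi>2 (E3 f)) = E1 (\<lambda>h. f a (mul H b c) h)"
    and "\<Psi> (\<Phi>3 (E3 f)) = E1 (\<lambda>h. counit H h * f a b c)"
    and "\<Psi> (\<Phi>4 (E3 f)) = E1 (\<lambda>h. f a b (mul H c h))"
    and "\<Psi> (\<Phi>5 (E3 f)) = E1 (\<lambda>h. f (mul H a b) c h)"
proof -
  show "alg_hom \<A>\<^sub>4 \<A>\<^sub>1 \<Psi>"
    unfolding \<Psi>_def by (intro ev alg_hom_cmap_eval2 alg_hom_cmap_eval algs grp)
qed (use grp in \<open>auto simp: grouplike_def \<Psi>_def fun_eq_iff E3_def E2_def E1_def mul_car \<Phi>1_def \<Phi>2_def \<Phi>3_def \<Phi>4_def \<Phi>5_def
      cinc_def cmap_def cmu_def Conv_simps(2)\<close>)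

section \<open>One-dimensional Yetter-Drinfeld modules\<close>

lemma A1_alg: "is_alg \<A>\<^sub>1" and A2_alg: "is_alg \<A>\<^sub>2"
  by (intro algs)+

lemma bilin_omegas:
  assumes "trilin_form H f" "a \<in> car H"
  shows "bilin_map H H ground (\<lambda>h l. f h l a)" "bilin_map H H ground (\<lambda>h l. f h a l)"
    "bilin_map H H ground (\<lambda>h l. f a h l)"
  by (intro bilin_mapI trilin_formD[OF assms(1)] lin_id assms; assumption)+

lemma bilin_tensors:
  assumes "lin_map H ground f"
  shows "bilin_map H H ground (\<lambda>h l. counit H h * f l)" "bilin_map H H ground (\<lambda>h l. counit H l * f h)"
  by (intro bilin_mapI lin_mulL lin_mulR lin_counit assms)+

lemma amul_E2:
  assumes "bilin_map H H ground f" "bilin_map H H ground f'" "h \<in> car H" "l \<in> car H"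
  shows "amul \<A>\<^sub>2 (E2 f) (E2 f') h l = cop2 H h (\<lambda>h1 h2. cop2 H l (\<lambda>l1 l2. f h1 l1 * f' h2 l2))"
  unfolding amul_A2[OF E2_car[OF assms(1)] E2_car[OF assms(2)] assms(3,4)]
  by (intro cop2_cong) (simp add: E2_def)

lemma amul_E1:
  assumes "h \<in> car H"
  shows "amul \<A>\<^sub>1 (E1 f) (E1 f') h = cop2 H h (\<lambda>h1 h2. f h1 * f' h2)"
  using assms by (simp add: Conv_simps(3) E1_def cong: cop2_cong)

lemma A2_eqI:
  assumes "\<alpha> \<in> car \<A>\<^sub>2" "\<beta> \<in> car \<A>\<^sub>2"
    "\<And>h l. h \<in> car H \<Longrightarrow> l \<in> car H \<Longrightarrow> \<alpha> h l = \<beta> h l"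
  shows "\<alpha> = \<beta>"
  using assms by (intro Conv_eqI[of _ \<A>\<^sub>1] Conv_eqI[of _ base_alg]) (auto dest: ConvD(2))

lemma lprod2: "is_alg A \<Longrightarrow> x \<in> car A \<Longrightarrow> y \<in> car A \<Longrightarrow> lprod A [x, y] = amul A x y"
  by (simp add: lprod_simps is_algD)

text \<open>
  The counit absorbs the variable on which one of the factors does not depend, so only the
  convolution in the other variable remains.
\<close>

lemma amul_tensor:
  assumes f: "lin_map H ground f" and F: "bilin_map H H ground F" and h: "h \<in> car H" and l: "l \<in> car H"
  shows "amul \<A>\<^sub>2 (E2 (\<lambda>h l. counit H h * f l)) (E2 F) h l = cop2 H l (\<lambda>l1 l2. f l1 * F h l2)"
    and "amul \<A>\<^sub>2 (E2 F) (E2 (\<lambda>h l. counit H h * f l)) h l = cop2 H l (\<lambda>l1 l2. F h l1 * f l2)"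
    and "amul \<A>\<^sub>2 (E2 (\<lambda>h l. counit H l * f h)) (E2 F) h l = cop2 H h (\<lambda>h1 h2. f h1 * F h2 l)"
    and "amul \<A>\<^sub>2 (E2 F) (E2 (\<lambda>h l. counit H l * f h)) h l = cop2 H h (\<lambda>h1 h2. F h1 l * f h2)"
proof -
  note g = is_vspace_ground
  note lF = lin_bilin1[OF F] lin_bilin2[OF F]
  have bl: "bilin_map H H ground (\<lambda>l1 l2. f l1 * F h2 l2)" "bilin_map H H ground (\<lambda>l1 l2. F h2 l1 * f l2)"
    if "h2 \<in> car H" for h2
    using that by (intro bilin_mapI lin_mulL lin_mulR f lF; assumption)+
  have blh: "bilin_map H H ground (\<lambda>l1 l2. f l1 * F l2 h2)" "bilin_map H H ground (\<lambda>l1 l2. F l1 h2 * f l2)"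
    if "h2 \<in> car H" for h2
    using that by (intro bilin_mapI lin_mulL lin_mulR f lF; assumption)+
  have lc: "lin_map H ground (\<lambda>h2. cop2 H l (\<lambda>l1 l2. f l1 * F h2 l2))"
    "lin_map H ground (\<lambda>h2. cop2 H l (\<lambda>l1 l2. F h2 l1 * f l2))"
    by (intro lin_cop2_body g C_vspace l bl lin_mulL lin_mulR lF; assumption)+
  have "amul \<A>\<^sub>2 (E2 (\<lambda>h l. counit H h * f l)) (E2 F) h l
    = cop2 H h (\<lambda>h1 h2. counit H h1 * cop2 H l (\<lambda>l1 l2. f l1 * F h2 l2))"
    unfolding amul_E2[OF bilin_tensors(1)[OF f] F h l]
    using cop2_map[OF lin_mulR[OF lin_id] g g bl(1) l] by (intro cop2_cong) (simp add: mult.assoc)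
  thus "amul \<A>\<^sub>2 (E2 (\<lambda>h l. counit H h * f l)) (E2 F) h l = cop2 H l (\<lambda>l1 l2. f l1 * F h l2)"
    using cop2_counitL[OF g lc(1) h] by simp
  have "amul \<A>\<^sub>2 (E2 F) (E2 (\<lambda>h l. counit H h * f l)) h l
    = cop2 H h (\<lambda>h1 h2. counit H h2 * cop2 H l (\<lambda>l1 l2. F h1 l1 * f l2))"
    unfolding amul_E2[OF F bilin_tensors(1)[OF f] h l]
    using cop2_map[OF lin_mulR[OF lin_id] g g bl(2) l] by (intro cop2_cong) (simp add: mult.left_commute)
  thus "amul \<A>\<^sub>2 (E2 F) (E2 (\<lambda>h l. counit H h * f l)) h l = cop2 H l (\<lambda>l1 l2. F h l1 * f l2)"
    using cop2_counitR[OF g lc(2) h] by simp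
  have "cop2 H l (\<lambda>l1 l2. (counit H l1 * f h1) * F h2 l2) = f h1 * F h2 l"
    if "h1 \<in> car H" "h2 \<in> car H" for h1 h2
    using cop2_counitL[OF g lin_mulR[OF lF(1), of h2 "f h1"] l] that by (simp add: mult.assoc)
  thus "amul \<A>\<^sub>2 (E2 (\<lambda>h l. counit H l * f h)) (E2 F) h l = cop2 H h (\<lambda>h1 h2. f h1 * F h2 l)"
    unfolding amul_E2[OF bilin_tensors(2)[OF f] F h l] by (intro cop2_cong)
  have "cop2 H l (\<lambda>l1 l2. F h1 l1 * (counit H l2 * f h2)) = F h1 l * f h2"
    if "h1 \<in> car H" "h2 \<in> car H" for h1 h2
    using cop2_counitR[OF g lin_mulR[OF lF(1), of h1 "f h2"] l] that by (simp add: mult_ac)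
  thus "amul \<A>\<^sub>2 (E2 F) (E2 (\<lambda>h l. counit H l * f h)) h l = cop2 H h (\<lambda>h1 h2. F h1 l * f h2)"
    unfolding amul_E2[OF F bilin_tensors(2)[OF f] h l] by (intro cop2_cong)
qed

text \<open>
  The one-dimensional Yetter-Drinfeld modules: degree \<open>g\<close> and action through \<open>\<chi>\<close>. The unit
  axiom \<open>\<chi>(1) = 1\<close> is kept apart (\<open>chi_one\<close>). The first equation is the quasi-module axiom, as an equation between
  forms in two variables. The second is the compatibility of action and coaction, paired with an
  arbitrary functional \<open>F\<close>, which keeps it inside the convolution algebras.
\<close>

definition yd_character :: "'h \<Rightarrow> ('h \<Rightarrow> 'k) \<Rightarrow> bool" where
  "yd_character g \<chi> \<longleftrightarrow> g \<in> grouplike H \<and> lin_map H ground \<chi>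
    \<and> cmu (E1 \<chi>) = lprod \<A>\<^sub>2 [E2 (\<lambda>h l. omega_inv H h l g), E2 (\<lambda>h l. counit H h * \<chi> l),
        E2 (\<lambda>h l. omega H h g l), E2 (\<lambda>h l. counit H l * \<chi> h), E2 (\<lambda>h l. omega_inv H g h l)]
    \<and> (\<forall>F h. lin_map H ground F \<longrightarrow> h \<in> car H \<longrightarrow>
        cop2 H h (\<lambda>a b. \<chi> a * F (mul H g b)) = cop2 H h (\<lambda>a b. F (mul H a g) * \<chi> b))"

lemma yd_characterD:
  assumes "yd_character g \<chi>"
  shows "g \<in> grouplike H" "lin_map H ground \<chi>" "g \<in> car H"
    and "cmu (E1 \<chi>) = lprod \<A>\<^sub>2 [E2 (\<lambda>h l. omega_inv H h l g), E2 (\<lambda>h l. counit H h * \<chi> l),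
        E2 (\<lambda>h l. omega H h g l), E2 (\<lambda>h l. counit H l * \<chi> h), E2 (\<lambda>h l. omega_inv H g h l)]"
    and "lin_map H ground F \<Longrightarrow> h \<in> car H \<Longrightarrow>
        cop2 H h (\<lambda>a b. \<chi> a * F (mul H g b)) = cop2 H h (\<lambda>a b. F (mul H a g) * \<chi> b)"
  using assms by (auto simp: yd_character_def grouplike_def)

lemma bilin_shift:
  assumes "bilin_map H H ground f" "g \<in> car H"
  shows "bilin_map H H ground (\<lambda>h l. f h (mul H g l))" "bilin_map H H ground (\<lambda>h l. f h (mul H l g))"
    "bilin_map H H ground (\<lambda>h l. f (mul H g h) l)" "bilin_map H H ground (\<lambda>h l. f (mul H h g) l)"
  by (intro bilin_mapI lin_comp[OF lin_bilin1[OF assms(1)]] lin_comp[OF lin_bilin2[OF assms(1)]]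
      lin_mul1 lin_mul2 lin_id assms(2) mul_car; (assumption | rule assms(2)))+

text \<open>
  The compatibility of action and coaction lets \<open>\<chi>\<close> carry the variable of a
  functional past \<open>g\<close>.
\<close>

lemma yd_character_twist1:
  assumes "yd_character g \<chi>" "lin_map H ground F"
  shows "lprod \<A>\<^sub>1 [E1 \<chi>, E1 (\<lambda>h. F (mul H g h))] = lprod \<A>\<^sub>1 [E1 (\<lambda>h. F (mul H h g)), E1 \<chi>]"
proof -
  note d = yd_characterD[OF assms(1)]
  have c: "E1 \<chi> \<in> car \<A>\<^sub>1" "E1 (\<lambda>h. F (mul H g h)) \<in> car \<A>\<^sub>1" "E1 (\<lambda>h. F (mul H h g)) \<in> car \<A>\<^sub>1"
    by (intro E1_car d lin_comp[OF assms(2)] lin_mul1 lin_mul2 lin_id)+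
  show ?thesis
    unfolding lprod2[OF A1_alg c(1,2)] lprod2[OF A1_alg c(3,1)]
    by (rule Conv_eqI[of _ base_alg])
       (simp_all add: c is_algD(4)[OF A1_alg] amul_E1 d(5)[OF assms(2)])
qed

lemma yd_character_twist2:
  assumes "yd_character g \<chi>" "bilin_map H H ground f"
  shows "lprod \<A>\<^sub>2 [E2 (\<lambda>h l. counit H h * \<chi> l), E2 (\<lambda>h l. f h (mul H g l))]
      = lprod \<A>\<^sub>2 [E2 (\<lambda>h l. f h (mul H l g)), E2 (\<lambda>h l. counit H h * \<chi> l)]"
    and "lprod \<A>\<^sub>2 [E2 (\<lambda>h l. counit H l * \<chi> h), E2 (\<lambda>h l. f (mul H g h) l)]
      = lprod \<A>\<^sub>2 [E2 (\<lambda>h l. f (mul H h g) l), E2 (\<lambda>h l. counit H l * \<chi> h)]"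
proof -
  note d = yd_characterD[OF assms(1)]
  note b = bilin_tensors[OF d(2)] and s = bilin_shift[OF assms(2) d(3)]
  note c = E2_car[OF b(1)] E2_car[OF b(2)] s[THEN E2_car]
  show "lprod \<A>\<^sub>2 [E2 (\<lambda>h l. counit H h * \<chi> l), E2 (\<lambda>h l. f h (mul H g l))]
      = lprod \<A>\<^sub>2 [E2 (\<lambda>h l. f h (mul H l g)), E2 (\<lambda>h l. counit H h * \<chi> l)]"
    unfolding lprod2[OF A2_alg c(1,3)] lprod2[OF A2_alg c(4,1)]
    by (rule A2_eqI) (simp_all add: c is_algD(4)[OF A2_alg] amul_tensor(1)[OF d(2) s(1)]
        amul_tensor(2)[OF d(2) s(2)] d(5)[OF lin_bilin1[OF assms(2)]])
  show "lprod \<A>\<^sub>2 [E2 (\<lambda>h l. counit H l * \<chi> h), E2 (\<lambda>h l. f (mul H g h) l)]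
      = lprod \<A>\<^sub>2 [E2 (\<lambda>h l. f (mul H h g) l), E2 (\<lambda>h l. counit H l * \<chi> h)]"
    unfolding lprod2[OF A2_alg c(2,5)] lprod2[OF A2_alg c(6,2)]
    by (rule A2_eqI) (simp_all add: c is_algD(4)[OF A2_alg] amul_tensor(3)[OF d(2) s(3)]
        amul_tensor(4)[OF d(2) s(4)] d(5)[OF lin_bilin2[OF assms(2)]])
qed

text \<open>The two forms live on different tensor factors of \<open>H \<otimes> H\<close>.\<close>

lemma tensor_commute:
  assumes "lin_map H ground f" "lin_map H ground f'"
  shows "lprod \<A>\<^sub>2 [E2 (\<lambda>h l. counit H l * f h), E2 (\<lambda>h l. counit H h * f' l)]
    = lprod \<A>\<^sub>2 [E2 (\<lambda>h l. counit H h * f' l), E2 (\<lambda>h l. counit H l * f h)]"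
proof -
  note b = bilin_tensors(2)[OF assms(1)] bilin_tensors(1)[OF assms(2)]
  note c = E2_car[OF b(1)] E2_car[OF b(2)]
  have "cop2 H l (\<lambda>l1 l2. f' l1 * (counit H l2 * f h)) = f' l * f h" if "l \<in> car H" for h l
    using cop2_counitR[OF is_vspace_ground lin_mulL[OF assms(2), of "f h"] that] by (simp add: mult_ac)
  moreover have "cop2 H l (\<lambda>l1 l2. counit H l1 * f h * f' l2) = f' l * f h" if "l \<in> car H" for h l
    using cop2_counitL[OF is_vspace_ground lin_mulL[OF assms(2), of "f h"] that] by (simp add: mult_ac)
  ultimately show ?thesis
    unfolding lprod2[OF A2_alg c(1,2)] lprod2[OF A2_alg c(2,1)]
    by (intro A2_eqI) (simp_all add: c is_algD(4)[OF A2_alg] amul_tensor(1)[OF assms(2) b(1)]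
        amul_tensor(2)[OF assms(2) b(1)])
qed

lemma tensor_embeddings:
  "alg_hom \<A>\<^sub>1 \<A>\<^sub>2 (cinc \<A>\<^sub>1)" "alg_hom \<A>\<^sub>1 \<A>\<^sub>2 (cmap (cinc base_alg))"
  "cinc \<A>\<^sub>1 (E1 f) = E2 (\<lambda>h l. counit H h * f l)"
  "cmap (cinc base_alg) (E1 f) = E2 (\<lambda>h l. counit H l * f h)"
  "cmu (E1 f) = E2 (\<lambda>h l. f (mul H h l))"
  by (intro alg_hom_cinc alg_hom_cmap algs)+
     (auto simp: fun_eq_iff cinc_def cmap_def cmu_def E1_def E2_def Conv_simps(2) mul_car)

lemma inverse_pairD: "inverse_pair A x y \<Longrightarrow> x \<in> car A" "inverse_pair A x y \<Longrightarrow> y \<in> car A"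
  by (simp_all add: inverse_pair_def)

text \<open>
  Quasi-associativity of the multiplication of \<open>H\<close> takes values in \<open>H\<close>.
  Composing it with a functional turns it into a commutation rule for \<open>\<omega>\<close> in
  the algebra of trilinear forms.
\<close>

lemma quasi_assoc_A3:
  assumes F: "lin_map H ground F"
  shows "lprod \<A>\<^sub>3 [cmap cmu (cmu (E1 F)), \<Omega>] = lprod \<A>\<^sub>3 [\<Omega>, cmu (cmu (E1 F))]"
proof -
  have A3: "is_alg \<A>\<^sub>3" by (intro algs)
  note g = is_vspace_ground
  have c: "cmap cmu (cmu (E1 F)) \<in> car \<A>\<^sub>3" "cmu (cmu (E1 F)) \<in> car \<A>\<^sub>3" "\<Omega> \<in> car \<A>\<^sub>3"
    by (intro alg_homD(4)[OF alg_hom_cmap[OF A1_alg A2_alg alg_hom_cmu[OF is_alg_base_alg]]]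
        alg_homD(4)[OF alg_hom_cmu] algs E1_car F \<Omega>_car)+
  have lin: "lin_map V ground (\<lambda>v. F (f v))" if "lin_map V H f" for V f
    by (rule lin_comp[OF F that])
  have F_cop: "F (cop2 H h (\<lambda>h1 h2. cop2 H k (\<lambda>k1 k2. cop2 H l (\<lambda>l1 l2. T h1 h2 k1 k2 l1 l2))))
      = cop2 H h (\<lambda>h1 h2. cop2 H k (\<lambda>k1 k2. cop2 H l (\<lambda>l1 l2. F (T h1 h2 k1 k2 l1 l2))))"
    if car: "h \<in> car H" "k \<in> car H" "l \<in> car H"
      and b1: "\<And>h1 h2 k1 k2. h1 \<in> car H \<Longrightarrow> h2 \<in> car H \<Longrightarrow> k1 \<in> car H \<Longrightarrow> k2 \<in> car H \<Longrightarrow> bilin_map H H H (T h1 h2 k1 k2)"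
      and b2: "\<And>h1 h2. h1 \<in> car H \<Longrightarrow> h2 \<in> car H \<Longrightarrow> bilin_map H H H (\<lambda>k1 k2. cop2 H l (\<lambda>l1 l2. T h1 h2 k1 k2 l1 l2))"
      and b3: "bilin_map H H H (\<lambda>h1 h2. cop2 H k (\<lambda>k1 k2. cop2 H l (\<lambda>l1 l2. T h1 h2 k1 k2 l1 l2)))"
    for h k l T
    unfolding cop2_map[OF F C_vspace g b3 car(1)]
    by (intro cop2_cong) (simp add: cop2_map[OF F C_vspace g b2 car(2)] cop2_map[OF F C_vspace g b1 car(3)] cong: cop2_cong)
  note rules = bilin_mapI lin_cop2_body lin_scl lin_sclL lin_mul1 lin_mul2 mul_car lin_omega lin_id C_vspace
  have "amul \<A>\<^sub>3 (cmap cmu (cmu (E1 F))) \<Omega> h k l = amul \<A>\<^sub>3 \<Omega> (cmu (cmu (E1 F))) h k l"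
    if car: "h \<in> car H" "k \<in> car H" "l \<in> car H" for h k l
  proof -
    have "F (cop2 H h (\<lambda>h1 h2. cop2 H k (\<lambda>k1 k2. cop2 H l (\<lambda>l1 l2.
            scl H (omega H h2 k2 l2) (mul H h1 (mul H k1 l1))))))
      = F (cop2 H h (\<lambda>h1 h2. cop2 H k (\<lambda>k1 k2. cop2 H l (\<lambda>l1 l2.
            scl H (omega H h1 k1 l1) (mul H (mul H h2 k2) l2)))))"
      using dqb car by (simp add: dual_quasi_bialgebra_def)
    also have "F (cop2 H h (\<lambda>h1 h2. cop2 H k (\<lambda>k1 k2. cop2 H l (\<lambda>l1 l2.
            scl H (omega H h2 k2 l2) (mul H h1 (mul H k1 l1))))))
      = cop2 H h (\<lambda>h1 h2. cop2 H k (\<lambda>k1 k2. cop2 H l (\<lambda>l1 l2.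
            F (scl H (omega H h2 k2 l2) (mul H h1 (mul H k1 l1))))))"
      by (rule F_cop[OF car]) (intro rules car; assumption)+
    also have "\<dots> = amul \<A>\<^sub>3 (cmap cmu (cmu (E1 F))) \<Omega> h k l"
      unfolding amul_A3[OF c(1,3) car] conv3_def
      by (intro cop2_cong) (simp add: lin_mapD(3)[OF F] mul_car cmap_def cmu_def E1_def \<Omega>_def E3_def mult.commute)
    also have "F (cop2 H h (\<lambda>h1 h2. cop2 H k (\<lambda>k1 k2. cop2 H l (\<lambda>l1 l2.
            scl H (omega H h1 k1 l1) (mul H (mul H h2 k2) l2)))))
      = cop2 H h (\<lambda>h1 h2. cop2 H k (\<lambda>k1 k2. cop2 H l (\<lambda>l1 l2.
            F (scl H (omega H h1 k1 l1) (mul H (mul H h2 k2) l2)))))"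
      by (rule F_cop[OF car]) (intro rules car; assumption)+
    also have "\<dots> = amul \<A>\<^sub>3 \<Omega> (cmu (cmu (E1 F))) h k l"
      unfolding amul_A3[OF c(3,2) car] conv3_def
      by (intro cop2_cong) (simp add: lin_mapD(3)[OF F] mul_car cmap_def cmu_def E1_def \<Omega>_def E3_def)
    finally show ?thesis .
  qed
  thus ?thesis
    unfolding lprod2[OF A3 c(1,3)] lprod2[OF A3 c(3,2)] by (intro A3_eqI is_algD(4)[OF A3] c)
qed


subsection \<open>Tensor products of one-dimensional modules\<close>

text \<open>
  The action on the tensor product of the one-dimensional modules \<open>(a, \<chi>)\<close> and
  \<open>(b, \<chi>')\<close>: the formula for the action on \<open>v \<otimes> w\<close> with all
  coactions evaluated.
\<close>

definition tensor_char :: "'h \<Rightarrow> 'h \<Rightarrow> ('h \<Rightarrow> 'k) \<Rightarrow> ('h \<Rightarrow> 'k) \<Rightarrow> 'h \<Rightarrow> 'k" where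
  "tensor_char a b \<chi> \<chi>' = conv H (conv H (conv H (conv H (\<lambda>h. omega H h a b) \<chi>)
     (\<lambda>h. omega_inv H a h b)) \<chi>') (\<lambda>h. omega H a b h)"

lemma E1_conv: "E1 (conv H f f') = amul \<A>\<^sub>1 (E1 f) (E1 f')"
proof
  fix h show "E1 (conv H f f') h = amul \<A>\<^sub>1 (E1 f) (E1 f') h"
    using amul_E1[of h f f'] by (cases "h \<in> car H") (simp_all add: E1_def conv_def Conv_simps(3))
qed

lemma E1_car_iff: "E1 f \<in> car \<A>\<^sub>1 \<longleftrightarrow> lin_map H ground f"
  using E1_car ConvD(1)[of "E1 f" base_alg] lin_cong[OF C_vspace, of "E1 f" f ground] by (auto simp: E1_def)

lemma E1_eqD: "E1 f = E1 f' \<Longrightarrow> h \<in> car H \<Longrightarrow> f h = f' h"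
  by (metis E1_def)

lemma omega_at_grouplikes_car:
  assumes "a \<in> grouplike H" "b \<in> grouplike H" "trilin_form H f"
  shows "E1 (\<lambda>h. f h a b) \<in> car \<A>\<^sub>1" "E1 (\<lambda>h. f a h b) \<in> car \<A>\<^sub>1" "E1 (\<lambda>h. f a b h) \<in> car \<A>\<^sub>1"
  by (intro E1_car trilin_formD[OF assms(3)] lin_id grouplikeD(1)[OF assms(1)] grouplikeD(1)[OF assms(2)])+

lemmas omega_E1_car = omega_at_grouplikes_car[OF _ _ omega_trilin] omega_at_grouplikes_car[OF _ _ omega_inv_trilin]

lemma E1_tensor_char:
  assumes "a \<in> grouplike H" "b \<in> grouplike H" "lin_map H ground \<chi>" "lin_map H ground \<chi>'"
  shows "E1 (tensor_char a b \<chi> \<chi>') = lprod \<A>\<^sub>1 [E1 (\<lambda>h. omega H h a b), E1 \<chi>,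
    E1 (\<lambda>h. omega_inv H a h b), E1 \<chi>', E1 (\<lambda>h. omega H a b h)]"
  using assms
  by (simp add: tensor_char_def E1_conv lprod_simps is_algD[OF A1_alg] omega_E1_car E1_car)

lemma lin_tensor_char:
  assumes "a \<in> grouplike H" "b \<in> grouplike H" "lin_map H ground \<chi>" "lin_map H ground \<chi>'"
  shows "lin_map H ground (tensor_char a b \<chi> \<chi>')"
  unfolding E1_car_iff[symmetric] E1_tensor_char[OF assms] using assms
  by (intro lprod_car[OF A1_alg]) (simp add: omega_E1_car E1_car)

lemma quasi_assoc_grouplikes:
  assumes a: "a \<in> grouplike H" and b: "b \<in> grouplike H" and F: "lin_map H ground F"
  shows "lprod \<A>\<^sub>1 [E1 (\<lambda>h. F (mul H h (mul H a b))), E1 (\<lambda>h. omega H h a b)]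
      = lprod \<A>\<^sub>1 [E1 (\<lambda>h. omega H h a b), E1 (\<lambda>h. F (mul H (mul H h a) b))]"
    and "lprod \<A>\<^sub>1 [E1 (\<lambda>h. F (mul H a (mul H h b))), E1 (\<lambda>h. omega H a h b)]
      = lprod \<A>\<^sub>1 [E1 (\<lambda>h. omega H a h b), E1 (\<lambda>h. F (mul H (mul H a h) b))]"
    and "lprod \<A>\<^sub>1 [E1 (\<lambda>h. F (mul H a (mul H b h))), E1 (\<lambda>h. omega H a b h)]
      = lprod \<A>\<^sub>1 [E1 (\<lambda>h. omega H a b h), E1 (\<lambda>h. F (mul H (mul H a b) h))]"
proof -
  have A3: "is_alg \<A>\<^sub>3" by (intro algs)
  have c: "cmap cmu (cmu (E1 F)) \<in> car \<A>\<^sub>3" "cmu (cmu (E1 F)) \<in> car \<A>\<^sub>3"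
    by (intro alg_homD(4)[OF alg_hom_cmap[OF A1_alg A2_alg alg_hom_cmu[OF is_alg_base_alg]]]
        alg_homD(4)[OF alg_hom_cmu] algs E1_car F)+
  have hom: "alg_hom \<A>\<^sub>3 \<A>\<^sub>1 (cmap (\<lambda>\<alpha>. \<alpha> a b))" "alg_hom \<A>\<^sub>3 \<A>\<^sub>1 (\<lambda>\<alpha>. cmap (\<lambda>\<alpha>. \<alpha> b) (\<alpha> a))"
    "alg_hom \<A>\<^sub>3 \<A>\<^sub>1 (\<lambda>\<alpha>. \<alpha> a b)"
    by (intro ev alg_hom_cmap_eval algs a b)+
  note q = arg_cong[OF quasi_assoc_A3[OF F]]
  note defs = cmap_def cmu_def E1_def \<Omega>_def E3_def mul_car fun_eq_iff grouplikeD(1)[OF a] grouplikeD(1)[OF b]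
  have "cmap (\<lambda>\<alpha>. \<alpha> a b) (cmap cmu (cmu (E1 F))) = E1 (\<lambda>h. F (mul H h (mul H a b)))"
    "cmap (\<lambda>\<alpha>. \<alpha> a b) (cmu (cmu (E1 F))) = E1 (\<lambda>h. F (mul H (mul H h a) b))"
    "cmap (\<lambda>\<alpha>. \<alpha> a b) \<Omega> = E1 (\<lambda>h. omega H h a b)"
    by (simp_all add: defs)
  with q[of "cmap (\<lambda>\<alpha>. \<alpha> a b)"]
  show "lprod \<A>\<^sub>1 [E1 (\<lambda>h. F (mul H h (mul H a b))), E1 (\<lambda>h. omega H h a b)]
      = lprod \<A>\<^sub>1 [E1 (\<lambda>h. omega H h a b), E1 (\<lambda>h. F (mul H (mul H h a) b))]"
    by (simp add: alg_hom_lprod[OF A3 hom(1)] c \<Omega>_car)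
  have "cmap (\<lambda>\<alpha>. \<alpha> b) (cmap cmu (cmu (E1 F)) a) = E1 (\<lambda>h. F (mul H a (mul H h b)))"
    "cmap (\<lambda>\<alpha>. \<alpha> b) (cmu (cmu (E1 F)) a) = E1 (\<lambda>h. F (mul H (mul H a h) b))"
    "cmap (\<lambda>\<alpha>. \<alpha> b) (\<Omega> a) = E1 (\<lambda>h. omega H a h b)"
    by (simp_all add: defs)
  with q[of "\<lambda>\<alpha>. cmap (\<lambda>\<alpha>. \<alpha> b) (\<alpha> a)"]
  show "lprod \<A>\<^sub>1 [E1 (\<lambda>h. F (mul H a (mul H h b))), E1 (\<lambda>h. omega H a h b)]
      = lprod \<A>\<^sub>1 [E1 (\<lambda>h. omega H a h b), E1 (\<lambda>h. F (mul H (mul H a h) b))]"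
    by (simp add: alg_hom_lprod[OF A3 hom(2)] c \<Omega>_car)
  have "cmap cmu (cmu (E1 F)) a b = E1 (\<lambda>h. F (mul H a (mul H b h)))"
    "cmu (cmu (E1 F)) a b = E1 (\<lambda>h. F (mul H (mul H a b) h))"
    "\<Omega> a b = E1 (\<lambda>h. omega H a b h)"
    by (simp_all add: defs)
  with q[of "\<lambda>\<alpha>. \<alpha> a b"]
  show "lprod \<A>\<^sub>1 [E1 (\<lambda>h. F (mul H a (mul H b h))), E1 (\<lambda>h. omega H a b h)]
      = lprod \<A>\<^sub>1 [E1 (\<lambda>h. omega H a b h), E1 (\<lambda>h. F (mul H (mul H a b) h))]"
    by (simp add: alg_hom_lprod[OF A3 hom(3)] c \<Omega>_car)
qed

lemma omega_grouplike_inverse: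
  assumes a: "a \<in> grouplike H" and b: "b \<in> grouplike H"
  shows "inverse_pair \<A>\<^sub>1 (E1 (\<lambda>h. omega H h a b)) (E1 (\<lambda>h. omega_inv H h a b))"
    and "inverse_pair \<A>\<^sub>1 (E1 (\<lambda>h. omega H a h b)) (E1 (\<lambda>h. omega_inv H a h b))"
    and "inverse_pair \<A>\<^sub>1 (E1 (\<lambda>h. omega H a b h)) (E1 (\<lambda>h. omega_inv H a b h))"
proof -
  have hom: "alg_hom \<A>\<^sub>3 \<A>\<^sub>1 (cmap (\<lambda>\<alpha>. \<alpha> a b))" "alg_hom \<A>\<^sub>3 \<A>\<^sub>1 (\<lambda>\<alpha>. cmap (\<lambda>\<alpha>. \<alpha> b) (\<alpha> a))"
    "alg_hom \<A>\<^sub>3 \<A>\<^sub>1 (\<lambda>\<alpha>. \<alpha> a b)"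
    by (intro ev alg_hom_cmap_eval algs a b)+
  note defs = cmap_def E1_def \<Omega>_def \<Omega>'_def E3_def fun_eq_iff grouplikeD(1)[OF a] grouplikeD(1)[OF b]
  have "cmap (\<lambda>\<alpha>. \<alpha> a b) \<Omega> = E1 (\<lambda>h. omega H h a b)" "cmap (\<lambda>\<alpha>. \<alpha> a b) \<Omega>' = E1 (\<lambda>h. omega_inv H h a b)"
    by (simp_all add: defs)
  with alg_hom_inverse_pair[OF hom(1) \<Omega>_inverse]
  show "inverse_pair \<A>\<^sub>1 (E1 (\<lambda>h. omega H h a b)) (E1 (\<lambda>h. omega_inv H h a b))" by simp
  have "cmap (\<lambda>\<alpha>. \<alpha> b) (\<Omega> a) = E1 (\<lambda>h. omega H a h b)" "cmap (\<lambda>\<alpha>. \<alpha> b) (\<Omega>' a) = E1 (\<lambda>h. omega_inv H a h b)"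
    by (simp_all add: defs)
  with alg_hom_inverse_pair[OF hom(2) \<Omega>_inverse]
  show "inverse_pair \<A>\<^sub>1 (E1 (\<lambda>h. omega H a h b)) (E1 (\<lambda>h. omega_inv H a h b))" by simp
  have "\<Omega> a b = E1 (\<lambda>h. omega H a b h)" "\<Omega>' a b = E1 (\<lambda>h. omega_inv H a b h)"
    by (simp_all add: defs)
  with alg_hom_inverse_pair[OF hom(3) \<Omega>_inverse]
  show "inverse_pair \<A>\<^sub>1 (E1 (\<lambda>h. omega H a b h)) (E1 (\<lambda>h. omega_inv H a b h))" by simp
qed

lemma inverse_conjugate:
  assumes A: "is_alg A" and inv: "inverse_pair A x x'" and car: "y \<in> car A" "z \<in> car A"
    and eq: "lprod A [y, x] = lprod A [x, z]"
  shows "lprod A [x', y] = lprod A [z, x']"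
proof -
  note c = car inverse_pairD[OF inv] and seg = lprod_rewrite[OF A]
  have "lprod A [x', y] = lprod A [x', y, x, x']"
    by (rule seg[OF lprod_inverse(1)[OF A inv, symmetric], where xs = "[x', y]" and ys = "[]"]) (simp_all add: c)
  also have "\<dots> = lprod A [x', x, z, x']"
    by (rule seg[OF eq, where xs = "[x']" and ys = "[x']"]) (simp_all add: c)
  also have "\<dots> = lprod A [z, x']"
    by (rule seg[OF lprod_inverse(2)[OF A inv], where xs = "[]" and ys = "[z, x']"]) (simp_all add: c)
  finally show ?thesis .
qed

lemma tensor_char_twist:
  assumes x: "yd_character a \<chi>" and y: "yd_character b \<chi>'" and F: "lin_map H ground F" and h: "h \<in> car H"
  shows "cop2 H h (\<lambda>h1 h2. tensor_char a b \<chi> \<chi>' h1 * F (mul H (mul H a b) h2))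
    = cop2 H h (\<lambda>h1 h2. F (mul H h1 (mul H a b)) * tensor_char a b \<chi> \<chi>' h2)"
proof -
  note dx = yd_characterD[OF x] and dy = yd_characterD[OF y]
  note tc = E1_tensor_char[OF dx(1) dy(1) dx(2) dy(2)]
  have Fc: "E1 (\<lambda>h. F (f h)) \<in> car \<A>\<^sub>1" if "lin_map H H f" for f
    by (intro E1_car lin_comp[OF F that])
  have Fl: "lin_map H ground (\<lambda>h. F (mul H a h))" "lin_map H ground (\<lambda>h. F (mul H h b))"
    by (intro lin_comp[OF F] lin_mul1 lin_mul2 lin_id dx dy)+
  have mem: "E1 (\<lambda>h. F (mul H (mul H a b) h)) \<in> car \<A>\<^sub>1" "E1 (\<lambda>h. F (mul H a (mul H b h))) \<in> car \<A>\<^sub>1"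
    "E1 (\<lambda>h. F (mul H a (mul H h b))) \<in> car \<A>\<^sub>1" "E1 (\<lambda>h. F (mul H (mul H a h) b)) \<in> car \<A>\<^sub>1"
    "E1 (\<lambda>h. F (mul H (mul H h a) b)) \<in> car \<A>\<^sub>1" "E1 (\<lambda>h. F (mul H h (mul H a b))) \<in> car \<A>\<^sub>1"
    by (intro Fc lin_mul1 lin_mul2 lin_id dx dy mul_car)+
  note q = quasi_assoc_grouplikes[OF dx(1) dy(1) F]
  note om = omega_E1_car[OF dx(1) dy(1)] E1_car[OF dx(2)] E1_car[OF dy(2)]
  have "lprod \<A>\<^sub>1 [E1 (\<lambda>h. omega H h a b), E1 \<chi>, E1 (\<lambda>h. omega_inv H a h b), E1 \<chi>',
      E1 (\<lambda>h. omega H a b h), E1 (\<lambda>h. F (mul H (mul H a b) h))]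
    = lprod \<A>\<^sub>1 [E1 (\<lambda>h. F (mul H h (mul H a b))), E1 (\<lambda>h. omega H h a b), E1 \<chi>,
      E1 (\<lambda>h. omega_inv H a h b), E1 \<chi>', E1 (\<lambda>h. omega H a b h)]"
    by (rule tensor_twist_chain[OF A1_alg _ q(3) yd_character_twist1[OF y Fl(1)]
          inverse_conjugate[OF A1_alg omega_grouplike_inverse(2)[OF dx(1) dy(1)] mem(3,4) q(2)]
          yd_character_twist1[OF x Fl(2)] q(1)])
       (simp add: om mem)
  hence "amul \<A>\<^sub>1 (E1 (tensor_char a b \<chi> \<chi>')) (E1 (\<lambda>h. F (mul H (mul H a b) h)))
    = amul \<A>\<^sub>1 (E1 (\<lambda>h. F (mul H h (mul H a b)))) (E1 (tensor_char a b \<chi> \<chi>'))"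
    unfolding tc using om mem by (simp add: lprod_simps is_algD[OF A1_alg])
  from fun_cong[OF this, of h] show ?thesis by (simp add: amul_E1 h)
qed

lemma tensor_char_multiplicative:
  assumes x: "yd_character a \<chi>" and y: "yd_character b \<chi>'"
  defines "\<xi> \<equiv> tensor_char a b \<chi> \<chi>'" and "c \<equiv> mul H a b"
  shows "cmu (E1 \<xi>) = lprod \<A>\<^sub>2 [E2 (\<lambda>h l. omega_inv H h l c), E2 (\<lambda>h l. counit H h * \<xi> l),
        E2 (\<lambda>h l. omega H h c l), E2 (\<lambda>h l. counit H l * \<xi> h), E2 (\<lambda>h l. omega_inv H c h l)]"
proof -
  note dx = yd_characterD[OF x] and dy = yd_characterD[OF y]
  note tc = E1_tensor_char[OF dx(1) dy(1) dx(2) dy(2), folded \<xi>_def]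
  note om = omega_E1_car[OF dx(1) dy(1)] E1_car[OF dx(2)] E1_car[OF dy(2)]
  note te = tensor_embeddings
  note A2 = A2_alg
  note hlab = cocycle_hlab[OF dx(1) dy(1)] and halb = cocycle_halb[OF dx(1) dy(1)]
    and habl = cocycle_habl[OF dx(1) dy(1)] and ahlb = cocycle_ahlb[OF dx(1) dy(1)]
    and ahbl = cocycle_ahbl[OF dx(1) dy(1)] and abhl = cocycle_abhl[OF dx(1) dy(1)]
  \<comment> \<open>The six instances of the cocycle condition with two grouplikes and two variables,
    rearranged as the word identity needs them.\<close>
  note R1 = lprod_moves(1)[OF A2 cocycle_hom(2-6)[OF hlab(1)] cocycle_hom(1)[OF hlab(1)], unfolded \<Omega>_def \<Omega>'_def hlab(2-6)]
  note R2 = lprod_moves(2)[OF A2 cocycle_hom(2-6)[OF halb(1)] cocycle_hom(1)[OF halb(1)], unfolded \<Omega>_def \<Omega>'_def halb(2-6)]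
  note R3 = lprod_moves(3)[OF A2 cocycle_hom(2-6)[OF ahlb(1)] cocycle_hom(1)[OF ahlb(1)], unfolded \<Omega>_def \<Omega>'_def ahlb(2-6)]
  note R4 = cocycle_hom(1)[OF habl(1), unfolded \<Omega>_def habl(2-6), symmetric]
  note R5 = lprod_moves(1)[OF A2 cocycle_hom(2-6)[OF ahbl(1)] cocycle_hom(1)[OF ahbl(1)], unfolded \<Omega>_def \<Omega>'_def ahbl(2-6), symmetric]
  note R6 = lprod_moves(2)[OF A2 cocycle_hom(2-6)[OF abhl(1)] cocycle_hom(1)[OF abhl(1)], unfolded \<Omega>_def \<Omega>'_def abhl(2-6)]
  have b: "bilin_map H H ground (\<lambda>h l. omega H h l b)" "bilin_map H H ground (\<lambda>h l. omega_inv H h l b)"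
    "bilin_map H H ground (\<lambda>h l. omega_inv H a h l)" "bilin_map H H ground (\<lambda>h l. omega H a h l)"
    "bilin_map H H ground (\<lambda>h l. omega H h a l)" "bilin_map H H ground (\<lambda>h l. omega H h b l)"
    by (intro bilin_omegas omega_trilin omega_inv_trilin dx dy)+
  note cars = cocycle_hom(2-6)[OF hlab(1), THEN inverse_pairD(1), unfolded \<Omega>_def hlab(2-6)]
    cocycle_hom(2-6)[OF halb(1), THEN inverse_pairD(1), unfolded \<Omega>_def halb(2-6)]
    cocycle_hom(2-6)[OF habl(1), THEN inverse_pairD(1), unfolded \<Omega>_def habl(2-6)]
    cocycle_hom(2-6)[OF ahlb(1), THEN inverse_pairD(1), unfolded \<Omega>_def ahlb(2-6)]
    cocycle_hom(2-6)[OF ahbl(1), THEN inverse_pairD(1), unfolded \<Omega>_def ahbl(2-6)]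
    cocycle_hom(2-6)[OF abhl(1), THEN inverse_pairD(1), unfolded \<Omega>_def abhl(2-6)]
    cocycle_hom(2-6)[OF hlab(1), THEN inverse_pairD(2), unfolded \<Omega>'_def hlab(2-6)]
    cocycle_hom(2-6)[OF halb(1), THEN inverse_pairD(2), unfolded \<Omega>'_def halb(2-6)]
    cocycle_hom(2-6)[OF habl(1), THEN inverse_pairD(2), unfolded \<Omega>'_def habl(2-6)]
    cocycle_hom(2-6)[OF ahlb(1), THEN inverse_pairD(2), unfolded \<Omega>'_def ahlb(2-6)]
    cocycle_hom(2-6)[OF ahbl(1), THEN inverse_pairD(2), unfolded \<Omega>'_def ahbl(2-6)]
    cocycle_hom(2-6)[OF abhl(1), THEN inverse_pairD(2), unfolded \<Omega>'_def abhl(2-6)]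
    bilin_tensors[OF dx(2), THEN E2_car] bilin_tensors[OF dy(2), THEN E2_car]
  \<comment> \<open>The values of the new character at \<open>l\<close> and at \<open>h\<close>, as products
    of forms in two variables.\<close>
  have ci: "cinc \<A>\<^sub>1 (E1 \<xi>) = lprod \<A>\<^sub>2 [E2 (\<lambda>h l. counit H h * omega H l a b), E2 (\<lambda>h l. counit H h * \<chi> l),
      E2 (\<lambda>h l. counit H h * omega_inv H a l b), E2 (\<lambda>h l. counit H h * \<chi>' l),
      E2 (\<lambda>h l. counit H h * omega H a b l)]"
    unfolding tc by (simp add: alg_hom_lprod[OF A1_alg te(1)] om te(3))
  have cj: "cmap (cinc base_alg) (E1 \<xi>) = lprod \<A>\<^sub>2 [E2 (\<lambda>h l. counit H l * omega H h a b),
      E2 (\<lambda>h l. counit H l * \<chi> h), E2 (\<lambda>h l. counit H l * omega_inv H a h b),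
      E2 (\<lambda>h l. counit H l * \<chi>' h), E2 (\<lambda>h l. counit H l * omega H a b h)]"
    unfolding tc by (simp add: alg_hom_lprod[OF A1_alg te(2)] om te(4))
  have "cmu (E1 \<xi>) = lprod \<A>\<^sub>2 [E2 (\<lambda>h l. omega H (mul H h l) a b), cmu (E1 \<chi>),
      E2 (\<lambda>h l. omega_inv H a (mul H h l) b), cmu (E1 \<chi>'), E2 (\<lambda>h l. omega H a b (mul H h l))]"
    unfolding tc by (simp add: alg_hom_lprod[OF A1_alg alg_hom_cmu[OF is_alg_base_alg]] om te(5))
  also have "\<dots> = lprod \<A>\<^sub>2 [E2 (\<lambda>h l. omega H (mul H h l) a b), E2 (\<lambda>h l. omega_inv H h l a),
      E2 (\<lambda>h l. counit H h * \<chi> l), E2 (\<lambda>h l. omega H h a l), E2 (\<lambda>h l. counit H l * \<chi> h),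
      E2 (\<lambda>h l. omega_inv H a h l), E2 (\<lambda>h l. omega_inv H a (mul H h l) b),
      E2 (\<lambda>h l. omega_inv H h l b), E2 (\<lambda>h l. counit H h * \<chi>' l), E2 (\<lambda>h l. omega H h b l),
      E2 (\<lambda>h l. counit H l * \<chi>' h), E2 (\<lambda>h l. omega_inv H b h l), E2 (\<lambda>h l. omega H a b (mul H h l))]"
    unfolding dx(4) dy(4) by (simp add: lprod_simps is_algD[OF A2] cars)
  also have "\<dots> = lprod \<A>\<^sub>2 [E2 (\<lambda>h l. omega_inv H h l c), E2 (\<lambda>h l. counit H h * omega H l a b),
      E2 (\<lambda>h l. counit H h * \<chi> l), E2 (\<lambda>h l. counit H h * omega_inv H a l b),
      E2 (\<lambda>h l. counit H h * \<chi>' l), E2 (\<lambda>h l. counit H h * omega H a b l), E2 (\<lambda>h l. omega H h c l),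
      E2 (\<lambda>h l. counit H l * omega H h a b), E2 (\<lambda>h l. counit H l * \<chi> h),
      E2 (\<lambda>h l. counit H l * omega_inv H a h b), E2 (\<lambda>h l. counit H l * \<chi>' h),
      E2 (\<lambda>h l. counit H l * omega H a b h), E2 (\<lambda>h l. omega_inv H c h l)]"
    unfolding c_def
    by (rule tensor_multiplicative_chain[OF A2 _ R1 R3 R6 yd_character_twist2(1)[OF x b(1), symmetric]
          yd_character_twist2(2)[OF x b(2)] R2 yd_character_twist2(1)[OF y b(3), symmetric]
          yd_character_twist2(2)[OF y b(4)] R5 tensor_commute[OF dx(2) dy(2)]
          yd_character_twist2(1)[OF y b(5), symmetric] yd_character_twist2(2)[OF x b(6)] R4])
       (simp add: cars)
  also have "\<dots> = lprod \<A>\<^sub>2 [E2 (\<lambda>h l. omega_inv H h l c), cinc \<A>\<^sub>1 (E1 \<xi>), E2 (\<lambda>h l. omega H h c l),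
      cmap (cinc base_alg) (E1 \<xi>), E2 (\<lambda>h l. omega_inv H c h l)]"
    unfolding ci cj by (simp add: lprod_simps is_algD[OF A2] cars c_def)
  finally show ?thesis by (simp only: te)
qed

text \<open>
  One-dimensional case of the closure of Yetter-Drinfeld modules under tensor products. Both
  equations are instances of the word identities above.
\<close>

theorem yd_character_tensor:
  assumes x: "yd_character a \<chi>" and y: "yd_character b \<chi>'"
  shows "yd_character (mul H a b) (tensor_char a b \<chi> \<chi>')"
  unfolding yd_character_def
  by (intro conjI allI impI tensor_char_multiplicative[OF x y] tensor_char_twist[OF x y]
      grouplike_mul lin_tensor_char yd_characterD(1,2)[OF x] yd_characterD(1,2)[OF y])


lemma omega_scalar_inverse:
  assumes "a \<in> grouplike H" "b \<in> grouplike H" "c \<in> grouplike H"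
  shows "omega H a b c * omega_inv H a b c = 1"
proof -
  have "inverse_pair base_alg (\<Omega> a b c) (\<Omega>' a b c)"
    by (rule alg_hom_inverse_pair[OF alg_hom_eval3 \<Omega>_inverse]) (intro algs assms)+
  thus ?thesis
    using assms[THEN grouplikeD(1)] by (simp add: inverse_pair_def \<Omega>_def \<Omega>'_def E3_def)
qed

text \<open>
  The associativity constraint between the two triple tensor products is multiplication by
  \<open>\<omega>\<^sup>-\<^sup>1(a, b, c)\<close>. It is nonzero and commutes with the action, so
  the characters agree.
\<close>

lemma tensor_char_assoc:
  assumes x: "yd_character a \<chi>" and y: "yd_character b \<chi>'" and z: "yd_character c \<chi>''" and h: "h \<in> car H"
  shows "tensor_char (mul H a b) c (tensor_char a b \<chi> \<chi>') \<chi>'' h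
    = tensor_char a (mul H b c) \<chi> (tensor_char b c \<chi>' \<chi>'') h"
proof -
  note dx = yd_characterD[OF x] and dy = yd_characterD[OF y] and dz = yd_characterD[OF z]
  note A1 = A1_alg
  note gl = dx(1) dy(1) dz(1)
  note habc = cocycle_habc[OF gl] and ahbc = cocycle_ahbc[OF gl]
    and abhc = cocycle_abhc[OF gl] and abch = cocycle_abch[OF gl]
  \<comment> \<open>The four instances with one variable; the scalar \<open>\<omega>(a, b, c)\<close> occurs
    in the first and the last of them.\<close>
  note Q1 = cocycle_hom(1)[OF habc(1), unfolded \<Omega>_def habc(2-6)]
  note Q2 = lprod_moves(1)[OF A1 cocycle_hom(2-6)[OF ahbc(1)] cocycle_hom(1)[OF ahbc(1)], unfolded \<Omega>_def \<Omega>'_def ahbc(2-6)]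
  note Q3 = lprod_moves(4)[OF A1 cocycle_hom(2-6)[OF abhc(1)] cocycle_hom(1)[OF abhc(1)], unfolded \<Omega>_def \<Omega>'_def abhc(2-6)]
  note Q4 = cocycle_hom(1)[OF abch(1), unfolded \<Omega>_def abch(2-6), symmetric]
  note I = lprod_inverse(1)[OF A1 cocycle_hom(3)[OF abhc(1)], unfolded \<Omega>_def \<Omega>'_def abhc(2-6)]
  note cars = cocycle_hom(2-6)[OF habc(1), THEN inverse_pairD(1), unfolded \<Omega>_def habc(2-6)]
    cocycle_hom(2-6)[OF ahbc(1), THEN inverse_pairD(1), unfolded \<Omega>_def ahbc(2-6)]
    cocycle_hom(2-6)[OF abhc(1), THEN inverse_pairD(1), unfolded \<Omega>_def abhc(2-6)]
    cocycle_hom(2-6)[OF abch(1), THEN inverse_pairD(1), unfolded \<Omega>_def abch(2-6)]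
    cocycle_hom(2-6)[OF habc(1), THEN inverse_pairD(2), unfolded \<Omega>'_def habc(2-6)]
    cocycle_hom(2-6)[OF ahbc(1), THEN inverse_pairD(2), unfolded \<Omega>'_def ahbc(2-6)]
    cocycle_hom(2-6)[OF abhc(1), THEN inverse_pairD(2), unfolded \<Omega>'_def abhc(2-6)]
    cocycle_hom(2-6)[OF abch(1), THEN inverse_pairD(2), unfolded \<Omega>'_def abch(2-6)]
    E1_car[OF dx(2)] E1_car[OF dy(2)] E1_car[OF dz(2)] omega_E1_car[OF dx(1) dy(1)] omega_E1_car[OF dy(1) dz(1)]
  have F: "lin_map H ground (\<lambda>h. omega H h b c)" "lin_map H ground (\<lambda>h. omega H a h c)"
    "lin_map H ground (\<lambda>h. omega H a b h)"
    by (intro lin_omega lin_id dx dy dz)+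
  define L where "L = tensor_char (mul H a b) c (tensor_char a b \<chi> \<chi>') \<chi>''"
  define R where "R = tensor_char a (mul H b c) \<chi> (tensor_char b c \<chi>' \<chi>'')"
  let ?s = "E1 (\<lambda>h. counit H h * omega H a b c)"
  note lin = lin_tensor_char[OF dx(1) dy(1) dx(2) dy(2)] lin_tensor_char[OF dy(1) dz(1) dy(2) dz(2)]
  note gm = grouplike_mul[OF dx(1) dy(1)] grouplike_mul[OF dy(1) dz(1)]
  have L: "E1 L = lprod \<A>\<^sub>1 [E1 (\<lambda>h. omega H h (mul H a b) c), E1 (\<lambda>h. omega H h a b), E1 \<chi>,
      E1 (\<lambda>h. omega_inv H a h b), E1 \<chi>', E1 (\<lambda>h. omega H a b h), E1 (\<lambda>h. omega_inv H (mul H a b) h c),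
      E1 \<chi>'', E1 (\<lambda>h. omega H (mul H a b) c h)]"
    unfolding L_def E1_tensor_char[OF gm(1) dz(1) lin(1) dz(2)] E1_tensor_char[OF dx(1) dy(1) dx(2) dy(2)]
    by (simp add: lprod_simps is_algD[OF A1] cars)
  have R: "E1 R = lprod \<A>\<^sub>1 [E1 (\<lambda>h. omega H h a (mul H b c)), E1 \<chi>, E1 (\<lambda>h. omega_inv H a h (mul H b c)),
      E1 (\<lambda>h. omega H h b c), E1 \<chi>', E1 (\<lambda>h. omega_inv H b h c), E1 \<chi>'', E1 (\<lambda>h. omega H b c h),
      E1 (\<lambda>h. omega H a (mul H b c) h)]"
    unfolding R_def E1_tensor_char[OF dx(1) gm(2) dx(2) lin(2)] E1_tensor_char[OF dy(1) dz(1) dy(2) dz(2)]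
    by (simp add: lprod_simps is_algD[OF A1] cars)
  have "lprod \<A>\<^sub>1 (?s # [E1 (\<lambda>h. omega H h (mul H a b) c), E1 (\<lambda>h. omega H h a b), E1 \<chi>,
      E1 (\<lambda>h. omega_inv H a h b), E1 \<chi>', E1 (\<lambda>h. omega H a b h), E1 (\<lambda>h. omega_inv H (mul H a b) h c),
      E1 \<chi>'', E1 (\<lambda>h. omega H (mul H a b) c h)])
    = lprod \<A>\<^sub>1 ([E1 (\<lambda>h. omega H h a (mul H b c)), E1 \<chi>, E1 (\<lambda>h. omega_inv H a h (mul H b c)),
      E1 (\<lambda>h. omega H h b c), E1 \<chi>', E1 (\<lambda>h. omega_inv H b h c), E1 \<chi>'', E1 (\<lambda>h. omega H b c h),
      E1 (\<lambda>h. omega H a (mul H b c) h)] @ [?s])"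
    unfolding append.simps
    by (rule tensor_associative_chain[OF A1 _ Q1 yd_character_twist1[OF x F(1), symmetric] Q2 Q3
          yd_character_twist1[OF y F(2), symmetric] I yd_character_twist1[OF z F(3), symmetric] Q4])
       (simp add: cars)
  hence "amul \<A>\<^sub>1 ?s (E1 L) = amul \<A>\<^sub>1 (E1 R) ?s"
    unfolding L R using cars by (simp add: lprod_simps is_algD[OF A1])
  from fun_cong[OF this, of h] have "cop2 H h (\<lambda>h1 h2. (counit H h1 * omega H a b c) * L h2)
      = cop2 H h (\<lambda>h1 h2. R h1 * (counit H h2 * omega H a b c))"
    by (simp add: amul_E1 h)
  moreover have "lin_map H ground L" "lin_map H ground R"
    unfolding L_def R_def by (intro lin_tensor_char gm lin dx dy dz)+
  ultimately have "omega H a b c * L h = omega H a b c * R h"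
    using cop2_counitL[OF is_vspace_ground lin_mulR[of H L "omega H a b c"] h]
      cop2_counitR[OF is_vspace_ground lin_mulR[of H R "omega H a b c"] h]
    by (simp add: mult_ac)
  thus ?thesis
    using omega_scalar_inverse[OF gl] unfolding L_def R_def by auto
qed

subsection \<open>The unit\<close>

lemma lprod_idem_unit:
  assumes A: "is_alg A" and inv: "inverse_pair A x x'" and idem: "amul A x x = x"
  shows "x = aone A"
proof -
  note c = inverse_pairD[OF inv]
  have "x = amul A (amul A x' x) x" using inv by (simp add: inverse_pair_def is_algD[OF A])
  also have "\<dots> = amul A x' x" by (simp add: is_algD(5)[OF A] c idem)
  finally show ?thesis using inv by (simp add: inverse_pair_def)
qed

lemma omega_middle_one:
  "h \<in> car H \<Longrightarrow> l \<in> car H \<Longrightarrow> omega H h (one H) l = counit H h * counit H l"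
  using dqb by (simp add: dual_quasi_bialgebra_def)

lemma aone_A2: "aone \<A>\<^sub>2 = E2 (\<lambda>h l. counit H h * counit H l)"
  by (auto simp: fun_eq_iff E2_def Conv_simps(2,4))

lemma E2_eq_iff: "E2 f = E2 f' \<longleftrightarrow> (\<forall>h\<in>car H. \<forall>l\<in>car H. f h l = f' h l)"
  by (auto simp: E2_def fun_eq_iff)

text \<open>
  The normalization concerns a unit in the middle. For the outer positions, two adjacent units in
  the cocycle condition make \<open>\<omega>(-, -, 1)\<close> and \<open>\<omega>(1, -, -)\<close>
  idempotent, and they are invertible.
\<close>

lemma omega_one_E2:
  "E2 (\<lambda>h l. omega H h l (one H)) = aone \<A>\<^sub>2" "E2 (\<lambda>h l. omega H h (one H) l) = aone \<A>\<^sub>2"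
  "E2 (\<lambda>h l. omega H (one H) h l) = aone \<A>\<^sub>2"
proof -
  let ?e = "one H"
  note g = one_grouplike
  note A2 = A2_alg
  show mid: "E2 (\<lambda>h l. omega H h ?e l) = aone \<A>\<^sub>2"
    unfolding aone_A2 by (simp add: E2_eq_iff omega_middle_one)
  note hlab = cocycle_hlab[OF g g] and abhl = cocycle_abhl[OF g g]
  note one = is_algD(3)[OF A2] grouplikeD(2)[OF g] mul_one[OF one_car]
  have p: "E2 (\<lambda>h l. counit H h * omega H l ?e ?e) = aone \<A>\<^sub>2" "E2 (\<lambda>h l. omega H (mul H h l) ?e ?e) = aone \<A>\<^sub>2"
    "E2 (\<lambda>h l. omega H h (mul H l ?e) ?e) = E2 (\<lambda>h l. omega H h l ?e)"
    "E2 (\<lambda>h l. counit H l * omega H ?e ?e h) = aone \<A>\<^sub>2" "E2 (\<lambda>h l. omega H ?e ?e (mul H h l)) = aone \<A>\<^sub>2"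
    "E2 (\<lambda>h l. omega H ?e (mul H ?e h) l) = E2 (\<lambda>h l. omega H ?e h l)"
    unfolding aone_A2
    by (simp_all add: E2_eq_iff omega_middle_one one_car mul_car counit_mul mul_one one)
  note i1 = cocycle_hom(4)[OF hlab(1), unfolded \<Omega>_def \<Omega>'_def hlab(2-6)]
  have "lprod \<A>\<^sub>2 [aone \<A>\<^sub>2, E2 (\<lambda>h l. omega H h l ?e), E2 (\<lambda>h l. omega H h l ?e)]
    = lprod \<A>\<^sub>2 [E2 (\<lambda>h l. omega H h l ?e), aone \<A>\<^sub>2]"
    using cocycle_hom(1)[OF hlab(1), unfolded \<Omega>_def hlab(2-6)] by (simp add: p one)
  thus "E2 (\<lambda>h l. omega H h l ?e) = aone \<A>\<^sub>2"
    using inverse_pairD[OF i1]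
    by (intro lprod_idem_unit[OF A2 i1]) (simp add: lprod_simps is_algD[OF A2])
  note i2 = cocycle_hom(2)[OF abhl(1), unfolded \<Omega>_def \<Omega>'_def abhl(2-6)]
  have "lprod \<A>\<^sub>2 [E2 (\<lambda>h l. omega H ?e h l), E2 (\<lambda>h l. omega H ?e h l), aone \<A>\<^sub>2]
    = lprod \<A>\<^sub>2 [aone \<A>\<^sub>2, E2 (\<lambda>h l. omega H ?e h l)]"
    using cocycle_hom(1)[OF abhl(1), unfolded \<Omega>_def abhl(2-6)] by (simp only: p one)
  thus "E2 (\<lambda>h l. omega H ?e h l) = aone \<A>\<^sub>2"
    using inverse_pairD[OF i2]
    by (intro lprod_idem_unit[OF A2 i2]) (simp add: lprod_simps is_algD[OF A2])
qed

lemma omega_inverse_E2: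
  assumes "a \<in> grouplike H"
  shows "inverse_pair \<A>\<^sub>2 (E2 (\<lambda>h l. omega H h l a)) (E2 (\<lambda>h l. omega_inv H h l a))"
    and "inverse_pair \<A>\<^sub>2 (E2 (\<lambda>h l. omega H h a l)) (E2 (\<lambda>h l. omega_inv H h a l))"
    and "inverse_pair \<A>\<^sub>2 (E2 (\<lambda>h l. omega H a h l)) (E2 (\<lambda>h l. omega_inv H a h l))"
  using cocycle_hom(4)[OF cocycle_hlab(1), unfolded \<Omega>_def \<Omega>'_def, OF assms assms]
    cocycle_hom(4)[OF cocycle_halb(1), unfolded \<Omega>_def \<Omega>'_def, OF assms assms]
    cocycle_hom(4)[OF cocycle_ahlb(1), unfolded \<Omega>_def \<Omega>'_def, OF assms assms]
  by (simp_all add: cocycle_hlab[OF assms assms] cocycle_halb[OF assms assms] cocycle_ahlb[OF assms assms])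

lemma omega_inv_one_E2:
  "E2 (\<lambda>h l. omega_inv H h l (one H)) = aone \<A>\<^sub>2" "E2 (\<lambda>h l. omega_inv H h (one H) l) = aone \<A>\<^sub>2"
  "E2 (\<lambda>h l. omega_inv H (one H) h l) = aone \<A>\<^sub>2"
proof -
  have *: "y = aone \<A>\<^sub>2" if "inverse_pair \<A>\<^sub>2 x y" "x = aone \<A>\<^sub>2" for x y
    using that is_algD(6)[OF A2_alg, of y] by (simp add: inverse_pair_def)
  show "E2 (\<lambda>h l. omega_inv H h l (one H)) = aone \<A>\<^sub>2" "E2 (\<lambda>h l. omega_inv H h (one H) l) = aone \<A>\<^sub>2"
    "E2 (\<lambda>h l. omega_inv H (one H) h l) = aone \<A>\<^sub>2"
    by (rule *[OF omega_inverse_E2(1)[OF one_grouplike] omega_one_E2(1)]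
        *[OF omega_inverse_E2(2)[OF one_grouplike] omega_one_E2(2)]
        *[OF omega_inverse_E2(3)[OF one_grouplike] omega_one_E2(3)])+
qed

lemma omega_one:
  assumes "h \<in> car H" "l \<in> car H"
  shows "omega H h l (one H) = counit H h * counit H l" "omega H h (one H) l = counit H h * counit H l"
    "omega H (one H) h l = counit H h * counit H l"
    "omega_inv H h l (one H) = counit H h * counit H l" "omega_inv H h (one H) l = counit H h * counit H l"
    "omega_inv H (one H) h l = counit H h * counit H l"
  using omega_one_E2 omega_inv_one_E2 assms by (simp_all add: aone_A2 E2_eq_iff)

lemma yd_character_one: "yd_character (one H) (counit H)"
  unfolding yd_character_def
proof (intro conjI allI impI one_grouplike lin_counit)
  have e: "E2 (\<lambda>h l. counit H h * counit H l) = aone \<A>\<^sub>2" "E2 (\<lambda>h l. counit H l * counit H h) = aone \<A>\<^sub>2"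
    "E2 (\<lambda>h l. counit H (mul H h l)) = aone \<A>\<^sub>2"
    unfolding aone_A2 by (simp_all add: E2_eq_iff counit_mul)
  show "cmu (E1 (counit H)) = lprod \<A>\<^sub>2 [E2 (\<lambda>h l. omega_inv H h l (one H)), E2 (\<lambda>h l. counit H h * counit H l),
        E2 (\<lambda>h l. omega H h (one H) l), E2 (\<lambda>h l. counit H l * counit H h), E2 (\<lambda>h l. omega_inv H (one H) h l)]"
    unfolding omega_one_E2 omega_inv_one_E2 tensor_embeddings(5)
    by (simp only: e lprod_simps is_algD[OF A2_alg])
  fix F h assume F: "lin_map H ground F" and h: "h \<in> car H"
  show "cop2 H h (\<lambda>a b. counit H a * F (mul H (one H) b)) = cop2 H h (\<lambda>a b. F (mul H a (one H)) * counit H b)"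
    using cop2_counitL[OF is_vspace_ground F h] cop2_counitR[OF is_vspace_ground F h]
    by (simp add: mul_one mult.commute cong: cop2_cong)
qed

subsection \<open>Sweedler form of products of forms\<close>

lemma cop2_scale:
  assumes "bilin_map H H ground F" "h \<in> car H"
  shows "cop2 H h (\<lambda>a b. c * F a b) = c * cop2 H h F"
  using cop2_map[OF lin_mulR[OF lin_id] is_vspace_ground is_vspace_ground assms, of c] by simp

lemma lprod_E1_Cons:
  "h \<in> car H \<Longrightarrow> lprod \<A>\<^sub>1 (E1 f # xs) h = cop2 H h (\<lambda>a b. f a * lprod \<A>\<^sub>1 xs b)"
  by (simp add: lprod_simps Conv_simps(3) E1_def cong: cop2_cong)

lemma lprod_E1_single: "lin_map H ground f \<Longrightarrow> h \<in> car H \<Longrightarrow> lprod \<A>\<^sub>1 [E1 f] h = f h"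
  by (simp add: lprod_simps is_algD[OF A1_alg] E1_car) (simp add: E1_def)

lemma cop_lprod_step:
  assumes "lin_map H ground f" "set xs \<subseteq> car \<A>\<^sub>1" "h \<in> car H"
  shows "cop2 H h (\<lambda>a b. x * f a * lprod \<A>\<^sub>1 xs b) = x * lprod \<A>\<^sub>1 (E1 f # xs) h"
proof -
  have "lin_map H ground (lprod \<A>\<^sub>1 xs)" using ConvD(1)[OF lprod_car[OF A1_alg assms(2)]] by simp
  hence "bilin_map H H ground (\<lambda>a b. f a * lprod \<A>\<^sub>1 xs b)"
    by (intro bilin_mapI lin_mulL lin_mulR assms(1); assumption)
  from cop2_scale[OF this assms(3)] show ?thesis
    by (simp add: lprod_E1_Cons assms(3) mult.assoc)
qed

text \<open>
  Convolution products of linear forms in Sweedler notation, in the nested shape in which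
  \<open>cop3\<close> to \<open>cop5\<close> write them. The scalar \<open>x\<close> makes the
  induction over the number of factors possible.
\<close>

lemma cop_lprod:
  assumes "h \<in> car H" "lin_map H ground f1" "lin_map H ground f2" "lin_map H ground f3"
  shows cop2_lprod: "cop2 H h (\<lambda>a b. x * f1 a * f2 b) = x * lprod \<A>\<^sub>1 [E1 f1, E1 f2] h"
    and cop3_lprod: "cop3 H h (\<lambda>a b c. x * f1 a * f2 b * f3 c) = x * lprod \<A>\<^sub>1 [E1 f1, E1 f2, E1 f3] h"
    and cop4_lprod: "lin_map H ground f4 \<Longrightarrow> cop4 H h (\<lambda>a b c d. x * f1 a * f2 b * f3 c * f4 d)
      = x * lprod \<A>\<^sub>1 [E1 f1, E1 f2, E1 f3, E1 f4] h"
    and cop5_lprod: "lin_map H ground f4 \<Longrightarrow> lin_map H ground f5 \<Longrightarrow>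
      cop5 H h (\<lambda>a b c d e. x * f1 a * f2 b * f3 c * f4 d * f5 e)
      = x * lprod \<A>\<^sub>1 [E1 f1, E1 f2, E1 f3, E1 f4, E1 f5] h"
proof -
  have 2: "cop2 H h (\<lambda>a b. x * f1 a * f2 b) = x * lprod \<A>\<^sub>1 [E1 f1, E1 f2] h"
    if "h \<in> car H" "lin_map H ground f1" "lin_map H ground f2" for f1 f2 x h
    using cop_lprod_step[OF that(2) _ that(1), of "[E1 f2]" x] that
    by (simp add: E1_car lprod_E1_single cong: cop2_cong)
  have 3: "cop3 H h (\<lambda>a b c. x * f1 a * f2 b * f3 c) = x * lprod \<A>\<^sub>1 [E1 f1, E1 f2, E1 f3] h"
    if "h \<in> car H" "lin_map H ground f1" "lin_map H ground f2" "lin_map H ground f3" for f1 f2 f3 x h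
    using cop_lprod_step[OF that(2) _ that(1), of "[E1 f2, E1 f3]" x] that
    by (simp add: E1_car 2 cop3_def cong: cop2_cong)
  have 4: "cop4 H h (\<lambda>a b c d. x * f1 a * f2 b * f3 c * f4 d) = x * lprod \<A>\<^sub>1 [E1 f1, E1 f2, E1 f3, E1 f4] h"
    if "h \<in> car H" "lin_map H ground f1" "lin_map H ground f2" "lin_map H ground f3" "lin_map H ground f4"
    for f1 f2 f3 f4 x h
    using cop_lprod_step[OF that(2) _ that(1), of "[E1 f2, E1 f3, E1 f4]" x] that
    by (simp add: E1_car 3 cop4_def cong: cop2_cong)
  show "cop2 H h (\<lambda>a b. x * f1 a * f2 b) = x * lprod \<A>\<^sub>1 [E1 f1, E1 f2] h"
    "cop3 H h (\<lambda>a b c. x * f1 a * f2 b * f3 c) = x * lprod \<A>\<^sub>1 [E1 f1, E1 f2, E1 f3] h"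
    "lin_map H ground f4 \<Longrightarrow> cop4 H h (\<lambda>a b c d. x * f1 a * f2 b * f3 c * f4 d)
      = x * lprod \<A>\<^sub>1 [E1 f1, E1 f2, E1 f3, E1 f4] h"
    by (intro 2 3 4 assms; assumption)+
  show "lin_map H ground f4 \<Longrightarrow> lin_map H ground f5 \<Longrightarrow>
      cop5 H h (\<lambda>a b c d e. x * f1 a * f2 b * f3 c * f4 d * f5 e)
      = x * lprod \<A>\<^sub>1 [E1 f1, E1 f2, E1 f3, E1 f4, E1 f5] h"
    using cop_lprod_step[OF assms(2) _ assms(1), of "[E1 f2, E1 f3, E1 f4, E1 f5]" x] assms
    by (simp add: E1_car 4 cop5_def cong: cop2_cong)
qed

text \<open>
  The first axiom of a datum is written with two iterated coproducts. This matches it with a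
  product in the algebra of bilinear forms.
\<close>

lemma cop44_lprod:
  assumes A: "bilin_map H H ground A" and B: "bilin_map H H ground B" and D: "bilin_map H H ground D"
    and f: "lin_map H ground f" and h: "h \<in> car H" and l: "l \<in> car H"
  shows "cop4 H h (\<lambda>h1 h2 h3 h4. cop4 H l (\<lambda>l1 l2 l3 l4. A h1 l1 * f l2 * B h2 l3 * f h3 * D h4 l4))
    = lprod \<A>\<^sub>2 [E2 A, E2 (\<lambda>h l. counit H h * f l), E2 B, E2 (\<lambda>h l. counit H l * f h), E2 D] h l"
proof -
  let ?m = "amul \<A>\<^sub>1"
  note A1 = A1_alg and A1v = is_algD(1)[OF A1_alg]
  define K where "K h1 h2 h3 h4 = ?m (E1 (A h1)) (?m (E1 f) (?m (E1 (B h2)) (scl \<A>\<^sub>1 (f h3) (E1 (D h4)))))" for h1 h2 h3 h4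
  have E: "E2 F h = E1 (F h)" if "h \<in> car H" for F :: "'h \<Rightarrow> 'h \<Rightarrow> 'k" and h
    using that by (simp add: E1_def E2_def fun_eq_iff)
  have linE: "lin_map H \<A>\<^sub>1 (\<lambda>h. E1 (F h))" if "bilin_map H H ground F" for F
    using ConvD(1)[OF E2_car[OF that]] by (subst lin_cong[OF C_vspace, of _ "E2 F"]) (simp_all add: E)
  have carE: "E1 (F h) \<in> car \<A>\<^sub>1" if "bilin_map H H ground F" "h \<in> car H" for F h
    by (rule E1_car[OF lin_bilin1[OF that]])
  note rules = bilin_mapI lin_cop2_body lin_cop2_arg lin_amul1 lin_amul2 lin_scl lin_sclL lin_id f E1_car[OF f]
    is_algD(4)[OF A1] vspaceD(4)[OF A1v] linE[OF A] linE[OF B] linE[OF D] carE[OF A] carE[OF B] carE[OF D]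
    A1 A1v C_vspace cop2_car
  have c2: "E2 (\<lambda>h l. counit H h * f l) \<in> car \<A>\<^sub>2" "E2 (\<lambda>h l. counit H l * f h) \<in> car \<A>\<^sub>2"
    by (intro E2_car bilin_tensors f)+
  define X5 where "X5 = E2 D"
  define X4 where "X4 = amul \<A>\<^sub>2 (E2 (\<lambda>h l. counit H l * f h)) X5"
  define X3 where "X3 = amul \<A>\<^sub>2 (E2 B) X4"
  define X2 where "X2 = amul \<A>\<^sub>2 (E2 (\<lambda>h l. counit H h * f l)) X3"
  have X: "X5 \<in> car \<A>\<^sub>2" "X4 \<in> car \<A>\<^sub>2" "X3 \<in> car \<A>\<^sub>2" "X2 \<in> car \<A>\<^sub>2"
    unfolding X5_def X4_def X3_def X2_def by (intro is_algD(4)[OF A2_alg] E2_car c2 A B D)+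
  have x4: "X4 h = cop2 H h (\<lambda>h3 h4. scl \<A>\<^sub>1 (f h3) (E1 (D h4)))" if "h \<in> car H" for h
  proof -
    have "E2 (\<lambda>h l. counit H l * f h) a = scl \<A>\<^sub>1 (f a) (aone \<A>\<^sub>1)" if "a \<in> car H" for a
      using that by (simp add: fun_eq_iff E2_def Conv_simps(2,4))
    thus ?thesis
      using that unfolding X4_def X5_def Conv_simps(3)[where A = \<A>\<^sub>1]
      by (simp add: E carE[OF D] is_algD[OF A1] cong: cop2_cong)
  qed
  have x3: "X3 h = cop2 H h (\<lambda>h2 h'. cop2 H h' (\<lambda>h3 h4. ?m (E1 (B h2)) (scl \<A>\<^sub>1 (f h3) (E1 (D h4)))))" if "h \<in> car H" for h
  proof -
    have "?m (E1 (B h2)) (X4 h') = cop2 H h' (\<lambda>h3 h4. ?m (E1 (B h2)) (scl \<A>\<^sub>1 (f h3) (E1 (D h4))))"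
      if "h2 \<in> car H" "h' \<in> car H" for h2 h'
      unfolding x4[OF that(2)]
      by (rule cop2_map[where Z = \<A>\<^sub>1 and Z' = \<A>\<^sub>1]) (intro rules that; assumption)+
    thus ?thesis
      using that unfolding X3_def Conv_simps(3)[where A = \<A>\<^sub>1] by (simp add: E cong: cop2_cong)
  qed
  have x2: "X2 h = cop3 H h (\<lambda>h2 h3 h4. ?m (E1 f) (?m (E1 (B h2)) (scl \<A>\<^sub>1 (f h3) (E1 (D h4)))))" if h: "h \<in> car H" for h
  proof -
    have "X2 h = ?m (E1 f) (X3 h)"
    proof -
      have "E2 (\<lambda>h l. counit H h * f l) a = scl \<A>\<^sub>1 (counit H a) (E1 f)" if "a \<in> car H" for a
        using that by (simp add: fun_eq_iff E1_def E2_def Conv_simps(2))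
      hence "X2 h = cop2 H h (\<lambda>a b. scl \<A>\<^sub>1 (counit H a) (?m (E1 f) (X3 b)))"
        using h unfolding X2_def Conv_simps(3)[where A = \<A>\<^sub>1]
        by (simp add: is_algD[OF A1] E1_car[OF f] ConvD(2)[OF X(3)] cong: cop2_cong)
      also have "\<dots> = ?m (E1 f) (X3 h)"
        by (rule cop2_counitL[OF A1v lin_amul2[OF A1 E1_car[OF f] ConvD(1)[OF X(3)]] h])
      finally show ?thesis .
    qed
    also have "\<dots> = cop2 H h (\<lambda>h2 h'. ?m (E1 f) (cop2 H h' (\<lambda>h3 h4. ?m (E1 (B h2)) (scl \<A>\<^sub>1 (f h3) (E1 (D h4))))))"
      unfolding x3[OF h]
      by (rule cop2_map[where Z = \<A>\<^sub>1 and Z' = \<A>\<^sub>1]) (intro rules h; assumption)+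
    also have "\<dots> = cop3 H h (\<lambda>h2 h3 h4. ?m (E1 f) (?m (E1 (B h2)) (scl \<A>\<^sub>1 (f h3) (E1 (D h4)))))"
      unfolding cop3_def
      by (intro cop2_cong, rule cop2_map[where Z = \<A>\<^sub>1 and Z' = \<A>\<^sub>1]) (intro rules; assumption)+
    finally show ?thesis .
  qed
  have K2: "bilin_map H H \<A>\<^sub>1 (K a b)" if "a \<in> car H" "b \<in> car H" for a b
    unfolding K_def by (intro rules that; assumption)
  have K3: "bilin_map H H \<A>\<^sub>1 (\<lambda>b h'. cop2 H h' (K a b))" if "a \<in> car H" for a
    unfolding K_def by (intro rules that; assumption)
  have K4: "bilin_map H H \<A>\<^sub>1 (\<lambda>a h'. cop3 H h' (K a))"
    unfolding K_def cop3_def by (intro rules; assumption)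
  have "lprod \<A>\<^sub>2 [E2 A, E2 (\<lambda>h l. counit H h * f l), E2 B, E2 (\<lambda>h l. counit H l * f h), E2 D] h
      = amul \<A>\<^sub>2 (E2 A) X2 h"
    unfolding X2_def X3_def X4_def X5_def by (simp add: lprod_simps is_algD[OF A2_alg] E2_car D)
  also have "\<dots> = cop4 H h K"
  proof -
    have "?m (E1 (A h1)) (X2 h') = cop3 H h' (K h1)" if h: "h1 \<in> car H" "h' \<in> car H" for h1 h'
    proof -
      have "?m (E1 (A h1)) (X2 h') = cop2 H h' (\<lambda>h2 h''. ?m (E1 (A h1)) (cop2 H h'' (\<lambda>h3 h4. ?m (E1 f) (?m (E1 (B h2)) (scl \<A>\<^sub>1 (f h3) (E1 (D h4)))))))"
        unfolding x2[OF h(2)] cop3_def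
        by (rule cop2_map[where Z = \<A>\<^sub>1 and Z' = \<A>\<^sub>1]) (intro rules h; assumption)+
      also have "\<dots> = cop3 H h' (K h1)"
        unfolding cop3_def K_def
        by (intro cop2_cong, rule cop2_map[where Z = \<A>\<^sub>1 and Z' = \<A>\<^sub>1]) (intro rules h; assumption)+
      finally show ?thesis .
    qed
    thus ?thesis
      using h unfolding cop4_def Conv_simps(3)[where A = \<A>\<^sub>1] by (simp add: E cong: cop2_cong)
  qed
  finally have "lprod \<A>\<^sub>2 [E2 A, E2 (\<lambda>h l. counit H h * f l), E2 B, E2 (\<lambda>h l. counit H l * f h), E2 D] h l
      = cop4 H h K l" by simp
  also have "\<dots> = cop4 H h (\<lambda>h1 h2 h3 h4. K h1 h2 h3 h4 l)"
  proof -
    note ev = lin_eval[OF l, of base_alg]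
    have "cop4 H h K l = cop2 H h (\<lambda>h1 h'. cop3 H h' (K h1) l)"
      unfolding cop4_def using cop2_map[OF ev A1v is_vspace_base_alg K4 h] by simp
    also have "\<dots> = cop2 H h (\<lambda>h1 h'. cop2 H h' (\<lambda>h2 h''. cop2 H h'' (K h1 h2) l))"
      unfolding cop3_def using cop2_map[OF ev A1v is_vspace_base_alg K3] by (intro cop2_cong) simp
    also have "\<dots> = cop4 H h (\<lambda>h1 h2 h3 h4. K h1 h2 h3 h4 l)"
      unfolding cop4_def cop3_def using cop2_map[OF ev A1v is_vspace_base_alg K2] by (intro cop2_cong) simp
    finally show ?thesis .
  qed
  also have "\<dots> = cop4 H h (\<lambda>h1 h2 h3 h4. cop4 H l (\<lambda>l1 l2 l3 l4. A h1 l1 * f l2 * B h2 l3 * f h3 * D h4 l4))"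
  proof -
    have "K h1 h2 h3 h4 l = cop4 H l (\<lambda>l1 l2 l3 l4. A h1 l1 * f l2 * B h2 l3 * f h3 * D h4 l4)"
      if c: "h1 \<in> car H" "h2 \<in> car H" "h3 \<in> car H" "h4 \<in> car H" for h1 h2 h3 h4
    proof -
      have "K h1 h2 h3 h4 = scl \<A>\<^sub>1 (f h3) (lprod \<A>\<^sub>1 [E1 (A h1), E1 f, E1 (B h2), E1 (D h4)])"
        unfolding K_def using c
        by (simp add: lprod_simps is_algD[OF A1] carE A B D E1_car f)
      hence "K h1 h2 h3 h4 l = f h3 * lprod \<A>\<^sub>1 [E1 (A h1), E1 f, E1 (B h2), E1 (D h4)] l"
        by (simp add: Conv_simps(2))
      also have "\<dots> = cop4 H l (\<lambda>l1 l2 l3 l4. f h3 * A h1 l1 * f l2 * B h2 l3 * D h4 l4)"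
        using c by (intro cop4_lprod[symmetric] l f lin_bilin1[OF A] lin_bilin1[OF B] lin_bilin1[OF D])
      finally show ?thesis by (simp add: mult_ac)
    qed
    thus ?thesis unfolding cop4_def cop3_def by (intro cop2_cong) simp
  qed
  finally show ?thesis ..
qed


subsection \<open>Scalars at grouplikes\<close>

text \<open>
  On grouplikes both factors \<open>\<omega>\<close> in the quasi-associativity law are the same
  nonzero scalar.
\<close>

lemma grouplike_mul_assoc:
  assumes a: "a \<in> grouplike H" and b: "b \<in> grouplike H" and c: "c \<in> grouplike H"
  shows "mul H (mul H a b) c = mul H a (mul H b c)"
proof -
  note car = grouplikeD(1)[OF a] grouplikeD(1)[OF b] grouplikeD(1)[OF c]
  note rules = bilin_mapI lin_cop2_body lin_scl lin_sclL lin_mul1 lin_mul2 mul_car lin_omega lin_id C_vspace car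
  have "cop2 H a (\<lambda>h1 h2. cop2 H b (\<lambda>k1 k2. cop2 H c (\<lambda>l1 l2. scl H (omega H h2 k2 l2) (mul H h1 (mul H k1 l1)))))
     = cop2 H b (\<lambda>k1 k2. cop2 H c (\<lambda>l1 l2. scl H (omega H a k2 l2) (mul H a (mul H k1 l1))))"
    by (rule cop2_grouplike[OF a C_vspace]) (intro rules; assumption)
  also have "\<dots> = cop2 H c (\<lambda>l1 l2. scl H (omega H a b l2) (mul H a (mul H b l1)))"
    by (rule cop2_grouplike[OF b C_vspace]) (intro rules; assumption)
  also have "\<dots> = scl H (omega H a b c) (mul H a (mul H b c))"
    by (rule cop2_grouplike[OF c C_vspace]) (intro rules; assumption)
  finally have 1: "cop2 H a (\<lambda>h1 h2. cop2 H b (\<lambda>k1 k2. cop2 H c (\<lambda>l1 l2. scl H (omega H h2 k2 l2) (mul H h1 (mul H k1 l1)))))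
    = scl H (omega H a b c) (mul H a (mul H b c))" .
  have "cop2 H a (\<lambda>h1 h2. cop2 H b (\<lambda>k1 k2. cop2 H c (\<lambda>l1 l2. scl H (omega H h1 k1 l1) (mul H (mul H h2 k2) l2))))
     = cop2 H b (\<lambda>k1 k2. cop2 H c (\<lambda>l1 l2. scl H (omega H a k1 l1) (mul H (mul H a k2) l2)))"
    by (rule cop2_grouplike[OF a C_vspace]) (intro rules; assumption)
  also have "\<dots> = cop2 H c (\<lambda>l1 l2. scl H (omega H a b l1) (mul H (mul H a b) l2))"
    by (rule cop2_grouplike[OF b C_vspace]) (intro rules; assumption)
  also have "\<dots> = scl H (omega H a b c) (mul H (mul H a b) c)"
    by (rule cop2_grouplike[OF c C_vspace]) (intro rules; assumption)
  finally have "scl H (omega H a b c) (mul H a (mul H b c)) = scl H (omega H a b c) (mul H (mul H a b) c)"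
    using dqb car 1 by (simp add: dual_quasi_bialgebra_def)
  hence "scl H (omega_inv H a b c) (scl H (omega H a b c) (mul H a (mul H b c)))
    = scl H (omega_inv H a b c) (scl H (omega H a b c) (mul H (mul H a b) c))" by simp
  thus ?thesis
    using omega_scalar_inverse[OF a b c] by (simp add: vspace_simps[OF C_vspace] mult.commute)
qed

lemma omega_scalar_cocycle:
  assumes "a \<in> grouplike H" "b \<in> grouplike H" "c \<in> grouplike H" "d \<in> grouplike H"
  shows "omega H b c d * omega H a (mul H b c) d * omega H a b c
    = omega H a b (mul H c d) * omega H (mul H a b) c d"
proof -
  have "alg_hom \<A>\<^sub>4 base_alg (\<lambda>\<alpha>. \<alpha> a b c d)"
    by (rule alg_hom_comp[OF alg_hom_eval alg_hom_eval3]) (intro algs assms)+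
  from cocycle_hom(1)[OF this] show ?thesis
    using assms[THEN grouplikeD(1)] assms[THEN grouplikeD(2)]
    by (simp add: lprod_simps \<Phi>_apply \<Omega>_def E3_def mul_car mult_ac)
qed

lemma tensor_char_grouplike:
  assumes a: "a \<in> grouplike H" "b \<in> grouplike H" "lin_map H ground \<chi>" "lin_map H ground \<chi>'" and x: "x \<in> grouplike H"
  shows "tensor_char a b \<chi> \<chi>' x = omega H x a b * \<chi> x * omega_inv H a x b * \<chi>' x * omega H a b x"
proof -
  have "tensor_char a b \<chi> \<chi>' x = E1 (tensor_char a b \<chi> \<chi>') x" using grouplikeD(1)[OF x] by (simp add: E1_def)
  also have "\<dots> = lprod base_alg (map (\<lambda>\<alpha>. \<alpha> x) [E1 (\<lambda>h. omega H h a b), E1 \<chi>,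
    E1 (\<lambda>h. omega_inv H a h b), E1 \<chi>', E1 (\<lambda>h. omega H a b h)])"
    unfolding E1_tensor_char[OF a]
    by (rule alg_hom_lprod[OF A1_alg alg_hom_eval[OF is_alg_base_alg x]]) (simp add: omega_E1_car E1_car a)
  finally show ?thesis using grouplikeD(1)[OF x] by (simp add: lprod_simps E1_def)
qed

lemma tensor_char_cong:
  assumes "a \<in> grouplike H" "b \<in> grouplike H" "lin_map H ground \<chi>" "lin_map H ground \<chi>'" "lin_map H ground \<chi>''"
    and "\<And>h. h \<in> car H \<Longrightarrow> \<chi>' h = \<chi>'' h" and "h \<in> car H"
  shows "tensor_char a b \<chi> \<chi>' h = tensor_char a b \<chi> \<chi>'' h"
proof -
  have "E1 \<chi>' = E1 \<chi>''" using assms(6) by (auto simp: E1_def)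
  hence "E1 (tensor_char a b \<chi> \<chi>') = E1 (tensor_char a b \<chi> \<chi>'')"
    by (simp add: E1_tensor_char assms)
  thus ?thesis using assms(7) by (rule E1_eqD)
qed

lemma tensor_char_unit:
  assumes "b \<in> grouplike H" "lin_map H ground \<chi>" "h \<in> car H"
  shows "tensor_char (one H) b (counit H) \<chi> h = \<chi> h"
proof -
  have e: "E1 (counit H) = aone \<A>\<^sub>1" by (auto simp: fun_eq_iff E1_def Conv_simps(4))
  have "E1 (\<lambda>h. omega H h (one H) b) = aone \<A>\<^sub>1" "E1 (\<lambda>h. omega_inv H (one H) h b) = aone \<A>\<^sub>1"
    "E1 (\<lambda>h. omega H (one H) b h) = aone \<A>\<^sub>1"
    using grouplikeD[OF assms(1)] by (auto simp: e[symmetric] fun_eq_iff E1_def omega_one)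
  hence "E1 (tensor_char (one H) b (counit H) \<chi>) = E1 \<chi>"
    unfolding E1_tensor_char[OF one_grouplike assms(1) lin_counit assms(2)]
    by (simp add: lprod_simps e is_algD[OF A1_alg] E1_car assms)
  thus ?thesis using assms(3) by (rule E1_eqD)
qed

text \<open>
  Linear functionals separate the points of a vector space. This removes the functional
  \<open>F\<close> from the second equation in \<open>yd_character\<close>.
\<close>

lemma functional_eqI:
  assumes "x \<in> car H" "y \<in> car H" "\<And>F. lin_map H ground F \<Longrightarrow> F x = F y"
  shows "x = y"
proof (rule ccontr)
  assume "x \<noteq> y"
  hence "x - y \<noteq> 0" by simp
  moreover have "vector_space (scl H)" using C_vspace by (simp add: is_vspace_def)
  ultimately obtain \<phi> where \<phi>: "Vector_Spaces.linear (scl H) ((*) :: 'k \<Rightarrow> 'k \<Rightarrow> 'k) \<phi>" "\<phi> (x - y) = 1"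
    using separating_functional by metis
  interpret Vector_Spaces.linear "scl H" "(*) :: 'k \<Rightarrow> 'k \<Rightarrow> 'k" \<phi> by fact
  have "lin_map H ground \<phi>" by (simp add: lin_map_def add scale)
  from assms(3)[OF this] \<phi>(2) show False by (simp add: diff)
qed

lemma yd_character_twist_H:
  assumes "yd_character g \<chi>" "h \<in> car H"
  shows "cop2 H h (\<lambda>h1 h2. scl H (\<chi> h1) (mul H g h2)) = cop2 H h (\<lambda>h1 h2. scl H (\<chi> h2) (mul H h1 g))"
proof (rule functional_eqI)
  note d = yd_characterD[OF assms(1)]
  have b: "bilin_map H H H (\<lambda>h1 h2. scl H (\<chi> h1) (mul H g h2))" "bilin_map H H H (\<lambda>h1 h2. scl H (\<chi> h2) (mul H h1 g))"
    by (intro bilin_mapI lin_scl lin_sclL lin_mul1 lin_mul2 lin_id C_vspace d mul_car; assumption)+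
  show "cop2 H h (\<lambda>h1 h2. scl H (\<chi> h1) (mul H g h2)) \<in> car H" "cop2 H h (\<lambda>h1 h2. scl H (\<chi> h2) (mul H h1 g)) \<in> car H"
    by (intro cop2_car C_vspace assms(2) b)+
  fix F assume F: "lin_map H ground F"
  show "F (cop2 H h (\<lambda>h1 h2. scl H (\<chi> h1) (mul H g h2))) = F (cop2 H h (\<lambda>h1 h2. scl H (\<chi> h2) (mul H h1 g)))"
    unfolding cop2_map[OF F C_vspace is_vspace_ground b(1) assms(2)] cop2_map[OF F C_vspace is_vspace_ground b(2) assms(2)]
    using d(5)[OF F assms(2)] by (simp add: lin_mapD(3)[OF F] mul_car d(3) mult.commute cong: cop2_cong)
qed

lemma yd_character_mul:
  assumes "yd_character g \<chi>" "h \<in> car H" "l \<in> car H"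
  shows "\<chi> (mul H h l) = cop4 H h (\<lambda>h1 h2 h3 h4. cop4 H l (\<lambda>l1 l2 l3 l4.
            omega_inv H h1 l1 g * \<chi> l2 * omega H h2 g l3 * \<chi> h3 * omega_inv H g h4 l4))"
proof -
  note d = yd_characterD[OF assms(1)]
  have "\<chi> (mul H h l) = cmu (E1 \<chi>) h l" using assms by (simp add: cmu_def E1_def mul_car)
  thus ?thesis unfolding d(4)
    using cop44_lprod[OF bilin_omegas(1)[OF omega_inv_trilin d(3)] bilin_omegas(2)[OF omega_trilin d(3)]
        bilin_omegas(3)[OF omega_inv_trilin d(3)] d(2) assms(2,3)] by simp
qed

end

section \<open>The characters of a quasi-Yetter-Drinfeld datum\<close>

locale qyd = dual_quasi_bialg H for H :: "('k::field, 'h::ab_group_add, 'm) dqb_scheme" +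
  fixes g :: 'h and \<chi> :: "'h \<Rightarrow> 'k"
  assumes datum: "qYD_datum H g \<chi>"
begin

lemma g_grouplike: "g \<in> grouplike H" and lin_\<chi>: "lin_map H ground \<chi>" and \<chi>_one: "\<chi> (one H) = 1"
  using datum by (simp_all add: qYD_datum_def)

lemma yd_character_datum: "yd_character g \<chi>"
  unfolding yd_character_def
proof (intro conjI allI impI g_grouplike lin_\<chi>)
  note gc = grouplikeD(1)[OF g_grouplike]
  note b = bilin_omegas(1)[OF omega_inv_trilin gc] bilin_omegas(2)[OF omega_trilin gc]
        bilin_omegas(3)[OF omega_inv_trilin gc]
  let ?L = "[E2 (\<lambda>h l. omega_inv H h l g), E2 (\<lambda>h l. counit H h * \<chi> l),
        E2 (\<lambda>h l. omega H h g l), E2 (\<lambda>h l. counit H l * \<chi> h), E2 (\<lambda>h l. omega_inv H g h l)]"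
  show "cmu (E1 \<chi>) = lprod \<A>\<^sub>2 ?L"
  proof (rule A2_eqI)
    show "cmu (E1 \<chi>) \<in> car \<A>\<^sub>2" by (intro alg_homD(4)[OF alg_hom_cmu] algs E1_car lin_\<chi>)
    show "lprod \<A>\<^sub>2 ?L \<in> car \<A>\<^sub>2"
      by (intro lprod_car[OF A2_alg]) (simp add: b[THEN E2_car] bilin_tensors[OF lin_\<chi>, THEN E2_car])
    fix h l assume hl: "h \<in> car H" "l \<in> car H"
    have "cmu (E1 \<chi>) h l = \<chi> (mul H h l)" using hl by (simp add: cmu_def E1_def mul_car)
    also have "\<dots> = cop4 H h (\<lambda>h1 h2 h3 h4. cop4 H l (\<lambda>l1 l2 l3 l4.
            omega_inv H h1 l1 g * \<chi> l2 * omega H h2 g l3 * \<chi> h3 * omega_inv H g h4 l4))"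
      using datum hl by (simp add: qYD_datum_def)
    also have "\<dots> = lprod \<A>\<^sub>2 ?L h l" by (rule cop44_lprod[OF b lin_\<chi> hl])
    finally show "cmu (E1 \<chi>) h l = lprod \<A>\<^sub>2 ?L h l" .
  qed
  fix F h assume F: "lin_map H ground F" and h: "h \<in> car H"
  have b: "bilin_map H H H (\<lambda>h1 h2. scl H (\<chi> h1) (mul H g h2))" "bilin_map H H H (\<lambda>h1 h2. scl H (\<chi> h2) (mul H h1 g))"
    by (intro bilin_mapI lin_scl lin_sclL lin_mul1 lin_mul2 lin_id C_vspace gc lin_\<chi> mul_car; assumption)+
  have "F (cop2 H h (\<lambda>h1 h2. scl H (\<chi> h1) (mul H g h2))) = F (cop2 H h (\<lambda>h1 h2. scl H (\<chi> h2) (mul H h1 g)))"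
    using datum h by (simp add: qYD_datum_def)
  thus "cop2 H h (\<lambda>a b. \<chi> a * F (mul H g b)) = cop2 H h (\<lambda>a b. F (mul H a g) * \<chi> b)"
    unfolding cop2_map[OF F C_vspace is_vspace_ground b(1) h] cop2_map[OF F C_vspace is_vspace_ground b(2) h]
    by (simp add: lin_mapD(3)[OF F] mul_car gc mult.commute cong: cop2_cong)
qed

abbreviation "gp \<equiv> gpow H g"
abbreviation "chi \<equiv> chi_br H g \<chi>"

lemma yd_character_chi: "yd_character (gp n) (chi n)"
proof (induction n)
  case (Suc n)
  from yd_character_tensor[OF yd_character_datum this] show ?case by (simp add: tensor_char_def)
qed (simp add: yd_character_one)

lemmas gp_grouplike = yd_characterD(1)[OF yd_character_chi]
  and lin_chi = yd_characterD(2)[OF yd_character_chi]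
  and gp_car = yd_characterD(3)[OF yd_character_chi]

lemma gp_counit [simp]: "counit H (gp n) = 1"
  by (rule grouplikeD(2)[OF gp_grouplike])

lemma gp_1: "gp (Suc 0) = g"
  by (simp add: mul_one grouplikeD(1)[OF g_grouplike])

lemma gp_add: "mul H (gp a) (gp b) = gp (a + b)"
  by (induction a) (simp_all add: mul_one gp_car grouplike_mul_assoc g_grouplike gp_grouplike)

lemma chi_Suc: "chi (Suc n) = tensor_char g (gp n) \<chi> (chi n)"
  by (simp add: tensor_char_def)

text \<open>
  By definition \<open>\<chi>\<^bsub>[n]\<^esub>\<close> belongs to the tensor power bracketed to
  the right. Induction on \<open>a\<close> with the associativity of \<open>tensor_char\<close>
  splits off the first \<open>a\<close> factors.
\<close>

lemma chi_add: "h \<in> car H \<Longrightarrow> tensor_char (gp a) (gp b) (chi a) (chi b) h = chi (a + b) h"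
proof (induction a arbitrary: h)
  case 0
  show ?case using tensor_char_unit[OF gp_grouplike lin_chi 0] by simp
next
  case (Suc a)
  have "chi (Suc a + b) h = tensor_char g (gp (a + b)) \<chi> (chi (a + b)) h"
    unfolding add_Suc chi_Suc ..
  also have "\<dots> = tensor_char g (mul H (gp a) (gp b)) \<chi> (tensor_char (gp a) (gp b) (chi a) (chi b)) h"
    unfolding gp_add using Suc
    by (intro tensor_char_cong) (simp_all add: g_grouplike gp_grouplike lin_\<chi> lin_chi lin_tensor_char)
  also have "\<dots> = tensor_char (mul H g (gp a)) (gp b) (tensor_char g (gp a) \<chi> (chi a)) (chi b) h"
    by (rule tensor_char_assoc[OF yd_character_datum yd_character_chi yd_character_chi Suc.prems, symmetric])
  finally show ?case by (simp add: tensor_char_def)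
qed

lemma chi_one: "chi n (one H) = 1"
proof (induction n)
  case (Suc n)
  thus ?case
    unfolding chi_Suc
    by (simp add: tensor_char_grouplike g_grouplike gp_grouplike lin_\<chi> lin_chi one_grouplike \<chi>_one
        omega_one one_car gp_car grouplikeD[OF g_grouplike])
qed (simp add: grouplikeD(2)[OF one_grouplike])

subsection \<open>Values at powers of the grouplike\<close>

definition omg :: "nat \<Rightarrow> nat \<Rightarrow> nat \<Rightarrow> 'k" where "omg a b c = omega H (gp a) (gp b) (gp c)"
definition omgi :: "nat \<Rightarrow> nat \<Rightarrow> nat \<Rightarrow> 'k" where "omgi a b c = omega_inv H (gp a) (gp b) (gp c)"
text \<open>
  The coefficient of the multiplication of \<open>R\<close>, as a cochain in the exponents. Its
  coboundary is \<open>\<omega>\<^sup>-\<^sup>1\<close> at powers of \<open>g\<close>.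
\<close>

definition cobd :: "nat \<Rightarrow> nat \<Rightarrow> 'k" where "cobd a b = (\<Prod>i<a. omgi 1 i b)"

lemma omg_omgi: "omg a b c * omgi a b c = 1"
  unfolding omg_def omgi_def by (intro omega_scalar_inverse gp_grouplike)

lemma omg_nz: "omg a b c \<noteq> 0" "omgi a b c \<noteq> 0"
  using omg_omgi[of a b c] by auto

lemma omg_eq: "omg a b c = 1 / omgi a b c"
  using omg_omgi[of a b c] omg_nz[of a b c] by (simp add: field_simps)

lemma omgi_zero [simp]: "omgi 0 b c = 1" "omgi a 0 c = 1" "omgi a b 0 = 1"
  unfolding omgi_def gpow.simps(1) using omega_one[OF gp_car gp_car] by simp_all

lemma cobd_nz: "cobd a b \<noteq> 0"
  by (simp add: cobd_def omg_nz)

lemma cobd_simps [simp]: "cobd 0 b = 1" "cobd (Suc a) b = cobd a b * omgi 1 a b" "cobd a 0 = 1"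
  by (simp_all add: cobd_def)

lemma omg_cocycle: "omgi b c d * omgi a (b + c) d * omgi a b c = omgi a b (c + d) * omgi (a + b) c d"
proof -
  have "omg b c d * omg a (b + c) d * omg a b c = omg a b (c + d) * omg (a + b) c d"
    using omega_scalar_cocycle[OF gp_grouplike[of a] gp_grouplike[of b] gp_grouplike[of c] gp_grouplike[of d]]
    by (simp add: omg_def gp_add)
  thus ?thesis by (simp add: omg_eq omg_nz field_simps)
qed

text \<open>
  Induction on \<open>a\<close>: the cocycle condition at \<open>g, g\<^sup>a, g\<^sup>b,
  g\<^sup>c\<close> expresses \<open>\<omega>\<^sup>-\<^sup>1(g\<^bsup>a+1\<^esup>, g\<^sup>b,
  g\<^sup>c)\<close> through \<open>\<omega>\<^sup>-\<^sup>1(g\<^sup>a, g\<^sup>b,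
  g\<^sup>c)\<close> and three values of \<open>\<omega>\<^sup>-\<^sup>1\<close> whose first
  argument is \<open>g\<close>. Those are the quotients of consecutive values of
  \<open>cobd\<close>.
\<close>

lemma omgi_coboundary: "omgi a b c = cobd a b * cobd (a + b) c / (cobd b c * cobd a (b + c))"
proof -
  have "omgi a b c * (cobd b c * cobd a (b + c)) = cobd a b * cobd (a + b) c"
  proof (induction a)
    case (Suc a)
    have "omgi 1 a (b + c) * (omgi (Suc a) b c * (cobd b c * cobd (Suc a) (b + c)))
       = (omgi 1 a (b + c) * omgi (Suc a) b c) * (cobd b c * cobd a (b + c)) * omgi 1 a (b + c)" by simp
    also have "\<dots> = (omgi a b c * (cobd b c * cobd a (b + c))) * omgi 1 (a + b) c * omgi 1 a b * omgi 1 a (b + c)"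
      using omg_cocycle[of a b c 1] by (simp add: mult_ac)
    also have "\<dots> = omgi 1 a (b + c) * (cobd (Suc a) b * cobd (Suc a + b) c)"
      unfolding Suc.IH by simp
    finally show ?case by (simp add: omg_nz)
  qed simp
  thus ?thesis by (simp add: cobd_nz field_simps)
qed

lemma cobd_1 [simp]: "cobd (Suc 0) b = 1"
  by simp

text \<open>
  The first axiom of a datum at \<open>h = g\<close> and \<open>l = g\<^sup>b\<close> is a
  recursion in \<open>b\<close>.
\<close>

lemma datum_char_gp: "\<chi> (gp b) = \<chi> g ^ b * cobd b 1"
proof (induction b)
  case (Suc b)
  note gl = g_grouplike gp_grouplike[of b]
  have g1: "gp 1 = g" using gp_1 by simp
  let ?L = "[E2 (\<lambda>h l. omega_inv H h l g), E2 (\<lambda>h l. counit H h * \<chi> l),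
        E2 (\<lambda>h l. omega H h g l), E2 (\<lambda>h l. counit H l * \<chi> h), E2 (\<lambda>h l. omega_inv H g h l)]"
  have "set ?L \<subseteq> car \<A>\<^sub>2"
    by (simp add: E2_car bilin_omegas omega_inv_trilin omega_trilin grouplikeD(1)[OF g_grouplike] bilin_tensors lin_\<chi>)
  from alg_hom_lprod[OF A2_alg alg_hom_eval2[OF is_alg_base_alg gl] this]
  have "lprod \<A>\<^sub>2 ?L g (gp b) = omega_inv H g (gp b) g * \<chi> (gp b) * omega H g g (gp b) * \<chi> g * omega_inv H g g (gp b)"
    using grouplikeD[OF g_grouplike] by (simp add: lprod_simps E2_def gp_car)
  moreover have "\<chi> (gp (Suc b)) = lprod \<A>\<^sub>2 ?L g (gp b)"
    unfolding yd_characterD(4)[OF yd_character_datum, symmetric]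
    using grouplikeD[OF g_grouplike] by (simp add: cmu_def E1_def mul_car gp_car)
  ultimately have "\<chi> (gp (Suc b)) = omgi 1 b 1 * \<chi> (gp b) * \<chi> g * (omg 1 1 b * omgi 1 1 b)"
    unfolding omg_def omgi_def g1 by (simp add: mult_ac)
  thus ?case unfolding omg_omgi using Suc by (simp add: mult_ac)
qed (simp add: \<chi>_one)

text \<open>
  The recursion for \<open>\<chi>\<^bsub>[c]\<^esub>\<close>, evaluated at the grouplike
  \<open>g\<^sup>b\<close>, involves three values of
  \<open>\<omega>\<^sup>\<plusminus>\<^sup>1\<close>. Written as coboundaries they telescope.
\<close>

lemma chi_gp: "chi c (gp b) = \<chi> g ^ (b * c) * cobd b c / cobd c b"
proof (induction c)
  case (Suc c)
  have g1: "gp 1 = g" using gp_1 by simp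
  have "chi (Suc c) (gp b) = omg b 1 c * \<chi> (gp b) * omgi 1 b c * chi c (gp b) * omg 1 c b"
    unfolding chi_Suc omg_def omgi_def g1
    by (rule tensor_char_grouplike[OF g_grouplike gp_grouplike lin_\<chi> lin_chi gp_grouplike])
  thus ?case
    unfolding Suc.IH datum_char_gp omg_eq omgi_coboundary[of b 1 c] omgi_coboundary[of 1 b c] omgi_coboundary[of 1 c b]
    using cobd_nz by (simp add: field_simps power_add cobd_nz del: cobd_simps(2))
qed (simp add: gp_counit)

end


section \<open>Finite bases\<close>

lemma lin_congI:
  assumes "is_vspace V" "lin_map V Z g" "\<And>v. v \<in> car V \<Longrightarrow> f v = g v"
  shows "lin_map V Z f"
  using assms(2,3) by (subst lin_cong[OF assms(1), of f g])

lemma sweedler_sum_body: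
  assumes V: "is_vspace V" and Z: "is_vspace Z" and t: "t \<in> car (tensor_space V W)"
    and b: "\<And>i. i \<in> I \<Longrightarrow> bilin_map V W Z (F i)"
  shows "sweedler V W t (\<lambda>v w. \<Sum>i\<in>I. F i v w) = (\<Sum>i\<in>I. sweedler V W t (F i))"
proof -
  obtain xs where xs: "set xs \<subseteq> car V \<times> car W" "t = (\<Sum>(v, w)\<leftarrow>xs. tens V W v w)"
    using tensor_space_sumE[OF V t] by metis
  have b': "bilin_map V W Z (\<lambda>v w. \<Sum>i\<in>I. F i v w)"
    by (intro bilin_mapI lin_sum Z lin_bilin1[OF b] lin_bilin2[OF b])
  have "(\<Sum>(v, w)\<leftarrow>xs. \<Sum>i\<in>I. F i v w) = (\<Sum>i\<in>I. \<Sum>(v, w)\<leftarrow>xs. F i v w)"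
    by (induction xs) (auto simp: sum.distrib)
  thus ?thesis
    unfolding xs(2) sweedler_sum[OF Z b' xs(1)] using sweedler_sum[OF Z b xs(1)] by simp
qed

lemma sweedler_scl:
  assumes V: "is_vspace V" and Z: "is_vspace Z" and t: "t \<in> car (tensor_space V W)"
    and b: "bilin_map V W ground f" and z: "z \<in> car Z"
  shows "sweedler V W t (\<lambda>v w. scl Z (f v w) z) = scl Z (sweedler V W t f) z"
  by (rule sweedler_map[OF V is_vspace_ground Z t b, symmetric]) (intro lin_sclL Z z lin_id)

lemma sweedler_id:
  assumes V: "is_vspace V" and t: "t \<in> car (tensor_space V W)"
  shows "sweedler V W t (tens V W) = t"
proof -
  obtain xs where xs: "set xs \<subseteq> car V \<times> car W" "t = (\<Sum>(v, w)\<leftarrow>xs. tens V W v w)"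
    using tensor_space_sumE[OF V t] by metis
  thus ?thesis using sweedler_sum[OF is_vspace_tensor_space bilin_map_tens xs(1)] by simp
qed

text \<open>
  A finite basis \<open>e\<close> together with its coordinate functionals \<open>c\<close>.
  Carrying the functionals along makes coactions and actions given in coordinates visibly linear.
\<close>

definition basis :: "('k::field, 'v::ab_group_add, 'm) vspace_scheme \<Rightarrow> 'i set \<Rightarrow> ('i \<Rightarrow> 'v)
    \<Rightarrow> ('i \<Rightarrow> 'v \<Rightarrow> 'k) \<Rightarrow> bool" where
  "basis V I e c \<longleftrightarrow> is_vspace V \<and> finite I \<and> (\<forall>i\<in>I. e i \<in> car V \<and> lin_map V ground (c i))
    \<and> (\<forall>i\<in>I. \<forall>j\<in>I. c i (e j) = (if i = j then 1 else 0))
    \<and> (\<forall>v\<in>car V. v = (\<Sum>i\<in>I. scl V (c i v) (e i)))"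

lemma basisD:
  assumes "basis V I e c"
  shows "is_vspace V" "finite I" "i \<in> I \<Longrightarrow> e i \<in> car V" "i \<in> I \<Longrightarrow> lin_map V ground (c i)"
    "i \<in> I \<Longrightarrow> j \<in> I \<Longrightarrow> c i (e j) = (if i = j then 1 else 0)"
    "v \<in> car V \<Longrightarrow> v = (\<Sum>i\<in>I. scl V (c i v) (e i))"
  using assms unfolding basis_def by blast+

lemma lin_map_basis:
  assumes b: "basis V I e c" and f: "lin_map V Z f" and v: "v \<in> car V"
  shows "f v = (\<Sum>i\<in>I. scl Z (c i v) (f (e i)))"
proof -
  note d = basisD[OF b]
  have "f v = f (\<Sum>i\<in>I. scl V (c i v) (e i))" using d(6)[OF v] by simp
  also have "\<dots> = (\<Sum>i\<in>I. f (scl V (c i v) (e i)))"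
    by (rule lin_map_sum[OF d(1) f]) (intro vspaceD(4)[OF d(1)] d)
  also have "\<dots> = (\<Sum>i\<in>I. scl Z (c i v) (f (e i)))"
    by (intro sum.cong refl lin_mapD(3)[OF f] d)
  finally show ?thesis .
qed

lemma lin_map_eq_on_basis:
  assumes "basis V I e c" "lin_map V Z f" "lin_map V Z f'" "\<And>i. i \<in> I \<Longrightarrow> f (e i) = f' (e i)" "v \<in> car V"
  shows "f v = f' v"
  using assms(4) by (simp add: lin_map_basis[OF assms(1,2,5)] lin_map_basis[OF assms(1,3,5)])

lemma bilin_coords:
  assumes "basis V I e c" "basis W J f d" "i \<in> I" "j \<in> J"
  shows "bilin_map V W ground (\<lambda>v w. c i v * d j w)"
  by (intro bilin_mapI lin_mulL lin_mulR basisD[OF assms(1)] basisD[OF assms(2)] assms(3,4))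

lemma basis_tensor:
  assumes V: "basis V I e c" and W: "basis W J f d"
  shows "basis (tensor_space V W) (I \<times> J) (\<lambda>(i, j). tens V W (e i) (f j))
    (\<lambda>(i, j) t. sweedler V W t (\<lambda>v w. c i v * d j w))"
proof -
  note v = basisD[OF V] and w = basisD[OF W] and bc = bilin_coords[OF V W]
  have "t = (\<Sum>(i, j)\<in>I \<times> J. tscl (sweedler V W t (\<lambda>v w. c i v * d j w)) (tens V W (e i) (f j)))"
    if t: "t \<in> car (tensor_space V W)" for t
  proof -
    have exp: "tens V W x y = (\<Sum>p\<in>I \<times> J. tscl (c (fst p) x * d (snd p) y) (tens V W (e (fst p)) (f (snd p))))"
      if "x \<in> car V" "y \<in> car W" for x y
    proof -
      have "tens V W x y = (\<Sum>i\<in>I. tscl (c i x) (tens V W (e i) y))"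
        using lin_map_basis[OF V lin_tens1[OF that(2) lin_id] that(1)] by simp
      also have "\<dots> = (\<Sum>i\<in>I. tscl (c i x) (\<Sum>j\<in>J. tscl (d j y) (tens V W (e i) (f j))))"
        using lin_map_basis[OF W lin_tens2[OF v(3) lin_id] that(2)] by (intro sum.cong) simp_all
      also have "\<dots> = (\<Sum>i\<in>I. \<Sum>j\<in>J. tscl (c i x * d j y) (tens V W (e i) (f j)))"
        by (simp add: tspace_simps)
      finally show ?thesis by (simp add: sum.cartesian_product case_prod_beta')
    qed
    have tc: "tens V W (e (fst p)) (f (snd p)) \<in> car (tensor_space V W)" if "p \<in> I \<times> J" for p
      using that by (auto intro!: tens_car v w)
    have "t = sweedler V W t (tens V W)" using sweedler_id[OF v(1) t] by simp
    also have "\<dots> = sweedler V W t (\<lambda>x y. \<Sum>p\<in>I \<times> J. tscl (c (fst p) x * d (snd p) y) (tens V W (e (fst p)) (f (snd p))))"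
      by (rule sweedler_cong) (rule exp)
    also have "\<dots> = (\<Sum>p\<in>I \<times> J. sweedler V W t (\<lambda>x y. tscl (c (fst p) x * d (snd p) y) (tens V W (e (fst p)) (f (snd p)))))"
      by (rule sweedler_sum_body[OF v(1) is_vspace_tensor_space[of V W] t])
         (intro bilin_mapI lin_tsclL lin_mulL lin_mulR v w tc[simplified]; auto)
    also have "\<dots> = (\<Sum>p\<in>I \<times> J. tscl (sweedler V W t (\<lambda>x y. c (fst p) x * d (snd p) y)) (tens V W (e (fst p)) (f (snd p))))"
      by (intro sum.cong refl) (rule sweedler_scl[OF v(1) is_vspace_tensor_space[of V W] t bc tc, simplified], auto)
    finally show ?thesis by (simp add: case_prod_beta')
  qed
  thus ?thesis
    unfolding basis_def
    by (auto simp: v w is_vspace_tensor_space tens_car case_prod_beta' sweedler_tens[OF is_vspace_ground bc]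
        intro!: lin_sweedler_arg is_vspace_ground bc lin_id)
qed

lemma sweedler_tens_basis:
  assumes "basis V I e c" "basis W J f d" "is_vspace Z" "bilin_map V W Z F" "i \<in> I" "j \<in> J"
  shows "sweedler V W (tens V W (e i) (f j)) F = F (e i) (f j)"
  by (intro sweedler_tens[OF assms(3,4)] basisD[OF assms(1)] basisD[OF assms(2)] assms(5,6))

text \<open>
  Inverse associators are defined as inverse functions on the carrier. On homogeneous bases the
  associator is a bijection of bases up to nonzero scalars, and for such maps the inverse function
  is linear and explicit.
\<close>

lemma monomial_map_inverse:
  assumes V: "basis V I e c" and W: "basis W J f d" and F: "lin_map V W F" and \<sigma>: "bij_betw \<sigma> I J"
    and mono: "\<And>i. i \<in> I \<Longrightarrow> F (e i) = scl W (\<mu> i) (f (\<sigma> i))" and nz: "\<And>i. i \<in> I \<Longrightarrow> \<mu> i \<noteq> 0"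
  shows "lin_map W V (inv_into (car V) F)"
    and "i \<in> I \<Longrightarrow> inv_into (car V) F (f (\<sigma> i)) = scl V (inverse (\<mu> i)) (e i)"
proof -
  note v = basisD[OF V] and w = basisD[OF W]
  have \<sigma>J: "\<sigma> i \<in> J" if "i \<in> I" for i using \<sigma> that by (auto simp: bij_betw_def)
  have coord: "d (\<sigma> i) (F x) = \<mu> i * c i x" if i: "i \<in> I" and x: "x \<in> car V" for i x
  proof -
    have "d (\<sigma> i) (F x) = (\<Sum>k\<in>I. c k x * d (\<sigma> i) (F (e k)))"
      using lin_map_basis[OF V lin_comp[OF w(4)[OF \<sigma>J[OF i]] F] x] by simp
    also have "\<dots> = (\<Sum>k\<in>I. if k = i then c k x * \<mu> k else 0)"
    proof (intro sum.cong refl)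
      fix k assume k: "k \<in> I"
      have "\<sigma> i = \<sigma> k \<longleftrightarrow> i = k" using \<sigma> i k by (auto simp: bij_betw_def inj_on_def)
      thus "c k x * d (\<sigma> i) (F (e k)) = (if k = i then c k x * \<mu> k else 0)"
        using k i by (simp add: mono lin_mapD(3)[OF w(4)] w(3,5) \<sigma>J)
    qed
    finally show ?thesis using i v(2) by (simp add: mult.commute)
  qed
  have inj: "inj_on F (car V)"
  proof (rule inj_onI)
    fix x y assume xy: "x \<in> car V" "y \<in> car V" "F x = F y"
    have "c i x = c i y" if "i \<in> I" for i
      using coord[OF that xy(1)] coord[OF that xy(2)] xy(3) nz[OF that] by simp
    hence "(\<Sum>i\<in>I. scl V (c i x) (e i)) = (\<Sum>i\<in>I. scl V (c i y) (e i))" by simp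
    thus "x = y" unfolding v(6)[OF xy(1), symmetric] v(6)[OF xy(2), symmetric] .
  qed
  have F_inv_e: "F (scl V (inverse (\<mu> i)) (e i)) = f (\<sigma> i)" if "i \<in> I" for i
    using that by (simp add: lin_mapD(3)[OF F] v(3) mono vspace_simps[OF w(1)] nz)
  show b: "inv_into (car V) F (f (\<sigma> i)) = scl V (inverse (\<mu> i)) (e i)" if "i \<in> I" for i
    using that by (intro inv_into_f_eq[OF inj] F_inv_e vspaceD(4)[OF v(1)] v)
  have surj: "F ` car V = car W"
  proof
    show "F ` car V \<subseteq> car W" using lin_mapD(1)[OF F] by auto
    show "car W \<subseteq> F ` car V"
    proof
      fix y assume y: "y \<in> car W"
      let ?x = "\<Sum>i\<in>I. scl V (d (\<sigma> i) y) (scl V (inverse (\<mu> i)) (e i))"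
      have x: "?x \<in> car V" by (intro vspaceD[OF v(1)] v)
      have "F ?x = (\<Sum>i\<in>I. scl W (d (\<sigma> i) y) (f (\<sigma> i)))"
      proof -
        have "F (scl V k (scl V (inverse (\<mu> i)) (e i))) = scl W k (f (\<sigma> i))" if "i \<in> I" for i k
          unfolding F_inv_e[OF that, symmetric] using that by (intro lin_mapD(3)[OF F] vspaceD(4)[OF v(1)] v)
        thus ?thesis by (subst lin_map_sum[OF v(1) F]) (simp_all add: vspaceD(4)[OF v(1)] v(3))
      qed
      also have "\<dots> = (\<Sum>j\<in>J. scl W (d j y) (f j))"
        using sum.reindex_bij_betw[OF \<sigma>] .
      finally have "F ?x = y" unfolding w(6)[OF y, symmetric] .
      thus "y \<in> F ` car V" by (rule rev_image_eqI[OF x, OF sym])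
    qed
  qed
  show "lin_map W V (inv_into (car V) F)"
    unfolding lin_map_def
  proof (intro conjI ballI allI)
    fix y assume "y \<in> car W"
    then obtain x where x: "x \<in> car V" "y = F x" using surj by blast
    show "inv_into (car V) F y \<in> car V" using x inj by simp
    fix k show "inv_into (car V) F (scl W k y) = scl V k (inv_into (car V) F y)"
      using x inj by (simp add: lin_mapD(3)[OF F, symmetric] vspaceD[OF v(1)])
    fix y' assume "y' \<in> car W"
    then obtain x' where x': "x' \<in> car V" "y' = F x'" using surj by blast
    show "inv_into (car V) F (y + y') = inv_into (car V) F y + inv_into (car V) F y'"
      using x x' inj by (simp add: lin_mapD(2)[OF F, symmetric] vspaceD[OF v(1)])
  qed
qed

section \<open>Dependence on the underlying vector space only\<close>

text \<open>
  Tensor products and linear maps depend on a structure only through its carrier and scalar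
  multiplication. These equations allow the records for tensor products of objects to be replaced
  by the tensor products of the underlying spaces.
\<close>

lemma tens_cong_space:
  assumes "car V = car V'" "scl V = scl V'" "car W = car W'" "scl W = scl W'"
  shows "tens V W = tens V' W'"
  unfolding tens_def bilin_map_def lin_map_def assms by simp

lemma lin_map_cong_space:
  assumes "car V = car V'" "scl V = scl V'" "car W = car W'" "scl W = scl W'"
  shows "lin_map V W = lin_map V' W'"
  unfolding lin_map_def assms by simp

lemma bilin_map_cong_space:
  assumes "car V = car V'" "scl V = scl V'" "car W = car W'" "scl W = scl W'" "car U = car U'" "scl U = scl U'"
  shows "bilin_map V W U = bilin_map V' W' U'"
  unfolding bilin_map_def lin_map_def assms by simp

lemma sweedler_cong_space:
  assumes "car V = car V'" "scl V = scl V'" "car W = car W'" "scl W = scl W'"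
  shows "sweedler V W = sweedler V' W'"
  unfolding sweedler_def assms tens_cong_space[OF assms] by simp

lemma tensor_space_cong_space:
  assumes "car V = car V'" "scl V = scl V'" "car W = car W'" "scl W = scl W'"
  shows "tensor_space V W = tensor_space V' W'" "subtensor V W = subtensor V' W'"
  by (simp_all add: tensor_space_def subtensor_def assms tens_cong_space[OF assms] fun_eq_iff)

lemma tmap_cong_space:
  assumes "car V = car V'" "scl V = scl V'" "car W = car W'" "scl W = scl W'"
    "car X = car X'" "scl X = scl X'" "car Y = car Y'" "scl Y = scl Y'"
  shows "tmap V W X Y = tmap V' W' X' Y'"
  unfolding tmap_def fun_eq_iff sweedler_cong_space[OF assms(1-4)] tens_cong_space[OF assms(5-8)] by simp

lemma yd_tensor_space [simp]:
  "car (yd_tensor H V W) = car (tensor_space V W)" "scl (yd_tensor H V W) = scl (tensor_space V W)"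
  by (simp_all add: yd_tensor_def)

lemma yd_unit_space [simp]: "car (yd_unit H) = car ground" "scl (yd_unit H) = scl ground"
  by (simp_all add: yd_unit_def)

section \<open>Graded comodules\<close>

context dual_quasi_bialg
begin

text \<open>Comodules with a basis of homogeneous vectors whose degrees are grouplike.\<close>

definition graded :: "('k, 'h, 'v::ab_group_add, 'n) yd_obj_scheme \<Rightarrow> 'i set \<Rightarrow> ('i \<Rightarrow> 'v)
    \<Rightarrow> ('i \<Rightarrow> 'v \<Rightarrow> 'k) \<Rightarrow> ('i \<Rightarrow> 'h) \<Rightarrow> bool" where
  "graded V I e c \<gamma> \<longleftrightarrow> basis V I e c \<and> (\<forall>i\<in>I. \<gamma> i \<in> grouplike H)
    \<and> (\<forall>v\<in>car V. coact V v = (\<Sum>i\<in>I. tscl (c i v) (tens H V (\<gamma> i) (e i))))"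

lemma gradedD:
  assumes "graded V I e c \<gamma>"
  shows "basis V I e c" "i \<in> I \<Longrightarrow> \<gamma> i \<in> grouplike H" "i \<in> I \<Longrightarrow> \<gamma> i \<in> car H"
    "v \<in> car V \<Longrightarrow> coact V v = (\<Sum>i\<in>I. tscl (c i v) (tens H V (\<gamma> i) (e i)))"
  using assms by (auto simp: graded_def grouplikeD)

lemma coa1_graded:
  assumes V: "graded V I e c \<gamma>" and Z: "is_vspace Z" and F: "bilin_map H V Z F" and v: "v \<in> car V"
  shows "coa1 H V v F = (\<Sum>i\<in>I. scl Z (c i v) (F (\<gamma> i) (e i)))"
proof -
  note g = gradedD[OF V] and b = basisD[OF gradedD(1)[OF V]]
  have lin: "lin_map (tensor_space H V) Z (\<lambda>t. sweedler H V t F)"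
    by (rule lin_map_sweedler[OF C_vspace Z F])
  have tc: "tens H V (\<gamma> i) (e i) \<in> car (tensor_space H V)" if "i \<in> I" for i
    using that by (simp add: tens_car g b)
  have "coa1 H V v F = (\<Sum>i\<in>I. sweedler H V (tscl (c i v) (tens H V (\<gamma> i) (e i))) F)"
    unfolding coa1_def g(4)[OF v]
    by (rule lin_map_sum[OF is_vspace_tensor_space lin]) (use tc in \<open>simp add: tspaceD\<close>)
  also have "\<dots> = (\<Sum>i\<in>I. scl Z (c i v) (F (\<gamma> i) (e i)))"
    using lin_mapD(3)[OF lin tc] by (intro sum.cong refl) (simp add: sweedler_tens[OF Z F] g b)
  finally show ?thesis .
qed

lemma sum_delta_scl:
  assumes "is_vspace Z" "finite I" "i \<in> I"
  shows "(\<Sum>k\<in>I. scl Z (if k = i then 1 else 0) (z k)) = z i"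
proof -
  have "(\<Sum>k\<in>I. scl Z (if k = i then 1 else 0) (z k)) = (\<Sum>k\<in>I. if k = i then z k else 0)"
    by (intro sum.cong refl) (simp add: vspace_simps[OF assms(1)])
  thus ?thesis using assms by simp
qed

lemma coa1_basis:
  assumes V: "graded V I e c \<gamma>" and Z: "is_vspace Z" and F: "bilin_map H V Z F" and i: "i \<in> I"
  shows "coa1 H V (e i) F = F (\<gamma> i) (e i)"
proof -
  note b = basisD[OF gradedD(1)[OF V]]
  have "coa1 H V (e i) F = (\<Sum>k\<in>I. scl Z (if k = i then 1 else 0) (F (\<gamma> k) (e k)))"
    unfolding coa1_graded[OF V Z F b(3)[OF i]] using i by (intro sum.cong refl) (simp add: b(5))
  thus ?thesis by (simp add: sum_delta_scl[OF Z b(2) i])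
qed

lemma lin_coa1:
  assumes V: "graded V I e c \<gamma>" and Z: "is_vspace Z" and F: "bilin_map H V Z F"
  shows "lin_map V Z (\<lambda>v. coa1 H V v F)"
proof -
  note g = gradedD[OF V] and b = basisD[OF gradedD(1)[OF V]]
  have "lin_map V Z (\<lambda>v. \<Sum>i\<in>I. scl Z (c i v) (F (\<gamma> i) (e i)))"
    by (intro lin_sum Z lin_sclL b bilin_mapD(1)[OF F] g)
  thus ?thesis by (rule lin_congI[OF b(1)]) (rule coa1_graded[OF V Z F])
qed

lemma lin_coact:
  assumes V: "graded V I e c \<gamma>"
  shows "lin_map V (tensor_space H V) (coact V)"
proof -
  note g = gradedD[OF V] and b = basisD[OF gradedD(1)[OF V]]
  have "lin_map V (tensor_space H V) (\<lambda>v. \<Sum>i\<in>I. tscl (c i v) (tens H V (\<gamma> i) (e i)))"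
    by (intro lin_sum is_vspace_tensor_space lin_tsclL b tens_car g)
  thus ?thesis by (rule lin_congI[OF b(1)]) (rule g(4))
qed

lemma coact_basis:
  assumes V: "graded V I e c \<gamma>" and i: "i \<in> I"
  shows "coact V (e i) = tens H V (\<gamma> i) (e i)"
proof -
  note g = gradedD[OF V] and b = basisD[OF gradedD(1)[OF V]]
  have "coact V (e i) = (\<Sum>k\<in>I. tscl (if k = i then 1 else 0) (tens H V (\<gamma> k) (e k)))"
    unfolding g(4)[OF b(3)[OF i]] using i by (intro sum.cong refl) (simp add: b(5))
  thus ?thesis using sum_delta_scl[OF is_vspace_tensor_space[of H V] b(2) i] by simp
qed

text \<open>
  Coassociativity and the counit law can be checked on the basis, where they say that the degrees
  are grouplike.
\<close>

lemma graded_left_comodule: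
  assumes V: "graded V I e c \<gamma>"
  shows "left_comodule H V"
proof -
  note g = gradedD[OF V] and b = basisD[OF gradedD(1)[OF V]]
  let ?T = "tensor_space H (tensor_space H V)"
  note T = is_vspace_tensor_space
  have bi: "bilin_map H V ?T (\<lambda>b v00. tens H (tensor_space H V) a (tens H V b v00))" if "a \<in> car H" for a
    by (intro bilin_mapI lin_tens1 lin_tens2 lin_id that tens_car; assumption)
  have bl: "bilin_map H V ?T (\<lambda>a v0. cop2 H a (\<lambda>a1 a2. tens H (tensor_space H V) a1 (tens H V a2 v0)))"
    by (intro bilin_mapI lin_cop2_arg lin_cop2_body lin_tens1 lin_tens2 lin_id T C_vspace b(1) | simp add: tens_car)+
  have br: "bilin_map H V ?T (\<lambda>a v0. coa1 H V v0 (\<lambda>b v00. tens H (tensor_space H V) a (tens H V b v00)))"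
  proof (intro bilin_mapI)
    show "lin_map V ?T (\<lambda>v0. coa1 H V v0 (\<lambda>b v00. tens H (tensor_space H V) a (tens H V b v00)))" if "a \<in> car H" for a
      by (rule lin_coa1[OF V T bi[OF that]])
    fix v0 assume v0: "v0 \<in> car V"
    have "lin_map H ?T (\<lambda>a. \<Sum>i\<in>I. tscl (c i v0) (tens H (tensor_space H V) a (tens H V (\<gamma> i) (e i))))"
      by (intro lin_sum T lin_tscl lin_tens1 lin_id) (simp add: tens_car g b)
    thus "lin_map H ?T (\<lambda>a. coa1 H V v0 (\<lambda>b v00. tens H (tensor_space H V) a (tens H V b v00)))"
      by (rule lin_congI[OF C_vspace]) (simp add: coa1_graded[OF V T bi v0])
  qed
  have bc: "bilin_map H V V (\<lambda>a v0. scl V (counit H a) v0)"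
    by (intro bilin_mapI lin_scl lin_sclL lin_id lin_counit b(1))
  show ?thesis
    unfolding left_comodule_def
  proof (intro conjI ballI b(1) lin_coact[OF V])
    fix v assume v: "v \<in> car V"
    show "coa1 H V v (\<lambda>a v0. cop2 H a (\<lambda>a1 a2. tens H (tensor_space H V) a1 (tens H V a2 v0)))
      = coa1 H V v (\<lambda>a v0. coa1 H V v0 (\<lambda>b v00. tens H (tensor_space H V) a (tens H V b v00)))"
    proof (rule lin_map_eq_on_basis[OF g(1) lin_coa1[OF V T bl] lin_coa1[OF V T br] _ v])
      fix i assume i: "i \<in> I"
      have "bilin_map H H ?T (\<lambda>a1 a2. tens H (tensor_space H V) a1 (tens H V a2 (e i)))"
        using i by (intro bilin_mapI lin_tens1 lin_tens2 lin_id) (simp_all add: tens_car g b)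
      thus "coa1 H V (e i) (\<lambda>a v0. cop2 H a (\<lambda>a1 a2. tens H (tensor_space H V) a1 (tens H V a2 v0)))
        = coa1 H V (e i) (\<lambda>a v0. coa1 H V v0 (\<lambda>b v00. tens H (tensor_space H V) a (tens H V b v00)))"
        using i by (simp add: coa1_basis[OF V T bl i] coa1_basis[OF V T br i] coa1_basis[OF V T bi[OF g(3)[OF i]] i]
            cop2_grouplike[OF g(2) T])
    qed
    show "coa1 H V v (\<lambda>a v0. scl V (counit H a) v0) = v"
      by (rule lin_map_eq_on_basis[OF g(1) lin_coa1[OF V b(1) bc] lin_id _ v])
         (simp add: coa1_basis[OF V b(1) bc] grouplikeD g(2) vspace_simps[OF b(1)])
  qed
qed

end


lemma yd_spaces:
  "tens (yd_tensor H V W) U = tens (tensor_space V W) U" "tens U (yd_tensor H V W) = tens U (tensor_space V W)"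
  "tensor_space (yd_tensor H V W) U = tensor_space (tensor_space V W) U"
  "tensor_space U (yd_tensor H V W) = tensor_space U (tensor_space V W)"
  "subtensor (yd_tensor H V W) U = subtensor (tensor_space V W) U"
  "subtensor U (yd_tensor H V W) = subtensor U (tensor_space V W)"
  "sweedler (yd_tensor H V W) U = sweedler (tensor_space V W) U"
  "sweedler U (yd_tensor H V W) = sweedler U (tensor_space V W)"
  "lin_map (yd_tensor H V W) U = lin_map (tensor_space V W) U"
  "lin_map U (yd_tensor H V W) = lin_map U (tensor_space V W)"
  "tmap (yd_tensor H V W) U X Y = tmap (tensor_space V W) U X Y"
  "tmap U (yd_tensor H V W) X Y = tmap U (tensor_space V W) X Y"
  "tmap X Y (yd_tensor H V W) U = tmap X Y (tensor_space V W) U"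
  "tmap X Y U (yd_tensor H V W) = tmap X Y U (tensor_space V W)"
  by (rule tens_cong_space tensor_space_cong_space sweedler_cong_space lin_map_cong_space tmap_cong_space; simp)+

lemma yd_unit_spaces:
  "tens (yd_unit H) U = tens ground U" "tens U (yd_unit H) = tens U ground"
  "tensor_space (yd_unit H) U = tensor_space ground U" "tensor_space U (yd_unit H) = tensor_space U ground"
  "subtensor (yd_unit H) U = subtensor ground U" "subtensor U (yd_unit H) = subtensor U ground"
  "sweedler (yd_unit H) U = sweedler ground U" "sweedler U (yd_unit H) = sweedler U ground"
  "lin_map (yd_unit H) U = lin_map ground U" "lin_map U (yd_unit H) = lin_map U ground"
  "tmap (yd_unit H) U X Y = tmap ground U X Y" "tmap U (yd_unit H) X Y = tmap U ground X Y"
  "tmap X Y (yd_unit H) U = tmap X Y ground U" "tmap X Y U (yd_unit H) = tmap X Y U ground"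
  by (rule tens_cong_space tensor_space_cong_space sweedler_cong_space lin_map_cong_space tmap_cong_space; simp)+

lemma tens_car_nested:
  "v \<in> car V \<Longrightarrow> t \<in> subtensor A B (car A) (car B)
    \<Longrightarrow> tens V (tensor_space A B) v t \<in> subtensor V (tensor_space A B) (car V) (subtensor A B (car A) (car B))"
  "t \<in> subtensor A B (car A) (car B) \<Longrightarrow> v \<in> car V
    \<Longrightarrow> tens (tensor_space A B) V t v \<in> subtensor (tensor_space A B) V (subtensor A B (car A) (car B)) (car V)"
  using tens_car[of v V t "tensor_space A B"] tens_car[of t "tensor_space A B" v V] by simp_all

lemma basis_cong_space:
  assumes "car V = car V'" "scl V = scl V'"
  shows "basis V I e c = basis V' I e c"
  unfolding basis_def is_vspace_def lin_map_def assms by simp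

lemma basis_delta:
  assumes "basis V I e c" "is_vspace Z" "i \<in> I"
  shows "(\<Sum>k\<in>I. scl Z (c k (e i)) (z k)) = z i"
proof -
  note b = basisD[OF assms(1)]
  have "(\<Sum>k\<in>I. scl Z (c k (e i)) (z k)) = (\<Sum>k\<in>I. if k = i then z k else 0)"
    using assms(3) by (intro sum.cong refl) (simp add: b(5) vspace_simps[OF assms(2)])
  thus ?thesis using assms(3) b(2) by simp
qed

lemmas basis_delta_tscl = basis_delta[OF _ is_vspace_tensor_space, simplified]

context dual_quasi_bialg
begin

lemma coact_tensor_summand:
  assumes V: "graded V I e c \<gamma>" and W: "graded W J f d \<delta>" and v: "v \<in> car V" and w: "w \<in> car W"
  shows "coa1 H V v (\<lambda>a v0. coa1 H W w (\<lambda>b w0. tens H (tensor_space V W) (mul H a b) (tens V W v0 w0)))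
    = (\<Sum>i\<in>I. tscl (c i v) (\<Sum>j\<in>J. tscl (d j w) (tens H (tensor_space V W) (mul H (\<gamma> i) (\<delta> j)) (tens V W (e i) (f j)))))"
proof -
  note gV = gradedD[OF V] and bV = basisD[OF gradedD(1)[OF V]] and gW = gradedD[OF W] and bW = basisD[OF gradedD(1)[OF W]]
  let ?T = "tensor_space H (tensor_space V W)"
  note T = is_vspace_tensor_space[of H "tensor_space V W"]
  have 1: "coa1 H W w (\<lambda>b w0. tens H (tensor_space V W) (mul H a b) (tens V W v0 w0))
     = (\<Sum>j\<in>J. tscl (d j w) (tens H (tensor_space V W) (mul H a (\<delta> j)) (tens V W v0 (f j))))"
    if "a \<in> car H" "v0 \<in> car V" for a v0
    by (subst coa1_graded[OF W T _ w])
       (use that in \<open>simp_all add: bilin_mapI lin_tens1 lin_tens2 lin_mul2 lin_id tens_car mul_car\<close>)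
  have b2: "bilin_map H V ?T (\<lambda>a v0. \<Sum>j\<in>J. tscl (d j w) (tens H (tensor_space V W) (mul H a (\<delta> j)) (tens V W v0 (f j))))"
    by (intro bilin_mapI lin_sum T lin_tscl lin_tens1 lin_tens2 lin_mul1 lin_id gW bW mul_car) (simp_all add: tens_car tens_car_nested bW)
  have "coa1 H V v (\<lambda>a v0. coa1 H W w (\<lambda>b w0. tens H (tensor_space V W) (mul H a b) (tens V W v0 w0)))
    = coa1 H V v (\<lambda>a v0. \<Sum>j\<in>J. tscl (d j w) (tens H (tensor_space V W) (mul H a (\<delta> j)) (tens V W v0 (f j))))"
    unfolding coa1_def[of H V] by (rule sweedler_cong) (rule 1)
  also have "\<dots> = (\<Sum>i\<in>I. tscl (c i v) (\<Sum>j\<in>J. tscl (d j w) (tens H (tensor_space V W) (mul H (\<gamma> i) (\<delta> j)) (tens V W (e i) (f j)))))"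
    using coa1_graded[OF V T b2 v] by simp
  finally show ?thesis .
qed

lemma graded_tensor:
  assumes V: "graded V I e c \<gamma>" and W: "graded W J f d \<delta>"
  shows "graded (yd_tensor H V W) (I \<times> J) (\<lambda>(i, j). tens V W (e i) (f j))
    (\<lambda>(i, j) t. sweedler V W t (\<lambda>v w. c i v * d j w)) (\<lambda>(i, j). mul H (\<gamma> i) (\<delta> j))"
proof -
  note gV = gradedD[OF V] and bV = basisD[OF gradedD(1)[OF V]] and gW = gradedD[OF W] and bW = basisD[OF gradedD(1)[OF W]]
  let ?VW = "tensor_space V W"
  let ?T = "tensor_space H ?VW"
  note T = is_vspace_tensor_space[of H ?VW]
  note bas = basis_tensor[OF gV(1) gW(1)]
  have "coact (yd_tensor H V W) t = (\<Sum>(i, j)\<in>I \<times> J. tscl (sweedler V W t (\<lambda>v w. c i v * d j w))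
      (tens H ?VW (mul H (\<gamma> i) (\<delta> j)) (tens V W (e i) (f j))))" if t: "t \<in> car ?VW" for t
  proof -
    let ?F = "\<lambda>v w. \<Sum>i\<in>I. tscl (c i v) (\<Sum>j\<in>J. tscl (d j w) (tens H ?VW (mul H (\<gamma> i) (\<delta> j)) (tens V W (e i) (f j))))"
    have tc: "tens H ?VW (mul H (\<gamma> i) (\<delta> j)) (tens V W (e i) (f j)) \<in> subtensor H ?VW (car H) (car ?VW)" if "i \<in> I" "j \<in> J" for i j
      using that by (simp add: tens_car tens_car_nested mul_car gV gW bV bW)
    have b: "bilin_map V W ?T ?F"
      by (intro bilin_mapI lin_sum T lin_tscl lin_tsclL bV bW tspaceD tc; assumption)
    have e: "coact (yd_tensor H V W) t = sweedler V W t ?F" if "t \<in> car ?VW" for t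
      unfolding yd_tensor_def by simp (rule sweedler_cong, rule coact_tensor_summand[OF V W])
    have "sweedler V W t ?F = (\<Sum>p\<in>I \<times> J. scl ?T ((\<lambda>(i, j) t. sweedler V W t (\<lambda>v w. c i v * d j w)) p t)
        (sweedler V W ((\<lambda>(i, j). tens V W (e i) (f j)) p) ?F))"
      by (rule lin_map_basis[OF bas lin_sweedler_arg[OF bV(1) T lin_id b] t])
    also have "\<dots> = (\<Sum>(i, j)\<in>I \<times> J. tscl (sweedler V W t (\<lambda>v w. c i v * d j w))
      (tens H ?VW (mul H (\<gamma> i) (\<delta> j)) (tens V W (e i) (f j))))"
      by (intro sum.cong refl)
         (auto simp: sweedler_tens_basis[OF gV(1) gW(1) T b] basis_delta_tscl[OF gV(1)] basis_delta_tscl[OF gW(1)])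
    finally show ?thesis using e[OF t] by simp
  qed
  moreover have "basis (yd_tensor H V W) (I \<times> J) (\<lambda>(i, j). tens V W (e i) (f j))
    (\<lambda>(i, j) t. sweedler V W t (\<lambda>v w. c i v * d j w))"
    unfolding basis_cong_space[OF yd_tensor_space] by (rule bas)
  ultimately show ?thesis
    unfolding graded_def
    by (auto simp: grouplike_mul gV gW yd_spaces case_prod_beta')
qed

subsection \<open>The associativity constraint\<close>

text \<open>
  On homogeneous vectors each coaction evaluates to the degree. This is the associator on pure
  tensors, expanded in the three bases.
\<close>

lemma assoc_summand:
  assumes U: "graded U I e c \<gamma>" and V: "graded V J f d \<delta>" and W: "graded W K k b \<kappa>"
    and u: "u \<in> car U" and v: "v \<in> car V" and w: "w \<in> car W"
  shows "coa1 H U u (\<lambda>a u0. coa1 H V v (\<lambda>b v0. coa1 H W w (\<lambda>c w0.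
         tscl (omega_inv H a b c) (tens U (tensor_space V W) u0 (tens V W v0 w0)))))
    = (\<Sum>i\<in>I. tscl (c i u) (\<Sum>j\<in>J. tscl (d j v) (\<Sum>l\<in>K. tscl (b l w)
        (tscl (omega_inv H (\<gamma> i) (\<delta> j) (\<kappa> l)) (tens U (tensor_space V W) (e i) (tens V W (f j) (k l)))))))"
proof -
  note gU = gradedD[OF U] and bU = basisD[OF gradedD(1)[OF U]] and gV = gradedD[OF V] and bV = basisD[OF gradedD(1)[OF V]]
    and gW = gradedD[OF W] and bW = basisD[OF gradedD(1)[OF W]]
  let ?VW = "tensor_space V W"
  let ?T = "tensor_space U ?VW"
  note T = is_vspace_tensor_space[of U ?VW]
  note rules = bilin_mapI lin_sum T lin_tscl lin_tsclL lin_tens1 lin_tens2 lin_id lin_omega_inv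
  have b1: "bilin_map H W ?T (\<lambda>c w0. tscl (omega_inv H a b c) (tens U ?VW u0 (tens V W v0 w0)))"
    if "a \<in> car H" "b \<in> car H" "u0 \<in> car U" "v0 \<in> car V" for a b u0 v0
    using that by (intro rules) (simp_all add: tens_car tens_car_nested)
  have 1: "coa1 H W w (\<lambda>c w0. tscl (omega_inv H a b' c) (tens U ?VW u0 (tens V W v0 w0)))
     = (\<Sum>l\<in>K. tscl (b l w) (tscl (omega_inv H a b' (\<kappa> l)) (tens U ?VW u0 (tens V W v0 (k l)))))"
    if "a \<in> car H" "b' \<in> car H" "u0 \<in> car U" "v0 \<in> car V" for a b' u0 v0
    using coa1_graded[OF W T b1[OF that] w] by simp
  have b2: "bilin_map H V ?T (\<lambda>b' v0. \<Sum>l\<in>K. tscl (b l w) (tscl (omega_inv H a b' (\<kappa> l)) (tens U ?VW u0 (tens V W v0 (k l)))))"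
    if "a \<in> car H" "u0 \<in> car U" for a u0
    using that by (intro rules) (simp_all add: tens_car tens_car_nested gW bW)
  have 2: "coa1 H V v (\<lambda>b v0. coa1 H W w (\<lambda>c w0. tscl (omega_inv H a b c) (tens U ?VW u0 (tens V W v0 w0))))
     = (\<Sum>j\<in>J. tscl (d j v) (\<Sum>l\<in>K. tscl (b l w) (tscl (omega_inv H a (\<delta> j) (\<kappa> l)) (tens U ?VW u0 (tens V W (f j) (k l))))))"
    if "a \<in> car H" "u0 \<in> car U" for a u0
    using coa1_graded[OF V T b2[OF that] v] 1[OF that(1) _ that(2)] unfolding coa1_def[of H V]
    by (simp cong: sweedler_cong)
  have b3: "bilin_map H U ?T (\<lambda>a u0. \<Sum>j\<in>J. tscl (d j v) (\<Sum>l\<in>K. tscl (b l w) (tscl (omega_inv H a (\<delta> j) (\<kappa> l)) (tens U ?VW u0 (tens V W (f j) (k l))))))"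
    by (intro rules) (simp_all add: tens_car tens_car_nested gV bV gW bW)
  show ?thesis
    using coa1_graded[OF U T b3 u] 2 unfolding coa1_def[of H U] by (simp cong: sweedler_cong)
qed

lemma yd_assoc_graded:
  assumes U: "graded U I e c \<gamma>" and V: "graded V J f d \<delta>" and W: "graded W K k b \<kappa>"
  shows "lin_map (tensor_space (tensor_space U V) W) (tensor_space U (tensor_space V W)) (yd_assoc H U V W)"
    and "i \<in> I \<Longrightarrow> j \<in> J \<Longrightarrow> l \<in> K \<Longrightarrow>
      yd_assoc H U V W (tens (tensor_space U V) W (tens U V (e i) (f j)) (k l))
      = tscl (omega_inv H (\<gamma> i) (\<delta> j) (\<kappa> l)) (tens U (tensor_space V W) (e i) (tens V W (f j) (k l)))"
proof -
  note gU = gradedD[OF U] and bU = basisD[OF gradedD(1)[OF U]] and gV = gradedD[OF V] and bV = basisD[OF gradedD(1)[OF V]]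
    and gW = gradedD[OF W] and bW = basisD[OF gradedD(1)[OF W]]
  let ?VW = "tensor_space V W" and ?UV = "tensor_space U V"
  let ?T = "tensor_space U ?VW"
  note T = is_vspace_tensor_space[of U ?VW]
  let ?G = "\<lambda>u v w. \<Sum>i\<in>I. tscl (c i u) (\<Sum>j\<in>J. tscl (d j v) (\<Sum>l\<in>K. tscl (b l w)
        (tscl (omega_inv H (\<gamma> i) (\<delta> j) (\<kappa> l)) (tens U ?VW (e i) (tens V W (f j) (k l))))))"
  have tc: "tens U ?VW (e i) (tens V W (f j) (k l)) \<in> subtensor U ?VW (car U) (car ?VW)" if "i \<in> I" "j \<in> J" "l \<in> K" for i j l
    using that by (simp add: tens_car tens_car_nested bU bV bW)
  have bG: "bilin_map U V ?T (\<lambda>u v. ?G u v w)" if "w \<in> car W" for w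
    by (intro bilin_mapI lin_sum T lin_tscl lin_tsclL bU bV tspaceD tc; assumption)
  have bG': "bilin_map ?UV W ?T (\<lambda>s w. sweedler U V s (\<lambda>u v. ?G u v w))"
    by (intro bilin_mapI lin_sweedler_arg lin_sweedler_body bG lin_id bU(1) bW(1) T
        lin_sum lin_tscl lin_tsclL bW tspaceD tc; assumption)
  have eq: "yd_assoc H U V W t = sweedler ?UV W t (\<lambda>s w. sweedler U V s (\<lambda>u v. ?G u v w))" for t
    unfolding yd_assoc_def by (intro sweedler_cong assoc_summand[OF U V W])
  show "lin_map (tensor_space ?UV W) ?T (yd_assoc H U V W)"
    unfolding eq[abs_def] by (rule lin_map_sweedler[OF is_vspace_tensor_space T bG'])
  assume ijl: "i \<in> I" "j \<in> J" "l \<in> K"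
  show "yd_assoc H U V W (tens ?UV W (tens U V (e i) (f j)) (k l))
      = tscl (omega_inv H (\<gamma> i) (\<delta> j) (\<kappa> l)) (tens U ?VW (e i) (tens V W (f j) (k l)))"
    using ijl sweedler_tens[OF T bG' _ bW(3)[OF ijl(3)], of "tens U V (e i) (f j)"]
      sweedler_tens[OF T bG[OF bW(3)[OF ijl(3)]] bU(3)[OF ijl(1)] bV(3)[OF ijl(2)]]
    by (simp add: eq tens_car bU(3) bV(3) basis_delta_tscl[OF gU(1)] basis_delta_tscl[OF gV(1)] basis_delta_tscl[OF gW(1)])
qed

lemma yd_assoc_inv_graded:
  assumes U: "graded U I e c \<gamma>" and V: "graded V J f d \<delta>" and W: "graded W K k b \<kappa>"
  shows "lin_map (tensor_space U (tensor_space V W)) (tensor_space (tensor_space U V) W) (yd_assoc_inv H U V W)"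
    and "i \<in> I \<Longrightarrow> j \<in> J \<Longrightarrow> l \<in> K \<Longrightarrow>
      yd_assoc_inv H U V W (tens U (tensor_space V W) (e i) (tens V W (f j) (k l)))
      = tscl (omega H (\<gamma> i) (\<delta> j) (\<kappa> l)) (tens (tensor_space U V) W (tens U V (e i) (f j)) (k l))"
proof -
  note gU = gradedD[OF U] and gV = gradedD[OF V] and gW = gradedD[OF W]
  note a = yd_assoc_graded[OF U V W]
  let ?\<sigma> = "\<lambda>((i, j), l). (i, (j, l))"
  let ?\<mu> = "\<lambda>((i, j), l). omega_inv H (\<gamma> i) (\<delta> j) (\<kappa> l)"
  have \<sigma>: "bij_betw ?\<sigma> ((I \<times> J) \<times> K) (I \<times> (J \<times> K))"
    by (rule bij_betw_byWitness[where f' = "\<lambda>(i, (j, l)). ((i, j), l)"]) auto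
  have om: "omega H (\<gamma> i) (\<delta> j) (\<kappa> l) * omega_inv H (\<gamma> i) (\<delta> j) (\<kappa> l) = 1" if "i \<in> I" "j \<in> J" "l \<in> K" for i j l
    by (intro omega_scalar_inverse gU gV gW that)
  have mono: "yd_assoc H U V W ((\<lambda>(p, l). tens (tensor_space U V) W ((\<lambda>(i, j). tens U V (e i) (f j)) p) (k l)) p)
      = scl (tensor_space U (tensor_space V W)) (?\<mu> p)
         ((\<lambda>(i, p). tens U (tensor_space V W) (e i) ((\<lambda>(j, l). tens V W (f j) (k l)) p)) (?\<sigma> p))"
    if "p \<in> (I \<times> J) \<times> K" for p
    using that by (auto simp: a(2))
  have nz: "?\<mu> p \<noteq> 0" if "p \<in> (I \<times> J) \<times> K" for p
    using that om by fastforce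
  note inv = monomial_map_inverse[where \<sigma> = ?\<sigma> and \<mu> = ?\<mu>
      and e = "\<lambda>(p, l). tens (tensor_space U V) W ((\<lambda>(i, j). tens U V (e i) (f j)) p) (k l)"
      and f = "\<lambda>(i, p). tens U (tensor_space V W) (e i) ((\<lambda>(j, l). tens V W (f j) (k l)) p)", OF basis_tensor[OF basis_tensor[OF gU(1) gV(1)] gW(1)]
      basis_tensor[OF gU(1) basis_tensor[OF gV(1) gW(1)]] a(1) \<sigma> mono nz]
  have car: "car (tensor_space (yd_tensor H U V) W) = car (tensor_space (tensor_space U V) W)"
    by (simp add: yd_spaces)
  show "lin_map (tensor_space U (tensor_space V W)) (tensor_space (tensor_space U V) W) (yd_assoc_inv H U V W)"
    using inv(1) unfolding yd_assoc_inv_def .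
  assume ijl: "i \<in> I" "j \<in> J" "l \<in> K"
  have "inverse (omega_inv H (\<gamma> i) (\<delta> j) (\<kappa> l)) = omega H (\<gamma> i) (\<delta> j) (\<kappa> l)"
    using om[OF ijl] by (metis inverse_unique mult.commute)
  thus "yd_assoc_inv H U V W (tens U (tensor_space V W) (e i) (tens V W (f j) (k l)))
      = tscl (omega H (\<gamma> i) (\<delta> j) (\<kappa> l)) (tens (tensor_space U V) W (tens U V (e i) (f j)) (k l))"
    using inv(2)[of "((i, j), l)"] ijl unfolding yd_assoc_inv_def by simp
qed

lemma yd_braid_graded:
  assumes V: "graded V I e c \<gamma>" and W: "graded W J f d \<delta>" and act: "bilin_map H W W (act W)"
  shows "lin_map (tensor_space V W) (tensor_space W V) (yd_braid H V W)"
    and "i \<in> I \<Longrightarrow> w \<in> car W \<Longrightarrow> yd_braid H V W (tens V W (e i) w) = tens W V (act W (\<gamma> i) w) (e i)"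
proof -
  note gV = gradedD[OF V] and bV = basisD[OF gradedD(1)[OF V]] and bW = basisD[OF gradedD(1)[OF W]]
  let ?T = "tensor_space W V"
  note T = is_vspace_tensor_space[of W V]
  let ?G = "\<lambda>v w. \<Sum>i\<in>I. tscl (c i v) (tens W V (act W (\<gamma> i) w) (e i))"
  have b1: "bilin_map H V ?T (\<lambda>a v0. tens W V (act W a w) v0)" if "w \<in> car W" for w
    by (intro bilin_mapI lin_tens1 lin_tens2 lin_id lin_bilin2[OF act that] bilin_mapD(1)[OF act _ that])
  have bG: "bilin_map V W ?T ?G"
    by (intro bilin_mapI lin_sum T lin_tscl lin_tsclL bV lin_tens1 lin_bilin1[OF act] gV tens_car bilin_mapD(1)[OF act])
  have eq: "yd_braid H V W t = sweedler V W t ?G" for t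
    unfolding yd_braid_def using coa1_graded[OF V T b1] by (intro sweedler_cong) simp
  show "lin_map (tensor_space V W) ?T (yd_braid H V W)"
    unfolding eq[abs_def] by (rule lin_map_sweedler[OF bV(1) T bG])
  assume "i \<in> I" "w \<in> car W"
  thus "yd_braid H V W (tens V W (e i) w) = tens W V (act W (\<gamma> i) w) (e i)"
    unfolding eq by (simp add: sweedler_tens[OF T bG] bV(3) basis_delta_tscl[OF gV(1)])
qed


subsection \<open>Iterated coproducts of multilinear functions\<close>

text \<open>Multilinearity in the variables of an iterated coproduct, curried.\<close>

definition lin3 :: "('k, 'z::ab_group_add, 'n) vspace_scheme \<Rightarrow> ('h \<Rightarrow> 'h \<Rightarrow> 'h \<Rightarrow> 'z) \<Rightarrow> bool" where
  "lin3 Z F \<longleftrightarrow> (\<forall>a\<in>car H. bilin_map H H Z (F a)) \<and> (\<forall>b\<in>car H. \<forall>c\<in>car H. lin_map H Z (\<lambda>a. F a b c))"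

definition lin4 :: "('k, 'z::ab_group_add, 'n) vspace_scheme \<Rightarrow> ('h \<Rightarrow> 'h \<Rightarrow> 'h \<Rightarrow> 'h \<Rightarrow> 'z) \<Rightarrow> bool" where
  "lin4 Z F \<longleftrightarrow> (\<forall>a\<in>car H. lin3 Z (F a))
    \<and> (\<forall>b\<in>car H. \<forall>c\<in>car H. \<forall>d\<in>car H. lin_map H Z (\<lambda>a. F a b c d))"

definition lin5 :: "('k, 'z::ab_group_add, 'n) vspace_scheme \<Rightarrow> ('h \<Rightarrow> 'h \<Rightarrow> 'h \<Rightarrow> 'h \<Rightarrow> 'h \<Rightarrow> 'z) \<Rightarrow> bool" where
  "lin5 Z F \<longleftrightarrow> (\<forall>a\<in>car H. lin4 Z (F a))
    \<and> (\<forall>b\<in>car H. \<forall>c\<in>car H. \<forall>d\<in>car H. \<forall>e\<in>car H. lin_map H Z (\<lambda>a. F a b c d e))"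

lemma lin3I:
  "(\<And>a. a \<in> car H \<Longrightarrow> bilin_map H H Z (F a))
    \<Longrightarrow> (\<And>b c. b \<in> car H \<Longrightarrow> c \<in> car H \<Longrightarrow> lin_map H Z (\<lambda>a. F a b c)) \<Longrightarrow> lin3 Z F"
  by (simp add: lin3_def)

lemma lin4I:
  "(\<And>a. a \<in> car H \<Longrightarrow> lin3 Z (F a))
    \<Longrightarrow> (\<And>b c d. b \<in> car H \<Longrightarrow> c \<in> car H \<Longrightarrow> d \<in> car H \<Longrightarrow> lin_map H Z (\<lambda>a. F a b c d)) \<Longrightarrow> lin4 Z F"
  by (simp add: lin4_def)

lemma lin5I:
  "(\<And>a. a \<in> car H \<Longrightarrow> lin4 Z (F a))
    \<Longrightarrow> (\<And>b c d e. b \<in> car H \<Longrightarrow> c \<in> car H \<Longrightarrow> d \<in> car H \<Longrightarrow> e \<in> car H \<Longrightarrow> lin_map H Z (\<lambda>a. F a b c d e))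
    \<Longrightarrow> lin5 Z F"
  by (simp add: lin5_def)

lemmas linI = lin3I lin4I lin5I

lemma lin_cop3_param:
  assumes "is_vspace Z" "is_vspace U" "h \<in> car H" "\<And>u. u \<in> car U \<Longrightarrow> lin3 Z (F u)"
    "\<And>a b c. a \<in> car H \<Longrightarrow> b \<in> car H \<Longrightarrow> c \<in> car H \<Longrightarrow> lin_map U Z (\<lambda>u. F u a b c)"
  shows "lin_map U Z (\<lambda>u. cop3 H h (F u))"
proof -
  have 4: "bilin_map H H Z (F u a)" "\<And>b c. b \<in> car H \<Longrightarrow> c \<in> car H \<Longrightarrow> lin_map H Z (\<lambda>a. F u a b c)"
    if "u \<in> car U" "a \<in> car H" for u a
    using assms(4)[OF that(1)] that(2) by (simp_all add: lin3_def)
  show ?thesis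
    unfolding cop3_def
    by (intro lin_cop2_body bilin_mapI lin_cop2_arg lin_id assms(1-3,5) C_vspace lin_bilin1[OF 4(1)] lin_bilin2[OF 4(1)] 4(2); assumption)
qed

lemma bilin_cop2_tail:
  assumes "is_vspace Z" "lin3 Z F"
  shows "bilin_map H H Z (\<lambda>a h. cop2 H h (F a))"
proof -
  have F: "bilin_map H H Z (F a)" "\<And>b c. b \<in> car H \<Longrightarrow> c \<in> car H \<Longrightarrow> lin_map H Z (\<lambda>a. F a b c)" if "a \<in> car H" for a
    using assms(2) that by (simp_all add: lin3_def)
  show ?thesis
    by (intro bilin_mapI lin_cop2_body lin_cop2_arg lin_id assms(1) C_vspace lin_bilin1[OF F(1)] lin_bilin2[OF F(1)] F(2); assumption)
qed

lemma bilin_cop3_tail: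
  assumes "is_vspace Z" "lin4 Z F"
  shows "bilin_map H H Z (\<lambda>a h. cop3 H h (F a))"
proof (intro bilin_mapI)
  have F: "lin3 Z (F a)" if "a \<in> car H" for a using assms(2) that by (simp add: lin4_def)
  show "lin_map H Z (\<lambda>h. cop3 H h (F a))" if "a \<in> car H" for a
    unfolding cop3_def by (rule lin_cop2_arg[OF assms(1) bilin_cop2_tail[OF assms(1) F[OF that]] lin_id])
  show "lin_map H Z (\<lambda>a. cop3 H h (F a))" if "h \<in> car H" for h
    using assms(2) that by (intro lin_cop3_param assms(1) C_vspace) (auto simp: lin4_def)
qed

lemma lin_cop4_param:
  assumes "is_vspace Z" "is_vspace U" "h \<in> car H" "\<And>u. u \<in> car U \<Longrightarrow> lin4 Z (F u)"
    "\<And>a b c d. a \<in> car H \<Longrightarrow> b \<in> car H \<Longrightarrow> c \<in> car H \<Longrightarrow> d \<in> car H \<Longrightarrow> lin_map U Z (\<lambda>u. F u a b c d)"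
  shows "lin_map U Z (\<lambda>u. cop4 H h (F u))"
  unfolding cop4_def
proof (rule lin_cop2_body[OF assms(1,2,3)])
  show "bilin_map H H Z (\<lambda>a h'. cop3 H h' (F u a))" if "u \<in> car U" for u
    by (rule bilin_cop3_tail[OF assms(1) assms(4)[OF that]])
  show "lin_map U Z (\<lambda>u. cop3 H b (F u a))" if "a \<in> car H" "b \<in> car H" for a b
    using assms(4,5) that by (intro lin_cop3_param assms(1,2)) (auto simp: lin4_def)
qed

lemma bilin_cop4_tail:
  assumes "is_vspace Z" "lin5 Z F"
  shows "bilin_map H H Z (\<lambda>a h. cop4 H h (F a))"
proof (intro bilin_mapI)
  have F: "lin4 Z (F a)" if "a \<in> car H" for a using assms(2) that by (simp add: lin5_def)
  show "lin_map H Z (\<lambda>h. cop4 H h (F a))" if "a \<in> car H" for a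
    unfolding cop4_def by (rule lin_cop2_arg[OF assms(1) bilin_cop3_tail[OF assms(1) F[OF that]] lin_id])
  show "lin_map H Z (\<lambda>a. cop4 H h (F a))" if "h \<in> car H" for h
    using assms(2) that by (intro lin_cop4_param assms(1) C_vspace) (auto simp: lin5_def)
qed

text \<open>
  An iterated coproduct of a vector-valued function with scalar coefficients acts on the
  coefficients. In this way computations in diagonal modules reduce to convolutions of forms.
\<close>

lemma cop2_family:
  assumes Z: "is_vspace Z" and h: "h \<in> car H" and z: "\<And>p. p \<in> S \<Longrightarrow> z p \<in> car Z"
    and b: "\<And>p. p \<in> S \<Longrightarrow> bilin_map H H ground (F p)"
  shows "cop2 H h (\<lambda>a b. \<Sum>p\<in>S. scl Z (F p a b) (z p)) = (\<Sum>p\<in>S. scl Z (cop2 H h (F p)) (z p))"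
proof -
  have "bilin_map H H Z (\<lambda>a b. scl Z (F p a b) (z p))" if "p \<in> S" for p
    by (intro bilin_mapI lin_sclL Z z that lin_bilin1[OF b[OF that]] lin_bilin2[OF b[OF that]])
  from sweedler_sum_body[OF C_vspace Z comul_car[OF h], of S, OF this]
  show ?thesis
    unfolding cop2_def using sweedler_scl[OF C_vspace Z comul_car[OF h] b z] by simp
qed

lemma cop3_family:
  assumes Z: "is_vspace Z" and h: "h \<in> car H" and z: "\<And>p. p \<in> S \<Longrightarrow> z p \<in> car Z"
    and b: "\<And>p. p \<in> S \<Longrightarrow> lin3 ground (F p)"
  shows "cop3 H h (\<lambda>a b c. \<Sum>p\<in>S. scl Z (F p a b c) (z p)) = (\<Sum>p\<in>S. scl Z (cop3 H h (F p)) (z p))"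
proof -
  have b': "bilin_map H H ground (F p a)" if "p \<in> S" "a \<in> car H" for p a
    using b[OF that(1)] that(2) by (simp add: lin3_def)
  show ?thesis
    unfolding cop3_def
    using cop2_family[OF Z h z bilin_cop2_tail[OF is_vspace_ground b]]
    by (simp add: cop2_family[OF Z _ z b'] cong: cop2_cong)
qed

lemma cop4_family:
  assumes Z: "is_vspace Z" and h: "h \<in> car H" and z: "\<And>p. p \<in> S \<Longrightarrow> z p \<in> car Z"
    and b: "\<And>p. p \<in> S \<Longrightarrow> lin4 ground (F p)"
  shows "cop4 H h (\<lambda>a b c d. \<Sum>p\<in>S. scl Z (F p a b c d) (z p)) = (\<Sum>p\<in>S. scl Z (cop4 H h (F p)) (z p))"
proof -
  have b': "lin3 ground (F p a)" if "p \<in> S" "a \<in> car H" for p a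
    using b[OF that(1)] that(2) by (simp add: lin4_def)
  show ?thesis
    unfolding cop4_def
    using cop2_family[OF Z h z bilin_cop3_tail[OF is_vspace_ground b]]
    by (simp add: cop3_family[OF Z _ z b'] cong: cop2_cong)
qed

lemma cop5_family:
  assumes Z: "is_vspace Z" and h: "h \<in> car H" and z: "\<And>p. p \<in> S \<Longrightarrow> z p \<in> car Z"
    and b: "\<And>p. p \<in> S \<Longrightarrow> lin5 ground (F p)"
  shows "cop5 H h (\<lambda>a b c d e. \<Sum>p\<in>S. scl Z (F p a b c d e) (z p)) = (\<Sum>p\<in>S. scl Z (cop5 H h (F p)) (z p))"
proof -
  have b': "lin4 ground (F p a)" if "p \<in> S" "a \<in> car H" for p a
    using b[OF that(1)] that(2) by (simp add: lin5_def)
  show ?thesis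
    unfolding cop5_def
    using cop2_family[OF Z h z bilin_cop4_tail[OF is_vspace_ground b]]
    by (simp add: cop4_family[OF Z _ z b'] cong: cop2_cong)
qed

lemma cop_cong:
  shows cop3_cong: "(\<And>a b c. a \<in> car H \<Longrightarrow> b \<in> car H \<Longrightarrow> c \<in> car H \<Longrightarrow> F a b c = F' a b c)
      \<Longrightarrow> cop3 H h F = cop3 H h F'"
    and cop4_cong: "(\<And>a b c d. a \<in> car H \<Longrightarrow> b \<in> car H \<Longrightarrow> c \<in> car H \<Longrightarrow> d \<in> car H \<Longrightarrow> G a b c d = G' a b c d)
      \<Longrightarrow> cop4 H h G = cop4 H h G'"
    and cop5_cong: "(\<And>a b c d e. a \<in> car H \<Longrightarrow> b \<in> car H \<Longrightarrow> c \<in> car H \<Longrightarrow> d \<in> car H \<Longrightarrow> e \<in> car H \<Longrightarrow> K a b c d e = K' a b c d e)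
      \<Longrightarrow> cop5 H h K = cop5 H h K'"
  unfolding cop5_def cop4_def cop3_def by (intro cop2_cong; simp)+

section \<open>Diagonal Yetter-Drinfeld modules\<close>

text \<open>
  Graded objects on whose basis vectors the action is by characters: direct sums of
  one-dimensional Yetter-Drinfeld modules once the pairs \<open>(\<gamma> i, \<xi> i)\<close> satisfy \<open>yd_character\<close> and
  the unit axiom.
\<close>

definition diagonal :: "('k, 'h, 'v::ab_group_add, 'n) yd_obj_scheme \<Rightarrow> 'i set \<Rightarrow> ('i \<Rightarrow> 'v)
    \<Rightarrow> ('i \<Rightarrow> 'v \<Rightarrow> 'k) \<Rightarrow> ('i \<Rightarrow> 'h) \<Rightarrow> ('i \<Rightarrow> 'h \<Rightarrow> 'k) \<Rightarrow> bool" where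
  "diagonal V I e c \<gamma> \<xi> \<longleftrightarrow> graded V I e c \<gamma> \<and> (\<forall>i\<in>I. lin_map H ground (\<xi> i)) \<and> bilin_map H V V (act V)
    \<and> (\<forall>h\<in>car H. \<forall>i\<in>I. act V h (e i) = scl V (\<xi> i h) (e i))"

lemma diagonalD:
  assumes "diagonal V I e c \<gamma> \<xi>"
  shows "graded V I e c \<gamma>" "i \<in> I \<Longrightarrow> lin_map H ground (\<xi> i)" "bilin_map H V V (act V)"
    "h \<in> car H \<Longrightarrow> i \<in> I \<Longrightarrow> act V h (e i) = scl V (\<xi> i h) (e i)"
    "h \<in> car H \<Longrightarrow> v \<in> car V \<Longrightarrow> act V h v \<in> car V"
  using assms unfolding diagonal_def by (auto dest: bilin_mapD(1))

lemma coord_act: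
  assumes V: "diagonal V I e c \<gamma> \<xi>" and h: "h \<in> car H" and v: "v \<in> car V" and i: "i \<in> I"
  shows "c i (act V h v) = c i v * \<xi> i h"
proof -
  note d = diagonalD[OF V] and b = basisD[OF gradedD(1)[OF diagonalD(1)[OF V]]]
  show ?thesis
    by (rule lin_map_eq_on_basis[OF gradedD(1)[OF d(1)] lin_comp[OF b(4)[OF i] lin_bilin1[OF d(3) h]] lin_mulL[OF b(4)[OF i]] _ v])
       (simp add: d(4)[OF h] lin_mapD(3)[OF b(4)[OF i]] b i)
qed

lemma act_expand:
  assumes V: "diagonal V I e c \<gamma> \<xi>" and h: "h \<in> car H" and v: "v \<in> car V"
  shows "act V h v = (\<Sum>i\<in>I. scl V (c i v * \<xi> i h) (e i))"
  using basisD(6)[OF gradedD(1)[OF diagonalD(1)[OF V]] diagonalD(5)[OF V h v]] coord_act[OF V h v] by simp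

lemma coa2_graded:
  assumes V: "graded V I e c \<gamma>" and Z: "is_vspace Z" and v: "v \<in> car V"
    and F: "\<And>a b. a \<in> car H \<Longrightarrow> b \<in> car H \<Longrightarrow> lin_map V Z (F a b)"
      "\<And>a v. a \<in> car H \<Longrightarrow> v \<in> car V \<Longrightarrow> lin_map H Z (\<lambda>b. F a b v)"
      "\<And>b v. b \<in> car H \<Longrightarrow> v \<in> car V \<Longrightarrow> lin_map H Z (\<lambda>a. F a b v)"
  shows "coa2 H V v F = (\<Sum>i\<in>I. scl Z (c i v) (F (\<gamma> i) (\<gamma> i) (e i)))"
proof -
  note g = gradedD[OF V] and b = basisD[OF gradedD(1)[OF V]]
  have 1: "coa1 H V v' (F a) = (\<Sum>i\<in>I. scl Z (c i v') (F a (\<gamma> i) (e i)))" if "a \<in> car H" "v' \<in> car V" for a v'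
    using that by (intro coa1_graded[OF V Z] bilin_mapI F)
  have 2: "bilin_map H V Z (\<lambda>a v'. \<Sum>i\<in>I. scl Z (c i v') (F a (\<gamma> i) (e i)))"
    by (intro bilin_mapI lin_sum Z lin_scl lin_sclL b F g lin_mapD(1)[OF F(1)])
  have "coa2 H V v F = coa1 H V v (\<lambda>a v'. \<Sum>i\<in>I. scl Z (c i v') (F a (\<gamma> i) (e i)))"
    unfolding coa2_def coa1_def[of H V v] by (rule sweedler_cong) (rule 1)
  also have "\<dots> = (\<Sum>i\<in>I. scl Z (c i v) (F (\<gamma> i) (\<gamma> i) (e i)))"
    unfolding coa1_graded[OF V Z 2 v]
    by (intro sum.cong refl) (simp add: basis_delta[OF g(1) Z])
  finally show ?thesis .
qed

lemma coa2_cong: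
  "(\<And>a b v. a \<in> car H \<Longrightarrow> b \<in> car H \<Longrightarrow> v \<in> car V \<Longrightarrow> F a b v = F' a b v) \<Longrightarrow> coa2 H V u F = coa2 H V u F'"
  unfolding coa2_def coa1_def by (intro sweedler_cong) blast

lemma coa1_cong:
  "(\<And>a v. a \<in> car H \<Longrightarrow> v \<in> car V \<Longrightarrow> F a v = F' a v) \<Longrightarrow> coa1 H V u F = coa1 H V u F'"
  unfolding coa1_def by (intro sweedler_cong) blast

text \<open>
  On a basis vector, all coactions in the axioms evaluate to its degree and all actions to its
  character, so the axioms reduce to \<open>yd_character\<close> and the unit axiom.
\<close>

theorem diagonal_yd_object:
  assumes V: "diagonal V I e c \<gamma> \<xi>" and yd: "\<And>i. i \<in> I \<Longrightarrow> yd_character (\<gamma> i) (\<xi> i)"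
    and one: "\<And>i. i \<in> I \<Longrightarrow> \<xi> i (one H) = 1"
  shows "yd_object H V"
proof -
  note d = diagonalD[OF V]
  note g = gradedD[OF d(1)] and b = basisD[OF gradedD(1)[OF d(1)]]
  note Vv = b(1)
  have quasi: "act V (mul H h l) v =
          cop4 H h (\<lambda>h1 h2 h3 h4. cop4 H l (\<lambda>l1 l2 l3 l4.
            coa1 H V v (\<lambda>a v0.
            coa1 H V (act V l2 v0) (\<lambda>b u0.
            coa1 H V (act V h3 u0) (\<lambda>c w0.
              scl V (omega_inv H h1 l1 a * omega H h2 b l3 * omega_inv H c h4 l4) w0)))))"
    if h: "h \<in> car H" and l: "l \<in> car H" and v: "v \<in> car V" for h l v
  proof -
    note rules = bilin_mapI lin_sum lin_scl lin_sclL lin_mulL lin_mulR lin_omega lin_omega_inv lin_id Vv b g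
    let ?x = "\<lambda>i h1 h2 h3 h4 l1 l2 l3 l4. omega_inv H h1 l1 (\<gamma> i) * \<xi> i l2 * omega H h2 (\<gamma> i) l3 * \<xi> i h3 * omega_inv H (\<gamma> i) h4 l4"
    have coactions: "coa1 H V v (\<lambda>a v0. coa1 H V (act V l2 v0) (\<lambda>b u0. coa1 H V (act V h3 u0) (\<lambda>c w0.
              scl V (omega_inv H h1 l1 a * omega H h2 b l3 * omega_inv H c h4 l4) w0)))
      = (\<Sum>i\<in>I. scl V (?x i h1 h2 h3 h4 l1 l2 l3 l4) (scl V (c i v) (e i)))"
      if car: "h1 \<in> car H" "h2 \<in> car H" "h3 \<in> car H" "h4 \<in> car H" "l1 \<in> car H" "l2 \<in> car H" "l3 \<in> car H" "l4 \<in> car H"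
      for h1 h2 h3 h4 l1 l2 l3 l4
    proof -
      have 1: "coa1 H V (act V h3 u0) (\<lambda>c w0. scl V (omega_inv H h1 l1 a * omega H h2 b' l3 * omega_inv H c h4 l4) w0)
        = (\<Sum>i\<in>I. scl V (c i u0) (scl V (\<xi> i h3 * (omega_inv H h1 l1 a * omega H h2 b' l3 * omega_inv H (\<gamma> i) h4 l4)) (e i)))"
        if "a \<in> car H" "b' \<in> car H" "u0 \<in> car V" for a b' u0
      proof -
        have bb: "bilin_map H V V (\<lambda>c w0. scl V (omega_inv H h1 l1 a * omega H h2 b' l3 * omega_inv H c h4 l4) w0)"
          using car by (intro bilin_mapI lin_scl lin_sclL lin_mulR lin_omega_inv lin_id Vv)
        show ?thesis
          unfolding coa1_graded[OF d(1) Vv bb d(5)[OF car(3) that(3)]] using that car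
          by (simp add: coord_act[OF V] vspace_simps[OF Vv] mult_ac)
      qed
      have 2: "coa1 H V (act V l2 v0) (\<lambda>b u0. coa1 H V (act V h3 u0) (\<lambda>c w0.
              scl V (omega_inv H h1 l1 a * omega H h2 b l3 * omega_inv H c h4 l4) w0))
        = (\<Sum>i\<in>I. scl V (c i v0) (scl V (\<xi> i l2 * \<xi> i h3 * (omega_inv H h1 l1 a * omega H h2 (\<gamma> i) l3 * omega_inv H (\<gamma> i) h4 l4)) (e i)))"
        if "a \<in> car H" "v0 \<in> car V" for a v0
      proof -
        have bb: "bilin_map H V V (\<lambda>b' u0. \<Sum>i\<in>I. scl V (c i u0) (scl V (\<xi> i h3 * (omega_inv H h1 l1 a * omega H h2 b' l3 * omega_inv H (\<gamma> i) h4 l4)) (e i)))"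
          using that car by (intro bilin_mapI lin_sum Vv lin_scl lin_sclL lin_mulR lin_mulL lin_omega lin_id b g vspaceD(4)[OF Vv])
        have "coa1 H V (act V l2 v0) (\<lambda>b u0. coa1 H V (act V h3 u0) (\<lambda>c w0.
              scl V (omega_inv H h1 l1 a * omega H h2 b l3 * omega_inv H c h4 l4) w0))
          = coa1 H V (act V l2 v0) (\<lambda>b' u0. \<Sum>i\<in>I. scl V (c i u0) (scl V (\<xi> i h3 * (omega_inv H h1 l1 a * omega H h2 b' l3 * omega_inv H (\<gamma> i) h4 l4)) (e i)))"
          using that by (intro coa1_cong 1)
        also have "\<dots> = (\<Sum>i\<in>I. scl V (c i (act V l2 v0)) (scl V (\<xi> i h3 * (omega_inv H h1 l1 a * omega H h2 (\<gamma> i) l3 * omega_inv H (\<gamma> i) h4 l4)) (e i)))"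
          unfolding coa1_graded[OF d(1) Vv bb d(5)[OF car(6) that(2)]]
          by (intro sum.cong refl) (simp add: basis_delta[OF g(1) Vv])
        finally show ?thesis
          using that car by (simp add: coord_act[OF V] vspace_simps[OF Vv] mult_ac)
      qed
      have bb: "bilin_map H V V (\<lambda>a v0. \<Sum>i\<in>I. scl V (c i v0) (scl V (\<xi> i l2 * \<xi> i h3 * (omega_inv H h1 l1 a * omega H h2 (\<gamma> i) l3 * omega_inv H (\<gamma> i) h4 l4)) (e i)))"
        using car by (intro bilin_mapI lin_sum Vv lin_scl lin_sclL lin_mulR lin_mulL lin_omega_inv lin_id b g vspaceD(4)[OF Vv])
      have "coa1 H V v (\<lambda>a v0. coa1 H V (act V l2 v0) (\<lambda>b u0. coa1 H V (act V h3 u0) (\<lambda>c w0.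
              scl V (omega_inv H h1 l1 a * omega H h2 b l3 * omega_inv H c h4 l4) w0)))
        = coa1 H V v (\<lambda>a v0. \<Sum>i\<in>I. scl V (c i v0) (scl V (\<xi> i l2 * \<xi> i h3 * (omega_inv H h1 l1 a * omega H h2 (\<gamma> i) l3 * omega_inv H (\<gamma> i) h4 l4)) (e i)))"
        by (intro coa1_cong 2)
      also have "\<dots> = (\<Sum>i\<in>I. scl V (c i v) (scl V (\<xi> i l2 * \<xi> i h3 * (omega_inv H h1 l1 (\<gamma> i) * omega H h2 (\<gamma> i) l3 * omega_inv H (\<gamma> i) h4 l4)) (e i)))"
        unfolding coa1_graded[OF d(1) Vv bb v]
        by (intro sum.cong refl) (simp add: basis_delta[OF g(1) Vv])
      finally show ?thesis by (simp add: vspace_simps[OF Vv] mult_ac)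
    qed
    have z: "scl V (c i v) (e i) \<in> car V" if "i \<in> I" for i by (intro vspaceD(4)[OF Vv] b that)
    have l4: "lin4 ground (?x i h1 h2 h3 h4)"
      if "i \<in> I" "h1 \<in> car H" "h2 \<in> car H" "h3 \<in> car H" "h4 \<in> car H" for i h1 h2 h3 h4
      by (intro linI bilin_mapI lin_mulL lin_mulR lin_omega lin_omega_inv d(2) lin_id g(3) that; assumption)
    have l4': "lin4 ground (\<lambda>h1 h2 h3 h4. cop4 H l (?x i h1 h2 h3 h4))" if "i \<in> I" for i
      by (intro linI bilin_mapI lin_cop4_param l4 that C_vspace is_vspace_ground l lin_mulL lin_mulR lin_omega lin_omega_inv d(2) lin_id g(3); assumption)
    have "cop4 H h (\<lambda>h1 h2 h3 h4. cop4 H l (\<lambda>l1 l2 l3 l4.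
            coa1 H V v (\<lambda>a v0. coa1 H V (act V l2 v0) (\<lambda>b u0. coa1 H V (act V h3 u0) (\<lambda>c w0.
              scl V (omega_inv H h1 l1 a * omega H h2 b l3 * omega_inv H c h4 l4) w0)))))
      = cop4 H h (\<lambda>h1 h2 h3 h4. cop4 H l (\<lambda>l1 l2 l3 l4. \<Sum>i\<in>I. scl V (?x i h1 h2 h3 h4 l1 l2 l3 l4) (scl V (c i v) (e i))))"
      by (intro cop4_cong coactions)
    also have "\<dots> = cop4 H h (\<lambda>h1 h2 h3 h4. \<Sum>i\<in>I. scl V (cop4 H l (?x i h1 h2 h3 h4)) (scl V (c i v) (e i)))"
      by (intro cop4_cong cop4_family[OF Vv l z l4])
    also have "\<dots> = (\<Sum>i\<in>I. scl V (cop4 H h (\<lambda>h1 h2 h3 h4. cop4 H l (?x i h1 h2 h3 h4))) (scl V (c i v) (e i)))"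
      by (rule cop4_family[OF Vv h z l4'])
    also have "\<dots> = (\<Sum>i\<in>I. scl V (\<xi> i (mul H h l)) (scl V (c i v) (e i)))"
      using yd_character_mul[OF yd h l] by simp
    also have "\<dots> = act V (mul H h l) v"
      unfolding act_expand[OF V mul_car[OF h l] v] by (simp add: vspace_simps[OF Vv] mult.commute)
    finally show ?thesis by simp
  qed
  have compat: "cop2 H h (\<lambda>h1 h2. coa1 H V (act V h1 v) (\<lambda>a w0. tens H V (mul H a h2) w0))
          = cop2 H h (\<lambda>h1 h2. coa1 H V v (\<lambda>a v0. tens H V (mul H h1 a) (act V h2 v0)))"
    if h: "h \<in> car H" and v: "v \<in> car V" for h v
  proof -
    let ?T = "tensor_space H V"
    note T = is_vspace_tensor_space[of H V]
    have pull: "cop2 H h (\<lambda>h1 h2. \<Sum>i\<in>I. tscl (c i v) (tens H V (F i h1 h2) (e i)))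
      = (\<Sum>i\<in>I. tscl (c i v) (tens H V (cop2 H h (F i)) (e i)))"
      if F: "\<And>i. i \<in> I \<Longrightarrow> bilin_map H H H (F i)" for F
    proof -
      have bT: "bilin_map H H ?T (\<lambda>h1 h2. tscl (c i v) (tens H V (F i h1 h2) (e i)))" if "i \<in> I" for i
        by (intro bilin_mapI lin_tscl lin_tens1 lin_bilin1[OF F[OF that]] lin_bilin2[OF F[OF that]] b that)
      have "cop2 H h (\<lambda>h1 h2. tscl (c i v) (tens H V (F i h1 h2) (e i))) = tscl (c i v) (tens H V (cop2 H h (F i)) (e i))"
        if "i \<in> I" for i
        by (rule cop2_map[OF _ C_vspace T F h, symmetric]) (intro lin_tscl lin_tens1 lin_id b that)+
      thus ?thesis
        using sweedler_sum_body[OF C_vspace T comul_car[OF h], of I, OF bT] unfolding cop2_def by simp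
    qed
    have 1: "coa1 H V (act V h1 v) (\<lambda>a w0. tens H V (mul H a h2) w0)
      = (\<Sum>i\<in>I. tscl (c i v) (tens H V (scl H (\<xi> i h1) (mul H (\<gamma> i) h2)) (e i)))"
      if "h1 \<in> car H" "h2 \<in> car H" for h1 h2
    proof -
      have bb: "bilin_map H V ?T (\<lambda>a w0. tens H V (mul H a h2) w0)"
        using that by (intro bilin_mapI lin_tens1 lin_tens2 lin_mul1 lin_id mul_car)
      show ?thesis
        unfolding coa1_graded[OF d(1) T bb d(5)[OF that(1) v]] using that v
        by (intro sum.cong refl) (simp add: coord_act[OF V] tscl_tens[symmetric] mul_car g b tspace_simps)
    qed
    have 2: "coa1 H V v (\<lambda>a v0. tens H V (mul H h1 a) (act V h2 v0))
      = (\<Sum>i\<in>I. tscl (c i v) (tens H V (scl H (\<xi> i h2) (mul H h1 (\<gamma> i))) (e i)))"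
      if "h1 \<in> car H" "h2 \<in> car H" for h1 h2
    proof -
      have bb: "bilin_map H V ?T (\<lambda>a v0. tens H V (mul H h1 a) (act V h2 v0))"
        using that by (intro bilin_mapI lin_tens1 lin_tens2 lin_mul2 lin_id mul_car lin_bilin1[OF d(3)] d(5))
      show ?thesis
        unfolding coa1_graded[OF d(1) T bb v] using that v
        by (intro sum.cong refl) (simp add: d(4) tscl_tens[symmetric] tens_scl_right mul_car g b tspace_simps)
    qed
    have F: "bilin_map H H H (\<lambda>h1 h2. scl H (\<xi> i h1) (mul H (\<gamma> i) h2))" "bilin_map H H H (\<lambda>h1 h2. scl H (\<xi> i h2) (mul H h1 (\<gamma> i)))"
      if "i \<in> I" for i
      by (intro bilin_mapI lin_scl lin_sclL lin_mul1 lin_mul2 lin_id mul_car C_vspace d g that; assumption)+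
    have "cop2 H h (\<lambda>h1 h2. coa1 H V (act V h1 v) (\<lambda>a w0. tens H V (mul H a h2) w0))
       = (\<Sum>i\<in>I. tscl (c i v) (tens H V (cop2 H h (\<lambda>h1 h2. scl H (\<xi> i h1) (mul H (\<gamma> i) h2))) (e i)))"
      by (rule trans[OF cop2_cong[OF 1] pull[of "\<lambda>i h1 h2. scl H (\<xi> i h1) (mul H (\<gamma> i) h2)", OF F(1)]])
    also have "\<dots> = (\<Sum>i\<in>I. tscl (c i v) (tens H V (cop2 H h (\<lambda>h1 h2. scl H (\<xi> i h2) (mul H h1 (\<gamma> i)))) (e i)))"
      using yd_character_twist_H[OF yd h] by simp
    also have "\<dots> = cop2 H h (\<lambda>h1 h2. coa1 H V v (\<lambda>a v0. tens H V (mul H h1 a) (act V h2 v0)))"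
      by (rule trans[OF cop2_cong[OF 2] pull[of "\<lambda>i h1 h2. scl H (\<xi> i h2) (mul H h1 (\<gamma> i))", OF F(2)], symmetric])
    finally show ?thesis .
  qed
  have unit: "act V (one H) v = v" if v: "v \<in> car V" for v
    using act_expand[OF V one_car v] b(6)[OF v] one by simp
  show ?thesis
    unfolding yd_object_def
    by (intro conjI ballI graded_left_comodule[OF d(1)] d(3) quasi unit compat)
qed


lemma tensor_char_cop5:
  assumes "a \<in> grouplike H" "b \<in> grouplike H" "lin_map H ground \<chi>" "lin_map H ground \<chi>'" "h \<in> car H"
  shows "cop5 H h (\<lambda>h1 h2 h3 h4 h5. omega H h1 a b * \<chi> h2 * omega_inv H a h3 b * \<chi>' h4 * omega H a b h5)
    = tensor_char a b \<chi> \<chi>' h"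
proof -
  have lin: "lin_map H ground (\<lambda>h. omega H h a b)" "lin_map H ground (\<lambda>h. omega_inv H a h b)"
    "lin_map H ground (\<lambda>h. omega H a b h)"
    by (intro lin_omega lin_omega_inv lin_id assms(1,2)[THEN grouplikeD(1)])+
  have "tensor_char a b \<chi> \<chi>' h = E1 (tensor_char a b \<chi> \<chi>') h" using assms(5) by (simp add: E1_def)
  thus ?thesis
    unfolding E1_tensor_char[OF assms(1-4)]
    using cop5_lprod[OF assms(5) lin(1) assms(3) lin(2) assms(4) lin(3), of 1] by simp
qed

text \<open>
  The summand of the action on \<open>V \<otimes> W\<close>, with all coactions expanded in the
  bases. The action does not change degrees, so each coaction contributes a degree of the original
  basis vector.
\<close>

lemma tensor_action_summand:
  assumes V: "diagonal V I e c \<gamma> \<xi>" and W: "diagonal W J f d \<delta> \<zeta>"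
    and v: "v \<in> car V" and w: "w \<in> car W"
    and car: "h1 \<in> car H" "h2 \<in> car H" "h3 \<in> car H" "h4 \<in> car H" "h5 \<in> car H"
  shows "coa1 H V v (\<lambda>v1 v0. coa2 H W w (\<lambda>w2 w1 w0. coa2 H V (act V h2 v0) (\<lambda>x2 x1 x0.
         coa1 H W (act W h4 w0) (\<lambda>y1 y0.
           tscl (omega H h1 v1 w2 * omega_inv H x2 h3 w1 * omega H x1 y1 h5) (tens V W x0 y0)))))
    = (\<Sum>i\<in>I. tscl (c i v) (\<Sum>j\<in>J. tscl (d j w) (tscl (omega H h1 (\<gamma> i) (\<delta> j) * \<xi> i h2
        * omega_inv H (\<gamma> i) h3 (\<delta> j) * \<zeta> j h4 * omega H (\<gamma> i) (\<delta> j) h5) (tens V W (e i) (f j)))))"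
proof -
  note dV = diagonalD[OF V] and dW = diagonalD[OF W]
  note gV = gradedD[OF dV(1)] and bV = basisD[OF gradedD(1)[OF dV(1)]]
    and gW = gradedD[OF dW(1)] and bW = basisD[OF gradedD(1)[OF dW(1)]]
  let ?T = "tensor_space V W"
  note T = is_vspace_tensor_space[of V W]
  note rules = bilin_mapI lin_sum T lin_tscl lin_tsclL lin_mulL lin_mulR lin_tens1 lin_tens2 lin_id
    lin_omega lin_omega_inv bV(4) bW(4) gV(3) gW(3) car
  note tc = tspaceD(4) tspaceD(5) tens_car bV(3) bW(3)
  have 1: "coa1 H W (act W h4 w0) (\<lambda>y1 y0. tscl (omega H h1 v1 w2 * omega_inv H x2 h3 w1 * omega H x1 y1 h5) (tens V W x0 y0))
    = (\<Sum>j\<in>J. tscl (d j w0) (tscl (\<zeta> j h4 * (omega H h1 v1 w2 * omega_inv H x2 h3 w1 * omega H x1 (\<delta> j) h5)) (tens V W x0 (f j))))"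
    if "v1 \<in> car H" "w2 \<in> car H" "w1 \<in> car H" "x2 \<in> car H" "x1 \<in> car H" "x0 \<in> car V" "w0 \<in> car W"
    for v1 w2 w1 x2 x1 x0 w0
  proof -
    have bb: "bilin_map H W ?T (\<lambda>y1 y0. tscl (omega H h1 v1 w2 * omega_inv H x2 h3 w1 * omega H x1 y1 h5) (tens V W x0 y0))"
      by (intro rules that tens_car; assumption)
    show ?thesis
      unfolding coa1_graded[OF dW(1) T bb dW(5)[OF car(4) that(7)]] using that car
      by (simp add: coord_act[OF W] tspace_simps mult_ac)
  qed
  have 2: "coa2 H V (act V h2 v0) (\<lambda>x2 x1 x0. coa1 H W (act W h4 w0) (\<lambda>y1 y0.
           tscl (omega H h1 v1 w2 * omega_inv H x2 h3 w1 * omega H x1 y1 h5) (tens V W x0 y0)))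
    = (\<Sum>i\<in>I. tscl (c i v0) (\<Sum>j\<in>J. tscl (d j w0) (tscl (\<xi> i h2 * \<zeta> j h4 * (omega H h1 v1 w2 * omega_inv H (\<gamma> i) h3 w1 * omega H (\<gamma> i) (\<delta> j) h5)) (tens V W (e i) (f j)))))"
    if "v1 \<in> car H" "w2 \<in> car H" "w1 \<in> car H" "v0 \<in> car V" "w0 \<in> car W" for v1 w2 w1 v0 w0
  proof -
    have "coa2 H V (act V h2 v0) (\<lambda>x2 x1 x0. coa1 H W (act W h4 w0) (\<lambda>y1 y0.
           tscl (omega H h1 v1 w2 * omega_inv H x2 h3 w1 * omega H x1 y1 h5) (tens V W x0 y0)))
      = coa2 H V (act V h2 v0) (\<lambda>x2 x1 x0. \<Sum>j\<in>J. tscl (d j w0) (tscl (\<zeta> j h4 * (omega H h1 v1 w2 * omega_inv H x2 h3 w1 * omega H x1 (\<delta> j) h5)) (tens V W x0 (f j))))"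
      by (intro coa2_cong 1 that)
    also have "\<dots> = (\<Sum>i\<in>I. tscl (c i (act V h2 v0)) (\<Sum>j\<in>J. tscl (d j w0) (tscl (\<zeta> j h4 * (omega H h1 v1 w2 * omega_inv H (\<gamma> i) h3 w1 * omega H (\<gamma> i) (\<delta> j) h5)) (tens V W (e i) (f j)))))"
      by (rule coa2_graded[OF dV(1) T dV(5)[OF car(2) that(4)], simplified]) (intro rules that bW(3) tens_car; assumption)+
    finally show ?thesis
      using that car by (simp add: coord_act[OF V] tspace_simps mult_ac)
  qed
  have 3: "coa2 H W w (\<lambda>w2 w1 w0. coa2 H V (act V h2 v0) (\<lambda>x2 x1 x0. coa1 H W (act W h4 w0) (\<lambda>y1 y0.
           tscl (omega H h1 v1 w2 * omega_inv H x2 h3 w1 * omega H x1 y1 h5) (tens V W x0 y0))))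
    = (\<Sum>j\<in>J. tscl (d j w) (\<Sum>i\<in>I. tscl (c i v0) (tscl (\<xi> i h2 * \<zeta> j h4 * (omega H h1 v1 (\<delta> j) * omega_inv H (\<gamma> i) h3 (\<delta> j) * omega H (\<gamma> i) (\<delta> j) h5)) (tens V W (e i) (f j)))))"
    if "v1 \<in> car H" "v0 \<in> car V" for v1 v0
  proof -
    have "coa2 H W w (\<lambda>w2 w1 w0. coa2 H V (act V h2 v0) (\<lambda>x2 x1 x0. coa1 H W (act W h4 w0) (\<lambda>y1 y0.
           tscl (omega H h1 v1 w2 * omega_inv H x2 h3 w1 * omega H x1 y1 h5) (tens V W x0 y0))))
      = coa2 H W w (\<lambda>w2 w1 w0. \<Sum>i\<in>I. tscl (c i v0) (\<Sum>j\<in>J. tscl (d j w0) (tscl (\<xi> i h2 * \<zeta> j h4 * (omega H h1 v1 w2 * omega_inv H (\<gamma> i) h3 w1 * omega H (\<gamma> i) (\<delta> j) h5)) (tens V W (e i) (f j)))))"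
      by (intro coa2_cong 2 that)
    also have "\<dots> = (\<Sum>l\<in>J. tscl (d l w) (\<Sum>i\<in>I. tscl (c i v0) (\<Sum>j\<in>J. tscl (d j (f l)) (tscl (\<xi> i h2 * \<zeta> j h4 * (omega H h1 v1 (\<delta> l) * omega_inv H (\<gamma> i) h3 (\<delta> l) * omega H (\<gamma> i) (\<delta> j) h5)) (tens V W (e i) (f j))))))"
      by (rule coa2_graded[OF dW(1) T w, simplified]) (intro rules that tc; assumption)+
    also have "\<dots> = (\<Sum>j\<in>J. tscl (d j w) (\<Sum>i\<in>I. tscl (c i v0) (tscl (\<xi> i h2 * \<zeta> j h4 * (omega H h1 v1 (\<delta> j) * omega_inv H (\<gamma> i) h3 (\<delta> j) * omega H (\<gamma> i) (\<delta> j) h5)) (tens V W (e i) (f j)))))"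
      by (intro sum.cong refl) (simp add: basis_delta_tscl[OF gW(1)])
    finally show ?thesis .
  qed
  have b4: "bilin_map H V ?T (\<lambda>v1 v0. \<Sum>j\<in>J. tscl (d j w) (\<Sum>i\<in>I. tscl (c i v0) (tscl (\<xi> i h2 * \<zeta> j h4 * (omega H h1 v1 (\<delta> j) * omega_inv H (\<gamma> i) h3 (\<delta> j) * omega H (\<gamma> i) (\<delta> j) h5)) (tens V W (e i) (f j)))))"
    by (intro rules tc; assumption)
  have "coa1 H V v (\<lambda>v1 v0. coa2 H W w (\<lambda>w2 w1 w0. coa2 H V (act V h2 v0) (\<lambda>x2 x1 x0.
         coa1 H W (act W h4 w0) (\<lambda>y1 y0.
           tscl (omega H h1 v1 w2 * omega_inv H x2 h3 w1 * omega H x1 y1 h5) (tens V W x0 y0)))))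
    = coa1 H V v (\<lambda>v1 v0. \<Sum>j\<in>J. tscl (d j w) (\<Sum>i\<in>I. tscl (c i v0) (tscl (\<xi> i h2 * \<zeta> j h4 * (omega H h1 v1 (\<delta> j) * omega_inv H (\<gamma> i) h3 (\<delta> j) * omega H (\<gamma> i) (\<delta> j) h5)) (tens V W (e i) (f j)))))"
    by (intro coa1_cong 3)
  also have "\<dots> = (\<Sum>l\<in>I. tscl (c l v) (\<Sum>j\<in>J. tscl (d j w) (\<Sum>i\<in>I. tscl (c i (e l)) (tscl (\<xi> i h2 * \<zeta> j h4 * (omega H h1 (\<gamma> l) (\<delta> j) * omega_inv H (\<gamma> i) h3 (\<delta> j) * omega H (\<gamma> i) (\<delta> j) h5)) (tens V W (e i) (f j))))))"
    using coa1_graded[OF dV(1) T b4 v] by simp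
  also have "\<dots> = (\<Sum>i\<in>I. tscl (c i v) (\<Sum>j\<in>J. tscl (d j w) (tscl (omega H h1 (\<gamma> i) (\<delta> j) * \<xi> i h2
        * omega_inv H (\<gamma> i) h3 (\<delta> j) * \<zeta> j h4 * omega H (\<gamma> i) (\<delta> j) h5) (tens V W (e i) (f j)))))"
    by (intro sum.cong refl) (simp add: basis_delta_tscl[OF gV(1)] mult_ac)
  finally show ?thesis .
qed

text \<open>
  Summing the scalars of \<open>tensor_action_summand\<close> over the fivefold coproduct gives
  \<open>tensor_char\<close>.
\<close>

theorem diagonal_tensor:
  assumes V: "diagonal V I e c \<gamma> \<xi>" and W: "diagonal W J f d \<delta> \<zeta>"
  shows "diagonal (yd_tensor H V W) (I \<times> J) (\<lambda>(i, j). tens V W (e i) (f j))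
    (\<lambda>(i, j) t. sweedler V W t (\<lambda>v w. c i v * d j w)) (\<lambda>(i, j). mul H (\<gamma> i) (\<delta> j))
    (\<lambda>(i, j). tensor_char (\<gamma> i) (\<delta> j) (\<xi> i) (\<zeta> j))"
proof -
  note dV = diagonalD[OF V] and dW = diagonalD[OF W]
  note gV = gradedD[OF dV(1)] and bV = basisD[OF gradedD(1)[OF dV(1)]]
    and gW = gradedD[OF dW(1)] and bW = basisD[OF gradedD(1)[OF dW(1)]]
  let ?T = "tensor_space V W"
  note T = is_vspace_tensor_space[of V W]
  let ?\<theta> = "\<lambda>i j. tensor_char (\<gamma> i) (\<delta> j) (\<xi> i) (\<zeta> j)"
  define G where "G h v w = (\<Sum>p\<in>I \<times> J. tscl (?\<theta> (fst p) (snd p) h) (tscl (c (fst p) v * d (snd p) w) (tens V W (e (fst p)) (f (snd p)))))" for h v w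
  have lin\<theta>: "lin_map H ground (?\<theta> i j)" if "i \<in> I" "j \<in> J" for i j
    by (intro lin_tensor_char gV gW dV dW that)
  have tc: "tens V W (e (fst p)) (f (snd p)) \<in> subtensor V W (car V) (car W)" if "p \<in> I \<times> J" for p
    using that by (auto intro!: tens_car bV bW)
  have summand: "cop5 H h (\<lambda>h1 h2 h3 h4 h5. coa1 H V v (\<lambda>v1 v0. coa2 H W w (\<lambda>w2 w1 w0. coa2 H V (act V h2 v0) (\<lambda>x2 x1 x0.
         coa1 H W (act W h4 w0) (\<lambda>y1 y0.
           tscl (omega H h1 v1 w2 * omega_inv H x2 h3 w1 * omega H x1 y1 h5) (tens V W x0 y0))))))
    = G h v w"
    if h: "h \<in> car H" and v: "v \<in> car V" and w: "w \<in> car W" for h v w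
  proof -
    let ?x = "\<lambda>p h1 h2 h3 h4 h5. omega H h1 (\<gamma> (fst p)) (\<delta> (snd p)) * \<xi> (fst p) h2
        * omega_inv H (\<gamma> (fst p)) h3 (\<delta> (snd p)) * \<zeta> (snd p) h4 * omega H (\<gamma> (fst p)) (\<delta> (snd p)) h5"
    let ?z = "\<lambda>p. tscl (c (fst p) v * d (snd p) w) (tens V W (e (fst p)) (f (snd p)))"
    have l5: "lin5 ground (?x p)" if "p \<in> I \<times> J" for p
    proof -
      have ij: "fst p \<in> I" "snd p \<in> J" using that by auto
      show ?thesis
        by (intro linI bilin_mapI lin_mulL lin_mulR lin_omega lin_omega_inv dV(2) dW(2) lin_id gV(3) gW(3) ij; assumption)
    qed
    have "cop5 H h (\<lambda>h1 h2 h3 h4 h5. coa1 H V v (\<lambda>v1 v0. coa2 H W w (\<lambda>w2 w1 w0. coa2 H V (act V h2 v0) (\<lambda>x2 x1 x0.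
         coa1 H W (act W h4 w0) (\<lambda>y1 y0.
           tscl (omega H h1 v1 w2 * omega_inv H x2 h3 w1 * omega H x1 y1 h5) (tens V W x0 y0))))))
      = cop5 H h (\<lambda>h1 h2 h3 h4 h5. \<Sum>p\<in>I \<times> J. tscl (?x p h1 h2 h3 h4 h5) (?z p))"
    proof (intro cop5_cong)
      fix h1 h2 h3 h4 h5 assume car: "h1 \<in> car H" "h2 \<in> car H" "h3 \<in> car H" "h4 \<in> car H" "h5 \<in> car H"
      show "coa1 H V v (\<lambda>v1 v0. coa2 H W w (\<lambda>w2 w1 w0. coa2 H V (act V h2 v0) (\<lambda>x2 x1 x0.
         coa1 H W (act W h4 w0) (\<lambda>y1 y0.
           tscl (omega H h1 v1 w2 * omega_inv H x2 h3 w1 * omega H x1 y1 h5) (tens V W x0 y0)))))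
        = (\<Sum>p\<in>I \<times> J. tscl (?x p h1 h2 h3 h4 h5) (?z p))"
        unfolding tensor_action_summand[OF V W v w car]
        by (simp add: tspace_simps mult_ac sum.cartesian_product case_prod_beta')
    qed
    also have "\<dots> = (\<Sum>p\<in>I \<times> J. tscl (cop5 H h (?x p)) (?z p))"
      by (rule cop5_family[OF T h _ l5, simplified]) (auto intro!: tspaceD(4) tens_car bV bW)
    also have "\<dots> = G h v w"
      unfolding G_def by (intro sum.cong refl) (auto simp: tensor_char_cop5 gV gW dV dW h)
    finally show ?thesis .
  qed
  have act: "act (yd_tensor H V W) h t = sweedler V W t (G h)" if "h \<in> car H" for h t
    unfolding yd_tensor_def by simp (intro sweedler_cong summand that)
  have bG: "bilin_map V W ?T (G h)" if "h \<in> car H" for h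
    unfolding G_def
    by (intro bilin_mapI lin_sum T lin_tscl lin_tsclL lin_mulL lin_mulR bV bW tc) (auto simp: mem_Times_iff)
  have lG: "lin_map H ?T (\<lambda>h. G h v w)" for v w
    unfolding G_def by (intro lin_sum T lin_tsclL lin\<theta> tspaceD(4) tc) (auto simp: mem_Times_iff)
  have bact: "bilin_map H ?T ?T (act (yd_tensor H V W))"
  proof (intro bilin_mapI)
    show "lin_map ?T ?T (act (yd_tensor H V W) h)" if "h \<in> car H" for h
      unfolding act[OF that, abs_def] by (rule lin_map_sweedler[OF bV(1) T bG[OF that]])
    show "lin_map H ?T (\<lambda>h. act (yd_tensor H V W) h t)" if "t \<in> car ?T" for t
      by (rule lin_congI[OF C_vspace lin_sweedler_body[OF bV(1) T C_vspace that bG lG] act])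
  qed
  have diag: "act (yd_tensor H V W) h (tens V W (e i) (f j)) = tscl (?\<theta> i j h) (tens V W (e i) (f j))"
    if "h \<in> car H" "i \<in> I" "j \<in> J" for h i j
  proof -
    have "act (yd_tensor H V W) h (tens V W (e i) (f j)) = G h (e i) (f j)"
      unfolding act[OF that(1)] by (rule sweedler_tens_basis[OF gV(1) gW(1) T bG that(2,3)]) (rule that)
    also have "\<dots> = (\<Sum>p\<in>I \<times> J. if p = (i, j) then tscl (?\<theta> i j h) (tens V W (e i) (f j)) else 0)"
      unfolding G_def using that by (intro sum.cong refl) (auto simp: bV(5) bW(5) tspace_simps)
    finally show ?thesis using that bV(2) bW(2) by simp
  qed
  have bil: "bilin_map H (yd_tensor H V W) (yd_tensor H V W) (act (yd_tensor H V W))"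
    using bact bilin_map_cong_space[of H H "yd_tensor H V W" ?T "yd_tensor H V W" ?T] by simp
  show ?thesis
    unfolding diagonal_def
    using graded_tensor[OF dV(1) dW(1)] bil lin\<theta> diag by auto
qed

end


lemma lin_map_eq_on_tensor_basis:
  assumes V: "basis V I e c" and W: "basis W J f d"
    and "lin_map (tensor_space V W) Z F" "lin_map (tensor_space V W) Z F'"
    and "\<And>i j. i \<in> I \<Longrightarrow> j \<in> J \<Longrightarrow> F (tens V W (e i) (f j)) = F' (tens V W (e i) (f j))"
    and "t \<in> subtensor V W (car V) (car W)"
  shows "F t = F' t"
  by (rule lin_map_eq_on_basis[OF basis_tensor[OF V W] assms(3,4)]) (use assms(5,6) in auto)

context dual_quasi_bialg
begin

section \<open>Morphisms out of diagonal modules\<close>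

text \<open>Vectors which span a one-dimensional subobject, or are zero.\<close>

definition weight_vector :: "('k, 'h, 'v::ab_group_add, 'n) yd_obj_scheme \<Rightarrow> 'h \<Rightarrow> ('h \<Rightarrow> 'k) \<Rightarrow> 'v \<Rightarrow> bool" where
  "weight_vector V \<gamma> \<xi> v \<longleftrightarrow> v \<in> car V \<and> coact V v = tens H V \<gamma> v
    \<and> (\<forall>h\<in>car H. act V h v = scl V (\<xi> h) v)"

lemma weight_vector_basis:
  assumes V: "diagonal V I e c \<gamma> \<xi>" and i: "i \<in> I"
  shows "weight_vector V (\<gamma> i) (\<xi> i) (e i)"
  using coact_basis[OF diagonalD(1)[OF V] i] diagonalD(4)[OF V _ i] basisD(3)[OF gradedD(1)[OF diagonalD(1)[OF V]] i]
  by (simp add: weight_vector_def)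

text \<open>
  Zero and all linear combinations stay weight vectors. The empty sum covers maps that kill basis
  vectors.
\<close>

lemma weight_vector_sum:
  assumes V: "diagonal V I e c \<gamma> \<xi>" and \<delta>: "\<delta> \<in> car H"
    and v: "\<And>j. j \<in> J \<Longrightarrow> weight_vector V \<delta> \<zeta> (v j)"
  shows "weight_vector V \<delta> \<zeta> (\<Sum>j\<in>J. scl V (k j) (v j))"
proof -
  note d = diagonalD[OF V] and b = basisD[OF gradedD(1)[OF diagonalD(1)[OF V]]]
  note vs = vspaceD[OF b(1)] vspace_simps[OF b(1)]
  have c: "v j \<in> car V" if "j \<in> J" for j using v[OF that] by (simp add: weight_vector_def)
  have s: "F (\<Sum>j\<in>J. scl V (k j) (v j)) = (\<Sum>j\<in>J. scl Z (k j) (F (v j)))" if "lin_map V Z F" for Z :: "('k, 'z::ab_group_add, 'y) vspace_scheme" and F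
    by (subst lin_map_sum[OF b(1) that]) (simp_all add: vs c lin_mapD(3)[OF that])
  have "coact V (\<Sum>j\<in>J. scl V (k j) (v j)) = (\<Sum>j\<in>J. tscl (k j) (tens H V \<delta> (v j)))"
    unfolding s[OF lin_coact[OF d(1)]] using v by (simp add: weight_vector_def)
  also have "\<dots> = tens H V \<delta> (\<Sum>j\<in>J. scl V (k j) (v j))"
    using s[OF lin_tens2[OF \<delta> lin_id]] by simp
  finally have 1: "coact V (\<Sum>j\<in>J. scl V (k j) (v j)) = tens H V \<delta> (\<Sum>j\<in>J. scl V (k j) (v j))" .
  have "act V h (\<Sum>j\<in>J. scl V (k j) (v j)) = scl V (\<zeta> h) (\<Sum>j\<in>J. scl V (k j) (v j))" if h: "h \<in> car H" for h
    unfolding s[OF lin_bilin1[OF d(3) h]] using v h by (simp add: weight_vector_def vs mult.commute)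
  thus ?thesis using 1 by (simp add: weight_vector_def vs c)
qed

lemma weight_vector_scl:
  assumes "diagonal V I e c \<gamma> \<xi>" "weight_vector V \<delta> \<zeta> v" "\<delta> \<in> car H"
  shows "weight_vector V \<delta> \<zeta> (scl V k v)"
  using weight_vector_sum[OF assms(1,3), of "{()}" \<zeta> "\<lambda>_. v" "\<lambda>_. k"] assms(2) by simp

lemma weight_vector_cong:
  "weight_vector V \<gamma> \<xi> v \<Longrightarrow> \<gamma> = \<gamma>' \<Longrightarrow> (\<And>h. h \<in> car H \<Longrightarrow> \<xi> h = \<xi>' h) \<Longrightarrow> weight_vector V \<gamma>' \<xi>' v"
  by (simp add: weight_vector_def)

text \<open>
  Compatibility with coaction and action can be checked on basis vectors, where it compares
  degrees and characters.
\<close>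

lemma diagonal_yd_hom:
  assumes V: "diagonal V I e c \<gamma> \<xi>" and W: "diagonal W J f d \<delta> \<zeta>" and F: "lin_map V W F"
    and wt: "\<And>i. i \<in> I \<Longrightarrow> weight_vector W (\<gamma> i) (\<xi> i) (F (e i))"
  shows "yd_hom H V W F"
proof -
  note dV = diagonalD[OF V] and dW = diagonalD[OF W]
  note gV = gradedD[OF dV(1)] and bV = basisD[OF gradedD(1)[OF dV(1)]]
  have "coact W (F v) = tmap H V H W (\<lambda>h. h) F (coact V v)" if v: "v \<in> car V" for v
  proof (rule lin_map_eq_on_basis[OF gV(1) lin_comp[OF lin_coact[OF dW(1)] F]
        lin_comp[OF lin_tmap[OF C_vspace lin_id F] lin_coact[OF dV(1)]] _ v])
    show "coact W (F (e i)) = tmap H V H W (\<lambda>h. h) F (coact V (e i))" if "i \<in> I" for i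
      using wt[OF that] that by (simp add: weight_vector_def coact_basis[OF dV(1)] tmap_tens[OF lin_id F] gV(3) bV(3))
  qed
  moreover have "F (act V h v) = act W h (F v)" if h: "h \<in> car H" and v: "v \<in> car V" for h v
  proof (rule lin_map_eq_on_basis[OF gV(1) lin_comp[OF F lin_bilin1[OF dV(3) h]] lin_comp[OF lin_bilin1[OF dW(3) h] F] _ v])
    show "F (act V h (e i)) = act W h (F (e i))" if "i \<in> I" for i
      using wt[OF that] that h by (simp add: weight_vector_def dV(4) lin_mapD(3)[OF F] bV)
  qed
  ultimately show ?thesis using F by (simp add: yd_hom_def)
qed

lemma diagonal_unit:
  "diagonal (yd_unit H) {()} (\<lambda>_. 1) (\<lambda>_ v. v) (\<lambda>_. one H) (\<lambda>_. counit H)"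
proof -
  have v: "is_vspace (yd_unit H)" using is_vspace_ground by (simp add: is_vspace_def)
  have t: "tens H (yd_unit H) a 1 = tens H ground a 1" for a by (simp add: yd_unit_spaces)
  have act: "act (yd_unit H) = (\<lambda>h c. counit H h * c)" by (simp add: yd_unit_def)
  have co: "coact (yd_unit H) c = tscl c (tens H (yd_unit H) (one H) 1)" for c
  proof -
    have "coact (yd_unit H) c = tens H ground (one H) (scl ground c 1)" by (simp add: yd_unit_def)
    also have "\<dots> = tscl c (tens H ground (one H) 1)" by (rule tens_scl_right) (simp_all add: one_car)
    finally show ?thesis by (simp only: t)
  qed
  have l: "lin_map (yd_unit H) ground (\<lambda>v. v)" unfolding yd_unit_spaces by (rule lin_id)
  have "bilin_map H ground ground (act (yd_unit H))"
    unfolding act by (intro bilin_mapI lin_mulL lin_mulR lin_counit lin_id)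
  hence bi: "bilin_map H (yd_unit H) (yd_unit H) (act (yd_unit H))"
    using bilin_map_cong_space[of H H "yd_unit H" ground "yd_unit H" ground] by simp
  have "basis (yd_unit H) {()} (\<lambda>_. 1) (\<lambda>_ v. v)"
    using v l by (simp add: basis_def)
  hence "graded (yd_unit H) {()} (\<lambda>_. 1) (\<lambda>_ v. v) (\<lambda>_. one H)"
    using one_grouplike co by (simp add: graded_def)
  thus ?thesis using bi by (simp add: diagonal_def lin_counit act)
qed

end

section \<open>The quantum line\<close>

locale qyd_root = qyd H g \<chi> for H :: "('k::field, 'h::ab_group_add, 'm) dqb_scheme" and g \<chi> +
  fixes q :: 'k and N :: nat
  assumes q: "q = \<chi> g" and q_ne_1: "q \<noteq> 1" and primitive: "primitive_root_of_unity N q"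
begin

lemma N_pos: "N > 0"
  using primitive by (simp add: primitive_root_of_unity_def)

text \<open>
  Functions supported on \<open>{..<N}\<close>: the coordinate vectors of the basis
  \<open>x\<close>.
\<close>

definition Rv :: "('k, nat \<Rightarrow> 'k) vspace" where
  "Rv = \<lparr>car = {f. \<forall>n\<ge>N. f n = 0}, scl = (\<lambda>c f n. c * f n)\<rparr>"

text \<open>
  Setting \<open>x n = 0\<close> for \<open>n \<ge> N\<close> makes the truncation of the
  multiplication automatic.
\<close>

definition x :: "nat \<Rightarrow> nat \<Rightarrow> 'k" where
  "x n = (\<lambda>m. if m = n \<and> n < N then 1 else 0)"

text \<open>
  The formulas of the theorem, extended linearly from the basis. The definition uses the plain
  space \<open>Rv\<close> because \<open>R\<close> is not available inside its own definition.
\<close>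

definition R :: "('k, 'h, nat \<Rightarrow> 'k) yd_bialg" where
  "R = \<lparr>car = car Rv, scl = scl Rv,
     coact = (\<lambda>v. \<Sum>n<N. tscl (v n) (tens H Rv (gp n) (x n))),
     act = (\<lambda>h v n. chi n h * v n),
     rmul = (\<lambda>t. sweedler Rv Rv t (\<lambda>v w. \<Sum>a<N. \<Sum>b<N. scl Rv (v a * w b) (scl Rv (cobd a b) (x (a + b))))),
     runit = (\<lambda>c. scl Rv c (x 0)),
     rcomul = (\<lambda>v. \<Sum>n<N. tscl (v n) (\<Sum>i\<le>n. tscl (beta_coeff H g q i n) (tens Rv Rv (x i) (x (n - i))))),
     rcounit = (\<lambda>v. v 0)\<rparr>"

lemma R_space [simp]: "car R = car Rv" "scl R = scl Rv"
  by (simp_all add: R_def)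

lemma R_fields:
  "coact R v = (\<Sum>n<N. tscl (v n) (tens H Rv (gp n) (x n)))"
  "rmul R t = sweedler Rv Rv t (\<lambda>v w. \<Sum>a<N. \<Sum>b<N. scl Rv (v a * w b) (scl Rv (cobd a b) (x (a + b))))"
  "rcomul R v = (\<Sum>n<N. tscl (v n) (\<Sum>i\<le>n. tscl (beta_coeff H g q i n) (tens Rv Rv (x i) (x (n - i)))))"
  by (simp_all add: R_def)

lemma R_spaces:
  "tens Rv Rv = tens R R" "tens H Rv = tens H R" "sweedler Rv Rv = sweedler R R"
  "tensor_space Rv Rv = tensor_space R R" "lin_map Rv U = lin_map R U" "lin_map U Rv = lin_map U R"
  by (rule tens_cong_space sweedler_cong_space tensor_space_cong_space lin_map_cong_space; simp)+

lemma scl_R: "scl Rv c f n = c * f n"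
  by (simp add: Rv_def)

lemma x_apply: "i < N \<Longrightarrow> x j i = (if i = j then 1 else 0)"
  by (auto simp: x_def)

lemma x_car: "x n \<in> car Rv"
  by (simp add: Rv_def x_def)

lemma x_zero: "N \<le> n \<Longrightarrow> x n = 0"
  by (auto simp: x_def fun_eq_iff)

lemma R_vspace: "is_vspace R"
proof -
  interpret v: vector_space "scl Rv :: 'k \<Rightarrow> (nat \<Rightarrow> 'k) \<Rightarrow> _"
    by unfold_locales (auto simp: scl_R fun_eq_iff algebra_simps)
  have "v.subspace (car Rv)"
    unfolding v.subspace_def by (auto simp: Rv_def)
  thus ?thesis by (simp add: is_vspace_def v.vector_space_axioms)
qed

lemmas R_vsD = vspaceD[OF R_vspace, simplified] and R_vsS = vspace_simps[OF R_vspace, simplified]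

lemma scl_zero: "scl Rv c 0 = 0"
  by (simp add: scl_R fun_eq_iff)

lemma lin_coord: "lin_map R ground (\<lambda>v. v i)"
  by (simp add: lin_map_def scl_R)

lemma sum_x_apply: "(\<Sum>i\<in>I. scl Rv (k i) (y i)) n = (\<Sum>i\<in>I. k i * y i n)"
  by (induction I rule: infinite_finite_induct) (simp_all add: scl_R)

lemma basis_R: "basis R {..<N} x (\<lambda>i v. v i)"
proof -
  have "v = (\<Sum>i<N. scl Rv (v i) (x i))" if "v \<in> car Rv" for v
  proof
    fix n
    have "(\<Sum>i<N. v i * x i n) = (\<Sum>i<N. if i = n then v i else 0)"
      by (intro sum.cong) (auto simp: x_def)
    also have "\<dots> = v n" using that by (simp add: Rv_def)
    finally show "v n = (\<Sum>i<N. scl Rv (v i) (x i)) n" by (simp add: sum_x_apply)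
  qed
  thus ?thesis
    unfolding basis_def using R_vspace x_car lin_coord by (auto simp: x_apply)
qed

lemma basis_delta_R: "a < N \<Longrightarrow> (\<Sum>k<N. scl Rv (x a k) (z k)) = z a"
  using basis_delta[OF basis_R R_vspace, of a z] by simp

lemma diagonal_R: "diagonal R {..<N} x (\<lambda>i v. v i) gp chi"
proof -
  have "coact R v = (\<Sum>n<N. tscl (v n) (tens H R (gp n) (x n)))" for v
    unfolding R_fields R_spaces ..
  hence g: "graded R {..<N} x (\<lambda>i v. v i) gp"
    unfolding graded_def by (simp add: basis_R gp_grouplike)
  have a: "act R h v = (\<lambda>n. chi n h * v n)" for h v by (simp add: R_def)
  have "bilin_map H R R (act R)"
  proof (intro bilin_mapI)
    show "lin_map R R (act R h)" for h
      by (auto simp: lin_map_def a Rv_def fun_eq_iff algebra_simps)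
    show "lin_map H R (\<lambda>h. act R h v)" if "v \<in> car R" for v
      using that by (auto simp: lin_map_def a Rv_def fun_eq_iff algebra_simps lin_mapD(2,3)[OF lin_chi])
  qed
  moreover have "act R h (x i) = scl R (chi i h) (x i)" for h i
    by (auto simp: a scl_R x_def fun_eq_iff)
  ultimately show ?thesis unfolding diagonal_def using g lin_chi by blast
qed

lemmas graded_R = diagonalD(1)[OF diagonal_R]

theorem R_yd_object: "yd_object H R"
  by (rule diagonal_yd_object[OF diagonal_R]) (simp_all add: yd_character_chi chi_one)

abbreviation "R2 \<equiv> yd_tensor H R R"
abbreviation "T2 \<equiv> tensor_space R R"
abbreviation "X a b \<equiv> tens R R (x a) (x b)"

lemma X_car: "X a b \<in> car T2"
  using tens_car[of "x a" R "x b" R] by (simp add: x_car)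

lemma X_car': "X a b \<in> subtensor R R (car Rv) (car Rv)"
  using X_car by simp

lemma tens_zero: "w \<in> car W \<Longrightarrow> is_vspace V \<Longrightarrow> tens V W 0 w = 0" "v \<in> car V \<Longrightarrow> is_vspace W \<Longrightarrow> tens V W v 0 = 0"
  for V :: "('k, 'v::ab_group_add, 'y) vspace_scheme" and W :: "('k, 'w::ab_group_add, 'z) vspace_scheme"
  using lin_map_0[OF _ lin_tens1[OF _ lin_id]] lin_map_0[OF _ lin_tens2[OF _ lin_id]] by blast+

lemma X_zero: "N \<le> a \<or> N \<le> b \<Longrightarrow> X a b = 0"
  by (auto simp: x_zero tens_zero R_vspace x_car)

lemmas diagonal_R2 = diagonal_tensor[OF diagonal_R diagonal_R]

lemma weight_X: "weight_vector R2 (gp (a + b)) (chi (a + b)) (X a b)"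
proof (cases "a < N \<and> b < N")
  case True
  hence "(a, b) \<in> {..<N} \<times> {..<N}" by simp
  from weight_vector_cong[OF weight_vector_basis[OF diagonal_R2 this], of "gp (a + b)" "chi (a + b)"]
  show ?thesis by (simp add: gp_add chi_add)
next
  case False
  have "weight_vector R2 (gp (a + b)) (chi (a + b)) (\<Sum>j\<in>({}::unit set). scl R2 0 0)"
    by (rule weight_vector_sum[OF diagonal_R2 gp_car]) simp
  thus ?thesis using X_zero[of a b] False by auto
qed

lemma weight_x: "weight_vector R (gp n) (chi n) (x n)"
proof (cases "n < N")
  case True
  thus ?thesis using weight_vector_basis[OF diagonal_R, of n] by simp
next
  case False
  have "weight_vector R (gp n) (chi n) (\<Sum>j\<in>({}::unit set). scl R 0 0)"
    by (rule weight_vector_sum[OF diagonal_R gp_car]) simp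
  thus ?thesis using x_zero[of n] False by simp
qed

subsection \<open>Structure maps on the basis\<close>

lemma bilin_rmul: "bilin_map R R R (\<lambda>v w. \<Sum>a<N. \<Sum>b<N. scl R (v a * w b) (scl R (cobd a b) (x (a + b))))"
  by (intro bilin_mapI lin_sum R_vspace lin_sclL lin_mulL lin_mulR lin_coord) (simp_all add: R_vsD x_car)

lemma rmul_def': "rmul R t = sweedler R R t (\<lambda>v w. \<Sum>a<N. \<Sum>b<N. scl R (v a * w b) (scl R (cobd a b) (x (a + b))))"
  unfolding R_fields R_spaces by simp

lemma lin_rmul: "lin_map T2 R (rmul R)"
  unfolding rmul_def'[abs_def] by (rule lin_map_sweedler[OF R_vspace R_vspace bilin_rmul])

lemma rmul_X: "rmul R (X a b) = scl Rv (cobd a b) (x (a + b))"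
proof (cases "a < N \<and> b < N")
  case True
  have "rmul R (X a b) = (\<Sum>k<N. \<Sum>l<N. scl R (x a k * x b l) (scl R (cobd k l) (x (k + l))))"
    unfolding rmul_def' by (rule sweedler_tens[OF R_vspace bilin_rmul]) (simp_all add: x_car)
  also have "\<dots> = (\<Sum>k<N. scl R (x a k) (\<Sum>l<N. scl R (x b l) (scl R (cobd k l) (x (k + l)))))"
    by (simp add: R_vsS mult.assoc)
  finally show ?thesis
    using True by (simp add: basis_delta_R)
next
  case False
  thus ?thesis using X_zero[of a b] x_zero[of "a + b"] lin_map_0[OF is_vspace_tensor_space lin_rmul]
    by (auto simp: scl_zero)
qed

lemma lin_runit: "lin_map ground R (runit R)"
  by (simp add: R_def) (simp add: lin_map_def R_vsD R_vsS x_car)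

lemma runit_R: "runit R c = scl Rv c (x 0)"
  by (simp add: R_def)

lemma rcounit_R: "rcounit R v = v 0"
  by (simp add: R_def)

lemma lin_rcounit: "lin_map R ground (rcounit R)"
  using lin_coord[of 0] by (simp add: R_def)

definition gb :: "nat \<Rightarrow> nat \<Rightarrow> 'k" where "gb n i = gauss_binom q n i"

text \<open>
  The product of values of \<open>\<omega>\<close> in \<open>\<beta>\<close> is the inverse of
  \<open>cobd\<close>.
\<close>

lemma beta_gb: "beta_coeff H g q i n = gb n i / cobd i (n - i)"
proof -
  have g1: "gp (Suc 0) = g" by (rule gp_1)
  have "(\<Prod>j<i. omega H g (gp j) (gp (n - i))) = (\<Prod>j<i. 1 / omgi 1 j (n - i))"
    using omg_eq[of 1 _ "n - i"] by (intro prod.cong refl) (simp add: omg_def gp_1 del: gpow.simps)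
  also have "\<dots> = 1 / cobd i (n - i)"
    by (simp add: cobd_def prod_dividef)
  finally show ?thesis by (simp add: beta_coeff_def gb_def)
qed

lemma rcomul_def': "rcomul R v = (\<Sum>n<N. tscl (v n) (\<Sum>i\<le>n. tscl (gb n i / cobd i (n - i)) (X i (n - i))))"
  unfolding beta_gb[symmetric] R_fields R_spaces ..

lemma lin_rcomul: "lin_map R T2 (rcomul R)"
  unfolding rcomul_def'[abs_def]
  by (intro lin_sum is_vspace_tensor_space lin_tsclL lin_coord tspaceD(5) tspaceD(4)) (simp add: X_car')

lemma rcomul_x: "rcomul R (x n) = (if n < N then \<Sum>i\<le>n. tscl (gb n i / cobd i (n - i)) (X i (n - i)) else 0)"
proof (cases "n < N")
  case True
  have "rcomul R (x n) = (\<Sum>k<N. if k = n then \<Sum>i\<le>n. tscl (gb n i / cobd i (n - i)) (X i (n - i)) else 0)"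
    unfolding rcomul_def' using True by (intro sum.cong refl) (auto simp: x_def tspace_simps)
  thus ?thesis using True by simp
next
  case False
  thus ?thesis using x_zero[of n] lin_map_0[OF R_vspace lin_rcomul] by simp
qed

lemma assoc_X:
  assumes "a < N" "b < N" "c < N"
  shows "yd_assoc H R R R (tens T2 R (X a b) (x c)) = tscl (omgi a b c) (tens R T2 (x a) (X b c))"
  using yd_assoc_graded(2)[OF graded_R graded_R graded_R, of a b c] assms by (simp add: omgi_def)

lemmas lin_assoc_R = yd_assoc_graded(1)[OF graded_R graded_R graded_R]

subsection \<open>Algebra and coalgebra axioms\<close>

lemmas basis_T2 = basis_tensor[OF basis_R basis_R]

lemma basis_unit: "basis ground {()} (\<lambda>_. 1) (\<lambda>_ v. v)"
  by (simp add: basis_def is_vspace_ground lin_id)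

text \<open>
  Associativity on \<open>x\<^bsup>[a]\<^esup>\<close>, \<open>x\<^bsup>[b]\<^esup>\<close>,
  \<open>x\<^bsup>[c]\<^esup>\<close> says that the coboundary of \<open>cobd\<close> is the
  associator, which is \<open>omgi_coboundary\<close>.
\<close>

theorem R_algebra: "yd_algebra H R"
  unfolding yd_algebra_def Let_def yd_spaces yd_unit_spaces
proof (intro conjI ballI)
  show "yd_hom H R2 R (rmul R)"
  proof (rule diagonal_yd_hom[OF diagonal_R2 diagonal_R])
    show "lin_map R2 R (rmul R)" using lin_rmul by (simp add: yd_spaces)
    fix p assume "p \<in> {..<N} \<times> {..<N}"
    then obtain a b where p: "p = (a, b)" "a < N" "b < N" by auto
    have "weight_vector R (gp (a + b)) (chi (a + b)) (scl R (cobd a b) (x (a + b)))"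
      by (rule weight_vector_scl[OF diagonal_R weight_x gp_car])
    hence "weight_vector R (mul H (gp a) (gp b)) (tensor_char (gp a) (gp b) (chi a) (chi b)) (rmul R (X a b))"
      unfolding rmul_X R_space by (rule weight_vector_cong) (simp_all add: gp_add chi_add)
    thus "weight_vector R (case p of (i, j) \<Rightarrow> mul H (gp i) (gp j)) (case p of (i, j) \<Rightarrow> tensor_char (gp i) (gp j) (chi i) (chi j))
           (rmul R (case p of (i, j) \<Rightarrow> X i j))"
      by (simp add: p)
  qed
  show "yd_hom H (yd_unit H) R (runit R)"
  proof (rule diagonal_yd_hom[OF diagonal_unit diagonal_R])
    show "lin_map (yd_unit H) R (runit R)" using lin_runit by (simp add: yd_unit_spaces)
    show "weight_vector R (one H) (counit H) (runit R 1)"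
      using weight_x[of 0] by (simp add: runit_R R_vsS)
  qed
  fix t assume t: "t \<in> car (yd_tensor H R2 R)"
  have tm1: "lin_map (tensor_space T2 R) T2 (tmap T2 R R R (rmul R) (\<lambda>r. r))"
    by (intro lin_tmap is_vspace_tensor_space lin_rmul lin_id)
  have tm2: "lin_map (tensor_space R T2) T2 (tmap R T2 R R (\<lambda>r. r) (rmul R))"
    by (intro lin_tmap R_vspace lin_rmul lin_id)
  show "rmul R (tmap T2 R R R (rmul R) (\<lambda>r. r) t)
           = rmul R (tmap R T2 R R (\<lambda>r. r) (rmul R) (yd_assoc H R R R t))"
  proof (rule lin_map_eq_on_tensor_basis[OF basis_T2 basis_R lin_comp[OF lin_rmul tm1]
        lin_comp[OF lin_rmul lin_comp[OF tm2 lin_assoc_R]]])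
    show "t \<in> subtensor T2 R (car T2) (car R)" using t by (simp add: yd_spaces)
    fix p c assume "p \<in> {..<N} \<times> {..<N}" "c \<in> {..<N}"
    then obtain a b where p: "p = (a, b)" "a < N" "b < N" "c < N" by auto
    have l: "rmul R (tmap T2 R R R (rmul R) (\<lambda>r. r) (tens T2 R (X a b) (x c)))
      = scl Rv (cobd a b * cobd (a + b) c) (x (a + b + c))"
      by (simp add: tmap_tens[OF lin_rmul lin_id] X_car' x_car rmul_X tscl_tens[symmetric, where V = R, simplified]
          lin_mapD(3)[OF lin_rmul, simplified] R_vsS)
    have r: "rmul R (tmap R T2 R R (\<lambda>r. r) (rmul R) (tscl (omgi a b c) (tens R T2 (x a) (X b c))))
      = scl Rv (omgi a b c * cobd b c * cobd a (b + c)) (x (a + b + c))"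
    proof -
      have m: "tens R T2 (x a) (X b c) \<in> car (tensor_space R T2)"
        using tens_car[of "x a" R "X b c" T2] X_car by (simp add: x_car)
      have e: "tmap R T2 R R (\<lambda>r. r) (rmul R) (tens R T2 (x a) (X b c)) = tscl (cobd b c) (X a (b + c))"
        using tens_scl_right[of "x a" R "x (b + c)" R] by (simp add: tmap_tens[OF lin_id lin_rmul] x_car X_car' rmul_X)
      have "tmap R T2 R R (\<lambda>r. r) (rmul R) (tscl (omgi a b c) (tens R T2 (x a) (X b c)))
        = tscl (omgi a b c * cobd b c) (X a (b + c))"
        using lin_mapD(3)[OF tm2 m, of "omgi a b c"] by (simp add: e tspace_simps)
      thus ?thesis
        using lin_mapD(3)[OF lin_rmul X_car, of "omgi a b c * cobd b c" a "b + c"] by (simp add: rmul_X R_vsS add.assoc)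
    qed
    have "cobd a b * cobd (a + b) c = omgi a b c * cobd b c * cobd a (b + c)"
      unfolding omgi_coboundary[of a b c] by (simp add: cobd_nz)
    with l r show "rmul R (tmap T2 R R R (rmul R) (\<lambda>r. r) (tens T2 R (case p of (i, j) \<Rightarrow> X i j) (x c)))
      = rmul R (tmap R T2 R R (\<lambda>r. r) (rmul R) (yd_assoc H R R R (tens T2 R (case p of (i, j) \<Rightarrow> X i j) (x c))))"
      by (simp add: p assoc_X)
  qed
next
  fix t assume t: "t \<in> car (yd_tensor H (yd_unit H) R)"
  have tm: "lin_map (tensor_space ground R) T2 (tmap ground R R R (runit R) (\<lambda>r. r))"
    by (intro lin_tmap is_vspace_ground lin_runit lin_id)
  have bl: "bilin_map ground R R (scl R)"
    by (intro bilin_mapI lin_scl lin_sclL lin_id R_vspace)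
  have lu: "lin_map (tensor_space ground R) R (yd_lunit R)"
    unfolding yd_lunit_def[abs_def] by (rule lin_map_sweedler[OF is_vspace_ground R_vspace bl])
  show "rmul R (tmap ground R R R (runit R) (\<lambda>r. r) t) = yd_lunit R t"
  proof (rule lin_map_eq_on_tensor_basis[OF basis_unit basis_R lin_comp[OF lin_rmul tm] lu])
    show "t \<in> subtensor ground R (car ground) (car R)" using t by (simp add: yd_unit_spaces)
    show "rmul R (tmap ground R R R (runit R) (\<lambda>r. r) (tens ground R 1 (x n))) = yd_lunit R (tens ground R 1 (x n))" for n
      using sweedler_tens[OF R_vspace bl, of 1 "x n"]
      by (simp add: tmap_tens[OF lin_runit lin_id] x_car runit_R R_vsS rmul_X yd_lunit_def)
  qed
next
  fix t assume t: "t \<in> car (yd_tensor H R (yd_unit H))"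
  have tm: "lin_map (tensor_space R ground) T2 (tmap R ground R R (\<lambda>r. r) (runit R))"
    by (intro lin_tmap R_vspace lin_runit lin_id)
  have bl: "bilin_map R ground R (\<lambda>v c. scl R c v)"
    by (intro bilin_mapI lin_scl lin_sclL lin_id R_vspace)
  have lu: "lin_map (tensor_space R ground) R (yd_runit R)"
    unfolding yd_runit_def[abs_def] by (rule lin_map_sweedler[OF R_vspace R_vspace bl])
  show "rmul R (tmap R ground R R (\<lambda>r. r) (runit R) t) = yd_runit R t"
  proof (rule lin_map_eq_on_tensor_basis[OF basis_R basis_unit lin_comp[OF lin_rmul tm] lu])
    show "t \<in> subtensor R ground (car R) (car ground)" using t by (simp add: yd_unit_spaces)
    show "rmul R (tmap R ground R R (\<lambda>r. r) (runit R) (tens R ground (x n) 1)) = yd_runit R (tens R ground (x n) 1)" for n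
      using sweedler_tens[OF R_vspace bl, of "x n" 1]
      by (simp add: tmap_tens[OF lin_id lin_runit] x_car runit_R R_vsS rmul_X yd_runit_def)
  qed
qed

end


section \<open>Gaussian binomial coefficients\<close>

text \<open>
  Induction on \<open>m\<close> with the Pascal recursion. For \<open>a > m\<close> the
  subtraction in the exponent is truncated, but then the binomial coefficient vanishes.
\<close>

lemma gauss_binom_Vandermonde:
  "gauss_binom q (m + n) i = (\<Sum>a\<le>i. gauss_binom q m a * gauss_binom q n (i - a) * q ^ ((m - a) * (i - a)))"
proof (induction m arbitrary: i)
  case 0
  have "(\<Sum>a\<le>i. gauss_binom q 0 a * gauss_binom q n (i - a) * q ^ ((0 - a) * (i - a)))
    = (\<Sum>a\<le>i. if a = 0 then gauss_binom q n i else 0)"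
    by (intro sum.cong refl) (auto simp: gauss_binom_eq_0)
  thus ?case by simp
next
  case (Suc m)
  show ?case
  proof (cases i)
    case (Suc k)
    let ?f = "\<lambda>a. gauss_binom q (Suc m) a * gauss_binom q n (Suc k - a) * q ^ ((Suc m - a) * (Suc k - a))"
    let ?h = "\<lambda>a. gauss_binom q m a * gauss_binom q n (Suc k - a) * q ^ ((m - a) * (Suc k - a))"
    have f: "?f (Suc b) = gauss_binom q m b * gauss_binom q n (k - b) * q ^ ((m - b) * (k - b)) + q ^ Suc k * ?h (Suc b)"
      if "b \<le> k" for b
    proof (cases "Suc b \<le> m")
      case True
      have "(m - b) * (k - b) = (m - Suc b) * (k - b) + (k - b)"
        using True by (metis Suc_diff_Suc Suc_le_lessD add.commute mult_Suc)
      hence "q ^ Suc b * q ^ ((m - b) * (k - b)) = q ^ Suc k * q ^ ((m - Suc b) * (k - b))"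
        using that by (simp add: power_add[symmetric] add.commute)
      moreover have "?f (Suc b) = gauss_binom q m b * gauss_binom q n (k - b) * q ^ ((m - b) * (k - b))
          + gauss_binom q m (Suc b) * gauss_binom q n (k - b) * (q ^ Suc b * q ^ ((m - b) * (k - b)))"
        by (simp only: gauss_binom.simps diff_Suc_Suc distrib_right distrib_left mult_ac)
      ultimately show ?thesis by (simp only: diff_Suc_Suc mult_ac)
    next
      case False
      thus ?thesis by (simp add: gauss_binom_eq_0)
    qed
    have f0: "?f 0 = q ^ Suc k * ?h 0" by (simp add: power_add mult_ac)
    have "(\<Sum>b\<le>k. ?f (Suc b)) = (\<Sum>b\<le>k. gauss_binom q m b * gauss_binom q n (k - b) * q ^ ((m - b) * (k - b))
        + q ^ Suc k * ?h (Suc b))"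
      by (intro sum.cong refl f) simp
    also have "\<dots> = gauss_binom q (m + n) k + q ^ Suc k * (\<Sum>b\<le>k. ?h (Suc b))"
      unfolding Suc.IH[of k] by (simp only: sum.distrib sum_distrib_left)
    finally have fS: "(\<Sum>b\<le>k. ?f (Suc b)) = gauss_binom q (m + n) k + q ^ Suc k * (\<Sum>b\<le>k. ?h (Suc b))" .
    have "(\<Sum>a\<le>Suc k. ?f a) = ?f 0 + (\<Sum>b\<le>k. ?f (Suc b))" by (rule sum.atMost_Suc_shift)
    also have "\<dots> = q ^ Suc k * ?h 0 + (gauss_binom q (m + n) k + q ^ Suc k * (\<Sum>b\<le>k. ?h (Suc b)))"
      by (simp only: f0 fS)
    also have "\<dots> = gauss_binom q (m + n) k + q ^ Suc k * (\<Sum>a\<le>Suc k. ?h a)"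
      by (simp only: sum.atMost_Suc_shift distrib_left add_ac)
    also have "\<dots> = gauss_binom q (Suc m + n) (Suc k)"
      unfolding Suc.IH[of "Suc k", symmetric] by simp
    finally show ?thesis by (simp only: Suc)
  qed simp
qed

lemma lin_map_lincomb:
  assumes "is_vspace V" "lin_map V Z F" "\<And>j. j \<in> J \<Longrightarrow> v j \<in> car V"
  shows "F (\<Sum>j\<in>J. scl V (k j) (v j)) = (\<Sum>j\<in>J. scl Z (k j) (F (v j)))"
  by (subst lin_map_sum[OF assms(1,2)]) (simp_all add: vspaceD[OF assms(1)] assms(3) lin_mapD(3)[OF assms(2)])

context qyd_root
begin

lemma qint_nz: "0 < k \<Longrightarrow> k < N \<Longrightarrow> qint q k \<noteq> 0"
  using primitive one_diff_power_eq[of q k] by (auto simp: qint_def primitive_root_of_unity_def)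

lemma qint_N: "qint q N = 0"
  using primitive one_diff_power_eq[of q N] q_ne_1 by (simp add: qint_def primitive_root_of_unity_def)

lemma qfact_nz: "n < N \<Longrightarrow> qfact q n \<noteq> 0"
  by (simp add: qfact_def qint_nz)

text \<open>Below \<open>N\<close> the \<open>q\<close>-factorials are invertible.\<close>

lemma gb_eq:
  assumes "i + j < N"
  shows "gb (i + j) i = qfact q (i + j) / (qfact q i * qfact q j)"
  using gauss_binom_qfact[of q i j] qfact_nz[of i] qfact_nz[of j] assms by (simp add: gb_def field_simps)

text \<open>
  The factor \<open>[N]\<^sub>q = 0\<close> occurs in \<open>[i+j]\<^sub>q!\<close> but not in
  \<open>[i]\<^sub>q!\<close> or \<open>[j]\<^sub>q!\<close>.
\<close>

lemma gb_vanish: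
  assumes "i < N" "j < N" "N \<le> i + j"
  shows "gb (i + j) i = 0"
proof -
  have "N - 1 < i + j" "Suc (N - 1) = N" using assms N_pos by auto
  hence "qfact q (i + j) = 0"
    unfolding qfact_def using qint_N by (intro prod_zero) (auto intro!: bexI[of _ "N - 1"])
  thus ?thesis
    using gauss_binom_qfact[of q i j] qfact_nz[of i] qfact_nz[of j] assms(1,2) by (simp add: gb_def)
qed

lemma gb_0 [simp]: "gb n 0 = 1" "gb n n = 1"
proof -
  show "gb n 0 = 1" by (simp add: gb_def)
  show "gb n n = 1" unfolding gb_def by (induction n) (simp_all add: gauss_binom_eq_0)
qed

section \<open>The coalgebra axioms\<close>

lemma Y_car: "tens R T2 (x a) (X b c) \<in> car (tensor_space R T2)" "tens T2 R (X a b) (x c) \<in> car (tensor_space T2 R)"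
  using tens_car[of "x a" R "X b c" T2] tens_car[of "X a b" T2 "x c" R] X_car by (simp_all add: x_car)

text \<open>
  Both sides are sums over \<open>i + j \<le> n\<close>. The coefficients agree by the trinomial
  identity for \<open>q\<close>-binomials, and the values of \<open>cobd\<close> combine to the
  associator by \<open>omgi_coboundary\<close>.
\<close>

lemma R_coassoc:
  assumes n: "n < N"
  shows "yd_assoc H R R R (tmap R R T2 R (rcomul R) (\<lambda>r. r) (rcomul R (x n)))
    = tmap R R R T2 (\<lambda>r. r) (rcomul R) (rcomul R (x n))"
proof -
  let ?\<beta> = "\<lambda>i n. gb n i / cobd i (n - i)"
  let ?Y = "\<lambda>a b c. tens R T2 (x a) (X b c)"
  have l1: "lin_map T2 (tensor_space R T2) (\<lambda>t. yd_assoc H R R R (tmap R R T2 R (rcomul R) (\<lambda>r. r) t))"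
    by (intro lin_comp[OF lin_assoc_R] lin_tmap R_vspace lin_rcomul lin_id)
  have l2: "lin_map T2 (tensor_space R T2) (tmap R R R T2 (\<lambda>r. r) (rcomul R))"
    by (intro lin_tmap R_vspace lin_rcomul lin_id)
  let ?g = "\<lambda>i j. tscl (?\<beta> (i + j) n * ?\<beta> i (i + j) * omgi i j (n - (i + j))) (?Y i j (n - (i + j)))"
  have 1: "yd_assoc H R R R (tmap R R T2 R (rcomul R) (\<lambda>r. r) (X k (n - k)))
    = (\<Sum>i\<le>k. tscl (?\<beta> i k * omgi i (k - i) (n - k)) (?Y i (k - i) (n - k)))" if k: "k \<le> n" for k
  proof -
    have "tmap R R T2 R (rcomul R) (\<lambda>r. r) (X k (n - k)) = tens T2 R (rcomul R (x k)) (x (n - k))"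
      by (rule tmap_tens[OF lin_rcomul lin_id]) (simp_all add: x_car)
    also have "\<dots> = (\<Sum>i\<le>k. tscl (?\<beta> i k) (tens T2 R (X i (k - i)) (x (n - k))))"
      using lin_map_lincomb[OF is_vspace_tensor_space[of R R] lin_tens1[OF _ lin_id], of "x (n - k)" R "{..k}" "\<lambda>i. X i (k - i)"] k n
      by (simp add: rcomul_x x_car X_car')
    finally have "yd_assoc H R R R (tmap R R T2 R (rcomul R) (\<lambda>r. r) (X k (n - k)))
      = (\<Sum>i\<le>k. tscl (?\<beta> i k) (yd_assoc H R R R (tens T2 R (X i (k - i)) (x (n - k)))))"
      using lin_map_lincomb[OF is_vspace_tensor_space lin_assoc_R, of "{..k}" "\<lambda>i. tens T2 R (X i (k - i)) (x (n - k))"] Y_car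
      by simp
    also have "\<dots> = (\<Sum>i\<le>k. tscl (?\<beta> i k * omgi i (k - i) (n - k)) (?Y i (k - i) (n - k)))"
      using k n by (intro sum.cong refl) (simp add: assoc_X tspace_simps)
    finally show ?thesis .
  qed
  have "yd_assoc H R R R (tmap R R T2 R (rcomul R) (\<lambda>r. r) (rcomul R (x n)))
    = (\<Sum>k\<le>n. tscl (?\<beta> k n) (yd_assoc H R R R (tmap R R T2 R (rcomul R) (\<lambda>r. r) (X k (n - k)))))"
    using lin_map_lincomb[OF is_vspace_tensor_space l1, of "{..n}" "\<lambda>k. X k (n - k)"] X_car' n by (simp add: rcomul_x)
  also have "\<dots> = (\<Sum>k\<le>n. \<Sum>i\<le>k. ?g i (k - i))"
    by (intro sum.cong refl) (simp add: 1 tspace_simps mult.assoc)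
  also have "\<dots> = (\<Sum>(i, j)\<in>{(i, j). i + j \<le> n}. ?g i j)"
    by (rule sum.triangle_reindex_eq[symmetric])
  finally have L: "yd_assoc H R R R (tmap R R T2 R (rcomul R) (\<lambda>r. r) (rcomul R (x n)))
    = (\<Sum>(i, j)\<in>{(i, j). i + j \<le> n}. ?g i j)" .
  have 2: "tmap R R R T2 (\<lambda>r. r) (rcomul R) (X i (n - i)) = (\<Sum>j\<le>n - i. tscl (?\<beta> j (n - i)) (?Y i j (n - i - j)))"
    if i: "i \<le> n" for i
  proof -
    have "tmap R R R T2 (\<lambda>r. r) (rcomul R) (X i (n - i)) = tens R T2 (x i) (rcomul R (x (n - i)))"
      by (rule tmap_tens[OF lin_id lin_rcomul]) (simp_all add: x_car)
    also have "\<dots> = (\<Sum>j\<le>n - i. tscl (?\<beta> j (n - i)) (?Y i j (n - i - j)))"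
      using lin_map_lincomb[OF is_vspace_tensor_space[of R R] lin_tens2[OF _ lin_id], of "x i" R "{..n - i}" "\<lambda>j. X j (n - i - j)"] i n
        le_less_trans[OF diff_le_self n, of i]
      by (simp add: rcomul_x x_car X_car')
    finally show ?thesis .
  qed
  have "tmap R R R T2 (\<lambda>r. r) (rcomul R) (rcomul R (x n))
    = (\<Sum>i\<le>n. tscl (?\<beta> i n) (tmap R R R T2 (\<lambda>r. r) (rcomul R) (X i (n - i))))"
    using lin_map_lincomb[OF is_vspace_tensor_space l2, of "{..n}" "\<lambda>k. X k (n - k)"] X_car' n by (simp add: rcomul_x)
  also have "\<dots> = (\<Sum>i\<le>n. \<Sum>j\<le>n - i. ?g i j)"
  proof (intro sum.cong refl)
    fix i assume "i \<in> {..n}"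
    hence i: "i \<le> n" by simp
    have "?\<beta> i n * ?\<beta> j (n - i) = ?\<beta> (i + j) n * ?\<beta> i (i + j) * omgi i j (n - (i + j))" if j: "j \<le> n - i" for j
    proof -
      define l where "l = n - (i + j)"
      have nl: "n = i + (j + l)" "n - i = j + l" "n - i - j = l" using i j by (auto simp: l_def)
      \<comment> \<open>The trinomial identity: both sides are the quotient of the factorial of
        \<open>n\<close> by those of \<open>i\<close>, \<open>j\<close> and \<open>l\<close>.\<close>
      have g: "gb n i * gb (j + l) j = gb n (i + j) * gb (i + j) i"
        using gb_eq[of i "j + l"] gb_eq[of "i + j" l] gb_eq[of j l] gb_eq[of i j] n qfact_nz[of "j + l"] qfact_nz[of "i + j"]
        by (simp add: nl add.assoc)
      have "?\<beta> i n * ?\<beta> j (n - i) = gb n i * gb (j + l) j / (cobd i (j + l) * cobd j l)"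
        by (simp add: nl(2))
      also have "\<dots> = ?\<beta> (i + j) n * ?\<beta> i (i + j) * omgi i j l"
        unfolding g omgi_coboundary[of i j l] l_def[symmetric] by (simp add: cobd_nz)
      finally show ?thesis by (simp add: l_def)
    qed
    thus "tscl (?\<beta> i n) (tmap R R R T2 (\<lambda>r. r) (rcomul R) (X i (n - i))) = (\<Sum>j\<le>n - i. ?g i j)"
      by (simp add: 2[OF i] tspace_simps)
  qed
  also have "\<dots> = (\<Sum>(i, j)\<in>(SIGMA i:{..n}. {..n - i}). ?g i j)"
    by (rule sum.Sigma) simp_all
  also have "(SIGMA i:{..n}. {..n - i}) = {(i, j). i + j \<le> n}" by auto
  finally show ?thesis using L by simp
qed

theorem R_coalgebra: "yd_coalgebra H R"
  unfolding yd_coalgebra_def Let_def yd_spaces yd_unit_spaces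
proof (intro conjI ballI)
  show "yd_hom H R R2 (rcomul R)"
  proof (rule diagonal_yd_hom[OF diagonal_R diagonal_R2])
    show "lin_map R R2 (rcomul R)" using lin_rcomul by (simp add: yd_spaces)
    fix n assume "n \<in> {..<N}"
    have "weight_vector R2 (gp n) (chi n) (\<Sum>i\<le>n. scl R2 (gb n i / cobd i (n - i)) (X i (n - i)))"
      by (rule weight_vector_sum[OF diagonal_R2 gp_car]) (use weight_X in \<open>metis atMost_iff le_add_diff_inverse\<close>)
    thus "weight_vector R2 (gp n) (chi n) (rcomul R (x n))" using \<open>n \<in> {..<N}\<close> by (simp add: rcomul_x)
  qed
  show "yd_hom H R (yd_unit H) (rcounit R)"
  proof (rule diagonal_yd_hom[OF diagonal_R diagonal_unit])
    show "lin_map R (yd_unit H) (rcounit R)" using lin_rcounit by (simp add: yd_unit_spaces)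
    fix n assume n: "n \<in> {..<N}"
    have 1: "weight_vector (yd_unit H) (one H) (counit H) 1"
      using weight_vector_basis[OF diagonal_unit, of "()"] by simp
    show "weight_vector (yd_unit H) (gp n) (chi n) (rcounit R (x n))"
    proof (cases "n = 0")
      case True
      thus ?thesis using 1 N_pos by (simp add: rcounit_R x_def)
    next
      case False
      \<comment> \<open>Zero has every weight: the empty sum.\<close>
      have "weight_vector (yd_unit H) (gp n) (chi n) (\<Sum>j\<in>({}::unit set). scl (yd_unit H) 0 0)"
        by (rule weight_vector_sum[OF diagonal_unit gp_car]) simp
      thus ?thesis using False by (simp add: rcounit_R x_def)
    qed
  qed
  fix r assume r: "r \<in> car R"
  have l1: "lin_map R (tensor_space R T2) (\<lambda>r. yd_assoc H R R R (tmap R R T2 R (rcomul R) (\<lambda>r. r) (rcomul R r)))"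
    by (intro lin_comp[OF lin_assoc_R] lin_comp[OF lin_tmap] R_vspace lin_rcomul lin_id)
  have l2: "lin_map R (tensor_space R T2) (\<lambda>r. tmap R R R T2 (\<lambda>r. r) (rcomul R) (rcomul R r))"
    by (intro lin_comp[OF lin_tmap] R_vspace lin_rcomul lin_id)
  show "yd_assoc H R R R (tmap R R T2 R (rcomul R) (\<lambda>r. r) (rcomul R r)) = tmap R R R T2 (\<lambda>r. r) (rcomul R) (rcomul R r)"
    by (rule lin_map_eq_on_basis[OF basis_R l1 l2 _ r]) (simp add: R_coassoc)
  have bl1: "bilin_map ground R R (scl R)"
    by (intro bilin_mapI lin_scl lin_sclL lin_id R_vspace)
  have bl2: "bilin_map R ground R (\<lambda>v c. scl R c v)"
    by (intro bilin_mapI lin_scl lin_sclL lin_id R_vspace)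
  note bl = bl1 bl2
  have lu: "lin_map (tensor_space ground R) R (yd_lunit R)" "lin_map (tensor_space R ground) R (yd_runit R)"
    unfolding yd_lunit_def[abs_def] yd_runit_def[abs_def]
    by (intro lin_map_sweedler is_vspace_ground R_vspace bl)+
  have m3: "lin_map T2 R (\<lambda>t. yd_lunit R (tmap R R ground R (rcounit R) (\<lambda>r. r) t))"
    by (intro lin_comp[OF lu(1)] lin_tmap R_vspace lin_rcounit lin_id)
  have m4: "lin_map T2 R (\<lambda>t. yd_runit R (tmap R R R ground (\<lambda>r. r) (rcounit R) t))"
    by (intro lin_comp[OF lu(2)] lin_tmap R_vspace lin_rcounit lin_id)
  have c: "rcounit R (x i) = (if i = 0 then 1 else 0)" for i
    using N_pos by (simp add: rcounit_R x_def)
  have v3: "yd_lunit R (tmap R R ground R (rcounit R) (\<lambda>r. r) (X i j)) = (if i = 0 then x j else 0)" for i j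
    using sweedler_tens[OF R_vspace bl(1), of "rcounit R (x i)" "x j"]
    by (simp add: tmap_tens[OF lin_rcounit lin_id] x_car yd_lunit_def c R_vsS)
  have v4: "yd_runit R (tmap R R R ground (\<lambda>r. r) (rcounit R) (X i j)) = (if j = 0 then x i else 0)" for i j
    using sweedler_tens[OF R_vspace bl(2), of "x i" "rcounit R (x j)"]
    by (simp add: tmap_tens[OF lin_id lin_rcounit] x_car yd_runit_def c R_vsS)
  show "yd_lunit R (tmap R R ground R (rcounit R) (\<lambda>r. r) (rcomul R r)) = r"
  proof (rule lin_map_eq_on_basis[OF basis_R lin_comp[OF m3 lin_rcomul] lin_id _ r])
    fix n assume "n \<in> {..<N}"
    hence "yd_lunit R (tmap R R ground R (rcounit R) (\<lambda>r. r) (rcomul R (x n)))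
      = (\<Sum>i\<le>n. scl Rv (gb n i / cobd i (n - i)) (if i = 0 then x (n - i) else 0))"
      using lin_map_lincomb[OF is_vspace_tensor_space m3, of "{..n}" "\<lambda>i. X i (n - i)"] X_car' by (simp add: rcomul_x v3)
    also have "\<dots> = (\<Sum>i\<le>n. if i = 0 then x n else 0)"
      by (intro sum.cong refl) (auto simp: R_vsS)
    finally show "yd_lunit R (tmap R R ground R (rcounit R) (\<lambda>r. r) (rcomul R (x n))) = x n" by simp
  qed
  show "yd_runit R (tmap R R R ground (\<lambda>r. r) (rcounit R) (rcomul R r)) = r"
  proof (rule lin_map_eq_on_basis[OF basis_R lin_comp[OF m4 lin_rcomul] lin_id _ r])
    fix n assume "n \<in> {..<N}"
    hence "yd_runit R (tmap R R R ground (\<lambda>r. r) (rcounit R) (rcomul R (x n)))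
      = (\<Sum>i\<le>n. scl Rv (gb n i / cobd i (n - i)) (if n - i = 0 then x i else 0))"
      using lin_map_lincomb[OF is_vspace_tensor_space m4, of "{..n}" "\<lambda>i. X i (n - i)"] X_car' by (simp add: rcomul_x v4)
    also have "\<dots> = (\<Sum>i\<le>n. if i = n then x n else 0)"
      by (intro sum.cong refl) (auto simp: R_vsS)
    finally show "yd_runit R (tmap R R R ground (\<lambda>r. r) (rcounit R) (rcomul R (x n))) = x n" by simp
  qed
qed

end


context qyd_root
begin

section \<open>Multiplicativity of the comultiplication\<close>

abbreviation "S a b c d \<equiv> tens T2 T2 (X a b) (X c d)"

lemmas graded_R2 = diagonalD(1)[OF diagonal_R2]

lemma chi_g_gp: "chi c (gp b) = q ^ (b * c) * cobd b c / cobd c b"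
  unfolding q by (rule chi_gp)

lemma S_car: "S a b c d \<in> car (tensor_space T2 T2)"
  using tens_car[of "X a b" T2 "X c d" T2] X_car by simp

lemma assoc_R2:
  "lin_map (tensor_space T2 T2) (tensor_space R (tensor_space R T2)) (yd_assoc H R R R2)"
  "lin_map (tensor_space R (tensor_space R T2)) (tensor_space T2 T2) (yd_assoc_inv H R R R2)"
  "a < N \<Longrightarrow> b < N \<Longrightarrow> c < N \<Longrightarrow> d < N \<Longrightarrow> yd_assoc H R R R2 (S a b c d)
    = tscl (omgi a b (c + d)) (tens R (tensor_space R T2) (x a) (tens R T2 (x b) (X c d)))"
  "a < N \<Longrightarrow> b < N \<Longrightarrow> c < N \<Longrightarrow> d < N \<Longrightarrow> yd_assoc_inv H R R R2 (tens R (tensor_space R T2) (x a) (tens R T2 (x b) (X c d)))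
    = tscl (omg a b (c + d)) (S a b c d)"
  using yd_assoc_graded(1)[OF graded_R graded_R graded_R2] yd_assoc_inv_graded(1)[OF graded_R graded_R graded_R2]
    yd_assoc_graded(2)[OF graded_R graded_R graded_R2, of a b "(c, d)"]
    yd_assoc_inv_graded(2)[OF graded_R graded_R graded_R2, of a b "(c, d)"]
  by (simp_all add: yd_spaces gp_add omg_def omgi_def)

lemma assoc_inv_X:
  assumes "a < N" "b < N" "c < N"
  shows "yd_assoc_inv H R R R (tens R T2 (x a) (X b c)) = tscl (omg a b c) (tens T2 R (X a b) (x c))"
  using yd_assoc_inv_graded(2)[OF graded_R graded_R graded_R, of a b c] assms by (simp add: omg_def)

lemmas lin_assoc_inv_R = yd_assoc_inv_graded(1)[OF graded_R graded_R graded_R]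

lemmas lin_braid_R = yd_braid_graded(1)[OF graded_R graded_R diagonalD(3)[OF diagonal_R]]

lemma braid_X:
  assumes "b < N" "c < N"
  shows "yd_braid H R R (X b c) = tscl (chi c (gp b)) (X c b)"
  using yd_braid_graded(2)[OF graded_R graded_R diagonalD(3)[OF diagonal_R], of b "x c"]
    diagonalD(4)[OF diagonal_R gp_car, of c b] tscl_tens[of "x c" R "x b" R] assms
  by (simp add: x_car)

lemma tmap_id_scale:
  assumes G: "lin_map W (tensor_space A B) G" and w: "w \<in> car W"
    and u: "u \<in> car (tensor_space A B)" and e: "G w = tscl k u"
  shows "tmap R W R (tensor_space A B) (\<lambda>r. r) G (tens R W (x a) w) = tscl k (tens R (tensor_space A B) (x a) u)"
proof -
  have xc: "x a \<in> car R" by (simp add: x_car)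
  show ?thesis
    unfolding tmap_tens[OF lin_id G xc w] e using tens_scl_right[OF xc u, of k] by simp
qed

text \<open>Each of the five maps that make up the middle exchange permutes basis tensors up to a scalar.\<close>

lemma Omega_R:
  shows "lin_map (tensor_space T2 T2) (tensor_space T2 T2) (yd_Omega H R)"
    and "a < N \<Longrightarrow> b < N \<Longrightarrow> c < N \<Longrightarrow> d < N \<Longrightarrow> yd_Omega H R (S a b c d)
      = tscl (omgi a b (c + d) * omg b c d * chi c (gp b) * omgi c b d * omg a c (b + d)) (S a c b d)"
proof -
  let ?RT = "tensor_space R T2" and ?TR = "tensor_space T2 R"
  let ?RRT = "tensor_space R ?RT" and ?RTR = "tensor_space R ?TR"
  let ?F2 = "tmap R ?RT R ?TR (\<lambda>r. r) (yd_assoc_inv H R R R)"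
  let ?B = "tmap T2 R T2 R (yd_braid H R R) (\<lambda>r. r)"
  let ?F3 = "tmap R ?TR R ?TR (\<lambda>r. r) ?B"
  let ?F4 = "tmap R ?TR R ?RT (\<lambda>r. r) (yd_assoc H R R R)"
  have Om: "yd_Omega H R = (\<lambda>t. yd_assoc_inv H R R R2 (?F4 (?F3 (?F2 (yd_assoc H R R R2 t)))))"
    by (simp add: yd_Omega_def Let_def yd_spaces comp_def)
  have lB: "lin_map ?TR ?TR ?B"
    by (intro lin_tmap is_vspace_tensor_space lin_braid_R lin_id)
  have l2: "lin_map ?RRT ?RTR ?F2" by (intro lin_tmap R_vspace lin_id lin_assoc_inv_R)
  have l3: "lin_map ?RTR ?RTR ?F3" by (intro lin_tmap R_vspace lin_id lB)
  have l4: "lin_map ?RTR ?RRT ?F4" by (intro lin_tmap R_vspace lin_id lin_assoc_R)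
  show "lin_map (tensor_space T2 T2) (tensor_space T2 T2) (yd_Omega H R)"
    unfolding Om by (intro lin_comp[OF assoc_R2(2)] lin_comp[OF l4] lin_comp[OF l3] lin_comp[OF l2] assoc_R2(1))
  assume lt: "a < N" "b < N" "c < N" "d < N"
  have xc: "x n \<in> car R" for n by (simp add: x_car)
  have c1: "tens R ?RT (x a) (tens R T2 (x b') (X c' d')) \<in> car ?RRT" for b' c' d'
    using tens_car[OF xc Y_car(1), of a b' c' d'] by simp
  have c2: "tens R ?TR (x a) (tens T2 R (X b' c') (x d')) \<in> car ?RTR" for b' c' d'
    using tens_car[OF xc Y_car(2), of a b' c' d'] by simp
  have B: "?B (tens T2 R (X b c) (x d)) = tscl (chi c (gp b)) (tens T2 R (X c b) (x d))"
    using tmap_tens[OF lin_braid_R lin_id X_car xc, of b c d] tscl_tens[OF X_car xc, of "chi c (gp b)" c b d]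
    by (simp add: braid_X lt)
  have 2: "?F2 (tens R ?RT (x a) (tens R T2 (x b) (X c d))) = tscl (omg b c d) (tens R ?TR (x a) (tens T2 R (X b c) (x d)))"
    by (rule tmap_id_scale[where G = "yd_assoc_inv H R R R", OF lin_assoc_inv_R Y_car(1) Y_car(2) assoc_inv_X[OF lt(2-4)]])
  have 3: "?F3 (tens R ?TR (x a) (tens T2 R (X b c) (x d))) = tscl (chi c (gp b)) (tens R ?TR (x a) (tens T2 R (X c b) (x d)))"
    by (rule tmap_id_scale[where G = ?B, OF lB Y_car(2) Y_car(2) B])
  have 4: "?F4 (tens R ?TR (x a) (tens T2 R (X c b) (x d))) = tscl (omgi c b d) (tens R ?RT (x a) (tens R T2 (x c) (X b d)))"
    by (rule tmap_id_scale[where G = "yd_assoc H R R R", OF lin_assoc_R Y_car(2) Y_car(1) assoc_X[OF lt(3,2,4)]])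
  have s2: "?F2 (tscl k (tens R ?RT (x a) (tens R T2 (x b) (X c d)))) = tscl (k * omg b c d) (tens R ?TR (x a) (tens T2 R (X b c) (x d)))" for k
    using lin_mapD(3)[OF l2 c1, of k] by (simp add: 2 tspace_simps)
  have s3: "?F3 (tscl k (tens R ?TR (x a) (tens T2 R (X b c) (x d)))) = tscl (k * chi c (gp b)) (tens R ?TR (x a) (tens T2 R (X c b) (x d)))" for k
    using lin_mapD(3)[OF l3 c2, of k] by (simp add: 3 tspace_simps)
  have s4: "?F4 (tscl k (tens R ?TR (x a) (tens T2 R (X c b) (x d)))) = tscl (k * omgi c b d) (tens R ?RT (x a) (tens R T2 (x c) (X b d)))" for k
    using lin_mapD(3)[OF l4 c2, of k] by (simp add: 4 tspace_simps)
  have s5: "yd_assoc_inv H R R R2 (tscl k (tens R ?RT (x a) (tens R T2 (x c) (X b d)))) = tscl (k * omg a c (b + d)) (S a c b d)" for k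
    using lin_mapD(3)[OF assoc_R2(2) c1, of k] by (simp add: assoc_R2(4) lt tspace_simps)
  show "yd_Omega H R (S a b c d)
      = tscl (omgi a b (c + d) * omg b c d * chi c (gp b) * omgi c b d * omg a c (b + d)) (S a c b d)"
    unfolding Om by (simp add: assoc_R2(3) lt s2 s3 s4 s5)
qed

text \<open>
  All five scalars are coboundaries of \<open>cobd\<close>, up to the power of \<open>q\<close>
  from the braiding. Together with the coefficients of the two multiplications that follow, they leave the coefficient
  of the product \<open>x\<^bsup>[a+b]\<^esup> x\<^bsup>[c+d]\<^esup>\<close>, the denominator in the comultiplication of the result, and
  two factors that cancel the denominators in the comultiplications of \<open>x\<^bsup>[a+b]\<^esup>\<close> and \<open>x\<^bsup>[c+d]\<^esup>\<close>.
\<close>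

lemma Omega_scalar:
  "omgi a b (c + d) * omg b c d * chi c (gp b) * omgi c b d * omg a c (b + d) * cobd a c * cobd b d
    = q ^ (b * c) * (cobd (a + b) (c + d) * cobd a b * cobd c d) / cobd (a + c) (b + d)"
  unfolding chi_g_gp omg_eq omgi_coboundary[of a b "c + d"] omgi_coboundary[of b c d] omgi_coboundary[of c b d]
    omgi_coboundary[of a c "b + d"]
  using cobd_nz by (simp add: field_simps add.commute add.left_commute)

text \<open>
  After \<open>Omega_scalar\<close> the coefficient of \<open>x\<^bsup>[i]\<^esup> \<otimes>
  x\<^bsup>[m+n-i]\<^esup>\<close> is a \<open>q\<close>-Vandermonde sum. If \<open>m + n \<ge>
  N\<close> the left side is zero, and so is the right side, by \<open>gb_vanish\<close> where
  both exponents are below \<open>N\<close> and because the basis tensor is zero otherwise.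
\<close>

lemma comul_mul_X:
  assumes m: "m < N" and n: "n < N"
  shows "rcomul R (rmul R (X m n))
    = tmap T2 T2 R R (rmul R) (rmul R) (yd_Omega H R (tmap R R T2 T2 (rcomul R) (rcomul R) (X m n)))"
proof -
  let ?\<beta> = "\<lambda>i n. gb n i / cobd i (n - i)"
  let ?\<Phi> = "\<lambda>t. tmap T2 T2 R R (rmul R) (rmul R) (yd_Omega H R t)"
  let ?Z = "\<lambda>i. tscl (1 / cobd i (m + n - i)) (X i (m + n - i))"
  let ?f = "\<lambda>a c. gb m a * gb n c * q ^ ((m - a) * c)"
  have lm: "lin_map (tensor_space T2 T2) T2 (tmap T2 T2 R R (rmul R) (rmul R))"
    by (intro lin_tmap is_vspace_tensor_space lin_rmul)
  have l\<Phi>: "lin_map (tensor_space T2 T2) T2 ?\<Phi>"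
    by (rule lin_comp[OF lm Omega_R(1)])
  have \<Phi>: "?\<Phi> (S a b c d) = tscl (q ^ (b * c) * (cobd (a + b) (c + d) * cobd a b * cobd c d) / cobd (a + c) (b + d)) (X (a + c) (b + d))"
    if "a < N" "b < N" "c < N" "d < N" for a b c d
  proof -
    have xc: "scl R k (x i) \<in> car R" "x i \<in> car R" for k i using vspaceD(4)[OF R_vspace, of "x i" k] x_car by auto
    have "tmap T2 T2 R R (rmul R) (rmul R) (S a c b d) = tens R R (scl R (cobd a c) (x (a + c))) (scl R (cobd b d) (x (b + d)))"
      using tmap_tens[OF lin_rmul lin_rmul X_car X_car, of a c b d] by (simp add: rmul_X)
    also have "\<dots> = tscl (cobd a c * cobd b d) (X (a + c) (b + d))"
      unfolding tscl_tens[OF xc(2) xc(1), symmetric] tens_scl_right[OF xc(2) xc(2)] by (simp add: tspace_simps)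
    finally have e: "tmap T2 T2 R R (rmul R) (rmul R) (S a c b d) = tscl (cobd a c * cobd b d) (X (a + c) (b + d))" .
    show ?thesis
      unfolding Omega_R(2)[OF that] lin_mapD(3)[OF lm S_car, simplified] e Omega_scalar[symmetric]
      by (simp add: tspace_simps mult.assoc)
  qed
  have "tmap R R T2 T2 (rcomul R) (rcomul R) (X m n) = tens T2 T2 (rcomul R (x m)) (rcomul R (x n))"
    by (rule tmap_tens[OF lin_rcomul lin_rcomul]) (simp_all add: x_car)
  also have "\<dots> = (\<Sum>a\<le>m. tscl (?\<beta> a m) (tens T2 T2 (X a (m - a)) (rcomul R (x n))))"
    using lin_map_lincomb[OF is_vspace_tensor_space[of R R] lin_tens1[OF _ lin_id], of "rcomul R (x n)" T2 "{..m}" "\<lambda>a. X a (m - a)"]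
      m lin_mapD(1)[OF lin_rcomul, of "x n"] by (simp add: rcomul_x[of m] x_car X_car')
  also have "\<dots> = (\<Sum>a\<le>m. \<Sum>c\<le>n. tscl (?\<beta> a m * ?\<beta> c n) (S a (m - a) c (n - c)))"
  proof (intro sum.cong refl)
    fix a
    have "tens T2 T2 (X a (m - a)) (rcomul R (x n)) = (\<Sum>c\<le>n. tscl (?\<beta> c n) (S a (m - a) c (n - c)))"
      using lin_map_lincomb[OF is_vspace_tensor_space[of R R] lin_tens2[OF _ lin_id], of "X a (m - a)" T2 "{..n}" "\<lambda>c. X c (n - c)"]
        n by (simp add: rcomul_x[of n] X_car')
    thus "tscl (?\<beta> a m) (tens T2 T2 (X a (m - a)) (rcomul R (x n))) = (\<Sum>c\<le>n. tscl (?\<beta> a m * ?\<beta> c n) (S a (m - a) c (n - c)))"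
      by (simp add: tspace_simps)
  qed
  finally have e: "tmap R R T2 T2 (rcomul R) (rcomul R) (X m n)
    = (\<Sum>a\<le>m. \<Sum>c\<le>n. tscl (?\<beta> a m * ?\<beta> c n) (S a (m - a) c (n - c)))" .
  have Sc: "(\<Sum>c\<le>n. tscl (k c) (S a (m - a) c (n - c))) \<in> car (tensor_space T2 T2)" for a k
    by (intro vspaceD(5)[OF is_vspace_tensor_space] vspaceD(4)[OF is_vspace_tensor_space, unfolded car_scl(2)] S_car)
  have "?\<Phi> (tmap R R T2 T2 (rcomul R) (rcomul R) (X m n))
    = (\<Sum>a\<le>m. ?\<Phi> (\<Sum>c\<le>n. tscl (?\<beta> a m * ?\<beta> c n) (S a (m - a) c (n - c))))"
    unfolding e by (rule lin_map_sum[OF is_vspace_tensor_space l\<Phi> Sc])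
  also have "\<dots> = (\<Sum>a\<le>m. \<Sum>c\<le>n. tscl (?\<beta> a m * ?\<beta> c n) (?\<Phi> (S a (m - a) c (n - c))))"
    using lin_map_lincomb[OF is_vspace_tensor_space l\<Phi>, of _ "\<lambda>c. S a (m - a) c (n - c)" for a] S_car
    by (intro sum.cong refl) simp
  also have "\<dots> = (\<Sum>a\<le>m. \<Sum>c\<le>n. tscl (cobd m n) (tscl (?f a c) (?Z (a + c))))"
  proof (intro sum.cong refl)
    fix a c assume "a \<in> {..m}" "c \<in> {..n}"
    hence ac: "a \<le> m" "c \<le> n" by simp_all
    define b d where "b = m - a" and "d = n - c"
    have mn: "m = a + b" "n = c + d" using ac by (simp_all add: b_def d_def)
    have lt: "a < N" "b < N" "c < N" "d < N" using m n mn by auto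
    have "m + n - (a + c) = b + d" using mn by simp
    thus "tscl (?\<beta> a m * ?\<beta> c n) (?\<Phi> (S a (m - a) c (n - c))) = tscl (cobd m n) (tscl (?f a c) (?Z (a + c)))"
      unfolding b_def[symmetric] d_def[symmetric] \<Phi>[OF lt]
      by (simp add: tspace_simps mn[symmetric] cobd_nz mult_ac)
  qed
  also have "\<dots> = (\<Sum>(a, c)\<in>{..m} \<times> {..n}. tscl (cobd m n) (tscl (?f a c) (?Z (a + c))))"
    by (simp add: sum.cartesian_product)
  \<comment> \<open>The binomial coefficients vanish on the added pairs; the triangle can be summed along
    \<open>a + c = i\<close>.\<close>
  also have "\<dots> = (\<Sum>(a, c)\<in>{(a, c). a + c \<le> m + n}. tscl (cobd m n) (tscl (?f a c) (?Z (a + c))))"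
  proof (rule sum.mono_neutral_left)
    have "{(a, c). a + c \<le> m + n} \<subseteq> {..m + n} \<times> {..m + n}" by auto
    thus "finite {(a, c). a + c \<le> m + n}" by (rule finite_subset) simp
    show "{..m} \<times> {..n} \<subseteq> {(a, c). a + c \<le> m + n}" by auto
    show "\<forall>p\<in>{(a, c). a + c \<le> m + n} - {..m} \<times> {..n}. (case p of (a, c) \<Rightarrow> tscl (cobd m n) (tscl (?f a c) (?Z (a + c)))) = 0"
      by (auto simp: gb_def gauss_binom_eq_0 tspace_simps not_le)
  qed
  also have "\<dots> = (\<Sum>i\<le>m + n. \<Sum>a\<le>i. tscl (cobd m n) (tscl (?f a (i - a)) (?Z (a + (i - a)))))"
    by (rule sum.triangle_reindex_eq)
  also have "\<dots> = (\<Sum>i\<le>m + n. tscl (cobd m n) (tscl (gb (m + n) i) (?Z i)))"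
  proof (intro sum.cong refl)
    fix i
    have s: "(\<Sum>a\<in>I. tscl (k a) z) = tscl (\<Sum>a\<in>I. k a) z" for I :: "nat set" and k and z :: "('k, nat \<Rightarrow> 'k, nat \<Rightarrow> 'k) tensor"
      by (induction I rule: infinite_finite_induct) (simp_all add: tspace_simps)
    have "(\<Sum>a\<le>i. tscl (cobd m n) (tscl (?f a (i - a)) (?Z (a + (i - a))))) = (\<Sum>a\<le>i. tscl (?f a (i - a)) (tscl (cobd m n) (?Z i)))"
      by (intro sum.cong refl) (simp add: tspace_simps mult_ac)
    also have "\<dots> = tscl (gb (m + n) i) (tscl (cobd m n) (?Z i))"
      unfolding s gb_def gauss_binom_Vandermonde[of q m n i] ..
    finally show "(\<Sum>a\<le>i. tscl (cobd m n) (tscl (?f a (i - a)) (?Z (a + (i - a))))) = tscl (cobd m n) (tscl (gb (m + n) i) (?Z i))"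
      by (simp add: tspace_simps mult_ac)
  qed
  also have "\<dots> = tscl (cobd m n) (rcomul R (x (m + n)))"
  proof (cases "m + n < N")
    case True
    thus ?thesis by (simp add: rcomul_x tspace_simps)
  next
    case False
    have "tscl (gb (m + n) i) (?Z i) = 0" if "i \<le> m + n" for i
    proof (cases "i < N \<and> m + n - i < N")
      case True
      thus ?thesis using gb_vanish[of i "m + n - i"] False that by (simp add: tspace_simps)
    next
      case False
      hence "X i (m + n - i) = 0" by (intro X_zero) auto
      thus ?thesis by (simp add: tspace_simps)
    qed
    thus ?thesis using False by (simp add: rcomul_x tspace_simps)
  qed
  also have "\<dots> = rcomul R (rmul R (X m n))"
    unfolding rmul_X using lin_mapD(3)[OF lin_rcomul, of "x (m + n)" "cobd m n"] by (simp add: x_car)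
  finally show ?thesis by simp
qed

theorem R_bialgebra: "yd_bialgebra H R"
  unfolding yd_bialgebra_def Let_def yd_spaces yd_unit_spaces
proof (intro conjI ballI R_yd_object R_algebra R_coalgebra)
  fix t assume "t \<in> car R2"
  hence t: "t \<in> subtensor R R (car R) (car R)" by simp
  have l1: "lin_map T2 T2 (\<lambda>t. tmap T2 T2 R R (rmul R) (rmul R) (yd_Omega H R (tmap R R T2 T2 (rcomul R) (rcomul R) t)))"
    by (intro lin_comp[OF lin_tmap] lin_comp[OF Omega_R(1)] lin_tmap is_vspace_tensor_space lin_rmul lin_rcomul R_vspace)
  show "rcomul R (rmul R t) = tmap T2 T2 R R (rmul R) (rmul R) (yd_Omega H R (tmap R R T2 T2 (rcomul R) (rcomul R) t))"
    by (rule lin_map_eq_on_tensor_basis[OF basis_R basis_R lin_comp[OF lin_rcomul lin_rmul] l1 _ t]) (simp add: comul_mul_X)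
  have bl: "bilin_map ground ground ground (\<lambda>c v. c * v :: 'k)"
    by (intro bilin_mapI lin_mulL lin_mulR lin_id)
  have lu: "lin_map (tensor_space ground ground) ground (yd_lunit (yd_unit H) :: _ \<Rightarrow> 'k)"
    unfolding yd_lunit_def[abs_def] yd_unit_spaces
    using lin_map_sweedler[OF is_vspace_ground is_vspace_ground bl] by simp
  have c: "rcounit R (x i) = (if i = 0 then 1 else 0)" for i
    using N_pos by (simp add: rcounit_R x_def)
  show "rcounit R (rmul R t) = yd_lunit (yd_unit H) (tmap R R ground ground (rcounit R) (rcounit R) t)"
  proof (rule lin_map_eq_on_tensor_basis[OF basis_R basis_R lin_comp[OF lin_rcounit lin_rmul]
        lin_comp[OF lu lin_tmap[OF R_vspace lin_rcounit lin_rcounit]] _ t])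
    fix i j
    have "rcounit R (rmul R (X i j)) = cobd i j * rcounit R (x (i + j))"
      unfolding rmul_X using lin_mapD(3)[OF lin_rcounit, of "x (i + j)" "cobd i j"] by (simp add: x_car)
    moreover have "yd_lunit (yd_unit H) (tmap R R ground ground (rcounit R) (rcounit R) (X i j)) = rcounit R (x i) * rcounit R (x j)"
      using sweedler_tens[OF is_vspace_ground bl, of "rcounit R (x i)" "rcounit R (x j)"]
      by (simp add: tmap_tens[OF lin_rcounit lin_rcounit] x_car yd_lunit_def yd_unit_spaces)
    ultimately show "rcounit R (rmul R (X i j)) = yd_lunit (yd_unit H) (tmap R R ground ground (rcounit R) (rcounit R) (X i j))"
      by (auto simp: c)
  qed
next
  have r1: "runit R 1 = x 0" by (simp add: runit_R R_vsS)
  show "rcomul R (runit R 1) = tens R R (runit R 1) (runit R 1)"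
    using N_pos by (simp add: r1 rcomul_x tspace_simps)
  show "rcounit R (runit R 1) = 1"
    using N_pos by (simp add: r1 rcounit_R x_def)
qed

end


section \<open>Subcoalgebras\<close>

lemma subtensor_induct [consumes 1, case_names zero step]:
  fixes V :: "('k::field, 'v::ab_group_add, 'm) vspace_scheme" and W :: "('k, 'w::ab_group_add, 'n) vspace_scheme"
  assumes "t \<in> subtensor V W A B" "P 0"
    and "\<And>c a b y. a \<in> A \<Longrightarrow> b \<in> B \<Longrightarrow> y \<in> subtensor V W A B \<Longrightarrow> P y \<Longrightarrow> P (tscl c (tens V W a b) + y)"
  shows "P t"
proof -
  interpret vector_space "tscl :: 'k \<Rightarrow> ('k, 'v, 'w) tensor \<Rightarrow> _" by (rule vector_space_tscl)
  have "t \<in> subtensor V W A B \<and> P t"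
    using assms(1) unfolding subtensor_def
  proof (induction rule: span_induct_alt)
    case base
    show ?case using assms(2) span_zero by blast
  next
    case (step c s y)
    then obtain a b where ab: "s = tens V W a b" "a \<in> A" "b \<in> B" by auto
    have "tscl c s + y \<in> span {tens V W a b | a b. a \<in> A \<and> b \<in> B}"
    proof (rule span_add[OF span_scale])
      show "s \<in> span {tens V W a b | a b. a \<in> A \<and> b \<in> B}" using ab by (intro span_base) blast
      show "y \<in> span {tens V W a b | a b. a \<in> A \<and> b \<in> B}" using step.IH by blast
    qed
    moreover have "P (tscl c s + y)"
      unfolding ab(1) by (rule assms(3)[OF ab(2,3)]) (use step.IH in \<open>simp_all add: subtensor_def\<close>)
    ultimately show ?case by blast
  qed
  thus ?thesis ..
qed

lemma subtensor_mono: "A \<subseteq> A' \<Longrightarrow> B \<subseteq> B' \<Longrightarrow> subtensor V W A B \<subseteq> subtensor V W A' B'"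
  for V :: "('k::field, 'v::ab_group_add, 'm) vspace_scheme" and W :: "('k, 'w::ab_group_add, 'n) vspace_scheme"
proof -
  assume "A \<subseteq> A'" "B \<subseteq> B'"
  interpret vector_space "tscl :: 'k \<Rightarrow> ('k, 'v, 'w) tensor \<Rightarrow> _" by (rule vector_space_tscl)
  show ?thesis
    unfolding subtensor_def by (rule span_mono) (use \<open>A \<subseteq> A'\<close> \<open>B \<subseteq> B'\<close> in blast)
qed

lemma subtensor_closed:
  fixes V :: "('k::field, 'v::ab_group_add, 'm) vspace_scheme" and W :: "('k, 'w::ab_group_add, 'n) vspace_scheme"
  shows "0 \<in> subtensor V W A B"
    "s \<in> subtensor V W A B \<Longrightarrow> t \<in> subtensor V W A B \<Longrightarrow> s + t \<in> subtensor V W A B"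
    "t \<in> subtensor V W A B \<Longrightarrow> tscl c t \<in> subtensor V W A B"
    "a \<in> A \<Longrightarrow> b \<in> B \<Longrightarrow> tens V W a b \<in> subtensor V W A B"
proof -
  interpret vector_space "tscl :: 'k \<Rightarrow> ('k, 'v, 'w) tensor \<Rightarrow> _" by (rule vector_space_tscl)
  show "0 \<in> subtensor V W A B"
    "s \<in> subtensor V W A B \<Longrightarrow> t \<in> subtensor V W A B \<Longrightarrow> s + t \<in> subtensor V W A B"
    "t \<in> subtensor V W A B \<Longrightarrow> tscl c t \<in> subtensor V W A B"
    unfolding subtensor_def by (auto intro: span_zero span_add span_scale)
  show "a \<in> A \<Longrightarrow> b \<in> B \<Longrightarrow> tens V W a b \<in> subtensor V W A B"
    unfolding subtensor_def by (rule span_base) blast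
qed

text \<open>
  Extend a basis of \<open>D\<close> by vectors of \<open>E\<close> to a basis of \<open>D +
  E\<close> and project along the added vectors. An element of \<open>E\<close> is then the sum of
  its projection and a vector of \<open>E\<close>, so its projection lies in \<open>E\<close>.
\<close>

lemma compatible_projection:
  assumes V: "is_vspace V" and D: "module.subspace (scl V) D" "D \<subseteq> car V" and E: "module.subspace (scl V) E" "E \<subseteq> car V"
  obtains p where "lin_map V V p" "\<And>d. d \<in> D \<Longrightarrow> p d = d" "\<And>b. b \<in> E \<Longrightarrow> p b \<in> D \<inter> E"
proof -
  interpret v: vector_space "scl V" using V by (simp add: is_vspace_def)
  interpret vp: vector_space_pair "scl V" "scl V" ..
  obtain B where B: "B \<subseteq> D" "v.independent B" "D \<subseteq> v.span B"
    using v.basis_exists[of D] by metis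
  obtain X where X: "B \<subseteq> X" "X \<subseteq> B \<union> E" "v.independent X" "B \<union> E \<subseteq> v.span X"
    using v.maximal_independent_subset_extend[of B "B \<union> E"] B(2) by blast
  define f where "f = (\<lambda>b. if b \<in> B then b else 0)"
  define p where "p = vp.construct X f"
  have lin: "Vector_Spaces.linear (scl V) (scl V) p" unfolding p_def by (rule vp.linear_construct[OF X(3)])
  interpret p: Vector_Spaces.linear "scl V" "scl V" p by (rule lin)
  have spanB: "v.span B \<subseteq> D" using v.span_minimal[OF B(1) D(1)] .
  have "f ` X \<subseteq> v.span B" by (auto simp: f_def v.span_base v.span_zero)
  hence range: "p y \<in> D" for y
    using vp.construct_in_span[OF X(3), of f y] v.span_minimal[of "f ` X" "v.span B"] spanB v.subspace_span unfolding p_def by blast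
  have pX: "p b = f b" if "b \<in> X" for b unfolding p_def by (rule vp.construct_basis[OF X(3) that])
  have pB: "p u = u" if "u \<in> v.span B" for u
    using that
  proof (induction rule: v.span_induct_alt)
    case (step c u y)
    thus ?case using pX[of u] X(1) by (auto simp: p.add p.scale f_def)
  qed (simp add: p.zero)
  have p0: "p u = 0" if "u \<in> v.span (X - B)" for u
    using that
  proof (induction rule: v.span_induct_alt)
    case (step c u y)
    thus ?case using pX[of u] by (auto simp: p.add p.scale f_def)
  qed (simp add: p.zero)
  have pE: "p b \<in> D \<inter> E" if b: "b \<in> E" for b
  proof -
    have "b \<in> v.span (B \<union> (X - B))" using X(1,4) b by (metis Un_Diff_cancel Un_absorb1 UnI2 subsetD)
    then obtain u w where uw: "b = u + w" "u \<in> v.span B" "w \<in> v.span (X - B)"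
      unfolding v.span_Un by blast
    have "X - B \<subseteq> E" using X(2) by blast
    hence "w \<in> E" using v.span_minimal[OF _ E(1)] uw(3) by blast
    hence "u \<in> E" using v.subspace_diff[OF E(1) b, of w] uw(1) by simp
    moreover have "p b = u" using uw by (simp add: p.add pB p0)
    ultimately show ?thesis using range[of b] by simp
  qed
  have "lin_map V V p" using range D(2) by (auto simp: lin_map_def p.add p.scale)
  moreover have "p d = d" if "d \<in> D" for d using pB that B(3) by blast
  ultimately show ?thesis using that pE by blast
qed

text \<open>
  For \<open>p\<close> as in \<open>compatible_projection\<close>, the map \<open>p \<otimes>
  p\<close> fixes \<open>D \<otimes> D\<close> and sends \<open>E \<otimes> E\<close> into
  \<open>(D \<inter> E) \<otimes> (D \<inter> E)\<close>.
\<close>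

lemma subtensor_Int:
  assumes V: "is_vspace V" and D: "module.subspace (scl V) D" "D \<subseteq> car V" and E: "module.subspace (scl V) E" "E \<subseteq> car V"
    and tD: "t \<in> subtensor V V D D" and tE: "t \<in> subtensor V V E E"
  shows "t \<in> subtensor V V (D \<inter> E) (D \<inter> E)"
proof -
  obtain p where p: "lin_map V V p" "\<And>d. d \<in> D \<Longrightarrow> p d = d" "\<And>b. b \<in> E \<Longrightarrow> p b \<in> D \<inter> E"
    using compatible_projection[OF V D E] by blast
  let ?F = "tmap V V V V p p"
  have F: "lin_map (tensor_space V V) (tensor_space V V) ?F" by (intro lin_tmap V p)
  have Ft: "?F (tens V V a b) = tens V V (p a) (p b)" if "a \<in> car V" "b \<in> car V" for a b
    by (rule tmap_tens[OF p(1) p(1) that])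
  have F_step: "?F (tscl c (tens V V a b) + y) = tscl c (tens V V (p a) (p b)) + ?F y"
    if "a \<in> car V" "b \<in> car V" "y \<in> subtensor V V (car V) (car V)" for c a b y
    using lin_mapD(2)[OF F, of "tscl c (tens V V a b)" y] lin_mapD(3)[OF F, of "tens V V a b" c] that
    by (simp add: Ft tens_car tspaceD)
  have sub: "subtensor V V D D \<subseteq> subtensor V V (car V) (car V)" "subtensor V V E E \<subseteq> subtensor V V (car V) (car V)"
    by (rule subtensor_mono[OF D(2) D(2)], rule subtensor_mono[OF E(2) E(2)])
  have "?F t = t"
    using tD
  proof (induction t rule: subtensor_induct)
    case (step c a b y)
    have "a \<in> car V" "b \<in> car V" "y \<in> subtensor V V (car V) (car V)" using step D(2) sub by blast+
    from F_step[OF this] show ?case unfolding p(2)[OF step(1)] p(2)[OF step(2)] step(4) .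
  qed (rule lin_map_0[OF is_vspace_tensor_space F])
  moreover have "?F t \<in> subtensor V V (D \<inter> E) (D \<inter> E)"
    using tE
  proof (induction t rule: subtensor_induct)
    case zero
    show ?case unfolding lin_map_0[OF is_vspace_tensor_space F] by (rule subtensor_closed(1))
  next
    case (step c a b y)
    have c: "a \<in> car V" "b \<in> car V" "y \<in> subtensor V V (car V) (car V)" using step E(2) sub by blast+
    show ?case
      unfolding F_step[OF c] by (intro subtensor_closed(2) subtensor_closed(3) subtensor_closed(4) p(3) step)
  qed
  ultimately show ?thesis by simp
qed

context qyd_root
begin

section \<open>The coradical of the bosonization\<close>

abbreviation "BT \<equiv> tensor_space R H"
abbreviation "BB \<equiv> tensor_space BT BT"

text \<open>
  The part of the comultiplication of \<open>x\<^bsup>[n]\<^esup> # h\<close> that comes from the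
  summand \<open>x\<^bsup>[i]\<^esup> \<otimes> x\<^bsup>[j]\<^esup>\<close> of the
  comultiplication of \<open>x\<^bsup>[n]\<^esup>\<close>, without its coefficient.
\<close>

definition boson_term :: "nat \<Rightarrow> nat \<Rightarrow> 'h \<Rightarrow> ('k, ('k, nat \<Rightarrow> 'k, 'h) tensor, ('k, nat \<Rightarrow> 'k, 'h) tensor) tensor" where
  "boson_term i j h = cop3 H h (\<lambda>h1 h2 h3. tscl (omega_inv H (gp i) (gp j) h1)
     (tens BT BT (tens R H (x i) (mul H (gp j) h2)) (tens R H (x j) h3)))"

lemma BT_car: "r \<in> car R \<Longrightarrow> h \<in> car H \<Longrightarrow> tens R H r h \<in> car BT"
  using tens_car[of r R h H] by simp

lemma BB_car: "a \<in> car BT \<Longrightarrow> b \<in> car BT \<Longrightarrow> tens BT BT a b \<in> subtensor BT BT (car BT) (car BT)"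
  by (rule tens_car)

lemmas BB_vspace = is_vspace_tensor_space[of BT BT]

lemmas boson_rules = linI bilin_mapI lin_tscl lin_tsclL lin_tens1 lin_tens2 lin_mul1 lin_mul2 lin_omega_inv
  lin_id BT_car BB_car mul_car

lemma boson_body_lin3:
  assumes "p1 \<in> car H" "p0 \<in> car R" "s2 \<in> car H" "s1 \<in> car H" "s0 \<in> car R"
  shows "lin3 BB (\<lambda>h1 h2 h3. tscl (omega_inv H p1 s2 h1) (tens BT BT (tens R H p0 (mul H s1 h2)) (tens R H s0 h3)))"
  by (intro boson_rules assms; assumption)

lemma lin_cop3: "is_vspace Z \<Longrightarrow> lin3 Z F \<Longrightarrow> lin_map H Z (\<lambda>h. cop3 H h F)"
  unfolding cop3_def by (rule lin_cop2_arg[OF _ bilin_cop2_tail lin_id])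

lemma lin_boson_term: "lin_map H BB (boson_term i j)"
  unfolding boson_term_def[abs_def] using x_car by (intro lin_cop3 BB_vspace boson_body_lin3 gp_car) simp_all

lemma boson_coactions:
  assumes p: "p \<in> car R" and s: "s \<in> car R" and h: "h \<in> car H"
  shows "coa1 H R p (\<lambda>p1 p0. coa2 H R s (\<lambda>s2 s1 s0. cop3 H h (\<lambda>h1 h2 h3.
          tscl (omega_inv H p1 s2 h1) (tens BT BT (tens R H p0 (mul H s1 h2)) (tens R H s0 h3)))))
    = (\<Sum>i<N. tscl (p i) (\<Sum>j<N. tscl (s j) (boson_term i j h)))"
proof -
  have xc: "x j \<in> car R" for j by (simp add: x_car)
  have 1: "coa2 H R s (\<lambda>s2 s1 s0. cop3 H h (\<lambda>h1 h2 h3.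
          tscl (omega_inv H p1 s2 h1) (tens BT BT (tens R H p0 (mul H s1 h2)) (tens R H s0 h3))))
    = (\<Sum>j<N. tscl (s j) (cop3 H h (\<lambda>h1 h2 h3.
          tscl (omega_inv H p1 (gp j) h1) (tens BT BT (tens R H p0 (mul H (gp j) h2)) (tens R H (x j) h3)))))"
    if "p1 \<in> car H" "p0 \<in> car R" for p1 p0
    by (rule trans[OF coa2_graded[OF graded_R BB_vspace s]])
       ((intro boson_rules lin_cop3_param that h C_vspace R_vspace BB_vspace; assumption)+, simp)
  have 2: "bilin_map H R BB (\<lambda>p1 p0. \<Sum>j<N. tscl (s j) (cop3 H h (\<lambda>h1 h2 h3.
          tscl (omega_inv H p1 (gp j) h1) (tens BT BT (tens R H p0 (mul H (gp j) h2)) (tens R H (x j) h3)))))"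
    by (intro bilin_mapI lin_sum BB_vspace lin_tscl lin_cop3_param C_vspace R_vspace h boson_rules gp_car xc; assumption)
  have "coa1 H R p (\<lambda>p1 p0. coa2 H R s (\<lambda>s2 s1 s0. cop3 H h (\<lambda>h1 h2 h3.
          tscl (omega_inv H p1 s2 h1) (tens BT BT (tens R H p0 (mul H s1 h2)) (tens R H s0 h3)))))
    = coa1 H R p (\<lambda>p1 p0. \<Sum>j<N. tscl (s j) (cop3 H h (\<lambda>h1 h2 h3.
          tscl (omega_inv H p1 (gp j) h1) (tens BT BT (tens R H p0 (mul H (gp j) h2)) (tens R H (x j) h3)))))"
    by (intro coa1_cong 1)
  also have "\<dots> = (\<Sum>i<N. tscl (p i) (\<Sum>j<N. tscl (s j) (boson_term i j h)))"
    unfolding coa1_graded[OF graded_R BB_vspace 2 p] by (simp add: boson_term_def)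
  finally show ?thesis .
qed

lemma boson_comul_tens:
  shows "lin_map BT BB (boson_comul H R)"
    and "n < N \<Longrightarrow> h \<in> car H \<Longrightarrow> boson_comul H R (tens R H (x n) h) = (\<Sum>i\<le>n. tscl (gb n i / cobd i (n - i)) (boson_term i (n - i) h))"
proof -
  let ?K = "\<lambda>h p s. \<Sum>i<N. tscl (p i) (\<Sum>j<N. tscl (s j) (boson_term i j h))"
  let ?G = "\<lambda>r h. sweedler R R (rcomul R r) (?K h)"
  have Qc: "boson_term i j h \<in> subtensor BT BT (car BT) (car BT)" if "h \<in> car H" for i j h
    using lin_mapD(1)[OF lin_boson_term that] by simp
  have bK: "bilin_map R R BB (?K h)" if "h \<in> car H" for h
    by (intro bilin_mapI lin_sum BB_vspace lin_tscl lin_tsclL lin_coord tspaceD(4) tspaceD(5) Qc that)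
  have bG: "bilin_map R H BB ?G"
    by (intro bilin_mapI lin_sweedler_arg lin_sweedler_body R_vspace C_vspace BB_vspace lin_rcomul bK
        lin_mapD(1)[OF lin_rcomul] lin_sum lin_tscl lin_boson_term; assumption)
  have eq: "boson_comul H R t = sweedler R H t ?G" for t
    unfolding boson_comul_def Let_def by (intro sweedler_cong boson_coactions)
  show "lin_map BT BB (boson_comul H R)"
    unfolding eq[abs_def] by (rule lin_map_sweedler[OF R_vspace BB_vspace bG])
  assume n: "n < N" and h: "h \<in> car H"
  have K: "sweedler R R (X i j) (?K h) = boson_term i j h" if "i < N" "j < N" for i j
    using sweedler_tens_basis[OF basis_R basis_R BB_vspace bK[OF h], of i j] that
    by (simp add: basis_delta_tscl[OF basis_R])
  have "boson_comul H R (tens R H (x n) h) = ?G (x n) h"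
    unfolding eq by (rule sweedler_tens[OF BB_vspace bG]) (simp_all add: x_car h)
  also have "\<dots> = (\<Sum>i\<le>n. tscl (gb n i / cobd i (n - i)) (sweedler R R (X i (n - i)) (?K h)))"
    using lin_map_lincomb[OF is_vspace_tensor_space lin_map_sweedler[OF R_vspace BB_vspace bK[OF h]], of "{..n}" "\<lambda>i. X i (n - i)"] X_car' n
    by (simp add: rcomul_x)
  also have "\<dots> = (\<Sum>i\<le>n. tscl (gb n i / cobd i (n - i)) (boson_term i (n - i) h))"
    using n by (intro sum.cong refl) (simp add: K)
  finally show "boson_comul H R (tens R H (x n) h) = (\<Sum>i\<le>n. tscl (gb n i / cobd i (n - i)) (boson_term i (n - i) h))" .
qed

text \<open>
  The functional \<open>x\<^bsup>[n]\<^esup> # h \<mapsto> \<delta>\<^bsub>m,n\<^esub>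
  \<epsilon>(h)\<close>.
\<close>

definition \<phi> :: "nat \<Rightarrow> ('k, nat \<Rightarrow> 'k, 'h) tensor \<Rightarrow> 'k" where
  "\<phi> m t = sweedler R H t (\<lambda>r h. r m * counit H h)"

text \<open>
  The functional \<open>\<phi> m\<close> applied to the left factor. It maps \<open>D \<otimes>
  D\<close> into \<open>D\<close> for every subspace \<open>D\<close>.
\<close>

definition \<Lambda> :: "nat \<Rightarrow> ('k, ('k, nat \<Rightarrow> 'k, 'h) tensor, ('k, nat \<Rightarrow> 'k, 'h) tensor) tensor \<Rightarrow> ('k, nat \<Rightarrow> 'k, 'h) tensor" where
  "\<Lambda> m T = sweedler BT BT T (\<lambda>a b. tscl (\<phi> m a) b)"

definition component :: "nat \<Rightarrow> ('k, nat \<Rightarrow> 'k, 'h) tensor \<Rightarrow> 'h" where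
  "component m t = sweedler R H t (\<lambda>r h. scl H (r m) h)"

lemma bilin_\<phi>: "bilin_map R H ground (\<lambda>r h. r m * counit H h)"
  by (intro bilin_mapI lin_mulL lin_mulR lin_coord lin_counit)

lemma lin_\<phi>: "lin_map BT ground (\<phi> m)"
  unfolding \<phi>_def[abs_def] by (rule lin_map_sweedler[OF R_vspace is_vspace_ground bilin_\<phi>])

lemma \<phi>_tens: "h \<in> car H \<Longrightarrow> \<phi> m (tens R H (x i) h) = x i m * counit H h"
  unfolding \<phi>_def using sweedler_tens[OF is_vspace_ground bilin_\<phi>, of "x i" h m] by (simp add: x_car)

lemma bilin_\<Lambda>: "bilin_map BT BT BT (\<lambda>a b. tscl (\<phi> m a) b)"
  using lin_\<phi> by (intro bilin_mapI lin_tscl lin_tsclL lin_id) simp_all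

lemma lin_\<Lambda>: "lin_map BB BT (\<Lambda> m)"
  unfolding \<Lambda>_def[abs_def] by (rule lin_map_sweedler[OF is_vspace_tensor_space is_vspace_tensor_space bilin_\<Lambda>])

lemma \<Lambda>_tens: "a \<in> car BT \<Longrightarrow> b \<in> car BT \<Longrightarrow> \<Lambda> m (tens BT BT a b) = tscl (\<phi> m a) b"
  unfolding \<Lambda>_def by (rule sweedler_tens[OF is_vspace_tensor_space bilin_\<Lambda>])

lemma bilin_component: "bilin_map R H H (\<lambda>r h. scl H (r m) h)"
  by (intro bilin_mapI lin_scl lin_sclL lin_coord lin_id C_vspace)

lemma lin_component: "lin_map BT H (component m)"
  unfolding component_def[abs_def] by (rule lin_map_sweedler[OF R_vspace C_vspace bilin_component])

lemma component_tens: "h \<in> car H \<Longrightarrow> component m (tens R H (x i) h) = scl H (x i m) h"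
  unfolding component_def using sweedler_tens[OF C_vspace bilin_component, of "x i" h m] by (simp add: x_car)

lemma component_expand:
  assumes t: "t \<in> car BT"
  shows "t = (\<Sum>n<N. tens R H (x n) (component n t))"
proof -
  have e: "tens R H r h = (\<Sum>n<N. tens R H (x n) (scl H (r n) h))" if "r \<in> car R" "h \<in> car H" for r h
  proof -
    have "tens R H r h = (\<Sum>n<N. tscl (r n) (tens R H (x n) h))"
      using lin_map_basis[OF basis_R lin_tens1[OF that(2) lin_id] that(1)] by simp
    thus ?thesis using that by (simp add: tens_scl_right x_car)
  qed
  have xc: "x n \<in> car R" for n by (simp add: x_car)
  have lt: "lin_map H BT (tens R H (x n))" for n by (intro lin_tens2 lin_id xc)
  have b: "bilin_map R H BT (\<lambda>r h. tens R H (x n) (scl H (r n) h))" for n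
    by (intro bilin_mapI lin_comp[OF lt] lin_bilin1[OF bilin_component] lin_bilin2[OF bilin_component])
  have "t = sweedler R H t (tens R H)" using sweedler_id[OF R_vspace t] by simp
  also have "\<dots> = sweedler R H t (\<lambda>r h. \<Sum>n<N. tens R H (x n) (scl H (r n) h))"
    by (intro sweedler_cong e)
  also have "\<dots> = (\<Sum>n<N. sweedler R H t (\<lambda>r h. tens R H (x n) (scl H (r n) h)))"
    by (rule sweedler_sum_body[OF R_vspace is_vspace_tensor_space t b])
  also have "\<dots> = (\<Sum>n<N. tens R H (x n) (component n t))"
    unfolding component_def
    by (intro sum.cong refl sweedler_map[OF R_vspace C_vspace is_vspace_tensor_space t bilin_component lt, symmetric])
  finally show ?thesis .
qed

lemma \<Lambda>_boson_term:
  assumes h: "h \<in> car H" and m: "m < N" and i: "i < N"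
  shows "\<Lambda> m (boson_term i j h) = (if i = m then cop3 H h (\<lambda>h1 h2 h3. tscl (omega_inv H (gp i) (gp j) h1 * counit H h2) (tens R H (x j) h3)) else 0)"
proof -
  let ?F = "\<lambda>h1 h2 h3. tscl (omega_inv H (gp i) (gp j) h1) (tens BT BT (tens R H (x i) (mul H (gp j) h2)) (tens R H (x j) h3))"
  have xc: "x n \<in> car R" for n by (simp add: x_car)
  have l3: "lin3 BB ?F" by (rule boson_body_lin3[OF gp_car xc gp_car gp_car xc])
  have b2: "bilin_map H H BB (?F h1)" if "h1 \<in> car H" for h1 using l3 that unfolding lin3_def by blast
  have "\<Lambda> m (boson_term i j h) = cop2 H h (\<lambda>h1 h'. \<Lambda> m (cop2 H h' (?F h1)))"
    unfolding boson_term_def cop3_def by (rule cop2_map[OF lin_\<Lambda> BB_vspace is_vspace_tensor_space bilin_cop2_tail[OF BB_vspace l3] h])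
  also have "\<dots> = cop3 H h (\<lambda>h1 h2 h3. \<Lambda> m (?F h1 h2 h3))"
    unfolding cop3_def by (intro cop2_cong cop2_map[OF lin_\<Lambda> BB_vspace is_vspace_tensor_space b2])
  also have "\<dots> = cop3 H h (\<lambda>h1 h2 h3. tscl (if i = m then 1 else 0) (tscl (omega_inv H (gp i) (gp j) h1 * counit H h2) (tens R H (x j) h3)))"
  proof (intro cop3_cong)
    fix h1 h2 h3 assume c: "h1 \<in> car H" "h2 \<in> car H" "h3 \<in> car H"
    have "\<Lambda> m (?F h1 h2 h3) = tscl (omega_inv H (gp i) (gp j) h1) (tscl (\<phi> m (tens R H (x i) (mul H (gp j) h2))) (tens R H (x j) h3))"
      using lin_mapD(3)[OF lin_\<Lambda>, of "tens BT BT (tens R H (x i) (mul H (gp j) h2)) (tens R H (x j) h3)" m]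
        \<Lambda>_tens[OF BT_car[OF xc mul_car[OF gp_car c(2)]] BT_car[OF xc c(3)], of m]
        BB_car[OF BT_car[OF xc mul_car[OF gp_car c(2)]] BT_car[OF xc c(3)]] by simp
    thus "\<Lambda> m (?F h1 h2 h3) = tscl (if i = m then 1 else 0) (tscl (omega_inv H (gp i) (gp j) h1 * counit H h2) (tens R H (x j) h3))"
      using c m i by (simp add: \<phi>_tens mul_car gp_car counit_mul x_apply tspace_simps)
  qed
  finally have *: "\<Lambda> m (boson_term i j h) = cop3 H h (\<lambda>h1 h2 h3. tscl (if i = m then 1 else 0) (tscl (omega_inv H (gp i) (gp j) h1 * counit H h2) (tens R H (x j) h3)))" .
  show ?thesis
  proof (cases "i = m")
    case True
    thus ?thesis unfolding * by (simp add: tspace_simps)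
  next
    case False
    \<comment> \<open>An iterated coproduct of the zero function is zero: the empty family.\<close>
    have "cop3 H h (\<lambda>h1 h2 h3. \<Sum>p\<in>({}::unit set). scl BT 0 0) = (\<Sum>p\<in>({}::unit set). scl BT (cop3 H h (\<lambda>_ _ _. 0)) 0)"
      using cop3_family[OF is_vspace_tensor_space[of R H] h, of "{}::unit set"] by simp
    thus ?thesis using False unfolding * by (simp add: tspace_simps)
  qed
qed

text \<open>
  For \<open>j = 0\<close> the value of \<open>\<omega>\<^sup>-\<^sup>1\<close> is a counit, since
  one of its arguments is the unit, and the two counits contract the threefold coproduct of
  \<open>h\<close>.
\<close>

lemma \<Lambda>_boson_term_top:
  assumes h: "h \<in> car H" and m: "m < N"
  shows "\<Lambda> m (boson_term m 0 h) = tens R H (x 0) h"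
proof -
  have xc: "x 0 \<in> car R" by (simp add: x_car)
  note BTv = is_vspace_tensor_space[of R H]
  have lt: "lin_map H BT (tens R H (x 0))" by (intro lin_tens2 lin_id xc)
  have "\<Lambda> m (boson_term m 0 h) = cop2 H h (\<lambda>h1 h'. cop2 H h' (\<lambda>h2 h3. tscl (counit H h2) (tscl (counit H h1) (tens R H (x 0) h3))))"
    unfolding \<Lambda>_boson_term[OF h m m] cop3_def
    by (simp add: omega_one gp_car tspace_simps mult.commute cong: cop2_cong)
  also have "\<dots> = cop2 H h (\<lambda>h1 h'. tscl (counit H h1) (tens R H (x 0) h'))"
    using cop2_counitL[OF BTv lin_tscl[OF lt]] by (intro cop2_cong) simp
  also have "\<dots> = tens R H (x 0) h"
    using cop2_counitL[OF BTv lt h] by simp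
  finally show ?thesis .
qed

definition base :: "('k, nat \<Rightarrow> 'k, 'h) tensor set" where
  "base = (\<lambda>h. tens R H (x 0) h) ` car H"

lemma base_facts: "module.subspace tscl base" "base \<subseteq> car BT"
proof -
  interpret v: vector_space "tscl :: 'k \<Rightarrow> ('k, nat \<Rightarrow> 'k, 'h) tensor \<Rightarrow> _" by (rule vector_space_tscl)
  have xc: "x 0 \<in> car R" by (simp add: x_car)
  have lt: "lin_map H BT (tens R H (x 0))" by (intro lin_tens2 lin_id xc)
  show "base \<subseteq> car BT" unfolding base_def using BT_car[OF xc] by blast
  show "v.subspace base"
    unfolding v.subspace_def base_def
  proof (intro conjI ballI allI)
    show "0 \<in> tens R H (x 0) ` car H"
      by (rule image_eqI[of _ _ 0]) (simp_all add: lin_map_0[OF C_vspace lt] vspaceD(1)[OF C_vspace])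
    fix s assume "s \<in> tens R H (x 0) ` car H"
    then obtain h where h: "h \<in> car H" "s = tens R H (x 0) h" by blast
    show "tscl c s \<in> tens R H (x 0) ` car H" for c
      by (rule image_eqI[of _ _ "scl H c h"]) (use lin_mapD(3)[OF lt h(1), of c] h vspaceD(4)[OF C_vspace] in simp_all)
    fix t assume "t \<in> tens R H (x 0) ` car H"
    then obtain k where k: "k \<in> car H" "t = tens R H (x 0) k" by blast
    show "s + t \<in> tens R H (x 0) ` car H"
      by (rule image_eqI[of _ _ "h + k"]) (use lin_mapD(2)[OF lt h(1) k(1)] h k vspaceD(2)[OF C_vspace] in simp_all)
  qed
qed

lemma base_comul:
  assumes "t \<in> base"
  shows "boson_comul H R t \<in> subtensor BT BT base base"
proof -
  obtain h where h: "h \<in> car H" "t = tens R H (x 0) h" using assms by (auto simp: base_def)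
  have xc: "x 0 \<in> car R" by (simp add: x_car)
  let ?D = "\<lambda>h2 h3. tens BT BT (tens R H (x 0) h2) (tens R H (x 0) h3)"
  have bD: "bilin_map H H BB ?D" by (intro boson_rules xc; assumption)
  have l: "lin_map H BB (\<lambda>h'. cop2 H h' ?D)" by (rule lin_cop2_arg[OF BB_vspace bD lin_id])
  have b': "bilin_map H H BB (\<lambda>h2 h3. tscl c (?D h2 h3))" for c by (intro boson_rules xc; assumption)
  have "boson_comul H R t = boson_term 0 0 h"
    using boson_comul_tens(2)[OF N_pos h(1)] h(2) by (simp add: tspace_simps)
  also have "\<dots> = cop2 H h (\<lambda>h1 h'. cop2 H h' (\<lambda>h2 h3. tscl (counit H h1) (?D h2 h3)))"
    unfolding boson_term_def cop3_def
    by (simp add: omega_one one_car mul_one grouplikeD(2)[OF one_grouplike] cong: cop2_cong)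
  also have "\<dots> = cop2 H h (\<lambda>h1 h'. tscl (counit H h1) (cop2 H h' ?D))"
    by (intro cop2_cong cop2_map[OF lin_tscl[OF lin_id] BB_vspace BB_vspace bD, symmetric])
  also have "\<dots> = cop2 H h ?D"
    using cop2_counitL[OF BB_vspace l h(1)] by simp
  also have "\<dots> \<in> subtensor BT BT base base"
  proof -
    obtain ps where ps: "set ps \<subseteq> car H \<times> car H" "comul H h = (\<Sum>(a, b)\<leftarrow>ps. tens H H a b)"
      using tensor_space_sumE[OF C_vspace comul_car[OF h(1)]] by blast
    have "cop2 H h ?D = (\<Sum>(a, b)\<leftarrow>ps. ?D a b)"
      unfolding cop2_def ps(2) by (rule sweedler_sum[OF BB_vspace bD ps(1)])
    moreover have "(\<Sum>(a, b)\<leftarrow>ps. ?D a b) \<in> subtensor BT BT base base"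
      using ps(1) by (induction ps) (auto intro!: subtensor_closed simp: base_def)
    ultimately show ?thesis by simp
  qed
  finally show ?thesis .
qed

abbreviation "B \<equiv> bosonization H R"

lemma B_simps: "car B = car BT" "scl B = tscl" "comul B = boson_comul H R"
  by (simp_all add: bosonization_def)

lemma B_subtensor: "subtensor B B = subtensor BT BT"
  by (rule tensor_space_cong_space(2)) (simp_all add: B_simps)

text \<open>
  Let \<open>n\<close> be the highest degree that occurs in \<open>d\<close>. The map
  \<open>\<Lambda> n\<close> kills all terms of the comultiplication whose left degree is not
  \<open>n\<close>. Only the component of degree \<open>n\<close> has such a term, namely the one
  with right degree \<open>0\<close>.
\<close>

lemma subcoalgebra_meets_base:
  assumes D: "subcoalgebra B D" "D \<noteq> {0}"
  obtains t where "t \<in> D \<inter> base" "t \<noteq> 0"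
proof -
  interpret v: vector_space "tscl :: 'k \<Rightarrow> ('k, nat \<Rightarrow> 'k, 'h) tensor \<Rightarrow> _" by (rule vector_space_tscl)
  have Dc: "D \<subseteq> car BT" and Ds: "v.subspace D" and DD: "\<And>d. d \<in> D \<Longrightarrow> boson_comul H R d \<in> subtensor BT BT D D"
    using D(1) by (simp_all add: subcoalgebra_def B_simps B_subtensor)
  obtain d where d: "d \<in> D" "d \<noteq> 0" using D(2) v.subspace_0[OF Ds] by blast
  have dc: "d \<in> car BT" using d(1) Dc by blast
  let ?M = "{k. k < N \<and> component k d \<noteq> 0}"
  have xc: "x n \<in> car R" for n by (simp add: x_car)
  have t0: "tens R H (x k) 0 = 0" for k by (rule tens_zero(2)[OF xc C_vspace])
  have "?M \<noteq> {}"
  proof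
    assume "?M = {}"
    hence "(\<Sum>n<N. tens R H (x n) (component n d)) = 0" by (intro sum.neutral) (auto simp: t0)
    thus False using component_expand[OF dc] d(2) by simp
  qed
  define n where "n = Max ?M"
  have n: "n < N" "component n d \<noteq> 0" using Max_in[of ?M] \<open>?M \<noteq> {}\<close> unfolding n_def by auto
  have above: "component k d = 0" if "n < k" "k < N" for k
    using that Max_ge[of ?M k] unfolding n_def by fastforce
  have hc: "component k d \<in> car H" for k by (rule lin_mapD(1)[OF lin_component dc])
  have lin: "lin_map BT BT (\<lambda>t. \<Lambda> n (boson_comul H R t))"
    by (rule lin_comp[OF lin_\<Lambda> boson_comul_tens(1)])
  have summand: "\<Lambda> n (boson_comul H R (tens R H (x k) (component k d))) = (if k = n then tens R H (x 0) (component n d) else 0)"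
    if k: "k < N" for k
  proof (cases "n < k")
    case True
    hence "tens R H (x k) (component k d) = 0" using above[OF True k] t0 by simp
    thus ?thesis using lin_map_0[OF is_vspace_tensor_space lin] True by simp
  next
    case False
    have Qc: "boson_term i j (component k d) \<in> car BB" for i j by (rule lin_mapD(1)[OF lin_boson_term hc])
    have "\<Lambda> n (boson_comul H R (tens R H (x k) (component k d)))
      = (\<Sum>i\<le>k. tscl (gb k i / cobd i (k - i)) (\<Lambda> n (boson_term i (k - i) (component k d))))"
      unfolding boson_comul_tens(2)[OF k hc]
      using lin_map_lincomb[OF BB_vspace lin_\<Lambda>, of "{..k}" "\<lambda>i. boson_term i (k - i) (component k d)"] Qc by simp
    also have "\<dots> = (\<Sum>i\<le>k. if i = n then tens R H (x 0) (component n d) else 0)"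
    proof (intro sum.cong refl)
      fix i assume "i \<in> {..k}"
      hence i: "i \<le> k" "i \<le> n" "i < N" using False k by auto
      show "tscl (gb k i / cobd i (k - i)) (\<Lambda> n (boson_term i (k - i) (component k d))) = (if i = n then tens R H (x 0) (component n d) else 0)"
      proof (cases "i = n")
        case True
        hence "k = n" using i False by simp
        thus ?thesis using True by (simp add: \<Lambda>_boson_term_top[OF hc n(1)] tspace_simps)
      next
        case False
        thus ?thesis by (simp add: \<Lambda>_boson_term[OF hc n(1) i(3)] tspace_simps)
      qed
    qed
    also have "\<dots> = (if k = n then tens R H (x 0) (component n d) else 0)" using False by auto
    finally show ?thesis .
  qed
  have "\<Lambda> n (boson_comul H R d) = (\<Sum>k<N. \<Lambda> n (boson_comul H R (tens R H (x k) (component k d))))"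
    using lin_map_sum[OF is_vspace_tensor_space lin, of "{..<N}" "\<lambda>k. tens R H (x k) (component k d)"] BT_car[OF xc hc]
      component_expand[OF dc] by simp
  also have "\<dots> = (\<Sum>k<N. if k = n then tens R H (x 0) (component n d) else 0)"
    by (intro sum.cong refl summand) simp
  finally have top: "\<Lambda> n (boson_comul H R d) = tens R H (x 0) (component n d)" using n(1) by simp
  have sub: "subtensor BT BT D D \<subseteq> car BB" using Dc by (simp add: subtensor_mono)
  have "\<Lambda> n T \<in> D" if "T \<in> subtensor BT BT D D" for T
    using that
  proof (induction T rule: subtensor_induct)
    case zero
    show ?case unfolding lin_map_0[OF BB_vspace lin_\<Lambda>] by (rule v.subspace_0[OF Ds])
  next
    case (step c a b y)
    have car: "a \<in> car BT" "b \<in> car BT" "y \<in> car BB" using step Dc sub by blast+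
    have tc: "tens BT BT a b \<in> car BB" "tscl c (tens BT BT a b) \<in> car BB"
      using BB_car[OF car(1,2)] vspaceD(4)[OF BB_vspace, of "tens BT BT a b" c] by simp_all
    have eq: "\<Lambda> n (tscl c (tens BT BT a b) + y) = tscl c (tscl (\<phi> n a) b) + \<Lambda> n y"
      using lin_mapD(2)[OF lin_\<Lambda> tc(2) car(3)] lin_mapD(3)[OF lin_\<Lambda> tc(1), of n c] \<Lambda>_tens[OF car(1,2)] by simp
    show ?case unfolding eq by (intro v.subspace_add[OF Ds] v.subspace_scale[OF Ds] step(2,4))
  qed
  from this[OF DD[OF d(1)]] have "tens R H (x 0) (component n d) \<in> D \<inter> base"
    unfolding top using hc by (simp add: base_def)
  moreover have "tens R H (x 0) (component n d) \<noteq> 0"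
  proof
    assume "tens R H (x 0) (component n d) = 0"
    hence "component 0 (tens R H (x 0) (component n d)) = 0"
      using lin_map_0[OF is_vspace_tensor_space lin_component] by simp
    thus False using n component_tens[OF hc, of 0 0 n] N_pos by (simp add: x_apply vspace_simps[OF C_vspace])
  qed
  ultimately show ?thesis using that by blast
qed

text \<open>The intersection with \<open>1 # H\<close> is a nonzero subcoalgebra of a simple one.\<close>

theorem simple_subcoalgebra_base:
  assumes "simple_subcoalgebra B D"
  shows "D \<subseteq> base"
proof -
  interpret v: vector_space "tscl :: 'k \<Rightarrow> ('k, nat \<Rightarrow> 'k, 'h) tensor \<Rightarrow> _" by (rule vector_space_tscl)
  have D: "subcoalgebra B D" "D \<noteq> {0}" and min: "\<And>E. subcoalgebra B E \<Longrightarrow> E \<subseteq> D \<Longrightarrow> E = {0} \<or> E = D"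
    using assms by (auto simp: simple_subcoalgebra_def)
  have Dc: "D \<subseteq> car BT" and Ds: "v.subspace D" and DD: "\<And>d. d \<in> D \<Longrightarrow> boson_comul H R d \<in> subtensor BT BT D D"
    using D(1) by (simp_all add: subcoalgebra_def B_simps B_subtensor)
  have "boson_comul H R e \<in> subtensor BT BT (D \<inter> base) (D \<inter> base)" if "e \<in> D \<inter> base" for e
    using that Ds Dc base_facts DD base_comul
    by (intro subtensor_Int[OF is_vspace_tensor_space]) simp_all
  hence "subcoalgebra B (D \<inter> base)"
    using Dc v.subspace_inter[OF Ds base_facts(1)] by (auto simp: subcoalgebra_def B_simps B_subtensor)
  moreover obtain t where "t \<in> D \<inter> base" "t \<noteq> 0" using subcoalgebra_meets_base[OF D] by blast
  ultimately show ?thesis using min[of "D \<inter> base"] by blast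
qed

theorem coradical_bosonization:
  "coradical B \<subseteq> subtensor R H {scl R c (runit R 1) | c. True} (car H)"
proof -
  interpret v: vector_space "tscl :: 'k \<Rightarrow> ('k, nat \<Rightarrow> 'k, 'h) tensor \<Rightarrow> _" by (rule vector_space_tscl)
  have "x 0 = scl R 1 (runit R 1)" by (simp add: runit_R R_vsS)
  hence "x 0 \<in> {scl R c (runit R 1) | c. True}" by blast
  hence "base \<subseteq> subtensor R H {scl R c (runit R 1) | c. True} (car H)"
    unfolding base_def by (auto intro: subtensor_closed(4))
  hence "\<Union>{D. simple_subcoalgebra B D} \<subseteq> subtensor R H {scl R c (runit R 1) | c. True} (car H)"
    using simple_subcoalgebra_base by blast
  thus ?thesis
    unfolding coradical_def B_simps by (rule v.span_minimal) (simp add: subtensor_def v.subspace_span)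
qed

lemma is_basis_family_R: "is_basis_family R N x"
proof -
  interpret v: vector_space "scl Rv" using R_vspace by (simp add: is_vspace_def)
  have inj: "inj_on x {..<N}"
  proof (rule inj_onI)
    fix i j assume "i \<in> {..<N}" "j \<in> {..<N}" "x i = x j"
    thus "i = j" using x_apply[of i i] x_apply[of i j] by (auto split: if_splits)
  qed
  have "\<not> v.dependent (x ` {..<N})"
  proof
    assume "v.dependent (x ` {..<N})"
    then obtain u where u: "\<exists>v\<in>x ` {..<N}. u v \<noteq> 0" "(\<Sum>v\<in>x ` {..<N}. scl Rv (u v) v) = 0"
      using v.dependent_finite[of "x ` {..<N}"] by auto
    have "(\<Sum>i<N. scl Rv (u (x i)) (x i)) = 0" using u(2) by (simp add: sum.reindex[OF inj])
    hence "(\<Sum>i<N. u (x i) * x i n) = 0" for n using sum_x_apply[of "\<lambda>i. u (x i)" x "{..<N}" n] by simp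
    moreover have "(\<Sum>i<N. u (x i) * x i n) = u (x n)" if "n < N" for n
      using that by (simp add: x_apply if_distrib[of "\<lambda>z. _ * z"] cong: if_cong)
    ultimately show False using u(1) by auto
  qed
  moreover have "v.span (x ` {..<N}) = car Rv"
  proof
    have "v.subspace (car Rv)" using R_vspace by (simp add: is_vspace_def)
    thus "v.span (x ` {..<N}) \<subseteq> car Rv" by (intro v.span_minimal) (auto simp: x_car)
    show "car Rv \<subseteq> v.span (x ` {..<N})"
    proof
      fix f assume "f \<in> car Rv"
      hence "f = (\<Sum>i<N. scl Rv (f i) (x i))" using basisD(6)[OF basis_R, of f] by simp
      moreover have "(\<Sum>i<N. scl Rv (f i) (x i)) \<in> v.span (x ` {..<N})"
        by (intro v.span_sum v.span_scale v.span_base) auto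
      ultimately show "f \<in> v.span (x ` {..<N})" by simp
    qed
  qed
  ultimately show ?thesis using inj by (simp add: is_basis_family_def)
qed

end

section \<open>The bialgebra and the coradical\<close>

theorem theorem4p6:
  fixes H :: "('k::{alg_closed_field, field_char_0}, 'h::ab_group_add) dqb"
    and g :: 'h and \<chi> :: "'h \<Rightarrow> 'k" and q :: 'k and N :: nat
  assumes "qYD_datum H g \<chi>"
    and "q = \<chi> g"
    and "q \<noteq> 1"
    and "primitive_root_of_unity N q"
  shows "\<exists>(R :: ('k, 'h, nat \<Rightarrow> 'k) yd_bialg) (x :: nat \<Rightarrow> nat \<Rightarrow> 'k).
    yd_bialgebra H R \<and>
    is_basis_family R N x \<and>
    (\<forall>n<N. coact R (x n) = tens H R (gpow H g n) (x n)) \<and>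
    (\<forall>n<N. \<forall>h\<in>car H. act R h (x n) = scl R (chi_br H g \<chi> n h) (x n)) \<and>
    runit R 1 = x 0 \<and>
    (\<forall>a<N. \<forall>b<N. rmul R (tens R R (x a) (x b)) =
       (if a + b \<le> N - 1
        then scl R (\<Prod>i<a. omega_inv H g (gpow H g i) (gpow H g b)) (x (a + b))
        else 0)) \<and>
    (\<forall>n<N. rcomul R (x n) =
       (\<Sum>i\<le>n. tscl (beta_coeff H g q i n) (tens R R (x i) (x (n - i))))) \<and>
    (\<forall>n<N. rcounit R (x n) = (if n = 0 then 1 else 0)) \<and>
    coradical (bosonization H R) \<subseteq> subtensor R H {scl R c (runit R 1) | c. True} (car H)"
proof -
  interpret qyd_root H g \<chi> q N
    using assms by unfold_locales (simp_all add: qYD_datum_def)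
  have "coact R (x n) = tens H R (gpow H g n) (x n)" if "n < N" for n
    using weight_x[of n] by (simp add: weight_vector_def)
  moreover have "act R h (x n) = scl R (chi_br H g \<chi> n h) (x n)" if "h \<in> car H" for n h
    using weight_x[of n] that by (simp add: weight_vector_def)
  moreover have "runit R 1 = x 0" by (simp add: runit_R R_vsS)
  moreover have "rmul R (tens R R (x a) (x b)) = (if a + b \<le> N - 1
        then scl R (\<Prod>i<a. omega_inv H g (gpow H g i) (gpow H g b)) (x (a + b)) else 0)" for a b
  proof -
    have "cobd a b = (\<Prod>i<a. omega_inv H g (gpow H g i) (gpow H g b))"
      unfolding cobd_def omgi_def using gp_1 by simp
    thus ?thesis using rmul_X[of a b] x_zero[of "a + b"] N_pos by (auto simp: scl_zero)
  qed
  moreover have "rcomul R (x n) = (\<Sum>i\<le>n. tscl (beta_coeff H g q i n) (tens R R (x i) (x (n - i))))" if "n < N" for n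
    using that by (simp add: rcomul_x beta_gb)
  moreover have "rcounit R (x n) = (if n = 0 then 1 else 0)" for n
    using N_pos by (simp add: rcounit_R x_def)
  ultimately show ?thesis
    using R_bialgebra is_basis_family_R coradical_bosonization by blast
qed


end
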